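(* Let $((X_s,Y_s):s\in\mathbb{Z}^N)$ be a strictly stationary process with $X_s\in\mathcal{S}$, $Y_s\in\mathcal{H}$, satisfying $Y_s=\Psi(X_s)+\epsilon_s$, where $\Psi:\mathcal{S}\to\mathcal{H}$ and the $\epsilon_s$ are $\mathcal{H}$-valued with $\mathbb{E}[\epsilon_s|X_s]=0$. Let $\hat\Psi_h$ be the kernel estimator of $\Psi$ with kernel $K$ and bandwidth $h$. Assume: (1) For some $r\in(0,1]$: $\|\Psi(x)-\Psi(y)\|_{\mathcal{H}}\le L_\Psi\|x-y\|_{\mathcal{H}}^r$ for all $x,y\in\mathcal{S}$. For some $\delta>0$, all $0\le u\le\delta$, all $j\in\mathbb{N}$ and all $x\in\mathcal{S}$: $\vartheta_{x,j}(0)=0$, $\vartheta'_{x,j}(u)$ exists, and there is $0<L_{x,j}<\infty$ with $|\vartheta'_{x,j}(u)-\vartheta'_{x,j}(0)|\le L_{x,j}u^r$ for all $0\le u\le\delta$. Moreover $\sup_{x\in\mathcal{S}}\sum_{j}\vartheta'_{x,j}(0)^2<\infty$ and $\sup_{x\in\mathcal{S}}\sum_jL_{x,j}^2<\infty$. (2) $K$ has support in $[0,1]$ and a continuous derivative $K'\le0$ on $[0,1]$; $|K(u)-K(v)|\le L_K|u-v|$ for $u,v\in[0,1]$. (3) $F_x(h)>0$ for all $h>0$, $x\in\mathcal{S}$; the limit $\tau_x(u)=\lim_{h\downarrow0}F_x(hu)/F_x(h)$ exists for all $u\in[0,1]$, $x\in\mathcal{S}$, and $\lim_{h\downarrow0}\sup_{x\in\mathcal{S}}\sup_{u\in[0,1]}|F_x(hu)/F_x(h)-\tau_x(u)|=0$.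 (4) $M_x=K(1)-\int_0^1K'(u)\tau_x(u)\,du>0$ for all $x\in\mathcal{S}$ and $\inf_{x\in\mathcal{S}}M_x>0$. (5) There is $\delta>0$ such that for each fixed $x\in\mathcal{S}$ the map $\mathcal{S}\times[0,1]\ni(z,u)\mapsto F_z(hu)/F_x(h)$ is Lipschitz continuous with a Lipschitz constant $L_x$ which is uniform in $h$ for $h\le\delta$. (6) $\mathbb{P}(\|Y_s\|_{\mathcal{H}}\ge z)\le\kappa_0\exp(-\kappa_1z^\gamma)$ for all $z\ge 0$, for some $\gamma\ge1$ and positive $\kappa_0,\kappa_1$; and there are positive $d_0,d_1$ with $\mathbb{E}[\langle Y_s,e_j\rangle^2]\le d_0\exp(-d_1j)$ for all $j\in\mathbb{N}$. (7) With $\tilde\vartheta_x(u)=\mathbb{E}[\|Y_s\|_{\mathcal{H}}\,|\,\rho(X_s,x)=u]$: $\sup_{x\in\mathcal{S},\|x\|_\infty\le R}\tilde\vartheta_x(0)=\mathcal{O}(R^r)$, and there is $\delta>0$ such that $\tilde\vartheta_x'(u)$ exists for all $x\in\mathcal{S}$, $0\le u\le\delta$, and $\sup_{x\in\mathcal{S},u\le\delta}|\tilde\vartheta'_x(u)|<\infty$. (8) The process $(X_s,Y_s)$ is strongly spatial mixing with $\alpha(k)\le c_0\exp(-c_1k)$ for constants $c_0,c_1>0$. Let $(n(k):k\in\mathbb{N})$ be a sequence in $\mathbb{N}^N$ which converges to infinity. Let $R_n$ be a real-valued sequence which has a limit in $(0,\infty]$, and assume that the bandwidth $h=h_n>0$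 converges to zero such that $$\frac{R_n^{5d/2}(\log|I_n|)^7}{|I_n|^{\frac1N\cdot\frac{2}{5d+2}}\ \inf_{x\in\mathcal{G}(R_n)}F_x(h)}\to0\quad\text{and}\quad\frac{R_n^r}{|I_n|^{\frac1N\cdot\frac2{5d+2}}\ h}\to0.$$ Then, almost surely, $$\sup_{x\in\mathcal{G}(R_n)}\left\|\hat\Psi_h(x)-\Psi(x)\right\|_{\mathcal{H}}=\mathcal{O}\left(\frac{R_n^{5d/2}(\log|I_n|)^7}{|I_n|^{\frac1N\cdot\frac2{5d+2}}\ \inf_{x\in\mathcal{G}(R_n)}F_x(h)}\right)+\mathcal{O}\left(\frac{R_n^r}{|I_n|^{\frac1N\cdot\frac2{5d+2}}\ h}\right)+\mathcal{O}(h^r).$$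
   Context: $\mathcal{D}$ is a convex and compact subset of $\mathbb{R}^d$; $\mathcal{H}=L^2(\mathcal{D},\mathcal{B}(\mathcal{D}),\nu)$ (real-valued functions) for a finite measure $\nu$, with $\langle x,y\rangle=\int_{\mathcal{D}}xy\,d\nu$, norm $\|\cdot\|_{\mathcal{H}}$ and an orthonormal basis $\{e_j:j\in\mathbb{N}\}$. $\mathcal{S}$ satisfies $C^0(\mathcal{D})\subseteq\mathcal{S}\subseteq\mathcal{H}$. $\|x\|_\infty$ is the $\nu$-essential supremum of $|x|$ on $\mathcal{D}$. $\rho$ is a pseudo-metric on $\mathcal{S}$ with $\rho(x,y)\le\|x-y\|_{\mathcal{H}}$ for all $x,y\in\mathcal{S}$. $N\ge1$ is an integer. Small ball probability: $F_x(h)=\mathbb{P}(\rho(X_s,x)\le h)$, $h\ge0$. Coordinates: $\psi_j=\langle\Psi(\cdot),e_j\rangle$ and $\vartheta_{x,j}(u)=\mathbb{E}[\psi_j(X_s)-\psi_j(x)\,|\,\rho(X_s,x)=u]$. In assumption (5), Lipschitz continuity in $z$ is with respect to $\rho$. For $n\in\mathbb{N}^N$, $I_n=\{s\in\mathbb{Z}^N:1\le s_i\le n_i,\ i=1,\dots,N\}$, with cardinality $|I_n|$. Estimator: for a kernel $K:[0,\infty)\to\mathbb{R}$ and $K_h=K(\cdot/h)$, $\hat\Psi_h(x)=\hat g_h(x)/\hat f_h(x)$, where $$\hat f_h(x)=\frac1{|I_n|F_x(h)}\sum_{s\in I_n}K_h(\rho(X_s,x))\in\mathbb{R},\qquad\hat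 g_h(x)=\frac1{|I_n|F_x(h)}\sum_{s\in I_n}Y_sK_h(\rho(X_s,x))\in\mathcal{H}.$$ For $R>0$, $\mathcal{G}(R)=\{x\in C^0(\mathcal{D}):\|x\|_{1,C^0(\mathcal{D})}\le R\}$, where $\|x\|_{1,C^0(\mathcal{D})}=\sup_{u\in\mathcal{D}}|x(u)|+\sup_{u,v\in\mathcal{D},u\ne v}|x(u)-x(v)|/\|u-v\|$. "$(n(k))$ converges to infinity" means $\liminf_{k\to\infty}\min_in_i(k)/\max_in_i(k)>0$ and $\lim_{k\to\infty}n_i(k)=\infty$ for all $i$; a sequence indexed by $n$ is indexed by $n=n(k)$, and limits and $\mathcal{O}$-terms are for $k\to\infty$. Mixing coefficients of $Z_s=(X_s,Y_s)$: $\alpha(k)=\sup\{\alpha(\mathcal{F}(I),\mathcal{F}(J)):I,J\subseteq\mathbb{Z}^N,\ d_\infty(I,J)\ge k\}$ with $\mathcal{F}(I)=\sigma(Z_s:s\in I)$, $d_\infty(I,J)=\inf\{\|s-t\|_{\max}:s\in I,t\in J\}$ and $\alpha(\mathcal{F},\mathcal{G})=\sup\{|\mathbb{P}(A\cap B)-\mathbb{P}(A)\mathbb{P}(B)|:A\in\mathcal{F},B\in\mathcal{G}\}$. *)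

theory Defs
  imports "HOL-Probability.Probability" "HOL-Library.Landau_Symbols"
begin

section \<open>The Hilbert space of square-integrable functions\<close>

definition L2_fun :: "'a measure \<Rightarrow> ('a \<Rightarrow> real) set" where
  "L2_fun \<nu> = {f \<in> borel_measurable \<nu>. integrable \<nu> (\<lambda>u. (f u)\<^sup>2)}"

text \<open>
  HOL types cannot depend on \<open>\<nu>\<close>, so the space of equivalence classes is given by a
  Hilbert space type \<open>'h\<close> together with the quotient map \<open>cls\<close> sending a function to its class;
  \<open>L2_space \<nu> cls\<close> determines \<open>'h\<close> up to isometric isomorphism. Lemma \<open>L2_space_eq_iff\<close>
  below: two functions have the same class iff they agree almost everywhere.
\<close>

definition L2_space :: "'a measure \<Rightarrow> (('a \<Rightarrow> real) \<Rightarrow> 'h::real_inner) \<Rightarrow> bool" where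
  "L2_space \<nu> cls \<longleftrightarrow>
     cls ` L2_fun \<nu> = UNIV \<and>
     (\<forall>f\<in>L2_fun \<nu>. \<forall>g\<in>L2_fun \<nu>. cls (\<lambda>u. f u + g u) = cls f + cls g) \<and>
     (\<forall>c. \<forall>f\<in>L2_fun \<nu>. cls (\<lambda>u. c * f u) = c *\<^sub>R cls f) \<and>
     (\<forall>f\<in>L2_fun \<nu>. \<forall>g\<in>L2_fun \<nu>. cls f \<bullet> cls g = (\<integral>u. f u * g u \<partial>\<nu>))"

lemma L2_space_eq_iff:
  assumes L2: "L2_space \<nu> cls" and f: "f \<in> L2_fun \<nu>" and g: "g \<in> L2_fun \<nu>"
  shows "cls f = cls g \<longleftrightarrow> (AE u in \<nu>. f u = g u)"
proof -
  have fm[measurable]: "f \<in> borel_measurable \<nu>" and gm[measurable]: "g \<in> borel_measurable \<nu>"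
    and fi: "integrable \<nu> (\<lambda>u. (f u)\<^sup>2)" and gi: "integrable \<nu> (\<lambda>u. (g u)\<^sup>2)"
    using f g by (auto simp: L2_fun_def)
  have fg: "integrable \<nu> (\<lambda>u. f u * g u)"
  proof (rule Bochner_Integration.integrable_bound[where f = "\<lambda>u. (f u)\<^sup>2 + (g u)\<^sup>2"])
    show "AE u in \<nu>. norm (f u * g u) \<le> norm ((f u)\<^sup>2 + (g u)\<^sup>2)"
    proof (rule AE_I2)
      fix u
      have "2 * \<bar>f u * g u\<bar> \<le> (f u)\<^sup>2 + (g u)\<^sup>2"
        using sum_squares_bound[of "\<bar>f u\<bar>" "\<bar>g u\<bar>"] by (simp add: abs_mult mult.assoc)
      then show "norm (f u * g u) \<le> norm ((f u)\<^sup>2 + (g u)\<^sup>2)" by simp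
    qed
  qed (use fi gi in auto)
  have "(norm (cls f - cls g))\<^sup>2 = cls f \<bullet> cls f - 2 * (cls f \<bullet> cls g) + cls g \<bullet> cls g"
    by (simp add: power2_norm_eq_inner inner_diff_left inner_diff_right inner_commute)
  also have "\<dots> = (\<integral>u. (f u)\<^sup>2 \<partial>\<nu>) - 2 * (\<integral>u. f u * g u \<partial>\<nu>) + (\<integral>u. (g u)\<^sup>2 \<partial>\<nu>)"
    using L2 f g by (simp add: L2_space_def power2_eq_square)
  also have "\<dots> = (\<integral>u. (f u)\<^sup>2 - 2 * (f u * g u) + (g u)\<^sup>2 \<partial>\<nu>)"
    using fi gi fg by simp
  also have "\<dots> = (\<integral>u. (f u - g u)\<^sup>2 \<partial>\<nu>)"
    by (intro Bochner_Integration.integral_cong) (auto simp: power2_diff)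
  finally have *: "(norm (cls f - cls g))\<^sup>2 = (\<integral>u. (f u - g u)\<^sup>2 \<partial>\<nu>)" .
  have "integrable \<nu> (\<lambda>u. (f u)\<^sup>2 - 2 * (f u * g u) + (g u)\<^sup>2)"
    using fi gi fg by auto
  then have "integrable \<nu> (\<lambda>u. (f u - g u)\<^sup>2)"
    by (rule Bochner_Integration.integrable_cong[THEN iffD1, OF refl, rotated])
       (simp add: power2_diff)
  then have "(\<integral>u. (f u - g u)\<^sup>2 \<partial>\<nu>) = 0 \<longleftrightarrow> (AE u in \<nu>. (f u - g u)\<^sup>2 = 0)"
    by (intro integral_nonneg_eq_0_iff_AE) auto
  with * have "(norm (cls f - cls g))\<^sup>2 = 0 \<longleftrightarrow> (AE u in \<nu>. (f u - g u)\<^sup>2 = 0)"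
    by metis
  then show ?thesis by simp
qed

definition orthonormal_basis :: "(nat \<Rightarrow> 'h::real_inner) \<Rightarrow> bool" where
  "orthonormal_basis e \<longleftrightarrow>
     (\<forall>i j. e i \<bullet> e j = (if i = j then 1 else 0)) \<and> closure (span (range e)) = UNIV"

text \<open>By \<open>L2_space_eq_iff\<close> the value does not depend on the chosen representative.\<close>

definition ess_norm ::
    "'a measure \<Rightarrow> (('a \<Rightarrow> real) \<Rightarrow> 'h) \<Rightarrow> 'h \<Rightarrow> ereal" where
  "ess_norm \<nu> cls x = esssup \<nu> (\<lambda>u. ereal \<bar>inv_into (L2_fun \<nu>) cls x u\<bar>)"

definition C0 :: "'a::topological_space set \<Rightarrow> ('a \<Rightarrow> real) set" where
  "C0 D = {f. continuous_on D f}"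

definition norm1_C0 :: "'a::real_normed_vector set \<Rightarrow> ('a \<Rightarrow> real) \<Rightarrow> ennreal" where
  "norm1_C0 D f = (SUP u\<in>D. ennreal \<bar>f u\<bar>) +
     (SUP (u, v)\<in>{(u, v). u \<in> D \<and> v \<in> D \<and> u \<noteq> v}. ennreal (\<bar>f u - f v\<bar> / norm (u - v)))"

definition Lip_ball ::
    "'a::real_normed_vector set \<Rightarrow> (('a \<Rightarrow> real) \<Rightarrow> 'h) \<Rightarrow> real \<Rightarrow> 'h set" where
  "Lip_ball D cls R = cls ` {f \<in> C0 D. norm1_C0 D f \<le> ennreal R}"

definition pseudometric_on :: "'a set \<Rightarrow> ('a \<Rightarrow> 'a \<Rightarrow> real) \<Rightarrow> bool" where
  "pseudometric_on S \<rho> \<longleftrightarrow>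
     (\<forall>x\<in>S. \<rho> x x = 0) \<and>
     (\<forall>x\<in>S. \<forall>y\<in>S. 0 \<le> \<rho> x y \<and> \<rho> x y = \<rho> y x) \<and>
     (\<forall>x\<in>S. \<forall>y\<in>S. \<forall>z\<in>S. \<rho> x z \<le> \<rho> x y + \<rho> y z)"


section \<open>Conditional expectations\<close>

text \<open>
  \<open>g\<close> is a version of the conditional expectation of the integrable random variable \<open>f\<close> given
  \<open>F\<close>. Unlike \<open>real_cond_exp\<close> this covers Hilbert-space valued \<open>f\<close>; for real \<open>f\<close> it agrees
  with \<open>real_cond_exp\<close> by \<open>is_cond_exp_real\<close>.
\<close>

definition is_cond_exp :: "'w measure \<Rightarrow> 'w measure \<Rightarrow>
    ('w \<Rightarrow> 'b::{banach, second_countable_topology}) \<Rightarrow> ('w \<Rightarrow> 'b) \<Rightarrow> bool" where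
  "is_cond_exp M F f g \<longleftrightarrow>
     integrable M f \<and> integrable M g \<and> g \<in> borel_measurable F \<and>
     (\<forall>A\<in>sets F. (\<integral>\<omega>\<in>A. f \<omega> \<partial>M) = (\<integral>\<omega>\<in>A. g \<omega> \<partial>M))"

definition sigma_rv :: "'w measure \<Rightarrow> ('w \<Rightarrow> 'b::topological_space) \<Rightarrow> 'w measure" where
  "sigma_rv M V = vimage_algebra (space M) V borel"

text \<open>
  \<open>g\<close> is a version of \<open>v \<mapsto> E[f | V = v]\<close>. Such a function is determined only up to null sets of
  the law of \<open>V\<close>; pointwise conditions are conditions on the chosen version.
\<close>

definition is_cond_exp_at :: "'w measure \<Rightarrow>
    ('w \<Rightarrow> real) \<Rightarrow> ('w \<Rightarrow> real) \<Rightarrow> (real \<Rightarrow> real) \<Rightarrow> bool" where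
  "is_cond_exp_at M f V g \<longleftrightarrow>
     g \<in> borel_measurable borel \<and> is_cond_exp M (sigma_rv M V) f (\<lambda>\<omega>. g (V \<omega>))"

lemma is_cond_exp_real:
  fixes f g :: "'w \<Rightarrow> real"
  assumes "prob_space M" and F: "subalgebra M F" and fg: "is_cond_exp M F f g"
  shows "AE \<omega> in M. real_cond_exp M F f \<omega> = g \<omega>"
proof -
  interpret prob_space M by fact
  interpret finite_measure_subalgebra M F using F by unfold_locales
  show ?thesis
    using fg by (intro real_cond_exp_charact) (auto simp: is_cond_exp_def)
qed


section \<open>Random fields on the integer lattice\<close>

text \<open>Invariance of all finite-dimensional distributions under translations.\<close>

definition strictly_stationary ::
    "'w measure \<Rightarrow> ('i::plus \<Rightarrow> 'w \<Rightarrow> 'b::topological_space) \<Rightarrow> bool" where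
  "strictly_stationary M Z \<longleftrightarrow>
     (\<forall>J t. finite J \<longrightarrow>
        distr M (\<Pi>\<^sub>M s\<in>J. borel) (\<lambda>\<omega>. \<lambda>s\<in>J. Z (s + t) \<omega>) =
        distr M (\<Pi>\<^sub>M s\<in>J. borel) (\<lambda>\<omega>. \<lambda>s\<in>J. Z s \<omega>))"

definition events_of ::
    "'w measure \<Rightarrow> ('i \<Rightarrow> 'w \<Rightarrow> 'b::topological_space) \<Rightarrow> 'i set \<Rightarrow> 'w set set" where
  "events_of M Z I =
     sigma_sets (space M) (\<Union>s\<in>I. {Z s -` A \<inter> space M | A. A \<in> sets borel})"

definition alpha_events :: "'w measure \<Rightarrow> 'w set set \<Rightarrow> 'w set set \<Rightarrow> real" where
  "alpha_events M \<F> \<G> =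
     (SUP (A, B)\<in>\<F> \<times> \<G>. \<bar>measure M (A \<inter> B) - measure M A * measure M B\<bar>)"

definition max_norm :: "int ^ 'n::finite \<Rightarrow> nat" where
  "max_norm s = Max (range (\<lambda>i. nat \<bar>s $ i\<bar>))"

definition set_dist :: "(int ^ 'n::finite) set \<Rightarrow> (int ^ 'n) set \<Rightarrow> enat" where
  "set_dist I J = (INF (s, t)\<in>I \<times> J. enat (max_norm (s - t)))"

definition mixing_coeff ::
    "'w measure \<Rightarrow> (int ^ 'n::finite \<Rightarrow> 'w \<Rightarrow> 'b::topological_space) \<Rightarrow> nat \<Rightarrow> real" where
  "mixing_coeff M Z k =
     (SUP (I, J)\<in>{(I, J). enat k \<le> set_dist I J}.
        alpha_events M (events_of M Z I) (events_of M Z J))"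

definition grid :: "nat ^ 'n::finite \<Rightarrow> (int ^ 'n) set" where
  "grid n = {s. \<forall>i. 1 \<le> s $ i \<and> s $ i \<le> int (n $ i)}"

definition converges_to_infinity :: "(nat \<Rightarrow> nat ^ 'n::finite) \<Rightarrow> bool" where
  "converges_to_infinity n \<longleftrightarrow>
     liminf (\<lambda>k. ereal (real (Min (range (\<lambda>i. n k $ i))) / real (Max (range (\<lambda>i. n k $ i))))) > 0 \<and>
     (\<forall>i. filterlim (\<lambda>k. n k $ i) at_top sequentially)"


section \<open>Small ball probabilities and the kernel estimator\<close>

text \<open>
  The fields are stationary, so \<open>s = 0\<close> represents the common law of all \<open>X s\<close>.
\<close>

definition small_ball :: "'w measure \<Rightarrow> ('h \<Rightarrow> 'h \<Rightarrow> real) \<Rightarrow>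
    (int ^ 'n::finite \<Rightarrow> 'w \<Rightarrow> 'h) \<Rightarrow> 'h \<Rightarrow> real \<Rightarrow> real" where
  "small_ball M \<rho> X x h = measure M {\<omega> \<in> space M. \<rho> (X 0 \<omega>) x \<le> h}"

definition f_hat :: "'w measure \<Rightarrow> ('h \<Rightarrow> 'h \<Rightarrow> real) \<Rightarrow> (real \<Rightarrow> real) \<Rightarrow>
    (int ^ 'n::finite \<Rightarrow> 'w \<Rightarrow> 'h) \<Rightarrow> nat ^ 'n \<Rightarrow> real \<Rightarrow> 'h \<Rightarrow> 'w \<Rightarrow> real" where
  "f_hat M \<rho> K X n h x \<omega> =
     (1 / (real (card (grid n)) * small_ball M \<rho> X x h)) *
       (\<Sum>s\<in>grid n. K (\<rho> (X s \<omega>) x / h))"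

definition g_hat :: "'w measure \<Rightarrow> ('h \<Rightarrow> 'h \<Rightarrow> real) \<Rightarrow> (real \<Rightarrow> real) \<Rightarrow>
    (int ^ 'n::finite \<Rightarrow> 'w \<Rightarrow> 'h) \<Rightarrow> (int ^ 'n \<Rightarrow> 'w \<Rightarrow> 'h) \<Rightarrow>
    nat ^ 'n \<Rightarrow> real \<Rightarrow> 'h \<Rightarrow> 'w \<Rightarrow> 'h::real_vector" where
  "g_hat M \<rho> K X Y n h x \<omega> =
     (1 / (real (card (grid n)) * small_ball M \<rho> X x h)) *\<^sub>R
       (\<Sum>s\<in>grid n. K (\<rho> (X s \<omega>) x / h) *\<^sub>R Y s \<omega>)"

text \<open>The estimator is \<open>0\<close> where the denominator \<open>f_hat\<close> vanishes.\<close>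

definition Psi_hat :: "'w measure \<Rightarrow> ('h \<Rightarrow> 'h \<Rightarrow> real) \<Rightarrow> (real \<Rightarrow> real) \<Rightarrow>
    (int ^ 'n::finite \<Rightarrow> 'w \<Rightarrow> 'h) \<Rightarrow> (int ^ 'n \<Rightarrow> 'w \<Rightarrow> 'h) \<Rightarrow>
    nat ^ 'n \<Rightarrow> real \<Rightarrow> 'h \<Rightarrow> 'w \<Rightarrow> 'h::real_vector" where
  "Psi_hat M \<rho> K X Y n h x \<omega> = g_hat M \<rho> K X Y n h x \<omega> /\<^sub>R f_hat M \<rho> K X n h x \<omega>"

text \<open>
  The two rates of the theorem, as functions of the index \<open>m\<close>. The infimum in the first is a
  real infimum over a bounded below set. When \<open>0 < R m\<close>, it is positive for small bandwidths:
  \<open>Lip_ball D cls (R m)\<close> is then compact and, as small ball probabilities are positive and Lipschitz in the centre,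
  the infimum over it is attained.
\<close>

definition rate1 :: "'w measure \<Rightarrow> ('h \<Rightarrow> 'h \<Rightarrow> real) \<Rightarrow> (int ^ 'n::finite \<Rightarrow> 'w \<Rightarrow> 'h) \<Rightarrow>
    (real ^ 'd::finite) set \<Rightarrow> ((real ^ 'd \<Rightarrow> real) \<Rightarrow> 'h) \<Rightarrow>
    (nat ^ 'n \<Rightarrow> real) \<Rightarrow> (nat ^ 'n \<Rightarrow> real) \<Rightarrow> nat ^ 'n \<Rightarrow> real" where
  "rate1 M \<rho> X D cls R h m =
     R m powr (5 * real CARD('d) / 2) * ln (real (card (grid m))) ^ 7 /
     (real (card (grid m)) powr (1 / real CARD('n) * (2 / (5 * real CARD('d) + 2))) *
        (INF x\<in>Lip_ball D cls (R m). small_ball M \<rho> X x (h m)))"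

definition rate2 :: "'d::finite itself \<Rightarrow> real \<Rightarrow>
    (nat ^ 'n::finite \<Rightarrow> real) \<Rightarrow> (nat ^ 'n \<Rightarrow> real) \<Rightarrow> nat ^ 'n \<Rightarrow> real" where
  "rate2 _ r R h m =
     R m powr r /
     (real (card (grid m)) powr (1 / real CARD('n) * (2 / (5 * real CARD('d) + 2))) * h m)"

end

theory Submission
  imports Defs "HOL-Complex_Analysis.Great_Picard"
begin

text \<open>
  Cutting the lattice into slabs along one coordinate axis turns the field into a strongly mixing
  sequence. A blocking argument with a Bernstein-type inequality bounds the deviation of averages of
  bounded functions of \<open>(X s, Y s)\<close>; the error caused by dependence is \<open>exp (- c1 q)\<close> for blocks of
  length \<open>q\<close>, so that it beats the entropy, of order \<open>(R / \<delta>)\<^sup>d\<close>, of the Lipschitz ball at the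
  scale \<open>\<delta>\<close> which enters the rates. Hence the averages are close to their means simultaneously at all
  points of a \<open>\<delta>\<close>-net. Between a net point and a nearby \<open>x\<close> the kernel weights differ by
  \<open>O(\<delta> / h)\<close> inside the ball of radius \<open>h\<close>, and by \<open>O(1)\<close> on a boundary layer whose probability
  is \<open>O(\<delta>)\<close> by assumption (5). The bias is \<open>O(h)\<close> by assumption (1) and Parseval's identity.
\<close>

section \<open>Deviations of strongly mixing sequences\<close>

text \<open>The exponents come from one balance. Let \<open>\<delta>\<close> = |I|^(-2/(N(5d+2))), L
  = log|I| and T = (R/\<open>\<delta>\<close>)^d. With blocks of length about T L^2, the exponential
  inequality needs p \<open>\<eta>\<close> to be a large multiple of T^2 L^3, where the side p is of
  order |I|^(1/N) = \<open>\<delta>\<close>^(-(5d+2)/2). Hence the deviation \<open>\<eta>\<close> =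
  R^(5d/2 - r) L^5 \<open>\<delta>\<close> is admissible, with (R/\<open>\<delta>\<close>)^(d/2) to
  spare against R^(-r). The rate has L^7 because \<open>Y\<close> is neither bounded nor finite
  dimensional: it is cut off at height O(L) and resolved into O(L) coordinates, one logarithm each.
  The factor R^r held back from \<open>\<eta>\<close> pays for the size of \<open>\<Psi>\<close> on
  the Lipschitz ball. Two kinds of error are kept apart. Fluctuations and the boundary layer are
  absolute; they become relative only after division by a small ball probability and give the first
  rate. Changes of the weights inside the ball are proportional to \<open>F x h\<close> and give the
  second rate without that division. The boundary layer is there because \<open>K\<close> may jump
  at 1.\<close>

context prob_space
begin

lemma integrable_bdd:
  fixes f :: "'a \<Rightarrow> real"
  assumes "f \<in> borel_measurable M" "\<And>x. x \<in> space M \<Longrightarrow> \<bar>f x\<bar> \<le> B"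
  shows "integrable M f"
  by (rule integrable_const_bound[where B = B]) (use assms in auto)

text \<open>Conditioning turns the left side into |E(f \<open>\<eta>\<close>)| with
  \<open>\<eta>\<close> = E[g|F] - E g, hence at most E|\<open>\<eta>\<close>|. As
  \<open>\<eta>\<close> has mean zero, that is twice its integral over the event where it is
  nonnegative. So a bounded test function is traded for an event at the cost of a factor 2.\<close>

lemma cov_step:
  fixes f g :: "'a \<Rightarrow> real"
  assumes F: "subalgebra M F" and f: "f \<in> borel_measurable F"
    and f1: "\<And>x. x \<in> space M \<Longrightarrow> \<bar>f x\<bar> \<le> 1" and g: "integrable M g"
  shows "\<exists>A\<in>sets F. \<bar>expectation (\<lambda>x. f x * g x) - expectation f * expectation g\<bar>
      \<le> 2 * \<bar>expectation (\<lambda>x. indicator A x * g x) - prob A * expectation g\<bar>"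
proof -
  interpret finite_measure_subalgebra M F using F by unfold_locales
  define \<eta> where "\<eta> x = real_cond_exp M F g x - expectation g" for x
  have [measurable]: "\<eta> \<in> borel_measurable F" unfolding \<eta>_def by measurable
  have [measurable]: "\<eta> \<in> borel_measurable M"
    by (rule measurable_from_subalg[OF F]) simp
  have fM [measurable]: "f \<in> borel_measurable M" by (rule measurable_from_subalg[OF F f])
  have [measurable]: "g \<in> borel_measurable M" using g by simp
  have sp: "space F = space M" using F by (simp add: subalgebra_def)
  define A where "A = {x \<in> space M. 0 \<le> \<eta> x}"
  have A: "A \<in> sets F" unfolding A_def sp[symmetric] by measurable
  then have AM [measurable]: "A \<in> sets M" using F by (auto simp: subalgebra_def)
  have rce: "integrable M (real_cond_exp M F g)" "expectation (real_cond_exp M F g) = expectation g"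
    using real_cond_exp_int[OF g] by auto
  have \<eta>i: "integrable M \<eta>" unfolding \<eta>_def using rce by auto
  have \<eta>0: "expectation \<eta> = 0" unfolding \<eta>_def using rce by (simp add: prob_space)
  have fi: "integrable M f" by (rule integrable_bdd[OF fM f1])
  have key: "expectation (\<lambda>x. u x * \<eta> x) = expectation (\<lambda>x. u x * g x) - expectation u * expectation g"
    if u: "u \<in> borel_measurable F" and u1: "\<And>x. x \<in> space M \<Longrightarrow> \<bar>u x\<bar> \<le> 1" for u :: "'a \<Rightarrow> real"
  proof -
    have uM[measurable]: "u \<in> borel_measurable M" by (rule measurable_from_subalg[OF F u])
    have ui: "integrable M u" by (rule integrable_bdd[OF uM u1])
    have ug: "integrable M (\<lambda>x. u x * g x)"
      by (rule Bochner_Integration.integrable_bound[OF g])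
        (use u1 in \<open>auto simp: abs_mult intro!: mult_left_le_one_le\<close>)
    note r = real_cond_exp_intg[OF ug u]
    have "expectation (\<lambda>x. u x * \<eta> x) = expectation (\<lambda>x. u x * real_cond_exp M F g x - u x * expectation g)"
      by (simp add: \<eta>_def algebra_simps)
    also have "\<dots> = expectation (\<lambda>x. u x * g x) - expectation u * expectation g"
      using r ui by simp
    finally show ?thesis .
  qed
  have f\<eta>: "integrable M (\<lambda>x. f x * \<eta> x)"
    by (rule Bochner_Integration.integrable_bound[OF \<eta>i])
      (use f1 in \<open>auto simp: abs_mult intro!: mult_left_le_one_le\<close>)
  have A\<eta>: "integrable M (\<lambda>x. indicator A x * \<eta> x)"
    using integrable_mult_indicator[OF AM \<eta>i] by simp
  have "\<bar>expectation (\<lambda>x. f x * \<eta> x)\<bar> \<le> expectation (\<lambda>x. \<bar>f x * \<eta> x\<bar>)"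
    by (rule integral_abs_bound)
  also have "\<dots> \<le> expectation (\<lambda>x. \<bar>\<eta> x\<bar>)"
    by (rule integral_mono[OF integrable_abs[OF f\<eta>] integrable_abs[OF \<eta>i]])
      (use f1 in \<open>auto simp: abs_mult intro!: mult_left_le_one_le\<close>)
  also have "\<dots> = expectation (\<lambda>x. 2 * (indicator A x * \<eta> x) - \<eta> x)"
    by (rule Bochner_Integration.integral_cong) (auto simp: A_def indicator_def)
  also have "\<dots> = 2 * expectation (\<lambda>x. indicator A x * \<eta> x)"
    using A\<eta> \<eta>i \<eta>0 by simp
  also have "expectation (\<lambda>x. indicator A x * \<eta> x) =
      expectation (\<lambda>x. indicator A x * g x) - prob A * expectation g"
    using key[of "indicator A"] A by (simp add: indicator_def)
  finally have "\<bar>expectation (\<lambda>x. f x * \<eta> x)\<bar>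
      \<le> 2 * (expectation (\<lambda>x. indicator A x * g x) - prob A * expectation g)" .
  then have "\<bar>expectation (\<lambda>x. f x * \<eta> x)\<bar>
      \<le> 2 * \<bar>expectation (\<lambda>x. indicator A x * g x) - prob A * expectation g\<bar>"
    by (rule order_trans) (intro mult_left_mono abs_ge_self, simp)
  then show ?thesis using key[OF f f1] A by auto
qed

text \<open>\<open>cov_step\<close> replaces first \<open>f\<close> and then \<open>g\<close> by an
  indicator; each replacement costs a factor 2.\<close>

lemma cov_le:
  fixes f g :: "'a \<Rightarrow> real"
  assumes F: "subalgebra M F" and G: "subalgebra M G"
    and f: "f \<in> borel_measurable F" "\<And>x. x \<in> space M \<Longrightarrow> \<bar>f x\<bar> \<le> 1"
    and g: "g \<in> borel_measurable G" "\<And>x. x \<in> space M \<Longrightarrow> \<bar>g x\<bar> \<le> 1"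
    and a: "\<And>A B. A \<in> sets F \<Longrightarrow> B \<in> sets G \<Longrightarrow> \<bar>prob (A \<inter> B) - prob A * prob B\<bar> \<le> a"
  shows "\<bar>expectation (\<lambda>x. f x * g x) - expectation f * expectation g\<bar> \<le> 4 * a"
proof -
  have gM: "g \<in> borel_measurable M" by (rule measurable_from_subalg[OF G g(1)])
  obtain A where A: "A \<in> sets F" and 1: "\<bar>expectation (\<lambda>x. f x * g x) - expectation f * expectation g\<bar>
      \<le> 2 * \<bar>expectation (\<lambda>x. indicator A x * g x) - prob A * expectation g\<bar>"
    using cov_step[OF F f integrable_bdd[OF gM g(2)]] by auto
  have AM[measurable]: "A \<in> sets M" using A F by (auto simp: subalgebra_def)
  obtain B where B: "B \<in> sets G" and 2: "\<bar>expectation (\<lambda>x. g x * indicator A x) - expectation g * expectation (indicator A)\<bar>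
      \<le> 2 * \<bar>expectation (\<lambda>x. indicator B x * indicator A x) - prob B * expectation (indicator A)\<bar>"
    using cov_step[OF G g, of "indicator A"] by (auto simp: less_top[symmetric])
  have BM[measurable]: "B \<in> sets M" using B G by (auto simp: subalgebra_def)
  have "expectation (\<lambda>x. indicator B x * indicator A x) = prob (A \<inter> B)"
    by (simp add: indicator_inter_arith[symmetric] Int_commute)
  with 1 2 a[OF A B] show ?thesis by (simp add: mult.commute)
qed

text \<open>
  The variables take finitely many values, so the mixing coefficient bounds the distance between
  the law of \<open>(past, U i)\<close> and the product of its marginals up to the factor \<open>card V\<close>; no factor
  involving the size of the exponentials is lost. The induction runs over the test function.
\<close>

lemma decoupling:
  fixes U :: "nat \<Rightarrow> 'a \<Rightarrow> real" and a :: real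
  assumes V: "finite V" "\<And>i x. x \<in> space M \<Longrightarrow> U i x \<in> V"
    and past: "\<And>i. subalgebra M (P i)" "\<And>i j. j < i \<Longrightarrow> U j \<in> borel_measurable (P i)"
    and U: "\<And>i. U i \<in> borel_measurable M"
    and a: "\<And>i A u. A \<in> sets (P i) \<Longrightarrow>
      \<bar>prob (A \<inter> {x \<in> space M. U i x = u}) - prob A * prob {x \<in> space M. U i x = u}\<bar> \<le> a"
    and g: "g \<in> borel_measurable borel" "\<And>s. 0 \<le> g s" "\<And>s. g s \<le> 1" "\<And>s. g s \<le> c * exp s"
  shows "expectation (\<lambda>x. g (\<Sum>i<J. U i x))
     \<le> c * (\<Prod>i<J. expectation (\<lambda>x. exp (U i x))) + real J * (real (card V) * (2 * a))"
  using g
proof (induction J arbitrary: g c)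
  case 0
  have "g 0 \<le> c" using "0.prems"(4)[of 0] by simp
  then show ?case by (simp add: prob_space)
next
  case (Suc J)
  note [measurable] = U Suc.prems(1)
  define p where "p u = prob {x \<in> space M. U J x = u}" for u
  \<comment> \<open>\<open>g'\<close> integrates \<open>U J\<close> out as if it were independent of
    the past. It is again a test function between 0 and 1, with \<open>c\<close> enlarged by the
    factor E exp(\<open>U J\<close>), so the induction hypothesis applies to it.\<close>
  define g' where "g' s = (\<Sum>u\<in>V. p u * g (s + u))" for s
  define S where "S x = (\<Sum>i<J. U i x)" for x
  have SP: "S \<in> borel_measurable (P J)" unfolding S_def using past by measurable
  have [measurable]: "S \<in> borel_measurable M" by (rule measurable_from_subalg[OF past(1) SP])
  have p0: "0 \<le> p u" for u by (simp add: p_def)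
  have sum_ind: "(\<Sum>u\<in>V. indicator {x \<in> space M. U J x = u} x * f u) = (f (U J x) :: real)"
    if "x \<in> space M" for x and f :: "real \<Rightarrow> real"
  proof -
    have "(\<Sum>u\<in>V. indicator {x \<in> space M. U J x = u} x * f u) = (\<Sum>u\<in>V. if U J x = u then f u else 0)"
      using that by (intro sum.cong) (auto simp: indicator_def)
    also have "\<dots> = f (U J x)" using V that by simp
    finally show ?thesis .
  qed
  have expU: "expectation (\<lambda>x. f (U J x)) = (\<Sum>u\<in>V. p u * f u)" for f :: "real \<Rightarrow> real"
  proof -
    have "expectation (\<lambda>x. f (U J x)) = expectation (\<lambda>x. \<Sum>u\<in>V. indicator {x \<in> space M. U J x = u} x * f u)"
      by (rule Bochner_Integration.integral_cong) (auto simp: sum_ind)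
    also have "\<dots> = (\<Sum>u\<in>V. p u * f u)"
      by (subst Bochner_Integration.integral_sum) (auto simp: p_def less_top[symmetric])
    finally show ?thesis .
  qed
  have psum: "(\<Sum>u\<in>V. p u) = 1" using expU[of "\<lambda>_. 1"] by (simp add: prob_space)
  have IH: "expectation (\<lambda>x. g' (S x)) \<le>
      (c * expectation (\<lambda>x. exp (U J x))) * (\<Prod>i<J. expectation (\<lambda>x. exp (U i x))) + real J * (real (card V) * (2 * a))"
    unfolding S_def
  proof (rule Suc.IH)
    show "g' \<in> borel_measurable borel" unfolding g'_def by measurable
    show "0 \<le> g' s" for s unfolding g'_def by (intro sum_nonneg mult_nonneg_nonneg p0 Suc.prems)
    have "g' s \<le> (\<Sum>u\<in>V. p u * 1)" for s
      unfolding g'_def by (intro sum_mono mult_left_mono p0 Suc.prems)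
    then show "g' s \<le> 1" for s using psum by simp
    show "g' s \<le> c * expectation (\<lambda>x. exp (U J x)) * exp s" for s
    proof -
      have "g' s \<le> (\<Sum>u\<in>V. p u * (c * exp (s + u)))"
        unfolding g'_def by (intro sum_mono mult_left_mono p0 Suc.prems)
      also have "\<dots> = c * expectation (\<lambda>x. exp (U J x)) * exp s"
        unfolding expU by (simp add: sum_distrib_left sum_distrib_right exp_add mult_ac)
      finally show ?thesis .
    qed
  qed
  have gi: "integrable M (\<lambda>x. g (S x + u))" for u
    by (rule integrable_bdd[where B = 1]) (use Suc.prems in auto)
  \<comment> \<open>The only use of mixing: \<open>cov_step\<close> exchanges the bounded function
    \<open>g (S x + u)\<close> of the past for an event of \<open>P J\<close>, while the event that
    \<open>U J\<close> equals \<open>u\<close> already has the required form.\<close>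
  have term_bnd: "expectation (\<lambda>x. indicator {x \<in> space M. U J x = u} x * g (S x + u))
      \<le> p u * expectation (\<lambda>x. g (S x + u)) + 2 * a" for u
  proof -
    have 1: "(\<lambda>x. g (S x + u)) \<in> borel_measurable (P J)"
      using SP by measurable
    obtain A where A: "A \<in> sets (P J)" and
      *: "\<bar>expectation (\<lambda>x. g (S x + u) * indicator {x \<in> space M. U J x = u} x)
           - expectation (\<lambda>x. g (S x + u)) * expectation (indicator {x \<in> space M. U J x = u})\<bar>
        \<le> 2 * \<bar>expectation (\<lambda>x. indicator A x * indicator {x \<in> space M. U J x = u} x)
           - prob A * expectation (indicator {x \<in> space M. U J x = u})\<bar>"
      using cov_step[OF past(1)[of J] 1, of "indicator {x \<in> space M. U J x = u}"] Suc.prems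
      by (auto simp: less_top[symmetric])
    have AM[measurable]: "A \<in> sets M" using A past(1)[of J] by (auto simp: subalgebra_def)
    have "expectation (\<lambda>x. indicator A x * indicator {x \<in> space M. U J x = u} x :: real)
        = prob (A \<inter> {x \<in> space M. U J x = u})"
      by (simp add: indicator_inter_arith[symmetric])
    then have "\<bar>expectation (\<lambda>x. g (S x + u) * indicator {x \<in> space M. U J x = u} x)
        - expectation (\<lambda>x. g (S x + u)) * p u\<bar> \<le> 2 * \<bar>prob (A \<inter> {x \<in> space M. U J x = u}) - prob A * p u\<bar>"
      using * by (simp add: p_def)
    moreover have "\<bar>x - y\<bar> \<le> 2 * \<bar>z\<bar> \<Longrightarrow> \<bar>z\<bar> \<le> a \<Longrightarrow> x \<le> y + 2 * a" for x y z :: real by linarith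
    moreover note a[OF A, of u, folded p_def]
    ultimately show ?thesis by (simp only: mult.commute[of "p u"] mult.commute[of _ "g _"])
  qed
  have "expectation (\<lambda>x. g (\<Sum>i<Suc J. U i x)) =
      expectation (\<lambda>x. \<Sum>u\<in>V. indicator {x \<in> space M. U J x = u} x * g (S x + u))"
    by (rule Bochner_Integration.integral_cong) (auto simp: sum_ind S_def)
  also have "\<dots> = (\<Sum>u\<in>V. expectation (\<lambda>x. indicator {x \<in> space M. U J x = u} x * g (S x + u)))"
    by (rule Bochner_Integration.integral_sum)
      (rule integrable_bdd[where B = 1], use Suc.prems in \<open>auto simp: indicator_def\<close>)
  also have "\<dots> \<le> (\<Sum>u\<in>V. p u * expectation (\<lambda>x. g (S x + u)) + 2 * a)"
    by (intro sum_mono term_bnd)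
  also have "\<dots> = expectation (\<lambda>x. g' (S x)) + real (card V) * (2 * a)"
    unfolding g'_def using gi by (simp add: sum.distrib)
  also have "\<dots> \<le> c * (\<Prod>i<Suc J. expectation (\<lambda>x. exp (U i x))) + real (Suc J) * (real (card V) * (2 * a))"
    using IH by (simp add: algebra_simps)
  finally show ?case .
qed

end

text \<open>Time is the position along one coordinate axis of the lattice. The sigma-algebras are
  indexed by arbitrary sets of times because the past of a block will consist of every second block,
  which is not an interval.\<close>

locale mixing_filtration = prob_space M for M :: "'w measure" +
  fixes F :: "nat set \<Rightarrow> 'w measure" and c0 c1 :: real
  assumes c0: "0 < c0" and c1: "0 < c1"
    and sub: "\<And>T. subalgebra M (F T)"
    and F_mono: "\<And>T T'. T \<subseteq> T' \<Longrightarrow> subalgebra (F T') (F T)"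
    and mix: "\<And>T T' k A B. (\<And>a b. a \<in> T \<Longrightarrow> b \<in> T' \<Longrightarrow> a + k \<le> b) \<Longrightarrow>
      A \<in> sets (F T) \<Longrightarrow> B \<in> sets (F T') \<Longrightarrow>
      \<bar>prob (A \<inter> B) - prob A * prob B\<bar> \<le> c0 * exp (- c1 * real k)"
begin

lemma F_up:
  assumes "T \<subseteq> T'" and f: "f \<in> borel_measurable (F T)"
  shows "f \<in> borel_measurable (F T')"
  by (rule measurable_from_subalg[OF F_mono[OF assms(1)] f])

text \<open>The factor 4 \<open>c0\<close> of the covariance inequality times the two-sided
  geometric sum 2/(1 - exp(-\<open>c1\<close>)).\<close>

definition block_const :: real where
  "block_const = 8 * c0 / (1 - exp (- c1))"

lemma block_const_pos: "0 < block_const"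
  using c0 c1 by (simp add: block_const_def)

lemma geometric_block:
  fixes a lo hi :: nat
  shows "(\<Sum>b\<in>{lo..<hi}. exp (- c1 * \<bar>real a - real b\<bar>)) \<le> 2 / (1 - exp (- c1))"
proof -
  let ?r = "exp (- c1)"
  have r: "0 < ?r" "?r < 1" using c1 by auto
  have geo: "(\<Sum>k\<in>K. ?r ^ k) \<le> 1 / (1 - ?r)" if "finite K" for K :: "nat set"
    using sum_le_suminf[OF summable_geometric[of ?r] that] r
    by (simp add: suminf_geometric)
  have e: "exp (- c1 * real k) = ?r ^ k" for k :: nat
    by (simp add: exp_of_nat_mult[symmetric] mult.commute)
  have "(\<Sum>b\<in>{lo..<hi}. exp (- c1 * \<bar>real a - real b\<bar>))
      = (\<Sum>b\<in>{b\<in>{lo..<hi}. b \<le> a}. exp (- c1 * \<bar>real a - real b\<bar>))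
      + (\<Sum>b\<in>{b\<in>{lo..<hi}. \<not> b \<le> a}. exp (- c1 * \<bar>real a - real b\<bar>))"
    by (subst sum.union_disjoint[symmetric]) (auto intro!: sum.cong)
  also have "(\<Sum>b\<in>{b\<in>{lo..<hi}. b \<le> a}. exp (- c1 * \<bar>real a - real b\<bar>))
      = (\<Sum>k\<in>(\<lambda>b. a - b) ` {b\<in>{lo..<hi}. b \<le> a}. ?r ^ k)"
    by (subst sum.reindex) (auto simp: inj_on_def e[symmetric] intro!: sum.cong)
  also have "(\<Sum>b\<in>{b\<in>{lo..<hi}. \<not> b \<le> a}. exp (- c1 * \<bar>real a - real b\<bar>))
      = (\<Sum>k\<in>(\<lambda>b. b - a) ` {b\<in>{lo..<hi}. \<not> b \<le> a}. ?r ^ k)"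
    by (subst sum.reindex) (auto simp: inj_on_def e[symmetric] intro!: sum.cong)
  also have "(\<Sum>k\<in>(\<lambda>b. a - b) ` {b\<in>{lo..<hi}. b \<le> a}. ?r ^ k)
      + (\<Sum>k\<in>(\<lambda>b. b - a) ` {b\<in>{lo..<hi}. \<not> b \<le> a}. ?r ^ k) \<le> 1 / (1 - ?r) + 1 / (1 - ?r)"
    by (intro add_mono geo) auto
  finally show ?thesis by simp
qed

end

locale mixing_sequence = mixing_filtration M F c0 c1
  for M :: "'w measure" and F c0 c1 +
  fixes W :: "nat \<Rightarrow> 'w \<Rightarrow> real"
  assumes W: "\<And>a. W a \<in> borel_measurable (F {a})"
    and W1: "\<And>a x. x \<in> space M \<Longrightarrow> \<bar>W a x\<bar> \<le> 1"
    and W0: "\<And>a. expectation (W a) = 0"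
begin

lemma WM [measurable]: "W a \<in> borel_measurable M"
  by (rule measurable_from_subalg[OF sub W])

text \<open>Division by \<open>q\<close> makes a block bounded by 1, so that exponential moments are
  taken at the fixed parameter 1; the variance is then of order 1/\<open>q\<close>.\<close>

definition block :: "nat \<Rightarrow> nat \<Rightarrow> 'w \<Rightarrow> real" where
  "block q i x = (\<Sum>a\<in>{i*q..<Suc i*q}. W a x) / q"

lemma block_measurable: "block q i \<in> borel_measurable (F {i*q..<Suc i*q})"
proof -
  have "(\<lambda>x. W a x) \<in> borel_measurable (F {i*q..<Suc i*q})" if "a \<in> {i*q..<Suc i*q}" for a
    by (rule F_up[OF _ W]) (use that in auto)
  then show ?thesis unfolding block_def by measurable
qed

lemma block_M [measurable]: "block q i \<in> borel_measurable M"
  by (rule measurable_from_subalg[OF sub block_measurable])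

lemma block_bound:
  assumes "0 < q" "x \<in> space M" shows "\<bar>block q i x\<bar> \<le> 1"
proof -
  have "\<bar>\<Sum>a\<in>{i*q..<Suc i*q}. W a x\<bar> \<le> (\<Sum>a\<in>{i*q..<Suc i*q}. 1)"
    by (rule order_trans[OF sum_abs sum_mono]) (use W1 assms in auto)
  then show ?thesis using assms by (simp add: block_def abs_div field_simps)
qed

lemma W_int: "integrable M (W a)"
  by (rule integrable_bdd[OF WM W1])

lemma block_mean: "expectation (block q i) = 0"
  unfolding block_def using W_int W0 by simp

lemma W_cov: "expectation (\<lambda>x. W a x * W b x) \<le> 4 * c0 * exp (- c1 * \<bar>real a - real b\<bar>)"
proof -
  have *: "expectation (\<lambda>x. W a x * W b x) \<le> 4 * c0 * exp (- c1 * \<bar>real a - real b\<bar>)"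
    if "a \<le> b" for a b
  proof -
    have m: "\<bar>prob (A \<inter> B) - prob A * prob B\<bar> \<le> c0 * exp (- c1 * real (b - a))"
      if "A \<in> sets (F {a})" "B \<in> sets (F {b})" for A B
      by (rule mix[of "{a}" "{b}"]) (use \<open>a \<le> b\<close> that in auto)
    have "\<bar>expectation (\<lambda>x. W a x * W b x) - expectation (W a) * expectation (W b)\<bar>
        \<le> 4 * (c0 * exp (- c1 * real (b - a)))"
      by (rule cov_le[OF sub sub W W1 W W1 m])
    then show ?thesis using W0 that by (simp add: of_nat_diff)
  qed
  show ?thesis
  proof (cases "a \<le> b")
    case False
    then show ?thesis using *[of b a] by (simp add: mult.commute abs_minus_commute)
  qed (rule *)
qed

text \<open>Covariances decay geometrically, so the double sum over \<open>q\<close>^2 pairs is only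
  of order \<open>q\<close>.\<close>

lemma block_second_moment:
  assumes q: "0 < q"
  shows "expectation (\<lambda>x. (block q i x)\<^sup>2) \<le> block_const / q"
proof -
  let ?I = "{i*q..<Suc i*q}"
  have WW: "integrable M (\<lambda>x. W a x * W b x)" for a b
    by (rule integrable_bdd[where B = 1])
      (use W1 in \<open>auto simp: abs_mult intro!: mult_le_one\<close>)
  have "expectation (\<lambda>x. (block q i x)\<^sup>2) = expectation (\<lambda>x. (\<Sum>a\<in>?I. \<Sum>b\<in>?I. W a x * W b x) / (real q)\<^sup>2)"
    unfolding block_def by (simp add: power_divide power2_eq_square sum_product)
  also have "\<dots> = (\<Sum>a\<in>?I. \<Sum>b\<in>?I. expectation (\<lambda>x. W a x * W b x)) / (real q)\<^sup>2"
    using WW by simp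
  also have "\<dots> \<le> (\<Sum>a\<in>?I. \<Sum>b\<in>?I. 4 * c0 * exp (- c1 * \<bar>real a - real b\<bar>)) / (real q)\<^sup>2"
    by (intro divide_right_mono sum_mono W_cov) auto
  also have "\<dots> \<le> (\<Sum>a\<in>?I. 4 * c0 * (2 / (1 - exp (- c1)))) / (real q)\<^sup>2"
    unfolding sum_distrib_left[symmetric] using c0
    by (intro divide_right_mono sum_mono mult_left_mono geometric_block) auto
  also have "\<dots> = block_const / q"
    using q by (simp add: block_const_def power2_eq_square)
  finally show ?thesis .
qed

text \<open>On [-1, 1] one has exp y \<le> 1 + y + y^2, and the linear term drops out because blocks
  are centred.\<close>

lemma block_exp_moment:
  assumes q: "0 < q"
  shows "expectation (\<lambda>x. exp (block q i x)) \<le> exp (block_const / q)"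
proof -
  have b1: "x \<in> space M \<Longrightarrow> \<bar>block q i x\<bar> \<le> 1" for x by (rule block_bound[OF q])
  have i2: "integrable M (\<lambda>x. (block q i x)\<^sup>2)"
    by (rule integrable_bdd[where B = 1]) (use b1 in \<open>auto simp: abs_square_le_1\<close>)
  have i1: "integrable M (block q i)" by (rule integrable_bdd[OF block_M b1])
  have ie: "integrable M (\<lambda>x. exp (block q i x))"
    by (rule integrable_bdd[where B = "exp 1"]) (use b1 in \<open>auto simp: abs_le_iff\<close>)
  have "expectation (\<lambda>x. exp (block q i x)) \<le> expectation (\<lambda>x. 1 + block q i x + (block q i x)\<^sup>2)"
  proof (rule integral_mono[OF ie])
    show "exp (block q i x) \<le> 1 + block q i x + (block q i x)\<^sup>2" if "x \<in> space M" for x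
    proof (cases "0 \<le> block q i x")
      case True
      then show ?thesis using exp_bound[OF True] b1[OF that] by simp
    next
      case False
      define y where "y = - block q i x"
      have y: "0 \<le> y" "y \<le> 1" using False b1[OF that] by (auto simp: y_def)
      \<comment> \<open>The product equals 1 + y^3.\<close>
      have "1 \<le> (1 - y + y\<^sup>2) * (1 + y)"
        using y by (simp add: algebra_simps power2_eq_square)
      also have "\<dots> \<le> (1 - y + y\<^sup>2) * exp y"
        using y exp_ge_add_one_self[of y] by (intro mult_left_mono) auto
      finally have "exp (- y) \<le> 1 - y + y\<^sup>2"
        by (simp add: exp_minus field_simps)
      then show ?thesis by (simp add: y_def)
    qed
  qed (use i1 i2 in auto)
  also have "\<dots> = 1 + expectation (\<lambda>x. (block q i x)\<^sup>2)"
    using i1 i2 block_mean[of q i] by (simp add: prob_space)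
  also have "\<dots> \<le> 1 + block_const / q" using block_second_moment[OF q] by simp
  also have "\<dots> \<le> exp (block_const / q)" by (rule exp_ge_add_one_self)
  finally show ?thesis .
qed

text \<open>Two blocks with different indices of the form 2i + o' are separated by at least one full
  block, which is the gap \<open>q\<close> seen by the mixing coefficient. Rounding the blocks up to
  multiples of \<open>\<kappa>\<close> makes \<open>decoupling\<close> applicable; it adds at most
  \<open>\<kappa>\<close> to each exponent and leaves at most 5/\<open>\<kappa>\<close>
  values.\<close>

lemma blocks_tail:
  fixes \<kappa> t :: real
  assumes q: "0 < q" and \<kappa>: "0 < \<kappa>" "\<kappa> \<le> 1"
  shows "prob {x \<in> space M. t \<le> (\<Sum>i<J. block q (2 * i + o') x)}
    \<le> exp (- t + J * (\<kappa> + block_const / q)) + 10 * c0 * J / \<kappa> * exp (- c1 * q)"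
proof -
  define U where "U i x = \<kappa> * of_int \<lceil>block q (2 * i + o') x / \<kappa>\<rceil>" for i x
  define V where "V = (\<lambda>z. \<kappa> * of_int z) ` {- \<lceil>1 / \<kappa>\<rceil>..\<lceil>1 / \<kappa>\<rceil>}"
  define T where "T i = {(2 * i + o') * q..<Suc (2 * i + o') * q}" for i
  define P where "P i = F (\<Union>j<i. T j)" for i
  have UT: "U i \<in> borel_measurable (F (T i))" for i
    unfolding U_def T_def using block_measurable[of q "2 * i + o'"] by measurable
  have UM[measurable]: "U i \<in> borel_measurable M" for i
    by (rule measurable_from_subalg[OF sub UT])
  have le: "block q (2 * i + o') x \<le> U i x" "U i x \<le> block q (2 * i + o') x + \<kappa>" for i x
  proof -
    have "block q (2 * i + o') x / \<kappa> \<le> of_int \<lceil>block q (2 * i + o') x / \<kappa>\<rceil>" by simp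
    then have "block q (2 * i + o') x \<le> of_int \<lceil>block q (2 * i + o') x / \<kappa>\<rceil> * \<kappa>"
      using \<kappa> by (simp only: pos_divide_le_eq)
    then show "block q (2 * i + o') x \<le> U i x" by (simp add: U_def mult.commute)
    have "of_int \<lceil>block q (2 * i + o') x / \<kappa>\<rceil> \<le> block q (2 * i + o') x / \<kappa> + 1" by linarith
    then have "\<kappa> * of_int \<lceil>block q (2 * i + o') x / \<kappa>\<rceil> \<le> \<kappa> * (block q (2 * i + o') x / \<kappa> + 1)"
      using \<kappa> by (intro mult_left_mono) auto
    then show "U i x \<le> block q (2 * i + o') x + \<kappa>" using \<kappa> by (simp add: U_def distrib_left)
  qed
  have cardV: "real (card V) \<le> 5 / \<kappa>"
  proof -
    define c where "c = \<lceil>1 / \<kappa>\<rceil>"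
    have "card V \<le> card {- c..c}" unfolding V_def c_def by (intro card_image_le) simp
    moreover have "0 \<le> c"
      using \<kappa> ceiling_mono[of 0 "1 / \<kappa>"] by (simp add: c_def del: zero_le_ceiling)
    ultimately have "real (card V) \<le> 2 * of_int c + 1" by simp
    then have "real (card V) \<le> 2 * of_int \<lceil>1 / \<kappa>\<rceil> + 1" by (simp add: c_def)
    also have "\<dots> \<le> 2 * (1 / \<kappa> + 1) + 1" by (intro add_right_mono mult_left_mono of_int_ceiling_le_add_one) simp
    also have "\<dots> \<le> 5 / \<kappa>" using \<kappa> by (simp add: field_simps)
    finally show ?thesis .
  qed
  \<comment> \<open>Chernoff bound: the indicator of [t, infinity) is at most exp(-t) exp s, the
    form that \<open>decoupling\<close> asks of a test function, with c = exp(-t).\<close>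
  define g where "g s = (indicator {t..} s :: real)" for s
  have E: "expectation (\<lambda>x. g (\<Sum>i<J. U i x)) \<le>
      exp (- t) * (\<Prod>i<J. expectation (\<lambda>x. exp (U i x))) + real J * (real (card V) * (2 * (c0 * exp (- c1 * q))))"
  proof (rule decoupling[where P = P])
    show "finite V" by (simp add: V_def)
    show "U i x \<in> V" if "x \<in> space M" for i x
    proof -
      have "\<bar>block q (2 * i + o') x / \<kappa>\<bar> \<le> 1 / \<kappa>"
        using block_bound[OF q that] \<kappa> by (simp add: abs_div field_simps)
      then have b: "- (1 / \<kappa>) \<le> block q (2 * i + o') x / \<kappa>" "block q (2 * i + o') x / \<kappa> \<le> 1 / \<kappa>"
        by (simp_all only: abs_le_iff) linarith+
      have "- \<lceil>1 / \<kappa>\<rceil> \<le> \<lceil>- (1 / \<kappa>)\<rceil>" by linarith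
      also have "\<dots> \<le> \<lceil>block q (2 * i + o') x / \<kappa>\<rceil>" by (rule ceiling_mono[OF b(1)])
      finally have "- \<lceil>1 / \<kappa>\<rceil> \<le> \<lceil>block q (2 * i + o') x / \<kappa>\<rceil>" "\<lceil>block q (2 * i + o') x / \<kappa>\<rceil> \<le> \<lceil>1 / \<kappa>\<rceil>"
        using ceiling_mono[OF b(2)] .
      then show ?thesis by (auto simp: U_def V_def)
    qed
    show "subalgebra M (P i)" for i unfolding P_def by (rule sub)
    show "U j \<in> borel_measurable (P i)" if "j < i" for i j
      unfolding P_def by (rule F_up[OF _ UT]) (use that in auto)
    show "\<bar>prob (A \<inter> {x \<in> space M. U i x = u}) - prob A * prob {x \<in> space M. U i x = u}\<bar>
        \<le> c0 * exp (- c1 * q)" if A: "A \<in> sets (P i)" for i A u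
    proof (rule mix[of "\<Union>j<i. T j" "T i"])
      show "A \<in> sets (F (\<Union>j<i. T j))" using A by (simp add: P_def)
      have "space (F (T i)) = space M" using sub by (auto simp: subalgebra_def)
      then show "{x \<in> space M. U i x = u} \<in> sets (F (T i))"
        using measurable_sets[OF UT[of i], of "{u}"] by (simp add: vimage_def Int_def conj_commute)
      fix a b assume "a \<in> (\<Union>j<i. T j)" and b: "b \<in> T i"
      then obtain j where j: "j < i" "a \<in> T j" by auto
      have "a + q < Suc (2 * j + o') * q + q" using j by (simp add: T_def)
      also have "\<dots> = (2 * Suc j + o') * q" by (simp add: algebra_simps)
      also have "\<dots> \<le> (2 * i + o') * q" using j by (intro mult_le_mono1) simp
      also have "\<dots> \<le> b" using b by (simp add: T_def)
      finally show "a + q \<le> b" by simp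
    qed
    show "g s \<le> exp (- t) * exp s" for s
      by (auto simp: g_def indicator_def exp_add[symmetric])
  qed (auto simp: g_def[abs_def] indicator_def)
  have exU: "expectation (\<lambda>x. exp (U i x)) \<le> exp (\<kappa> + block_const / q)" for i
  proof -
    have "expectation (\<lambda>x. exp (U i x)) \<le> expectation (\<lambda>x. exp \<kappa> * exp (block q (2 * i + o') x))"
    proof (rule integral_mono)
      have b: "\<bar>U i x\<bar> \<le> 1 + \<kappa>" "\<bar>block q (2 * i + o') x\<bar> \<le> 1" if "x \<in> space M" for x
        using le(1)[of i x] le(2)[of i x] block_bound[OF q that, of "2 * i + o'"] \<kappa> by (auto simp: abs_le_iff)
      show "integrable M (\<lambda>x. exp (U i x))"
        by (rule integrable_bdd[where B = "exp (1 + \<kappa>)"]) (use b in \<open>auto simp: abs_le_iff\<close>)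
      show "integrable M (\<lambda>x. exp \<kappa> * exp (block q (2 * i + o') x))"
        by (rule integrable_bdd[where B = "exp \<kappa> * exp 1"]) (use b in \<open>auto simp: abs_le_iff abs_mult\<close>)
      show "exp (U i x) \<le> exp \<kappa> * exp (block q (2 * i + o') x)" for x
        using le(2)[of i x] by (simp add: exp_add[symmetric] add.commute)
    qed
    also have "\<dots> \<le> exp \<kappa> * exp (block_const / q)" using block_exp_moment[OF q] by simp
    finally show ?thesis by (simp add: exp_add)
  qed
  have "(\<Prod>i<J. expectation (\<lambda>x. exp (U i x))) \<le> (\<Prod>i<J. exp (\<kappa> + block_const / q))"
    by (intro prod_mono) (auto simp: exU intro!: integral_nonneg_AE)
  then have "exp (- t) * (\<Prod>i<J. expectation (\<lambda>x. exp (U i x))) \<le> exp (- t) * exp (\<kappa> + block_const / q) ^ J"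
    by (intro mult_left_mono) simp_all
  then have E1: "exp (- t) * (\<Prod>i<J. expectation (\<lambda>x. exp (U i x))) \<le> exp (- t + J * (\<kappa> + block_const / q))"
    unfolding exp_add[of "- t"] exp_of_nat_mult .
  have "real (card V) * (2 * (c0 * exp (- c1 * q))) \<le> 5 / \<kappa> * (2 * (c0 * exp (- c1 * q)))"
    using c0 by (intro mult_right_mono[OF cardV]) auto
  then have "real J * (real (card V) * (2 * (c0 * exp (- c1 * q)))) \<le> real J * (5 / \<kappa> * (2 * (c0 * exp (- c1 * q))))"
    by (rule mult_left_mono) simp
  also have "\<dots> = 10 * c0 * J / \<kappa> * exp (- c1 * q)" by (simp add: mult_ac)
  finally have E2: "real J * (real (card V) * (2 * (c0 * exp (- c1 * q)))) \<le> 10 * c0 * J / \<kappa> * exp (- c1 * q)" .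
  have "{x \<in> space M. t \<le> (\<Sum>i<J. block q (2 * i + o') x)} \<subseteq> {x \<in> space M. t \<le> (\<Sum>i<J. U i x)}"
  proof
    fix x assume x: "x \<in> {x \<in> space M. t \<le> (\<Sum>i<J. block q (2 * i + o') x)}"
    have "(\<Sum>i<J. block q (2 * i + o') x) \<le> (\<Sum>i<J. U i x)" by (rule sum_mono) (rule le(1))
    with x show "x \<in> {x \<in> space M. t \<le> (\<Sum>i<J. U i x)}" by simp
  qed
  then have "prob {x \<in> space M. t \<le> (\<Sum>i<J. block q (2 * i + o') x)}
      \<le> prob {x \<in> space M. t \<le> (\<Sum>i<J. U i x)}"
    by (rule finite_measure_mono) simp
  also have "\<dots> = expectation (indicator {x \<in> space M. t \<le> (\<Sum>i<J. U i x)})"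
    by (simp add: less_top[symmetric])
  also have "\<dots> = expectation (\<lambda>x. g (\<Sum>i<J. U i x))"
    by (rule Bochner_Integration.integral_cong) (auto simp: g_def indicator_def)
  also have "\<dots> \<le> exp (- t + J * (\<kappa> + block_const / q)) + 10 * c0 * J / \<kappa> * exp (- c1 * q)"
    by (rule order_trans[OF E add_mono[OF E1 E2]])
  finally show ?thesis .
qed

text \<open>A sum of at least p \<open>\<eta>\<close> forces the even or the odd blocks to reach
  half of p \<open>\<eta>\<close>/q. With rounding width \<open>\<eta>\<close>/12 and variance bound
  at most \<open>\<eta>\<close>/12, the at most 3p/(2q) blocks of one parity use up half of that
  threshold, and the other half remains in the exponent.\<close>

lemma upper_deviation:
  fixes \<eta> :: real and p q :: nat
  assumes q: "1 \<le> q" "q \<le> p" and \<eta>: "0 < \<eta>" "\<eta> \<le> 1" "12 * block_const \<le> q * \<eta>"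
    and Wp: "\<And>a x. p \<le> a \<Longrightarrow> x \<in> space M \<Longrightarrow> W a x = 0"
  shows "prob {x \<in> space M. p * \<eta> \<le> (\<Sum>a<p. W a x)}
    \<le> 2 * exp (- (p * \<eta> / (4 * q))) + 360 * c0 * p / (q * \<eta>) * exp (- c1 * q)"
proof -
  \<comment> \<open>The summand 1 lets 2J blocks cover all times below \<open>p\<close>; the
    overhang is harmless since \<open>W\<close> vanishes there.\<close>
  define J where "J = p div (2 * q) + 1"
  define t where "t = p * \<eta> / (2 * q)"
  have q0: "0 < q" using q by simp
  have pJ: "p \<le> 2 * J * q"
  proof -
    have "p = (2 * q) * (p div (2 * q)) + p mod (2 * q)" by simp
    also have "\<dots> \<le> (2 * q) * (p div (2 * q)) + 2 * q" using q0 by (intro add_left_mono less_imp_le) simp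
    also have "\<dots> = 2 * J * q" by (simp add: J_def algebra_simps)
    finally show ?thesis .
  qed
  have J: "real J \<le> 3 * p / (2 * q)"
  proof -
    have "real (p div (2 * q) * (2 * q)) \<le> real p"
      by (simp only: of_nat_le_iff div_times_less_eq_dividend)
    then have "real (p div (2 * q)) \<le> real p / real (2 * q)"
      using q0 by (simp add: pos_le_divide_eq)
    moreover have "1 \<le> real p / q" using q by simp
    ultimately show ?thesis by (simp add: J_def field_simps)
  qed
  have blocks: "(\<Sum>a<p. W a x) = q * ((\<Sum>i<J. block q (2 * i + 0) x) + (\<Sum>i<J. block q (2 * i + 1) x))"
    if x: "x \<in> space M" for x
  proof -
    have "(\<Sum>a<p. W a x) = (\<Sum>a<2 * J * q. W a x)"
      using pJ Wp x by (intro sum.mono_neutral_left) auto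
    also have "\<dots> = (\<Sum>i<2 * J. \<Sum>a\<in>{i*q..<Suc i*q}. W a x)"
      using sum.nat_group[of "\<lambda>a. W a x" q "2 * J"] by (simp add: add.commute)
    also have "\<dots> = (\<Sum>i<2 * J. q * block q i x)"
      using q0 by (simp add: block_def)
    also have "\<dots> = (\<Sum>i<J. q * block q (2 * i) x + q * block q (2 * i + 1) x)"
      by (induction J) (auto simp: algebra_simps)
    finally show ?thesis by (simp add: sum.distrib sum_distrib_left distrib_left)
  qed
  define b where "b = exp (- (p * \<eta> / (4 * q))) + 180 * c0 * p / (q * \<eta>) * exp (- c1 * q)"
  have half: "prob {x \<in> space M. t \<le> (\<Sum>i<J. block q (2 * i + o') x)} \<le> b" for o'
  proof -
    have "prob {x \<in> space M. t \<le> (\<Sum>i<J. block q (2 * i + o') x)}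
      \<le> exp (- t + J * (\<eta> / 12 + block_const / q)) + 10 * c0 * J / (\<eta> / 12) * exp (- c1 * q)"
      using q0 \<eta> by (intro blocks_tail) auto
    also have "\<dots> \<le> b"
      unfolding b_def
    proof (intro add_mono mult_right_mono)
      have "block_const / q \<le> \<eta> / 12" using \<eta> q0 by (simp add: field_simps)
      then have "J * (\<eta> / 12 + block_const / q) \<le> (3 * p / (2 * q)) * (\<eta> / 12 + \<eta> / 12)"
        using J \<eta> block_const_pos \<open>block_const / q \<le> \<eta> / 12\<close> by (intro mult_mono add_mono) auto
      also have "\<dots> = p * \<eta> / (4 * q)" by simp
      finally show "exp (- t + J * (\<eta> / 12 + block_const / q)) \<le> exp (- (p * \<eta> / (4 * q)))"
        by (simp add: t_def)
      have "10 * c0 * J / (\<eta> / 12) \<le> 10 * c0 * (3 * p / (2 * q)) / (\<eta> / 12)"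
        using J \<eta> c0 by (intro divide_right_mono mult_left_mono) auto
      then show "10 * c0 * J / (\<eta> / 12) \<le> 180 * c0 * p / (q * \<eta>)" by simp
    qed simp
    finally show ?thesis .
  qed
  have "{x \<in> space M. p * \<eta> \<le> (\<Sum>a<p. W a x)} \<subseteq>
      {x \<in> space M. t \<le> (\<Sum>i<J. block q (2 * i + 0) x)} \<union> {x \<in> space M. t \<le> (\<Sum>i<J. block q (2 * i + 1) x)}"
  proof
    fix x assume x: "x \<in> {x \<in> space M. p * \<eta> \<le> (\<Sum>a<p. W a x)}"
    then have "p * \<eta> \<le> q * ((\<Sum>i<J. block q (2 * i + 0) x) + (\<Sum>i<J. block q (2 * i + 1) x))"
      using blocks by auto
    then have "2 * t \<le> (\<Sum>i<J. block q (2 * i + 0) x) + (\<Sum>i<J. block q (2 * i + 1) x)"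
      using q0 by (simp add: t_def field_simps)
    then show "x \<in> {x \<in> space M. t \<le> (\<Sum>i<J. block q (2 * i + 0) x)} \<union> {x \<in> space M. t \<le> (\<Sum>i<J. block q (2 * i + 1) x)}"
      using x by force
  qed
  then have "prob {x \<in> space M. p * \<eta> \<le> (\<Sum>a<p. W a x)} \<le>
     prob ({x \<in> space M. t \<le> (\<Sum>i<J. block q (2 * i + 0) x)} \<union> {x \<in> space M. t \<le> (\<Sum>i<J. block q (2 * i + 1) x)})"
    by (intro finite_measure_mono) auto
  also have "\<dots> \<le> prob {x \<in> space M. t \<le> (\<Sum>i<J. block q (2 * i + 0) x)} + prob {x \<in> space M. t \<le> (\<Sum>i<J. block q (2 * i + 1) x)}"
    by (rule measure_Un_le) auto
  also have "\<dots> \<le> b + b" by (intro add_mono half)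
  finally show ?thesis unfolding b_def by (simp add: mult_ac)
qed

end

context mixing_filtration
begin

lemma deviation:
  fixes \<eta> :: real and p q :: nat and W :: "nat \<Rightarrow> 'w \<Rightarrow> real"
  assumes W: "\<And>a. W a \<in> borel_measurable (F {a})"
    "\<And>a x. x \<in> space M \<Longrightarrow> \<bar>W a x\<bar> \<le> 1" "\<And>a. expectation (W a) = 0"
    "\<And>a x. p \<le> a \<Longrightarrow> x \<in> space M \<Longrightarrow> W a x = 0"
    and q: "1 \<le> q" "q \<le> p" and \<eta>: "0 < \<eta>" "\<eta> \<le> 1" "12 * block_const \<le> q * \<eta>"
  shows "prob {x \<in> space M. p * \<eta> \<le> \<bar>\<Sum>a<p. W a x\<bar>}
    \<le> 4 * exp (- (p * \<eta> / (4 * q))) + 720 * c0 * p / (q * \<eta>) * exp (- c1 * q)"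
proof -
  interpret pos: mixing_sequence M F c0 c1 W by unfold_locales (use W in auto)
  interpret neg: mixing_sequence M F c0 c1 "\<lambda>a x. - W a x" by unfold_locales (use W in auto)
  have "{x \<in> space M. p * \<eta> \<le> \<bar>\<Sum>a<p. W a x\<bar>} =
    {x \<in> space M. p * \<eta> \<le> (\<Sum>a<p. W a x)} \<union> {x \<in> space M. p * \<eta> \<le> (\<Sum>a<p. - W a x)}"
    by (auto simp: sum_negf abs_if)
  then have "prob {x \<in> space M. p * \<eta> \<le> \<bar>\<Sum>a<p. W a x\<bar>} \<le>
    prob {x \<in> space M. p * \<eta> \<le> (\<Sum>a<p. W a x)} + prob {x \<in> space M. p * \<eta> \<le> (\<Sum>a<p. - W a x)}"
    by (simp only:) (rule measure_Un_le, auto)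
  also have "\<dots> \<le> (2 * exp (- (p * \<eta> / (4 * q))) + 360 * c0 * p / (q * \<eta>) * exp (- c1 * q))
      + (2 * exp (- (p * \<eta> / (4 * q))) + 360 * c0 * p / (q * \<eta>) * exp (- c1 * q))"
    by (intro add_mono pos.upper_deviation neg.upper_deviation) (use q \<eta> W(4) in auto)
  finally show ?thesis by (simp add: algebra_simps)
qed

end

section \<open>Deviations of strongly mixing random fields\<close>

lemma vec_box_eq_image: "{s :: 'b ^ 'n. \<forall>i. s $ i \<in> A i} = vec_lambda ` (PiE UNIV A)"
proof -
  have "s \<in> vec_lambda ` (PiE UNIV A)" if "\<forall>i. s $ i \<in> A i" for s
    by (rule image_eqI[of _ _ "vec_nth s"]) (use that in \<open>auto simp: PiE_def extensional_def\<close>)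
  then show ?thesis by (auto simp: PiE_def Pi_def)
qed

lemma finite_vec_box: "(\<And>i. finite (A i)) \<Longrightarrow> finite {s :: 'b ^ 'n. \<forall>i. s $ i \<in> A i}"
  unfolding vec_box_eq_image by (intro finite_imageI finite_PiE) auto

lemma card_vec_box: "card {s :: 'b ^ 'n. \<forall>i. s $ i \<in> A i} = (\<Prod>i\<in>UNIV. card (A i))"
proof -
  have "inj_on (vec_lambda :: ('n \<Rightarrow> 'b) \<Rightarrow> 'b ^ 'n) (PiE UNIV A)"
    by (auto simp: inj_on_def vec_eq_iff)
  then show ?thesis unfolding vec_box_eq_image by (simp add: card_image card_PiE)
qed

lemma grid_eq_box: "grid m = {s. \<forall>i. s $ i \<in> {1..int (m $ i)}}"
  by (auto simp: grid_def)

lemma finite_grid [simp]: "finite (grid m)"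
  unfolding grid_eq_box by (rule finite_vec_box) simp

lemma card_grid: "card (grid m) = (\<Prod>i\<in>UNIV. m $ i)"
  unfolding grid_eq_box by (subst card_vec_box) simp

lemma card_grid_slab:
  assumes "a < m $ i0"
  shows "m $ i0 * card {s \<in> grid m. s $ i0 = int a + 1} = card (grid m)"
proof -
  have "s \<in> grid m \<and> s $ i0 = int a + 1 \<longleftrightarrow> (\<forall>i. s $ i \<in> (if i = i0 then {int a + 1} else {1..int (m $ i)}))" for s
  proof
    assume "s \<in> grid m \<and> s $ i0 = int a + 1"
    then show "\<forall>i. s $ i \<in> (if i = i0 then {int a + 1} else {1..int (m $ i)})" by (simp add: grid_def)
  next
    assume *: "\<forall>i. s $ i \<in> (if i = i0 then {int a + 1} else {1..int (m $ i)})"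
    have "1 \<le> s $ i \<and> s $ i \<le> int (m $ i)" for i
      using *[rule_format, of i] assms by (cases "i = i0") auto
    then show "s \<in> grid m \<and> s $ i0 = int a + 1"
      using *[rule_format, of i0] by (simp add: grid_def)
  qed
  then have "{s \<in> grid m. s $ i0 = int a + 1} =
      {s. \<forall>i. s $ i \<in> (if i = i0 then {int a + 1} else {1..int (m $ i)})}"
    by (rule Collect_cong)
  then have "card {s \<in> grid m. s $ i0 = int a + 1}
      = (\<Prod>i\<in>UNIV. card (if i = i0 then {int a + 1} else {1..int (m $ i)}))"
    using card_vec_box[of "\<lambda>i. if i = i0 then {int a + 1} else {1..int (m $ i)}"] by simp
  also have "\<dots> = (\<Prod>i\<in>UNIV - {i0}. m $ i)"
    by (subst prod.remove[of UNIV i0]) (auto intro!: prod.cong)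
  finally show ?thesis
    unfolding card_grid using prod.remove[of UNIV i0 "($) m"] by simp
qed

lemma sum_grid_slabs:
  fixes f :: "int ^ 'n \<Rightarrow> 'b::comm_monoid_add"
  shows "(\<Sum>s\<in>grid m. f s) = (\<Sum>a<m $ i0. \<Sum>s\<in>{s \<in> grid m. s $ i0 = int a + 1}. f s)"
proof -
  have "(\<Sum>s\<in>grid m. f s) = (\<Sum>a<m $ i0. \<Sum>s\<in>{s \<in> grid m. nat (s $ i0 - 1) = a}. f s)"
  proof (rule sum.group[symmetric])
    show "(\<lambda>s. nat (s $ i0 - 1)) ` grid m \<subseteq> {..<m $ i0}"
    proof clarify
      fix s assume "s \<in> grid m"
      then have "1 \<le> s $ i0 \<and> s $ i0 \<le> int (m $ i0)" by (simp add: grid_def)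
      then show "nat (s $ i0 - 1) < m $ i0" by auto
    qed
  qed auto
  also have "\<dots> = (\<Sum>a<m $ i0. \<Sum>s\<in>{s \<in> grid m. s $ i0 = int a + 1}. f s)"
  proof (intro sum.cong refl)
    fix a
    have "nat (s $ i0 - 1) = a \<longleftrightarrow> s $ i0 = int a + 1" if "s \<in> grid m" for s
      using that by (auto simp: grid_def dest!: spec[of _ i0])
    then show "{s \<in> grid m. nat (s $ i0 - 1) = a} = {s \<in> grid m. s $ i0 = int a + 1}" by auto
  qed
  finally show ?thesis .
qed

lemma max_norm_ge: "nat \<bar>s $ i\<bar> \<le> max_norm s"
  unfolding max_norm_def by (rule Max_ge) auto

locale mixing_field = prob_space M for M :: "'w measure" +
  fixes Z :: "int ^ 'n \<Rightarrow> 'w \<Rightarrow> 'b::topological_space" and c0 c1 :: real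
  assumes Z [measurable]: "\<And>s. Z s \<in> borel_measurable M"
    and stationary: "strictly_stationary M Z"
    and c0: "0 < c0" and c1: "0 < c1"
    and mixing: "\<And>k. mixing_coeff M Z k \<le> c0 * exp (- c1 * real k)"
begin

text \<open>Stationarity concerns laws on finite products; the product over one site is projected
  onto its single factor.\<close>

lemma law_eq: "distr M borel (Z s) = distr M borel (Z 0)"
proof -
  let ?P = "\<Pi>\<^sub>M s\<in>{0 :: int ^ 'n}. (borel :: 'b measure)"
  have eq: "distr M ?P (\<lambda>\<omega>. \<lambda>u\<in>{0}. Z (u + s) \<omega>) = distr M ?P (\<lambda>\<omega>. \<lambda>u\<in>{0}. Z u \<omega>)"
    using stationary unfolding strictly_stationary_def by blast
  have pr: "(\<lambda>f. f 0) \<in> measurable ?P borel" by (rule measurable_component_singleton) simp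
  have m: "(\<lambda>\<omega>. \<lambda>u\<in>{0}. Z (u + t) \<omega>) \<in> measurable M ?P" for t
    by (rule measurable_restrict) simp
  have "distr (distr M ?P (\<lambda>\<omega>. \<lambda>u\<in>{0}. Z (u + t) \<omega>)) borel (\<lambda>f. f 0) = distr M borel (Z t)" for t
    by (subst distr_distr[OF pr m]) (simp add: comp_def)
  from this[of s] this[of 0] eq show ?thesis by simp
qed

lemma expectation_shift:
  fixes v :: "'b \<Rightarrow> real"
  assumes [measurable]: "v \<in> borel_measurable borel"
  shows "expectation (\<lambda>\<omega>. v (Z s \<omega>)) = expectation (\<lambda>\<omega>. v (Z 0 \<omega>))"
  using integral_distr[OF Z[of s] assms] integral_distr[OF Z[of 0] assms] law_eq[of s] by simp

definition site_sets :: "(int ^ 'n) set \<Rightarrow> 'w set set" where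
  "site_sets I = (\<Union>s\<in>I. {Z s -` A \<inter> space M | A. A \<in> sets borel})"

lemma site_sets_sub: "site_sets I \<subseteq> sets M"
  unfolding site_sets_def by (auto intro: measurable_sets[OF Z])

lemma site_sets_Pow: "site_sets I \<subseteq> Pow (space M)"
  using site_sets_sub[of I] sets.sets_into_space by blast

lemma events_of_eq: "events_of M Z I = sigma_sets (space M) (site_sets I)"
  by (simp add: events_of_def site_sets_def)

lemma events_of_sub: "events_of M Z I \<subseteq> sets M"
  unfolding events_of_eq using site_sets_sub by (intro sets.sigma_sets_subset)

text \<open>The mixing coefficients are suprema of reals, so comparing a member with the supremum
  requires boundedness: all the differences of probabilities involved are at most 1 in absolute
  value.\<close>

lemma events_of_mixing:
  assumes A: "A \<in> events_of M Z I" and B: "B \<in> events_of M Z J" and k: "enat k \<le> set_dist I J"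
  shows "\<bar>prob (A \<inter> B) - prob A * prob B\<bar> \<le> c0 * exp (- c1 * real k)"
proof -
  have le1: "\<bar>prob A - prob B * prob C\<bar> \<le> 1" for A B C
  proof -
    have "0 \<le> prob B * prob C" "prob B * prob C \<le> 1" by (auto intro: mult_le_one)
    then show ?thesis using prob_le_1[of A] measure_nonneg[of M A] by linarith
  qed
  have bdd: "bdd_above ((\<lambda>(A, B). \<bar>prob (A \<inter> B) - prob A * prob B\<bar>) ` X)" for X
    using le1 by (auto intro!: bdd_aboveI[of _ 1])
  have ne: "events_of M Z I \<times> events_of M Z J \<noteq> {}" for I J
    unfolding events_of_eq using sigma_sets.Empty by blast
  have al1: "alpha_events M (events_of M Z I) (events_of M Z J) \<le> 1" for I J
    unfolding alpha_events_def using ne le1 by (intro cSUP_least) auto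
  have "\<bar>prob (A \<inter> B) - prob A * prob B\<bar> \<le> alpha_events M (events_of M Z I) (events_of M Z J)"
    unfolding alpha_events_def using A B by (intro cSUP_upper2[OF bdd, of "(A, B)"]) auto
  also have "\<dots> \<le> mixing_coeff M Z k"
    unfolding mixing_coeff_def using k al1
    by (intro cSUP_upper2[of _ _ "(I, J)"] bdd_aboveI[of _ 1]) auto
  also note mixing
  finally show ?thesis .
qed

text \<open>Slabs are numbered from 0, as times of the filtration, while the coordinates of
  \<open>grid\<close> start at 1.\<close>

definition slab :: "'n \<Rightarrow> nat set \<Rightarrow> (int ^ 'n) set" where
  "slab i0 T = {s. \<exists>a\<in>T. s $ i0 = int a + 1}"

definition slab_algebra :: "'n \<Rightarrow> nat set \<Rightarrow> 'w measure" where
  "slab_algebra i0 T = sigma (space M) (site_sets (slab i0 T))"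

lemma sets_slab_algebra: "sets (slab_algebra i0 T) = events_of M Z (slab i0 T)"
  unfolding slab_algebra_def events_of_eq by (rule sets_measure_of[OF site_sets_Pow])

lemma space_slab_algebra: "space (slab_algebra i0 T) = space M"
  unfolding slab_algebra_def by (rule space_measure_of[OF site_sets_Pow])

text \<open>A gap between times is a gap in coordinate \<open>i0\<close>, and a single coordinate
  bounds the maximum norm from below. So mixing of the field passes to the slabs with the same
  constants.\<close>

lemma slab_mixing_filtration: "mixing_filtration M (slab_algebra i0) c0 c1"
proof
  show "subalgebra M (slab_algebra i0 T)" for T
    using events_of_sub by (simp add: subalgebra_def sets_slab_algebra space_slab_algebra)
  show "subalgebra (slab_algebra i0 T') (slab_algebra i0 T)" if "T \<subseteq> T'" for T T'
  proof -
    have "site_sets (slab i0 T) \<subseteq> site_sets (slab i0 T')"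
      using that by (auto simp: site_sets_def slab_def)
    then show ?thesis
      unfolding subalgebra_def sets_slab_algebra space_slab_algebra events_of_eq
      by (simp add: sigma_sets_subseteq)
  qed
  show "\<bar>prob (A \<inter> B) - prob A * prob B\<bar> \<le> c0 * exp (- c1 * real k)"
    if gap: "\<And>a b. a \<in> T \<Longrightarrow> b \<in> T' \<Longrightarrow> a + k \<le> b"
      and A: "A \<in> sets (slab_algebra i0 T)" and B: "B \<in> sets (slab_algebra i0 T')" for T T' k A B
  proof (rule events_of_mixing[OF A[unfolded sets_slab_algebra] B[unfolded sets_slab_algebra]])
    show "enat k \<le> set_dist (slab i0 T) (slab i0 T')"
      unfolding set_dist_def
    proof (rule INF_greatest, clarify)
      fix s t assume "s \<in> slab i0 T" "t \<in> slab i0 T'"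
      then obtain a b where "a \<in> T" "b \<in> T'" "s $ i0 = int a + 1" "t $ i0 = int b + 1"
        by (auto simp: slab_def)
      then have "k \<le> nat \<bar>(s - t) $ i0\<bar>" using gap[of a b] by auto
      also have "\<dots> \<le> max_norm (s - t)" by (rule max_norm_ge)
      finally show "enat k \<le> enat (max_norm (s - t))" by simp
    qed
  qed
qed (use c0 c1 in auto)

lemma Z_slab:
  assumes "s \<in> slab i0 T"
  shows "Z s \<in> borel_measurable (slab_algebra i0 T)"
proof (rule measurableI)
  fix A :: "'b set" assume A: "A \<in> sets borel"
  have "Z s -` A \<inter> space M \<in> site_sets (slab i0 T)"
    using assms A by (auto simp: site_sets_def)
  then show "Z s -` A \<inter> space (slab_algebra i0 T) \<in> sets (slab_algebra i0 T)"
    unfolding space_slab_algebra sets_slab_algebra events_of_eq by (rule sigma_sets.Basic)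
qed simp

definition average :: "nat ^ 'n \<Rightarrow> ('b \<Rightarrow> real) \<Rightarrow> 'w \<Rightarrow> real" where
  "average m v \<omega> = (\<Sum>s\<in>grid m. v (Z s \<omega>)) / card (grid m)"

lemma average_measurable [measurable]:
  "v \<in> borel_measurable borel \<Longrightarrow> average m v \<in> borel_measurable M"
  unfolding average_def
  by (intro borel_measurable_divide borel_measurable_sum borel_measurable_const measurable_compose[OF Z])

lemma field_deviation:
  fixes v :: "'b \<Rightarrow> real" and \<eta> :: real and q :: nat
  defines "C \<equiv> 192 * c0 / (1 - exp (- c1))"
  assumes v [measurable]: "v \<in> borel_measurable borel" and v1: "\<And>z. \<bar>v z\<bar> \<le> 1"
    and m: "\<And>i. 1 \<le> m $ i"
    and q: "1 \<le> q" "q \<le> m $ i0" and \<eta>: "0 < \<eta>" "\<eta> \<le> 2" "C \<le> q * \<eta>"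
  shows "prob {\<omega> \<in> space M. \<eta> \<le> \<bar>average m v \<omega> - expectation (\<lambda>\<omega>. v (Z 0 \<omega>))\<bar>}
    \<le> 4 * exp (- ((m $ i0) * \<eta> / (8 * q))) + 1440 * c0 * (m $ i0) / (q * \<eta>) * exp (- c1 * q)"
proof -
  interpret F: mixing_filtration M "slab_algebra i0" c0 c1 by (rule slab_mixing_filtration)
  define p where "p = m $ i0"
  define \<mu> where "\<mu> = expectation (\<lambda>\<omega>. v (Z 0 \<omega>))"
  define I where "I = real (card (grid m))"
  define S where "S a = {s \<in> grid m. s $ i0 = int a + 1}" for a
  \<comment> \<open>A slab has |I|/p sites and each centred value is at most 2 in absolute value, so
    this scaling makes \<open>W a\<close> bounded by 1. Summed over all slabs it gives p/2 times the
    deviation of the average; hence \<open>\<eta>\<close>/2 below, and for the same reason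
    \<open>C\<close> is 24 times \<open>block_const\<close>.\<close>
  define W where "W a \<omega> = p / (2 * I) * (\<Sum>s\<in>S a. v (Z s \<omega>) - \<mu>)" for a \<omega>
  have I: "0 < I" using m by (auto simp: I_def card_grid Suc_le_eq intro!: prod_pos)
  have vi: "integrable M (\<lambda>\<omega>. v (Z s \<omega>))" for s
    by (rule integrable_bdd[where B = 1]) (use v1 in auto)
  have "\<bar>\<mu>\<bar> \<le> expectation (\<lambda>\<omega>. \<bar>v (Z 0 \<omega>)\<bar>)" unfolding \<mu>_def by (rule integral_abs_bound)
  also have "\<dots> \<le> expectation (\<lambda>\<omega>. 1)" using vi v1 by (intro integral_mono) auto
  finally have \<mu>1: "\<bar>\<mu>\<bar> \<le> 1" by (simp add: prob_space)
  have W_meas: "W a \<in> borel_measurable (slab_algebra i0 {a})" for a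
  proof -
    have "(\<lambda>\<omega>. v (Z s \<omega>)) \<in> borel_measurable (slab_algebra i0 {a})" if "s \<in> S a" for s
      using Z_slab[of s i0 "{a}"] that by (intro measurable_compose[OF _ v]) (auto simp: S_def slab_def)
    then show ?thesis unfolding W_def by measurable
  qed
  have W0: "W a \<omega> = 0" if "p \<le> a" for a \<omega>
  proof -
    have "S a = {}" using that by (auto simp: S_def p_def grid_def dest!: spec[of _ i0])
    then show ?thesis by (simp add: W_def)
  qed
  have W1: "\<bar>W a \<omega>\<bar> \<le> 1" for a \<omega>
  proof (cases "a < p")
    case True
    have "p * card (S a) = card (grid m)" using card_grid_slab[of a m i0] True by (simp add: p_def S_def)
    then have pI: "real p * real (card (S a)) = I" by (simp add: I_def flip: of_nat_mult)
    have "\<bar>\<Sum>s\<in>S a. v (Z s \<omega>) - \<mu>\<bar> \<le> (\<Sum>s\<in>S a. 2)"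
    proof (rule order_trans[OF sum_abs sum_mono])
      show "\<bar>v (Z s \<omega>) - \<mu>\<bar> \<le> 2" for s using v1[of "Z s \<omega>"] \<mu>1 by linarith
    qed
    then have "\<bar>W a \<omega>\<bar> \<le> p / (2 * I) * (2 * real (card (S a)))"
      unfolding W_def abs_mult using I by (intro mult_mono) (auto simp: mult.commute)
    also have "\<dots> = (p * card (S a)) / I" by simp
    also have "\<dots> = 1" using pI I by simp
    finally show ?thesis .
  next
    case False
    then show ?thesis using W0[of a \<omega>] by simp
  qed
  have EW: "expectation (W a) = 0" for a
  proof -
    have sh: "expectation (\<lambda>\<omega>. v (Z s \<omega>)) - \<mu> = 0" for s
      using expectation_shift[OF v, of s] by (simp add: \<mu>_def)
    have "expectation (W a) = p / (2 * I) * (\<Sum>s\<in>S a. expectation (\<lambda>\<omega>. v (Z s \<omega>)) - \<mu>)"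
      unfolding W_def using vi by (simp add: prob_space)
    also have "(\<Sum>s\<in>S a. expectation (\<lambda>\<omega>. v (Z s \<omega>)) - \<mu>) = 0"
      by (intro sum.neutral ballI sh)
    also have "p / (2 * I) * 0 = 0" by simp
    finally show ?thesis .
  qed
  have sumW: "(\<Sum>a<p. W a \<omega>) = p / 2 * (average m v \<omega> - \<mu>)" for \<omega>
  proof -
    have "(\<Sum>a<p. W a \<omega>) = p / (2 * I) * (\<Sum>s\<in>grid m. v (Z s \<omega>) - \<mu>)"
      unfolding W_def sum_distrib_left[symmetric] S_def p_def
      by (subst sum_grid_slabs[of _ m i0]) simp
    also have "\<dots> = p / (2 * I) * (I * (average m v \<omega> - \<mu>))"
      using I by (simp add: average_def sum_subtractf I_def right_diff_distrib)
    also have "\<dots> = p / 2 * (average m v \<omega> - \<mu>)" using I by simp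
    finally show ?thesis .
  qed
  have p0: "0 < p" using q by (simp add: p_def)
  have "{\<omega> \<in> space M. \<eta> \<le> \<bar>average m v \<omega> - \<mu>\<bar>} = {\<omega> \<in> space M. p * (\<eta> / 2) \<le> \<bar>\<Sum>a<p. W a \<omega>\<bar>}"
    unfolding sumW abs_mult using p0 by (auto simp: field_simps)
  also have "prob \<dots> \<le> 4 * exp (- (p * (\<eta> / 2) / (4 * q))) + 720 * c0 * p / (q * (\<eta> / 2)) * exp (- c1 * q)"
    using W_meas W1 EW W0 q \<eta> by (intro F.deviation) (auto simp: p_def C_def F.block_const_def)
  also have "\<dots> = 4 * exp (- (p * \<eta> / (8 * q))) + 1440 * c0 * p / (q * \<eta>) * exp (- c1 * q)" by simp
  finally show ?thesis by (simp add: p_def \<mu>_def)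
qed

end

section \<open>The Hilbert space and its Lipschitz balls\<close>

text \<open>One identity for the squared distance of \<open>w\<close> to a finite combination serves
  twice: with the Fourier coefficients it is Bessel's inequality, with the coefficients of an
  approximant from the dense span it bounds the partial sums from below.\<close>

lemma parseval:
  fixes e :: "nat \<Rightarrow> 'h::real_inner"
  assumes e: "orthonormal_basis e"
  shows "(\<lambda>j. (w \<bullet> e j)\<^sup>2) sums (norm w)\<^sup>2"
proof -
  have ee: "e i \<bullet> e j = (if i = j then 1 else 0)" for i j
    using e by (simp add: orthonormal_basis_def)
  have expand: "(norm (w - (\<Sum>j<J. a j *\<^sub>R e j)))\<^sup>2 = (norm w)\<^sup>2 - (\<Sum>j<J. (w \<bullet> e j)\<^sup>2) + (\<Sum>j<J. (a j - w \<bullet> e j)\<^sup>2)"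
    for J and a :: "nat \<Rightarrow> real"
  proof -
    let ?s = "\<Sum>j<J. a j *\<^sub>R e j"
    have ss: "?s \<bullet> ?s = (\<Sum>j<J. (a j)\<^sup>2)"
      by (simp add: inner_sum_left inner_sum_right ee power2_eq_square if_distrib cong: if_cong)
    have ws: "w \<bullet> ?s = (\<Sum>j<J. a j * (w \<bullet> e j))" by (simp add: inner_sum_right)
    have "(norm (w - ?s))\<^sup>2 = (norm w)\<^sup>2 - 2 * (w \<bullet> ?s) + ?s \<bullet> ?s"
      by (simp add: power2_norm_eq_inner inner_diff_left inner_diff_right inner_commute)
    also have "\<dots> = (norm w)\<^sup>2 - (\<Sum>j<J. (w \<bullet> e j)\<^sup>2) + (\<Sum>j<J. (a j - w \<bullet> e j)\<^sup>2)"
      unfolding ss ws by (simp add: power2_diff sum.distrib sum_subtractf sum_distrib_left mult.assoc)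
    finally show ?thesis .
  qed
  have le: "(\<Sum>j<J. (w \<bullet> e j)\<^sup>2) \<le> (norm w)\<^sup>2" for J
    using expand[where J = J and a = "\<lambda>j. w \<bullet> e j"]
      zero_le_power2[of "norm (w - (\<Sum>j<J. (w \<bullet> e j) *\<^sub>R e j))"] by simp
  have "\<exists>J0. \<forall>J\<ge>J0. (norm w)\<^sup>2 - \<epsilon>\<^sup>2 \<le> (\<Sum>j<J. (w \<bullet> e j)\<^sup>2)" if "0 < \<epsilon>" for \<epsilon>
  proof -
    have "w \<in> closure (span (range e))" using e by (simp add: orthonormal_basis_def)
    then obtain s where s: "s \<in> span (range e)" "dist s w < \<epsilon>"
      using \<open>0 < \<epsilon>\<close> unfolding closure_approachable by auto
    obtain t r where t: "finite t" "t \<subseteq> range e" "s = (\<Sum>x\<in>t. r x *\<^sub>R x)"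
      using s(1) unfolding span_explicit by auto
    obtain K where K: "finite K" "t = e ` K" using finite_subset_image[OF t(1,2)] by auto
    have "inj e"
    proof (rule injI)
      fix i j assume "e i = e j"
      then show "i = j" using ee[of i j] ee[of j j] by (auto split: if_splits)
    qed
    then have sK: "s = (\<Sum>j\<in>K. r (e j) *\<^sub>R e j)"
      unfolding t(3) K(2) by (subst sum.reindex) (auto intro: inj_on_subset)
    obtain J0 where J0: "K \<subseteq> {..<J0}"
      using K(1) finite_nat_iff_bounded by blast
    have "(norm w)\<^sup>2 - \<epsilon>\<^sup>2 \<le> (\<Sum>j<J. (w \<bullet> e j)\<^sup>2)" if "J0 \<le> J" for J
    proof -
      have "s = (\<Sum>j<J. (if j \<in> K then r (e j) else 0) *\<^sub>R e j)"
        unfolding sK using J0 that by (intro sum.mono_neutral_cong_left) auto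
      then have "(norm (w - s))\<^sup>2 \<ge> (norm w)\<^sup>2 - (\<Sum>j<J. (w \<bullet> e j)\<^sup>2)"
        using expand[where J = J and a = "\<lambda>j. if j \<in> K then r (e j) else 0"] by (simp add: sum_nonneg)
      moreover have "(norm (w - s))\<^sup>2 \<le> \<epsilon>\<^sup>2"
        using s(2) by (intro power_mono) (auto simp: dist_norm norm_minus_commute)
      ultimately show ?thesis by simp
    qed
    then show ?thesis by auto
  qed
  note low = this
  show ?thesis
    unfolding sums_def
  proof (rule LIMSEQ_I)
    fix r :: real assume r: "0 < r"
    define \<epsilon> where "\<epsilon> = sqrt (r / 2)"
    have "0 < \<epsilon>" "\<epsilon>\<^sup>2 = r / 2" using r by (auto simp: \<epsilon>_def)
    then obtain J0 where J0: "\<forall>J\<ge>J0. (norm w)\<^sup>2 - r / 2 \<le> (\<Sum>j<J. (w \<bullet> e j)\<^sup>2)" using low by metis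
    have "norm ((\<Sum>j<J. (w \<bullet> e j)\<^sup>2) - (norm w)\<^sup>2) < r" if "J0 \<le> J" for J
      using J0[rule_format, OF that] le[of J] r unfolding real_norm_def by linarith
    then show "\<exists>J0. \<forall>J\<ge>J0. norm ((\<Sum>j<J. (w \<bullet> e j)\<^sup>2) - (norm w)\<^sup>2) < r" by blast
  qed
qed

lemma norm1_C0_bound:
  assumes "norm1_C0 D f \<le> ennreal R" "0 \<le> R" "u \<in> D"
  shows "\<bar>f u\<bar> \<le> R"
proof -
  have "ennreal \<bar>f u\<bar> \<le> (SUP u\<in>D. ennreal \<bar>f u\<bar>)" using assms(3) by (rule SUP_upper)
  also have "\<dots> \<le> norm1_C0 D f" by (simp add: norm1_C0_def)
  also note assms(1)
  finally show ?thesis using assms(2) by simp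
qed

lemma norm1_C0_lipschitz:
  assumes "norm1_C0 D f \<le> ennreal R" "0 \<le> R" "u \<in> D" "v \<in> D"
  shows "\<bar>f u - f v\<bar> \<le> R * norm (u - v)"
proof (cases "u = v")
  case False
  have "ennreal (\<bar>f u - f v\<bar> / norm (u - v)) \<le>
      (SUP (u, v)\<in>{(u, v). u \<in> D \<and> v \<in> D \<and> u \<noteq> v}. ennreal (\<bar>f u - f v\<bar> / norm (u - v)))"
    using assms False by (intro SUP_upper2[of "(u, v)"]) auto
  also have "\<dots> \<le> norm1_C0 D f" by (simp add: norm1_C0_def)
  also note assms(1)
  finally show ?thesis using assms(2) False by (simp add: field_simps)
qed simp

locale L2_compact =
  fixes D :: "(real ^ 'd) set" and \<nu> :: "(real ^ 'd) measure"
    and cls :: "(real ^ 'd \<Rightarrow> real) \<Rightarrow> 'h::{real_inner, banach, second_countable_topology}"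
  assumes D: "compact D"
    and sets_\<nu>: "sets \<nu> = sets (restrict_space borel D)"
    and fin_\<nu>: "finite_measure \<nu>"
    and L2: "L2_space \<nu> cls"
begin

lemma space_\<nu>: "space \<nu> = D"
  using sets_eq_imp_space_eq[OF sets_\<nu>] by (simp add: space_restrict_space)

lemma C0_L2: "f \<in> C0 D \<Longrightarrow> f \<in> L2_fun \<nu>"
proof -
  assume f: "f \<in> C0 D"
  then have cf: "continuous_on D f" by (simp add: C0_def)
  interpret finite_measure \<nu> by (rule fin_\<nu>)
  have [measurable]: "f \<in> borel_measurable \<nu>"
    unfolding measurable_cong_sets[OF sets_\<nu> refl] using cf by (rule borel_measurable_continuous_on_restrict)
  have "bounded (f ` D)" by (rule compact_imp_bounded[OF compact_continuous_image[OF cf D]])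
  then obtain B where "\<forall>y\<in>f ` D. norm y \<le> B"
    unfolding bounded_iff ..
  then have B: "\<bar>f u\<bar> \<le> B" if "u \<in> D" for u using that by auto
  have "integrable \<nu> (\<lambda>u. (f u)\<^sup>2)"
  proof (rule integrable_const_bound[where B = "B\<^sup>2"])
    have "(f u)\<^sup>2 \<le> B\<^sup>2" if "u \<in> D" for u
      using power_mono[OF B[OF that] abs_ge_zero, of 2] by simp
    then show "AE u in \<nu>. norm ((f u)\<^sup>2) \<le> B\<^sup>2" by (intro AE_I2) (simp add: space_\<nu>)
  qed simp
  then show ?thesis by (simp add: L2_fun_def)
qed

lemma norm_cls_diff:
  assumes f: "f \<in> C0 D" and g: "g \<in> C0 D" and c: "0 \<le> c" "\<And>u. u \<in> D \<Longrightarrow> \<bar>f u - g u\<bar> \<le> c"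
  shows "norm (cls f - cls g) \<le> sqrt (measure \<nu> D) * c"
proof -
  interpret finite_measure \<nu> by (rule fin_\<nu>)
  \<comment> \<open>\<open>L2_space\<close> speaks of sums and scalar multiples of functions only,
    so the difference is written as a sum with (-1) times \<open>g\<close>.\<close>
  define k where "k u = f u + (-1) * g u" for u
  have kC: "k \<in> C0 D" using f g by (auto simp: C0_def k_def[abs_def] intro!: continuous_intros)
  have mg: "(\<lambda>u. - 1 * g u) \<in> C0 D" using g by (auto simp: C0_def intro!: continuous_intros)
  have "cls k = cls f + cls (\<lambda>u. (-1) * g u)"
    unfolding k_def[abs_def] using L2 C0_L2[OF f] C0_L2[OF mg] by (simp only: L2_space_def)
  also have "cls (\<lambda>u. (-1) * g u) = (-1) *\<^sub>R cls g"
    using L2 C0_L2[OF g] by (simp only: L2_space_def)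
  finally have k: "cls k = cls f - cls g" by simp
  have ki: "integrable \<nu> (\<lambda>u. (k u)\<^sup>2)" using C0_L2[OF kC] by (simp add: L2_fun_def)
  have "(norm (cls f - cls g))\<^sup>2 = (\<integral>u. (k u)\<^sup>2 \<partial>\<nu>)"
    unfolding k[symmetric] power2_norm_eq_inner using L2 C0_L2[OF kC] by (simp add: L2_space_def power2_eq_square)
  also have "\<dots> \<le> (\<integral>u. c\<^sup>2 \<partial>\<nu>)"
  proof (rule integral_mono[OF ki])
    show "(k u)\<^sup>2 \<le> c\<^sup>2" if "u \<in> space \<nu>" for u
      using c(2)[of u] that c(1) by (intro abs_le_square_iff[THEN iffD1]) (auto simp: k_def space_\<nu>)
  qed simp
  also have "\<dots> = (sqrt (measure \<nu> D) * c)\<^sup>2"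
    by (simp add: space_\<nu> power_mult_distrib)
  finally show ?thesis by (rule power2_le_imp_le) (use c(1) in simp)
qed

text \<open>\<open>ess_norm\<close> evaluates an arbitrarily chosen representative, which need not
  be \<open>f\<close> but agrees with it almost everywhere.\<close>

lemma ess_norm_le:
  assumes f: "f \<in> C0 D" and R: "\<And>u. u \<in> D \<Longrightarrow> \<bar>f u\<bar> \<le> R"
  shows "ess_norm \<nu> cls (cls f) \<le> ereal R"
proof -
  define g where "g = inv_into (L2_fun \<nu>) cls (cls f)"
  have cf: "cls f \<in> cls ` L2_fun \<nu>" using C0_L2[OF f] by simp
  have g: "g \<in> L2_fun \<nu>" unfolding g_def by (rule inv_into_into[OF cf])
  have "cls g = cls f" unfolding g_def by (rule f_inv_into_f[OF cf])
  then have ae: "AE u in \<nu>. g u = f u" using L2_space_eq_iff[OF L2 g C0_L2[OF f]] by simp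
  have [measurable]: "g \<in> borel_measurable \<nu>" using g by (simp add: L2_fun_def)
  show ?thesis unfolding ess_norm_def g_def[symmetric]
  proof (rule esssup_I)
    show "(\<lambda>u. ereal \<bar>g u\<bar>) \<in> borel_measurable \<nu>" by measurable
    show "AE u in \<nu>. ereal \<bar>g u\<bar> \<le> ereal R" using ae AE_space by eventually_elim (auto simp: space_\<nu> R)
  qed
qed

text \<open>A function is coded by its values, rounded to multiples of \<open>\<delta>\<close>, at one point of each cell of
  a cubic mesh of width \<open>\<delta> / R\<close>.\<close>

lemma Lip_ball_net:
  obtains A where "0 < A" and "\<And>R \<delta>. 0 < \<delta> \<Longrightarrow> \<delta> \<le> R \<Longrightarrow>
    \<exists>T\<subseteq>Lip_ball D cls R. finite T \<and> real (card T) \<le> exp ((A * (R / \<delta>)) ^ CARD('d) * ln (6 * (R / \<delta>))) \<and>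
      (\<forall>x\<in>Lip_ball D cls R. \<exists>y\<in>T. norm (x - y) \<le> A * \<delta>)"
proof -
  obtain b where b: "0 < b" "\<And>u i. u \<in> D \<Longrightarrow> \<bar>u $ i\<bar> \<le> b"
  proof -
    obtain b where b: "\<And>u. u \<in> D \<Longrightarrow> norm u \<le> b"
      using compact_imp_bounded[OF D] unfolding bounded_iff by auto
    have "\<bar>u $ i\<bar> \<le> max b 1" if "u \<in> D" for u i
      using b[OF that] component_le_norm_cart[of u i] by linarith
    then show ?thesis using that[of "max b 1"] by auto
  qed
  define d where "d = CARD('d)"
  define s where "s = sqrt (measure \<nu> D)"
  have s0: "0 \<le> s" by (simp add: s_def)
  \<comment> \<open>The first summand bounds the number of cells, the second the radius of the net
    in the Hilbert norm; one constant is kept for both.\<close>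
  define A where "A = (2 * b + 4) + s * (2 * d + 1)"
  have A: "0 < A" "2 * b + 4 \<le> A" "s * (2 * d + 1) \<le> A" using b(1) s0 by (auto simp: A_def intro: add_pos_nonneg)
  have "\<exists>T\<subseteq>Lip_ball D cls R. finite T \<and> real (card T) \<le> exp ((A * (R / \<delta>)) ^ CARD('d) * ln (6 * (R / \<delta>))) \<and>
      (\<forall>x\<in>Lip_ball D cls R. \<exists>y\<in>T. norm (x - y) \<le> A * \<delta>)" if \<delta>: "0 < \<delta>" "\<delta> \<le> R" for R \<delta> :: real
  proof -
    define y where "y = R / \<delta>"
    have R: "0 < R" using \<delta> by simp
    have y1: "1 \<le> y" using \<delta> by (simp add: y_def)
    define Q where "Q = \<lceil>b * y\<rceil>"
    define P where "P = \<lceil>y\<rceil>"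
    define cell :: "real ^ 'd \<Rightarrow> int ^ 'd" where "cell u = (\<chi> i. \<lfloor>u $ i * y\<rfloor>)" for u
    define C where "C = cell ` D"
    define pt where "pt c = (SOME u. u \<in> D \<and> cell u = c)" for c
    have pt: "pt c \<in> D \<and> cell (pt c) = c" if "c \<in> C" for c
      unfolding pt_def by (rule someI_ex[of "\<lambda>u. u \<in> D \<and> cell u = c"]) (use that in \<open>auto simp: C_def\<close>)
    define Fs where "Fs = {f \<in> C0 D. norm1_C0 D f \<le> ennreal R}"
    define code where "code f = restrict (\<lambda>c. \<lfloor>f (pt c) / \<delta>\<rfloor>) C" for f
    have Csub: "C \<subseteq> {c. \<forall>i. c $ i \<in> {-Q-1..Q}}"
    proof -
      have "\<lfloor>u $ i * y\<rfloor> \<in> {-Q-1..Q}" if "u \<in> D" for u i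
      proof -
        have "\<bar>u $ i * y\<bar> \<le> b * y" using b(2)[OF that, of i] y1 by (simp add: abs_mult mult_right_mono)
        then have "u $ i * y \<le> b * y" "- (b * y) \<le> u $ i * y" by (simp_all only: abs_le_iff) linarith+
        then show ?thesis unfolding Q_def by (auto simp: floor_le_iff le_floor_iff) linarith+
      qed
      then show ?thesis by (auto simp: C_def cell_def)
    qed
    have finC: "finite C" by (rule finite_subset[OF Csub finite_vec_box]) simp
    have "0 \<le> b * y" using b(1) y1 by simp
    then have Q0: "0 \<le> Q" unfolding Q_def zero_le_ceiling by linarith
    have P0: "0 \<le> P" unfolding P_def zero_le_ceiling using y1 by linarith
    have "card C \<le> (\<Prod>i\<in>(UNIV :: 'd set). card {-Q-1..Q})"
      using card_mono[OF _ Csub] card_vec_box[of "\<lambda>_ :: 'd. {-Q-1..Q}"] finite_vec_box[of "\<lambda>_ :: 'd. {-Q-1..Q}"] by simp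
    also have "card {-Q-1..Q} = nat (2 * Q + 2)" by simp
    finally have "real (card C) \<le> real (nat (2 * Q + 2) ^ d)" by (simp only: d_def of_nat_le_iff prod_constant)
    also have "\<dots> = (2 * of_int Q + 2) ^ d" using Q0 by simp
    also have "\<dots> \<le> (A * y) ^ d"
    proof (rule power_mono)
      have "of_int Q \<le> b * y + 1" unfolding Q_def by (rule of_int_ceiling_le_add_one)
      then have "2 * of_int Q + 2 \<le> 2 * b * y + 4" by linarith
      also have "\<dots> \<le> (2 * b + 4) * y" using y1 by (simp add: algebra_simps)
      also have "\<dots> \<le> A * y" using A y1 by (intro mult_right_mono) auto
      finally show "2 * of_int Q + 2 \<le> A * y" .
    qed (use Q0 in simp)
    finally have cardC: "real (card C) \<le> (A * y) ^ d" .
    have code_in: "code ` Fs \<subseteq> PiE C (\<lambda>_. {-P-1..P})"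
    proof -
      have "\<lfloor>f (pt c) / \<delta>\<rfloor> \<in> {-P-1..P}" if "f \<in> Fs" "c \<in> C" for f c
      proof -
        have "\<bar>f (pt c)\<bar> \<le> R" using that pt[of c] R by (auto simp: Fs_def intro: norm1_C0_bound)
        then have "\<bar>f (pt c) / \<delta>\<bar> \<le> y" using \<delta> by (simp add: y_def divide_right_mono)
        then have "f (pt c) / \<delta> \<le> y" "- y \<le> f (pt c) / \<delta>" by (simp_all only: abs_le_iff) linarith+
        then show ?thesis unfolding P_def by (auto simp: floor_le_iff le_floor_iff) linarith+
      qed
      then show ?thesis by (auto simp: code_def)
    qed
    have fin_code: "finite (code ` Fs)" by (rule finite_subset[OF code_in]) (auto intro!: finite_PiE finC)
    have "card (code ` Fs) \<le> nat (2 * P + 2) ^ card C"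
    proof -
      have "card {-P-1..P} = nat (2 * P + 2)" by simp
      then show ?thesis using card_mono[OF _ code_in] finC by (simp only: card_PiE finite_PiE prod_constant finite_atLeastAtMost_int)
    qed
    then have "real (card (code ` Fs)) \<le> real (nat (2 * P + 2) ^ card C)" by (simp only: of_nat_le_iff)
    also have "\<dots> = (2 * of_int P + 2) ^ card C" using P0 by simp
    also have "\<dots> \<le> (6 * y) ^ card C"
    proof (rule power_mono)
      have "of_int P \<le> y + 1" unfolding P_def by (rule of_int_ceiling_le_add_one)
      then show "2 * of_int P + 2 \<le> 6 * y" using y1 by linarith
    qed (use P0 in simp)
    also have "\<dots> = exp (card C * ln (6 * y))" using y1 by (simp add: exp_of_nat_mult)
    also have "\<dots> \<le> exp ((A * y) ^ d * ln (6 * y))"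
      using cardC y1 by (simp add: mult_right_mono)
    finally have card_code: "real (card (code ` Fs)) \<le> exp ((A * y) ^ d * ln (6 * y))" .
    \<comment> \<open>Each attained code is represented by a function of the ball having that code,
      so the net consists of points of the ball itself.\<close>
    define rep where "rep k = (SOME f. f \<in> Fs \<and> code f = k)" for k
    have rep: "rep (code f) \<in> Fs \<and> code (rep (code f)) = code f" if "f \<in> Fs" for f
      unfolding rep_def by (rule someI_ex[of "\<lambda>g. g \<in> Fs \<and> code g = code f"]) (use that in auto)
    define T where "T = (\<lambda>k. cls (rep k)) ` (code ` Fs)"
    have "T \<subseteq> Lip_ball D cls R" using rep by (auto simp: T_def Lip_ball_def Fs_def)
    moreover have "finite T" unfolding T_def by (rule finite_imageI[OF fin_code])
    moreover have "real (card T) \<le> exp ((A * (R / \<delta>)) ^ CARD('d) * ln (6 * (R / \<delta>)))"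
      using card_code card_image_le[OF fin_code, of "\<lambda>k. cls (rep k)"]
      unfolding T_def y_def[symmetric] d_def[symmetric] by linarith
    moreover have "\<exists>z\<in>T. norm (x - z) \<le> A * \<delta>" if x: "x \<in> Lip_ball D cls R" for x
    proof -
      obtain f where f: "f \<in> Fs" "x = cls f" using x unfolding Lip_ball_def Fs_def by blast
      define g where "g = rep (code f)"
      have g: "g \<in> Fs" "code g = code f" using rep[OF f(1)] by (auto simp: g_def)
      have "\<bar>f u - g u\<bar> \<le> (2 * d + 1) * \<delta>" if u: "u \<in> D" for u
      proof -
        define v where "v = pt (cell u)"
        have cu: "cell u \<in> C" using u by (simp add: C_def)
        have v: "v \<in> D" "cell v = cell u" using pt[OF cu] by (auto simp: v_def)
        have "norm (u - v) \<le> (\<Sum>i\<in>UNIV. \<bar>(u - v) $ i\<bar>)" by (rule norm_le_l1_cart)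
        also have "\<dots> \<le> (\<Sum>i\<in>(UNIV :: 'd set). 1 / y)"
        proof (rule sum_mono)
          fix i
          have "\<lfloor>u $ i * y\<rfloor> = \<lfloor>v $ i * y\<rfloor>" using v(2) by (simp add: cell_def vec_eq_iff)
          then have "\<bar>u $ i * y - v $ i * y\<bar> \<le> 1" by linarith
          then have "\<bar>u $ i - v $ i\<bar> * y \<le> 1" using y1 by (simp add: left_diff_distrib[symmetric] abs_mult)
          then show "\<bar>(u - v) $ i\<bar> \<le> 1 / y" using y1 by (simp add: field_simps)
        qed
        also have "\<dots> = d / y" by (simp add: d_def)
        finally have uv: "R * norm (u - v) \<le> d * \<delta>"
          using R \<delta> by (simp add: y_def field_simps)
        have 1: "\<bar>f u - f v\<bar> \<le> R * norm (u - v)"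
          using f(1) R u v(1) by (intro norm1_C0_lipschitz) (auto simp: Fs_def)
        have 2: "\<bar>g u - g v\<bar> \<le> R * norm (u - v)"
          using g(1) R u v(1) by (intro norm1_C0_lipschitz) (auto simp: Fs_def)
        \<comment> \<open>Equal codes bound the difference at the sample point \<open>v\<close> by
          one rounding step \<open>\<delta>\<close>; moving from \<open>u\<close> to
          \<open>v\<close> costs d \<open>\<delta>\<close> for each of the two functions.\<close>
        have "\<lfloor>f v / \<delta>\<rfloor> = \<lfloor>g v / \<delta>\<rfloor>"
          using fun_cong[OF g(2), of "cell u"] cu by (simp add: code_def v_def)
        then have "\<bar>f v / \<delta> - g v / \<delta>\<bar> \<le> 1" by linarith
        then have "\<bar>f v - g v\<bar> \<le> \<delta>" using \<delta> by (simp add: diff_divide_distrib[symmetric] field_simps)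
        with 1 2 uv have "\<bar>f u - g u\<bar> \<le> 2 * (d * \<delta>) + \<delta>" by linarith
        then show ?thesis by (simp add: algebra_simps)
      qed
      then have "norm (cls f - cls g) \<le> s * ((2 * d + 1) * \<delta>)"
        unfolding s_def using f(1) g(1) \<delta> by (intro norm_cls_diff) (auto simp: Fs_def)
      also have "\<dots> = (s * (2 * d + 1)) * \<delta>" by simp
      also have "\<dots> \<le> A * \<delta>" using A \<delta> by (intro mult_right_mono) auto
      finally have "norm (x - cls g) \<le> A * \<delta>" using f(2) by simp
      moreover have "cls g \<in> T" using f(1) by (auto simp: T_def g_def)
      ultimately show ?thesis by blast
    qed
    ultimately show ?thesis by blast
  qed
  then show ?thesis using that A(1) by blast
qed

lemma Lip_ball_C0: "Lip_ball D cls R \<subseteq> cls ` C0 D"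
  by (auto simp: Lip_ball_def)

text \<open>By Arzela--Ascoli a minimizing sequence in the Lipschitz ball has a cluster point in \<open>cls ` C0 D\<close>.\<close>

lemma Lip_ball_Inf_pos:
  fixes F :: "'h \<Rightarrow> real"
  assumes R: "0 < R" and ne: "Lip_ball D cls R \<noteq> {}"
    and pos: "\<And>x. x \<in> cls ` C0 D \<Longrightarrow> 0 < F x"
    and lip: "\<And>x y. x \<in> cls ` C0 D \<Longrightarrow> y \<in> cls ` C0 D \<Longrightarrow> \<bar>F x - F y\<bar> \<le> L * norm (x - y)"
  shows "0 < (INF x\<in>Lip_ball D cls R. F x)"
proof (rule ccontr)
  assume neg: "\<not> ?thesis"
  have bdd: "bdd_below (F ` Lip_ball D cls R)"
  proof (rule bdd_belowI[of _ 0])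
    fix y assume "y \<in> F ` Lip_ball D cls R"
    then obtain x where x: "x \<in> Lip_ball D cls R" "y = F x" by blast
    then show "0 \<le> y" using pos[OF subsetD[OF Lip_ball_C0 x(1)]] by simp
  qed
  have "\<exists>f. f \<in> C0 D \<and> norm1_C0 D f \<le> ennreal R \<and> F (cls f) < 1 / Suc i" for i
  proof -
    have "(INF x\<in>Lip_ball D cls R. F x) < 1 / Suc i" using neg by (simp add: not_less order.strict_trans1)
    then obtain x where "x \<in> Lip_ball D cls R" "F x < 1 / Suc i"
      using cINF_less_iff[OF ne bdd] by blast
    then show ?thesis unfolding Lip_ball_def by blast
  qed
  then obtain f where f: "\<And>i. f i \<in> C0 D" "\<And>i. norm1_C0 D (f i) \<le> ennreal R" "\<And>i. F (cls (f i)) < 1 / Suc i"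
    by metis
  obtain g k where g: "continuous_on D g" and k: "strict_mono (k :: nat \<Rightarrow> nat)"
    and conv: "\<And>e. 0 < e \<Longrightarrow> \<exists>N. \<forall>n x. n \<ge> N \<and> x \<in> D \<longrightarrow> norm (f (k n) x - g x) < e"
  proof (rule Arzela_Ascoli[OF D, of f R])
    show "norm (f n x) \<le> R" if "x \<in> D" for n x
      using norm1_C0_bound[OF f(2) _ that] R by simp
    show "\<exists>d>0. \<forall>n y. y \<in> D \<and> norm (x - y) < d \<longrightarrow> norm (f n x - f n y) < e"
      if "x \<in> D" "0 < e" for x e
    proof (intro exI conjI allI impI)
      show "0 < e / R" using that R by simp
      fix n y assume y: "y \<in> D \<and> norm (x - y) < e / R"
      have "\<bar>f n x - f n y\<bar> \<le> R * norm (x - y)"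
        using norm1_C0_lipschitz[OF f(2) _ that(1)] y R by simp
      also have "\<dots> < e" using y R by (simp add: field_simps)
      finally show "norm (f n x - f n y) < e" by simp
    qed
  qed blast
  \<comment> \<open>Continuity of the limit is enough: positivity and the Lipschitz bound are
    available for the classes of all continuous functions, so the limit is not traced back to the
    ball.\<close>
  have gC: "g \<in> C0 D" using g by (simp add: C0_def)
  have gpos: "0 < F (cls g)" using pos gC by blast
  \<comment> \<open>Uniform closeness F/(2c) becomes a change of \<open>F\<close> by at most F/2,
    through the passage to the Hilbert norm and the Lipschitz constant; the summands 1 keep
    \<open>c\<close> positive.\<close>
  define c where "c = (\<bar>L\<bar> + 1) * (sqrt (measure \<nu> D) + 1)"
  have c: "0 < c" by (auto simp: c_def intro!: mult_pos_pos add_nonneg_pos)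
  obtain N where N: "\<And>n x. n \<ge> N \<Longrightarrow> x \<in> D \<Longrightarrow> norm (f (k n) x - g x) < F (cls g) / (2 * c)"
    using conv[of "F (cls g) / (2 * c)"] gpos c by auto
  have "F (cls g) \<le> 2 / Suc n" if "N \<le> n" for n
  proof -
    have "norm (cls (f (k n)) - cls g) \<le> sqrt (measure \<nu> D) * (F (cls g) / (2 * c))"
      using N[OF that] gpos c by (intro norm_cls_diff f gC) (auto intro: less_imp_le)
    also have "\<dots> \<le> (sqrt (measure \<nu> D) + 1) * (F (cls g) / (2 * c))"
      using gpos c by (intro mult_right_mono) auto
    finally have nn: "norm (cls (f (k n)) - cls g) \<le> (sqrt (measure \<nu> D) + 1) * (F (cls g) / (2 * c))" .
    have "\<bar>F (cls (f (k n))) - F (cls g)\<bar> \<le> L * norm (cls (f (k n)) - cls g)"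
      using lip f(1) gC by blast
    also have "\<dots> \<le> (\<bar>L\<bar> + 1) * ((sqrt (measure \<nu> D) + 1) * (F (cls g) / (2 * c)))"
      using nn by (intro mult_mono) auto
    also have "\<dots> = c * (F (cls g) / (2 * c))" by (simp only: c_def mult.assoc)
    also have "\<dots> = F (cls g) / 2" using c by simp
    finally have "F (cls g) / 2 \<le> F (cls (f (k n)))" by linarith
    also have "\<dots> \<le> 1 / Suc (k n)" using f(3)[of "k n"] by simp
    also have "\<dots> \<le> 1 / Suc n" using seq_suble[OF k, of n] by (intro divide_left_mono) auto
    finally show ?thesis by simp
  qed
  note small = this
  have "(\<lambda>n. 2 * (1 / real (Suc n))) \<longlonglongrightarrow> 2 * 0"
    by (intro tendsto_intros LIMSEQ_Suc[OF lim_1_over_n])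
  then have "F (cls g) \<le> 2 * 0"
    by (rule LIMSEQ_le_const) (use small in auto)
  then show False using gpos by simp
qed

end

section \<open>Small ball probabilities and kernel moments\<close>

text \<open>McShane's extension by an infimal convolution, which preserves nonnegativity.\<close>

lemma lipschitz_extension:
  fixes f :: "'a::real_normed_vector \<Rightarrow> real"
  assumes ne: "S \<noteq> {}" and pos: "\<And>x. x \<in> S \<Longrightarrow> 0 \<le> f x"
    and lip: "\<And>x y. x \<in> S \<Longrightarrow> y \<in> S \<Longrightarrow> f x \<le> f y + norm (x - y)"
  obtains g where "continuous_on UNIV g" "\<And>x. x \<in> S \<Longrightarrow> g x = f x" "\<And>x. 0 \<le> g x"
proof -
  define g where "g y = (INF s\<in>S. f s + norm (y - s))" for y
  have bdd: "bdd_below ((\<lambda>s. f s + norm (y - s)) ` S)" for y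
    using pos by (intro bdd_belowI[of _ 0]) auto
  have le: "g y \<le> g z + norm (y - z)" for y z
  proof -
    have "g y - norm (y - z) \<le> f s + norm (z - s)" if "s \<in> S" for s
    proof -
      have "g y \<le> f s + norm (y - s)" unfolding g_def by (rule cINF_lower[OF bdd that])
      also have "norm (y - s) \<le> norm (y - z) + norm (z - s)" using norm_triangle_ineq[of "y - z" "z - s"] by simp
      finally show ?thesis by simp
    qed
    then have "g y - norm (y - z) \<le> g z" unfolding g_def[of z] by (intro cINF_greatest[OF ne]) auto
    then show ?thesis by simp
  qed
  have "\<bar>g y - g z\<bar> \<le> norm (y - z)" for y z
    using le[of y z] le[of z y] by (simp add: norm_minus_commute abs_le_iff)
  then have cont: "continuous_on UNIV g"
    unfolding continuous_on_iff dist_norm real_norm_def by (metis norm_minus_commute order_le_less_trans)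
  have gf: "g x = f x" if x: "x \<in> S" for x
  proof (rule antisym)
    show "g x \<le> f x" unfolding g_def using cINF_lower[OF bdd x, of x] by simp
    show "f x \<le> g x" unfolding g_def using lip[OF x] by (intro cINF_greatest[OF ne]) auto
  qed
  have "0 \<le> g x" for x unfolding g_def by (rule cINF_greatest[OF ne]) (simp add: pos)
  with cont gf show ?thesis by (rule that)
qed

context prob_space
begin

text \<open>For V \<le> h the kernel value is K 1 minus the integral of \<open>K'\<close> over
  [V/h, 1], and for V > h it is 0. Exchanging expectation and integral turns the condition V \<le> h
  u into a distribution function.\<close>

lemma kernel_moment:
  fixes V :: "'a \<Rightarrow> real" and K K' :: "real \<Rightarrow> real"
  assumes V [measurable]: "V \<in> borel_measurable M" and V0: "\<And>\<omega>. \<omega> \<in> space M \<Longrightarrow> 0 \<le> V \<omega>"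
    and K: "\<And>u. u \<in> {0..1} \<Longrightarrow> (K has_real_derivative K' u) (at u within {0..1})"
    and K': "continuous_on {0..1} K'" and K1: "\<And>u. 1 < u \<Longrightarrow> K u = 0" and h: "0 < h"
    and G: "continuous_on {0..1} (\<lambda>u. prob {\<omega> \<in> space M. V \<omega> \<le> h * u})"
  shows "expectation (\<lambda>\<omega>. K (V \<omega> / h)) =
    K 1 * prob {\<omega> \<in> space M. V \<omega> \<le> h} - integral {0..1} (\<lambda>u. K' u * prob {\<omega> \<in> space M. V \<omega> \<le> h * u})"
proof -
  interpret L: pair_sigma_finite M lborel
    by (intro pair_sigma_finite.intro sigma_finite_measure_axioms sigma_finite_lborel)
  define \<kappa> where "\<kappa> u = indicator {0..1} u *\<^sub>R K' u" for u
  have [measurable]: "\<kappa> \<in> borel_measurable borel"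
    unfolding \<kappa>_def[abs_def] by (rule borel_measurable_continuous_on_indicator) (use K' in auto)
  have \<kappa>i: "integrable lborel \<kappa>"
    using borel_integrable_atLeastAtMost'[OF K'] by (simp add: \<kappa>_def[abs_def] set_integrable_def)
  \<comment> \<open>The lower limit V/h of the integral is encoded as the joint condition V \<le> h
    u, which makes the integrand measurable on the product space for Fubini.\<close>
  define f where "f \<omega> u = (if V \<omega> \<le> h * u then \<kappa> u else 0)" for \<omega> u
  have fm: "case_prod f \<in> borel_measurable (M \<Otimes>\<^sub>M lborel)" unfolding f_def by measurable
  note [measurable] = fm
  have fi: "integrable lborel (f \<omega>)" if "\<omega> \<in> space M" for \<omega>
    by (rule Bochner_Integration.integrable_bound[OF \<kappa>i]) (auto simp: f_def[abs_def])
  have inner: "(\<integral>u. f \<omega> u \<partial>lborel) = (if V \<omega> \<le> h then K 1 - K (V \<omega> / h) else 0)" if \<omega>: "\<omega> \<in> space M" for \<omega>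
  proof (cases "V \<omega> \<le> h")
    case True
    let ?w = "V \<omega> / h"
    have w: "0 \<le> ?w" "?w \<le> 1" using V0[OF \<omega>] h True by auto
    have sub: "{?w..1} \<subseteq> {0..1}" using w by auto
    have si: "set_integrable lborel {?w..1} K'"
      by (rule borel_integrable_atLeastAtMost'[OF continuous_on_subset[OF K' sub]])
    have "(K' has_integral K 1 - K ?w) {?w..1}"
    proof (rule fundamental_theorem_of_calculus[OF w(2)])
      fix u assume u: "u \<in> {?w..1}"
      have "(K has_real_derivative K' u) (at u within {?w..1})"
        by (rule has_field_derivative_subset[OF K sub]) (use u sub in auto)
      then show "(K has_vector_derivative K' u) (at u within {?w..1})"
        by (rule has_real_derivative_iff_has_vector_derivative[THEN iffD1])
    qed
    then have "K 1 - K ?w = integral {?w..1} K'" by (simp add: integral_unique)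
    also have "\<dots> = (LINT u:{?w..1}|lborel. K' u)" using set_borel_integral_eq_integral(2)[OF si] by simp
    also have "\<dots> = (\<integral>u. f \<omega> u \<partial>lborel)"
      unfolding set_lebesgue_integral_def
    proof (rule Bochner_Integration.integral_cong[OF refl])
      fix u
      have "V \<omega> \<le> h * u \<longleftrightarrow> ?w \<le> u" using h by (simp add: field_simps)
      then show "indicator {?w..1} u *\<^sub>R K' u = f \<omega> u"
        using w by (auto simp: f_def \<kappa>_def indicator_def)
    qed
    finally show ?thesis using True by simp
  next
    case False
    have "f \<omega> u = 0" for u
    proof (cases "u \<in> {0..1}")
      case True
      then have "h * u \<le> h" using h by (simp add: mult_left_le)
      then show ?thesis using False by (simp add: f_def)
    qed (simp add: f_def \<kappa>_def)
    then show ?thesis using False by simp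
  qed
  have fint: "integrable (M \<Otimes>\<^sub>M lborel) (case_prod f)"
  proof (rule L.Fubini_integrable[OF fm])
    have "norm (\<integral>u. norm (f \<omega> u) \<partial>lborel) \<le> (\<integral>u. norm (\<kappa> u) \<partial>lborel)" if "\<omega> \<in> space M" for \<omega>
    proof -
      have "(\<integral>u. norm (f \<omega> u) \<partial>lborel) \<le> (\<integral>u. norm (\<kappa> u) \<partial>lborel)"
        by (rule integral_mono[OF integrable_norm[OF fi[OF that]] integrable_norm[OF \<kappa>i]]) (auto simp: f_def)
      then show ?thesis by simp
    qed
    then show "integrable M (\<lambda>\<omega>. \<integral>u. norm (case_prod f (\<omega>, u)) \<partial>lborel)"
      by (intro integrable_const_bound[where B = "\<integral>u. norm (\<kappa> u) \<partial>lborel"] AE_I2) auto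
    show "AE \<omega> in M. integrable lborel (\<lambda>u. case_prod f (\<omega>, u))" using fi by (intro AE_I2) simp
  qed
  have swap: "expectation (\<lambda>\<omega>. \<integral>u. f \<omega> u \<partial>lborel) = (\<integral>u. expectation (\<lambda>\<omega>. f \<omega> u) \<partial>lborel)"
    using L.Fubini_integral[OF fint] by simp
  have ex: "expectation (\<lambda>\<omega>. f \<omega> u) = \<kappa> u * prob {\<omega> \<in> space M. V \<omega> \<le> h * u}" for u
  proof -
    have "expectation (\<lambda>\<omega>. f \<omega> u) = expectation (\<lambda>\<omega>. \<kappa> u * indicator {\<omega> \<in> space M. V \<omega> \<le> h * u} \<omega>)"
      by (rule Bochner_Integration.integral_cong) (auto simp: f_def)
    then show ?thesis by (simp add: less_top[symmetric])
  qed
  have si: "set_integrable lborel {0..1} (\<lambda>u. K' u * prob {\<omega> \<in> space M. V \<omega> \<le> h * u})"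
    by (intro borel_integrable_atLeastAtMost' continuous_intros K' G)
  have "(\<integral>u. expectation (\<lambda>\<omega>. f \<omega> u) \<partial>lborel) = integral {0..1} (\<lambda>u. K' u * prob {\<omega> \<in> space M. V \<omega> \<le> h * u})"
    unfolding ex set_borel_integral_eq_integral(2)[OF si, symmetric] set_lebesgue_integral_def
    by (rule Bochner_Integration.integral_cong) (auto simp: \<kappa>_def)
  with swap have E: "expectation (\<lambda>\<omega>. \<integral>u. f \<omega> u \<partial>lborel) = integral {0..1} (\<lambda>u. K' u * prob {\<omega> \<in> space M. V \<omega> \<le> h * u})"
    by simp
  have "expectation (\<lambda>\<omega>. K (V \<omega> / h)) =
      expectation (\<lambda>\<omega>. K 1 * indicator {\<omega> \<in> space M. V \<omega> \<le> h} \<omega> - (\<integral>u. f \<omega> u \<partial>lborel))"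
    by (rule Bochner_Integration.integral_cong) (use h in \<open>auto simp: inner K1\<close>)
  also have "\<dots> = K 1 * prob {\<omega> \<in> space M. V \<omega> \<le> h} - expectation (\<lambda>\<omega>. \<integral>u. f \<omega> u \<partial>lborel)"
    using L.integrable_fst'[OF fint] by (subst Bochner_Integration.integral_diff) (auto simp: less_top[symmetric])
  finally show ?thesis unfolding E .
qed

lemma subalgebra_sigma_rv:
  assumes "V \<in> borel_measurable M"
  shows "subalgebra M (sigma_rv M V)"
  unfolding subalgebra_def sigma_rv_def
  using measurable_sets[OF assms] by (subst sets_vimage_algebra2) auto

text \<open>The version \<open>g\<close> agrees almost everywhere with \<open>real_cond_exp\<close>,
  for which taking out known factors is available.\<close>

lemma is_cond_exp_mult:
  fixes f g :: "'a \<Rightarrow> real"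
  assumes V: "V \<in> borel_measurable M" and fg: "is_cond_exp M (sigma_rv M V) f g"
    and \<phi>: "\<phi> \<in> borel_measurable borel" "\<And>v. \<bar>\<phi> v\<bar> \<le> B"
  shows "expectation (\<lambda>\<omega>. \<phi> (V \<omega>) * f \<omega>) = expectation (\<lambda>\<omega>. \<phi> (V \<omega>) * g \<omega>)"
proof -
  have sub: "subalgebra M (sigma_rv M V)" by (rule subalgebra_sigma_rv[OF V])
  interpret finite_measure_subalgebra M "sigma_rv M V" using sub by unfold_locales
  have fi: "integrable M f" and gi: "integrable M g" using fg by (auto simp: is_cond_exp_def)
  have VF: "V \<in> measurable (sigma_rv M V) borel"
    unfolding sigma_rv_def by (rule measurable_vimage_algebra1) simp
  have \<phi>F: "(\<lambda>\<omega>. \<phi> (V \<omega>)) \<in> borel_measurable (sigma_rv M V)" by (rule measurable_compose[OF VF \<phi>(1)])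
  have \<phi>M [measurable]: "(\<lambda>\<omega>. \<phi> (V \<omega>)) \<in> borel_measurable M" by (rule measurable_from_subalg[OF sub \<phi>F])
  have [measurable]: "f \<in> borel_measurable M" using fi by simp
  have int: "integrable M (\<lambda>\<omega>. \<phi> (V \<omega>) * f \<omega>)"
  proof (rule Bochner_Integration.integrable_bound[of _ "\<lambda>\<omega>. B * f \<omega>"])
    have "0 \<le> B" using \<phi>(2)[of undefined] by linarith
    then show "AE \<omega> in M. norm (\<phi> (V \<omega>) * f \<omega>) \<le> norm (B * f \<omega>)"
      using \<phi>(2) by (intro AE_I2) (auto simp: abs_mult intro!: mult_right_mono)
  qed (use fi in auto)
  have "expectation (\<lambda>\<omega>. \<phi> (V \<omega>) * f \<omega>) = expectation (\<lambda>\<omega>. \<phi> (V \<omega>) * real_cond_exp M (sigma_rv M V) f \<omega>)"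
    using real_cond_exp_intg(2)[OF int \<phi>F] by simp
  also have "\<dots> = expectation (\<lambda>\<omega>. \<phi> (V \<omega>) * g \<omega>)"
  proof (rule integral_cong_AE)
    show "(\<lambda>\<omega>. \<phi> (V \<omega>) * real_cond_exp M (sigma_rv M V) f \<omega>) \<in> borel_measurable M"
      using borel_measurable_cond_exp2[of M "sigma_rv M V" f] by (intro borel_measurable_times) auto
    show "AE \<omega> in M. \<phi> (V \<omega>) * real_cond_exp M (sigma_rv M V) f \<omega> = \<phi> (V \<omega>) * g \<omega>"
      using is_cond_exp_real[OF prob_space_axioms sub fg] by eventually_elim simp
  qed (use gi in auto)
  finally show ?thesis .
qed

lemma is_cond_exp_inner:
  fixes f :: "'a \<Rightarrow> 'h::{real_inner, banach, second_countable_topology}"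
  assumes "is_cond_exp M F f (\<lambda>\<omega>. 0)" and F: "subalgebra M F"
  shows "is_cond_exp M F (\<lambda>\<omega>. f \<omega> \<bullet> a) (\<lambda>\<omega>. 0)"
proof -
  have f: "integrable M f" "\<And>A. A \<in> sets F \<Longrightarrow> (\<integral>\<omega>\<in>A. f \<omega> \<partial>M) = 0"
    using assms by (auto simp: is_cond_exp_def set_lebesgue_integral_def)
  have "(\<integral>\<omega>\<in>A. f \<omega> \<bullet> a \<partial>M) = 0" if "A \<in> sets F" for A
  proof -
    have A: "A \<in> sets M" using that F by (auto simp: subalgebra_def)
    have "(\<integral>\<omega>\<in>A. f \<omega> \<bullet> a \<partial>M) = (\<integral>\<omega>. (indicator A \<omega> *\<^sub>R f \<omega>) \<bullet> a \<partial>M)"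
      by (simp add: set_lebesgue_integral_def)
    also have "\<dots> = (\<integral>\<omega>. indicator A \<omega> *\<^sub>R f \<omega> \<partial>M) \<bullet> a"
      by (rule integral_inner_left) (use integrable_mult_indicator[OF A f(1)] in auto)
    also have "\<dots> = 0" using f(2)[OF that] by (simp add: set_lebesgue_integral_def)
    finally show ?thesis .
  qed
  then show ?thesis using f(1) by (simp add: is_cond_exp_def set_lebesgue_integral_def)
qed

text \<open>The odd numbers 2k + 1 for k up to the integer part n of \<open>f\<close> add up to (n +
  1)^2, which dominates the square of \<open>f\<close>. The expectation is thus bounded by a series
  of tail probabilities.\<close>

lemma exp_tail_square_integrable:
  fixes f :: "'a \<Rightarrow> real"
  assumes f [measurable]: "f \<in> borel_measurable M" and f0: "\<And>\<omega>. 0 \<le> f \<omega>"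
    and tail: "\<And>k :: nat. prob {\<omega> \<in> space M. real k \<le> f \<omega>} \<le> c * exp (- b * real k)" and b: "0 < b"
  shows "integrable M (\<lambda>\<omega>. (f \<omega>)\<^sup>2)"
proof (rule integrableI_bounded)
  let ?r = "exp (- b / 2)"
  have c0: "0 \<le> c" using order_trans[OF measure_nonneg tail[of 0]] by simp
  have "(\<integral>\<^sup>+ \<omega>. norm ((f \<omega>)\<^sup>2) \<partial>M) \<le>
      (\<integral>\<^sup>+ \<omega>. (\<Sum>k. ennreal (2 * real k + 1) * indicator {\<omega> \<in> space M. real k \<le> f \<omega>} \<omega>) \<partial>M)"
  proof (rule nn_integral_mono)
    fix \<omega> assume \<omega>: "\<omega> \<in> space M"
    define n where "n = nat \<lfloor>f \<omega>\<rfloor>"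
    have n: "real n \<le> f \<omega>" "f \<omega> \<le> real n + 1" using f0[of \<omega>] by (auto simp: n_def)
    have "(f \<omega>)\<^sup>2 \<le> (real n + 1)\<^sup>2" using n f0[of \<omega>] by (intro power_mono) auto
    also have "(real n + 1)\<^sup>2 = (\<Sum>k<Suc n. 2 * real k + 1)"
      by (induction n) (auto simp: power2_eq_square algebra_simps)
    finally have "ennreal (norm ((f \<omega>)\<^sup>2)) \<le> ennreal (\<Sum>k<Suc n. 2 * real k + 1)" by (intro ennreal_leI) simp
    also have "\<dots> = (\<Sum>k<Suc n. ennreal (2 * real k + 1))" by (rule sum_ennreal[symmetric]) simp
    also have "\<dots> = (\<Sum>k<Suc n. ennreal (2 * real k + 1) * indicator {\<omega> \<in> space M. real k \<le> f \<omega>} \<omega>)"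
    proof (rule sum.cong[OF refl])
      fix k assume "k \<in> {..<Suc n}"
      then have "real k \<le> f \<omega>" using n(1) by (auto intro: order_trans[of _ "real n"])
      then show "ennreal (2 * real k + 1) = ennreal (2 * real k + 1) * indicator {\<omega> \<in> space M. real k \<le> f \<omega>} \<omega>"
        using \<omega> by simp
    qed
    also have "\<dots> \<le> (\<Sum>k. ennreal (2 * real k + 1) * indicator {\<omega> \<in> space M. real k \<le> f \<omega>} \<omega>)"
      by (rule sum_le_suminf) auto
    finally show "ennreal (norm ((f \<omega>)\<^sup>2)) \<le> (\<Sum>k. ennreal (2 * real k + 1) * indicator {\<omega> \<in> space M. real k \<le> f \<omega>} \<omega>)" .
  qed
  also have "\<dots> = (\<Sum>k. ennreal (2 * real k + 1) * emeasure M {\<omega> \<in> space M. real k \<le> f \<omega>})"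
    by (subst nn_integral_suminf) (auto simp: nn_integral_cmult_indicator)
  also have "\<dots> \<le> (\<Sum>k. ennreal ((1 + 4 / b) * c * ?r ^ k))"
  proof (rule suminf_le)
    fix k :: nat
    \<comment> \<open>Half of the exponential decay is spent on the linear factor 2k + 1; the other
      half remains as the geometric ratio \<open>?r\<close>.\<close>
    have "1 + b / 2 * k \<le> exp (b / 2 * k)" by (rule exp_ge_add_one_self)
    then have "(1 + 4 / b) * (1 + b / 2 * k) \<le> (1 + 4 / b) * exp (b / 2 * k)"
      using b by (intro mult_left_mono) auto
    moreover have "2 * real k + 1 \<le> (1 + 4 / b) * (1 + b / 2 * k)" using b by (simp add: field_simps)
    ultimately have "2 * real k + 1 \<le> (1 + 4 / b) * exp (b / 2 * k)" by linarith
    then have "(2 * real k + 1) * prob {\<omega> \<in> space M. real k \<le> f \<omega>} \<le> (1 + 4 / b) * exp (b / 2 * k) * (c * exp (- b * k))"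
      using tail[of k] b by (intro mult_mono) auto
    also have "\<dots> = (1 + 4 / b) * c * (exp (b / 2 * k) * exp (- b * k))" by simp
    also have "exp (b / 2 * k) * exp (- b * k) = ?r ^ k"
      by (simp add: exp_of_nat_mult[symmetric] exp_add[symmetric] algebra_simps)
    finally show "ennreal (2 * real k + 1) * emeasure M {\<omega> \<in> space M. real k \<le> f \<omega>} \<le> ennreal ((1 + 4 / b) * c * ?r ^ k)"
      unfolding emeasure_eq_measure by (subst ennreal_mult'[symmetric]) (simp_all add: ennreal_leI del: ennreal_plus)
  qed auto
  also have "\<dots> = ennreal (\<Sum>k. (1 + 4 / b) * c * ?r ^ k)"
    using b c0 by (intro suminf_ennreal2 summable_mult summable_geometric) auto
  also have "\<dots> < \<infinity>" by simp
  finally show "(\<integral>\<^sup>+ \<omega>. norm ((f \<omega>)\<^sup>2) \<partial>M) < \<infinity>" .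
qed simp

end

lemma ennreal_finite_eq: "s < (\<infinity> :: ennreal) \<Longrightarrow> \<exists>C\<ge>0. s = ennreal C"
  by (cases s) auto

lemma integrable_mult_bounded:
  fixes f :: "'a \<Rightarrow> 'b::{banach, second_countable_topology}" and g :: "'a \<Rightarrow> real"
  assumes f: "integrable M f" and g: "g \<in> borel_measurable M" "\<And>x. x \<in> space M \<Longrightarrow> \<bar>g x\<bar> \<le> B"
  shows "integrable M (\<lambda>x. g x *\<^sub>R f x)"
proof (rule Bochner_Integration.integrable_bound[of _ "\<lambda>x. B *\<^sub>R f x"])
  show "(\<lambda>x. g x *\<^sub>R f x) \<in> borel_measurable M" using f g(1) by (intro borel_measurable_scaleR) auto
  show "AE x in M. norm (g x *\<^sub>R f x) \<le> norm (B *\<^sub>R f x)"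
    using g(2) by (intro AE_I2) (auto intro!: mult_right_mono order_trans[OF _ abs_ge_self])
qed (use f in simp)

locale functional_field = L2_compact D \<nu> cls + prob_space M
  for D :: "(real ^ 'd) set" and \<nu> :: "(real ^ 'd) measure"
    and cls :: "(real ^ 'd \<Rightarrow> real) \<Rightarrow> 'h::{real_inner, banach, second_countable_topology}"
    and M :: "'w measure" +
  fixes S :: "'h set" and \<rho> :: "'h \<Rightarrow> 'h \<Rightarrow> real" and X :: "int ^ 'n \<Rightarrow> 'w \<Rightarrow> 'h"
  assumes S: "cls ` C0 D \<subseteq> S"
    and \<rho>: "pseudometric_on S \<rho>" and \<rho>_le: "\<And>x y. x \<in> S \<Longrightarrow> y \<in> S \<Longrightarrow> \<rho> x y \<le> norm (x - y)"
    and X [measurable]: "\<And>s. X s \<in> borel_measurable M"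
    and XS: "\<And>s \<omega>. \<omega> \<in> space M \<Longrightarrow> X s \<omega> \<in> S"
begin

abbreviation F :: "'h \<Rightarrow> real \<Rightarrow> real" where
  "F \<equiv> small_ball M \<rho> X"

text \<open>A fixed centre: it normalizes the Lipschitz condition on small ball probabilities and
  anchors the growth of \<open>\<Psi>\<close> over a Lipschitz ball.\<close>

definition origin :: 'h where "origin = cls (\<lambda>_. 0)"

lemma origin: "origin \<in> S"
  using S by (auto simp: origin_def C0_def)

lemma Lip_ball_S: "x \<in> Lip_ball D cls R \<Longrightarrow> x \<in> S"
  using Lip_ball_C0 S by blast

lemma \<rho>_self: "x \<in> S \<Longrightarrow> \<rho> x x = 0"
  and \<rho>_nonneg: "x \<in> S \<Longrightarrow> y \<in> S \<Longrightarrow> 0 \<le> \<rho> x y"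
  and \<rho>_sym: "x \<in> S \<Longrightarrow> y \<in> S \<Longrightarrow> \<rho> x y = \<rho> y x"
  and \<rho>_triangle: "x \<in> S \<Longrightarrow> y \<in> S \<Longrightarrow> z \<in> S \<Longrightarrow> \<rho> x z \<le> \<rho> x y + \<rho> y z"
  using \<rho> by (auto simp: pseudometric_on_def)

lemma \<rho>_diff:
  assumes "x \<in> S" "y \<in> S" "z \<in> S"
  shows "\<bar>\<rho> z x - \<rho> z y\<bar> \<le> norm (x - y)"
proof -
  have "\<rho> z x \<le> \<rho> z y + \<rho> y x" "\<rho> z y \<le> \<rho> z x + \<rho> x y"
    using assms by (auto intro: \<rho>_triangle)
  then show ?thesis
    using \<rho>_le[OF assms(1,2)] \<rho>_sym[OF assms(1,2)] by (auto simp: abs_le_iff)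
qed

text \<open>\<open>S\<close> is not assumed measurable, and \<open>\<rho>\<close> is unrestricted
  off \<open>S\<close>. A continuous extension to the whole space makes the distance to a centre a
  Borel function, as needed in test functions and in conditional expectations given
  \<open>X\<close>.\<close>

definition \<rho>_ext :: "'h \<Rightarrow> 'h \<Rightarrow> real" where
  "\<rho>_ext x = (SOME g. continuous_on UNIV g \<and> (\<forall>y\<in>S. g y = \<rho> y x) \<and> (\<forall>y. 0 \<le> g y))"

lemma \<rho>_ext:
  assumes x: "x \<in> S"
  shows "continuous_on UNIV (\<rho>_ext x)" "\<And>y. y \<in> S \<Longrightarrow> \<rho>_ext x y = \<rho> y x" "\<And>y. 0 \<le> \<rho>_ext x y"
proof -
  obtain g where "continuous_on UNIV g" "\<And>y. y \<in> S \<Longrightarrow> g y = \<rho> y x" "\<And>y. 0 \<le> g y"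
  proof (rule lipschitz_extension[of S "\<lambda>y. \<rho> y x"])
    show "S \<noteq> {}" using x by blast
    show "0 \<le> \<rho> y x" if "y \<in> S" for y by (rule \<rho>_nonneg[OF that x])
    show "\<rho> y x \<le> \<rho> z x + norm (y - z)" if "y \<in> S" "z \<in> S" for y z
      using \<rho>_triangle[OF that x] \<rho>_le[OF that] by linarith
  qed blast
  then have "\<exists>g. continuous_on UNIV g \<and> (\<forall>y\<in>S. g y = \<rho> y x) \<and> (\<forall>y. 0 \<le> g y)" by blast
  from someI_ex[OF this]
  have "continuous_on UNIV (\<rho>_ext x) \<and> (\<forall>y\<in>S. \<rho>_ext x y = \<rho> y x) \<and> (\<forall>y. 0 \<le> \<rho>_ext x y)"
    unfolding \<rho>_ext_def .
  then show "continuous_on UNIV (\<rho>_ext x)" "\<And>y. y \<in> S \<Longrightarrow> \<rho>_ext x y = \<rho> y x" "\<And>y. 0 \<le> \<rho>_ext x y"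
    by auto
qed

lemma \<rho>_ext_measurable: "x \<in> S \<Longrightarrow> \<rho>_ext x \<in> borel_measurable borel"
  by (rule borel_measurable_continuous_onI[OF \<rho>_ext(1)])

lemma \<rho>_ext_X: "x \<in> S \<Longrightarrow> \<omega> \<in> space M \<Longrightarrow> \<rho>_ext x (X s \<omega>) = \<rho> (X s \<omega>) x"
  by (rule \<rho>_ext(2)[OF _ XS])

lemma \<rho>X_measurable:
  assumes "x \<in> S" shows "(\<lambda>\<omega>. \<rho> (X s \<omega>) x) \<in> borel_measurable M"
proof -
  have "(\<lambda>\<omega>. \<rho>_ext x (X s \<omega>)) \<in> borel_measurable M"
    by (rule measurable_compose[OF X \<rho>_ext_measurable[OF assms]])
  then show ?thesis using \<rho>_ext_X[OF assms] by (simp cong: measurable_cong)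
qed

lemma \<rho>X_nonneg: "x \<in> S \<Longrightarrow> \<omega> \<in> space M \<Longrightarrow> 0 \<le> \<rho> (X s \<omega>) x"
  by (rule \<rho>_nonneg[OF XS])

lemma F_bounds: "0 \<le> F x h" "F x h \<le> 1"
  by (simp_all add: small_ball_def)

lemma F_event: "x \<in> S \<Longrightarrow> {\<omega> \<in> space M. \<rho> (X s \<omega>) x \<le> h} \<in> sets M"
  using \<rho>X_measurable[of x s] by measurable

text \<open>Assumption (5) with \<open>x = 0\<close> and the largest admissible bandwidth gives constants that do not
  depend on the centre.\<close>

lemma small_ball_regular:
  assumes pos: "\<forall>x\<in>S. \<forall>\<eta>>0. 0 < F x \<eta>" and \<delta>: "0 < \<delta>"
    and lip: "\<forall>x\<in>S. \<forall>\<eta>. 0 < \<eta> \<and> \<eta> \<le> \<delta> \<longrightarrow>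
        (\<forall>z\<in>S. \<forall>z'\<in>S. \<forall>u\<in>{0..1}. \<forall>u'\<in>{0..1}.
           \<bar>F z (\<eta> * u) / F x \<eta> - F z' (\<eta> * u') / F x \<eta>\<bar> \<le> L x * (\<rho> z z' + \<bar>u - u'\<bar>))"
  obtains C where "0 < C"
    "\<And>z a b. z \<in> S \<Longrightarrow> 0 \<le> a \<Longrightarrow> a \<le> b \<Longrightarrow> b \<le> \<delta> \<Longrightarrow> F z b - F z a \<le> C * (b - a)"
    "\<And>z z' a. z \<in> S \<Longrightarrow> z' \<in> S \<Longrightarrow> 0 \<le> a \<Longrightarrow> a \<le> \<delta> \<Longrightarrow> \<bar>F z a - F z' a\<bar> \<le> C * \<rho> z z'"
proof -
  define G where "G = F origin \<delta>"
  have G: "0 < G" using pos origin \<delta> by (simp add: G_def)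
  define L' where "L' = \<bar>L origin\<bar> + 1"
  define C where "C = L' * G * (1 + 1 / \<delta>)"
  have L': "0 < L'" by (simp add: L'_def)
  have C: "0 < C" "L' * G \<le> C" "L' * G / \<delta> \<le> C"
    using L' G \<delta> by (auto simp: C_def field_simps add_pos_pos)
  have key: "\<bar>F z a - F z' b\<bar> \<le> L' * G * (\<rho> z z' + \<bar>a - b\<bar> / \<delta>)"
    if z: "z \<in> S" "z' \<in> S" and ab: "0 \<le> a" "a \<le> \<delta>" "0 \<le> b" "b \<le> \<delta>" for z z' a b
  proof -
    \<comment> \<open>Writing radii as \<open>\<delta>\<close> u with u in [0, 1] lets the single
      bandwidth \<open>\<delta>\<close> cover all radii up to \<open>\<delta>\<close>;
      multiplication by \<open>G\<close> then removes the denominator.\<close>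
    have u: "a / \<delta> \<in> {0..1}" "b / \<delta> \<in> {0..1}" using ab \<delta> by auto
    have "\<bar>F z (\<delta> * (a / \<delta>)) / F origin \<delta> - F z' (\<delta> * (b / \<delta>)) / F origin \<delta>\<bar>
        \<le> L origin * (\<rho> z z' + \<bar>a / \<delta> - b / \<delta>\<bar>)"
      using lip origin \<delta> z u by blast
    also have "\<dots> \<le> L' * (\<rho> z z' + \<bar>a / \<delta> - b / \<delta>\<bar>)"
      using \<rho>_nonneg[OF z] by (intro mult_right_mono) (auto simp: L'_def)
    finally have "\<bar>F z a - F z' b\<bar> / G \<le> L' * (\<rho> z z' + \<bar>a - b\<bar> / \<delta>)"
      using \<delta> G by (simp add: G_def[symmetric] diff_divide_distrib[symmetric] abs_div)
    then show ?thesis using G by (simp add: field_simps)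
  qed
  show ?thesis
  proof (rule that[OF C(1)])
    fix z a b assume *: "z \<in> S" "0 \<le> a" "a \<le> b" "b \<le> \<delta>"
    have "F z b - F z a \<le> \<bar>F z b - F z a\<bar>" by simp
    also have "\<dots> \<le> L' * G * (\<rho> z z + \<bar>b - a\<bar> / \<delta>)" using * by (intro key) auto
    also have "\<dots> = L' * G / \<delta> * (b - a)" using * \<rho>_self by simp
    also have "\<dots> \<le> C * (b - a)" using * C by (intro mult_right_mono) auto
    finally show "F z b - F z a \<le> C * (b - a)" .
  next
    fix z z' a assume *: "z \<in> S" "z' \<in> S" "0 \<le> a" "a \<le> \<delta>"
    have "\<bar>F z a - F z' a\<bar> \<le> L' * G * (\<rho> z z' + \<bar>a - a\<bar> / \<delta>)" using * by (intro key) auto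
    also have "\<dots> \<le> C * \<rho> z z'" using C(2) \<rho>_nonneg[OF *(1,2)] by (simp add: mult_right_mono)
    finally show "\<bar>F z a - F z' a\<bar> \<le> C * \<rho> z z'" .
  qed
qed

text \<open>By \<open>kernel_moment\<close> the mean is \<open>F x h\<close> times K 1 minus the
  integral of \<open>K'\<close> against the ratios F x (h u)/F x h. Uniform convergence of the
  ratios brings this factor, for all centres at once, within half of the infimum in assumption (4)
  of its limit.\<close>

lemma kernel_mean_lower:
  fixes K K' :: "real \<Rightarrow> real" and \<tau> :: "'h \<Rightarrow> real \<Rightarrow> real"
  assumes A2a: "\<forall>u>1. K u = 0"
    and A2b: "\<forall>u\<in>{0..1}. (K has_real_derivative K' u) (at u within {0..1}) \<and> K' u \<le> 0"
      "continuous_on {0..1} K'"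
    and A3a: "\<forall>x\<in>S. \<forall>\<eta>>0. 0 < F x \<eta>"
    and A3b: "\<forall>x\<in>S. \<forall>u\<in>{0..1}. ((\<lambda>\<eta>. F x (\<eta> * u) / F x \<eta>) \<longlongrightarrow> \<tau> x u) (at_right 0)"
    and A3c: "((\<lambda>\<eta>. SUP x\<in>S. SUP u\<in>{0..1}. ennreal \<bar>F x (\<eta> * u) / F x \<eta> - \<tau> x u\<bar>) \<longlongrightarrow> 0) (at_right 0)"
    and A4: "\<forall>x\<in>S. 0 < K 1 - integral {0..1} (\<lambda>u. K' u * \<tau> x u)"
      "0 < (INF x\<in>S. K 1 - integral {0..1} (\<lambda>u. K' u * \<tau> x u))"
    and \<delta>: "0 < \<delta>"
    and A5: "\<forall>x\<in>S. \<forall>\<eta>. 0 < \<eta> \<and> \<eta> \<le> \<delta> \<longrightarrow>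
        (\<forall>z\<in>S. \<forall>z'\<in>S. \<forall>u\<in>{0..1}. \<forall>u'\<in>{0..1}.
           \<bar>F z (\<eta> * u) / F x \<eta> - F z' (\<eta> * u') / F x \<eta>\<bar> \<le> L x * (\<rho> z z' + \<bar>u - u'\<bar>))"
  shows "\<exists>c>0. \<exists>\<delta>'>0. \<forall>x\<in>S. \<forall>h. 0 < h \<and> h \<le> \<delta>' \<longrightarrow>
    c * F x h \<le> expectation (\<lambda>\<omega>. K (\<rho> (X 0 \<omega>) x / h))"
proof -
  define m where "m = (INF x\<in>S. K 1 - integral {0..1} (\<lambda>u. K' u * \<tau> x u))"
  have m: "0 < m" using A4(2) by (simp add: m_def)
  have m_le: "m \<le> K 1 - integral {0..1} (\<lambda>u. K' u * \<tau> x u)" if "x \<in> S" for x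
    unfolding m_def using A4(1) by (intro cINF_lower[OF _ that] bdd_belowI[of _ 0]) (auto intro: less_imp_le)
  have "bounded (K' ` {0..1})" by (rule compact_imp_bounded[OF compact_continuous_image[OF A2b(2)]]) simp
  then obtain B where B: "0 < B" "\<forall>y\<in>K' ` {0..1}. norm y \<le> B" unfolding bounded_pos by blast
  then have Kp: "\<bar>K' u\<bar> \<le> B" if "u \<in> {0..1}" for u using that by auto
  define \<epsilon> where "\<epsilon> = m / (2 * B)"
  have \<epsilon>: "0 < \<epsilon>" using m B by (simp add: \<epsilon>_def)
  have "\<forall>\<^sub>F \<eta> in at_right 0. (SUP x\<in>S. SUP u\<in>{0..1}. ennreal \<bar>F x (\<eta> * u) / F x \<eta> - \<tau> x u\<bar>) < ennreal \<epsilon>"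
    using order_tendstoD(2)[OF A3c, of "ennreal \<epsilon>"] \<epsilon> by simp
  then obtain b where b: "0 < b" and sup: "\<And>\<eta>. 0 < \<eta> \<Longrightarrow> \<eta> < b \<Longrightarrow>
      (SUP x\<in>S. SUP u\<in>{0..1}. ennreal \<bar>F x (\<eta> * u) / F x \<eta> - \<tau> x u\<bar>) < ennreal \<epsilon>"
    unfolding eventually_at_right_field by auto
  have close: "\<bar>F x (\<eta> * u) / F x \<eta> - \<tau> x u\<bar> \<le> \<epsilon>" if "0 < \<eta>" "\<eta> < b" "x \<in> S" "u \<in> {0..1}" for \<eta> x u
  proof -
    have "ennreal \<bar>F x (\<eta> * u) / F x \<eta> - \<tau> x u\<bar> \<le>
        (SUP x\<in>S. SUP u\<in>{0..1}. ennreal \<bar>F x (\<eta> * u) / F x \<eta> - \<tau> x u\<bar>)"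
      using that by (intro SUP_upper2[of x] SUP_upper) auto
    also have "\<dots> < ennreal \<epsilon>" using sup that by blast
    finally show ?thesis using \<epsilon> by (simp add: ennreal_less_iff)
  qed
  have g_lip: "\<bar>F x (\<eta> * u) / F x \<eta> - F x (\<eta> * u') / F x \<eta>\<bar> \<le> \<bar>L x\<bar> * \<bar>u - u'\<bar>"
    if "0 < \<eta>" "\<eta> \<le> \<delta>" "x \<in> S" "u \<in> {0..1}" "u' \<in> {0..1}" for x \<eta> u u'
  proof -
    have "\<bar>F x (\<eta> * u) / F x \<eta> - F x (\<eta> * u') / F x \<eta>\<bar> \<le> L x * (\<rho> x x + \<bar>u - u'\<bar>)"
      using A5 that by blast
    also have "\<dots> \<le> \<bar>L x\<bar> * \<bar>u - u'\<bar>" using that(3) by (simp add: \<rho>_self mult_right_mono)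
    finally show ?thesis .
  qed
  have lip_cont: "continuous_on {0..1} f" if "\<And>u u'. u \<in> {0..1} \<Longrightarrow> u' \<in> {0..1} \<Longrightarrow> \<bar>f u - f u'\<bar> \<le> C * \<bar>u - u'\<bar>" "0 \<le> C"
    for f :: "real \<Rightarrow> real" and C
  proof -
    have "C-lipschitz_on {0..1} f"
      by (rule lipschitz_onI) (use that in \<open>auto simp: dist_real_def\<close>)
    then show ?thesis by (rule lipschitz_on_continuous_on)
  qed
  \<comment> \<open>The ratios share a Lipschitz constant in \<open>u\<close> for all small
    bandwidths, and their pointwise limit inherits it. The integrals against \<open>\<tau> x\<close>
    rely on this continuity.\<close>
  have \<tau>_cont: "continuous_on {0..1} (\<tau> x)" if x: "x \<in> S" for x
  proof (rule lip_cont)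
    fix u u' :: real assume u: "u \<in> {0..1}" "u' \<in> {0..1}"
    have "((\<lambda>\<eta>. \<bar>F x (\<eta> * u) / F x \<eta> - F x (\<eta> * u') / F x \<eta>\<bar>) \<longlongrightarrow> \<bar>\<tau> x u - \<tau> x u'\<bar>) (at_right 0)"
      using A3b x u by (intro tendsto_intros) auto
    moreover have "\<forall>\<^sub>F \<eta> in at_right 0. \<bar>F x (\<eta> * u) / F x \<eta> - F x (\<eta> * u') / F x \<eta>\<bar> \<le> \<bar>L x\<bar> * \<bar>u - u'\<bar>"
      unfolding eventually_at_right_field using g_lip x u \<delta> by (intro exI[of _ \<delta>]) auto
    ultimately show "\<bar>\<tau> x u - \<tau> x u'\<bar> \<le> \<bar>L x\<bar> * \<bar>u - u'\<bar>"
      by (rule tendsto_upperbound) simp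
  qed simp
  define \<delta>' where "\<delta>' = min \<delta> (b / 2)"
  have \<delta>': "0 < \<delta>'" using \<delta> b by (simp add: \<delta>'_def)
  have "m / 2 * F x h \<le> expectation (\<lambda>\<omega>. K (\<rho> (X 0 \<omega>) x / h))" if x: "x \<in> S" and h: "0 < h" "h \<le> \<delta>'" for x h
  proof -
    have hb: "h < b" "h \<le> \<delta>" using h b by (auto simp: \<delta>'_def)
    define g where "g u = F x (h * u) / F x h" for u
    have Fp: "0 < F x h" using A3a x h by blast
    have g_cont: "continuous_on {0..1} g"
      unfolding g_def using g_lip[OF h(1) hb(2) x] by (intro lip_cont) auto
    have gF: "F x (h * u) = g u * F x h" for u using Fp by (simp add: g_def)
    have F_cont: "continuous_on {0..1} (\<lambda>u. F x (h * u))"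
      unfolding gF by (intro continuous_intros g_cont)
    have "expectation (\<lambda>\<omega>. K (\<rho> (X 0 \<omega>) x / h)) = K 1 * F x h - integral {0..1} (\<lambda>u. K' u * F x (h * u))"
      unfolding small_ball_def
      by (rule kernel_moment) (use A2a A2b x h F_cont in \<open>auto simp: \<rho>X_nonneg small_ball_def intro: \<rho>X_measurable\<close>)
    also have "integral {0..1} (\<lambda>u. K' u * F x (h * u)) = integral {0..1} (\<lambda>u. (K' u * g u) * F x h)"
      unfolding gF by (simp add: mult.assoc)
    also have "\<dots> = integral {0..1} (\<lambda>u. K' u * g u) * F x h" by simp
    finally have E: "expectation (\<lambda>\<omega>. K (\<rho> (X 0 \<omega>) x / h)) = (K 1 - integral {0..1} (\<lambda>u. K' u * g u)) * F x h"
      by (simp add: left_diff_distrib)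
    have "norm (integral {0..1} (\<lambda>u. K' u * (g u - \<tau> x u))) \<le> (B * \<epsilon>) * (1 - 0)"
    proof (rule integral_bound)
      show "continuous_on {0..1} (\<lambda>u. K' u * (g u - \<tau> x u))"
        by (intro continuous_intros A2b g_cont \<tau>_cont x)
      show "norm (K' u * (g u - \<tau> x u)) \<le> B * \<epsilon>" if "u \<in> {0..1}" for u
        using Kp[OF that] close[OF h(1) hb(1) x that] B by (auto simp: abs_mult g_def intro!: mult_mono)
    qed simp
    also have "integral {0..1} (\<lambda>u. K' u * (g u - \<tau> x u)) =
        integral {0..1} (\<lambda>u. K' u * g u) - integral {0..1} (\<lambda>u. K' u * \<tau> x u)"
      unfolding right_diff_distrib
      by (intro Henstock_Kurzweil_Integration.integral_diff integrable_continuous_interval continuous_intros A2b g_cont \<tau>_cont x)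
    also have "(B * \<epsilon>) * (1 - 0) = m / 2" using B(1) by (simp add: \<epsilon>_def)
    finally have "\<bar>integral {0..1} (\<lambda>u. K' u * g u) - integral {0..1} (\<lambda>u. K' u * \<tau> x u)\<bar> \<le> m / 2"
      by simp
    then have "integral {0..1} (\<lambda>u. K' u * g u) \<le> integral {0..1} (\<lambda>u. K' u * \<tau> x u) + m / 2"
      by linarith
    then have "m / 2 \<le> K 1 - integral {0..1} (\<lambda>u. K' u * g u)" using m_le[OF x] by linarith
    then show ?thesis unfolding E using Fp by (intro mult_right_mono) auto
  qed
  then show ?thesis using m \<delta>' by (intro exI[of _ "m / 2"] conjI exI[of _ \<delta>']) auto
qed

text \<open>Conditioning on \<open>X 0\<close> removes the noise; conditioning on the distance to
  \<open>x\<close> replaces the j-th coordinate of the increment by \<open>\<theta> x j\<close>,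
  which vanishes at 0 and has slope at most |\<open>\<theta>' x j 0\<close>| +
  \<open>Lx x j\<close>. So each coordinate is of order h F x h, with factors whose squares are
  summable uniformly in \<open>x\<close>.\<close>

lemma kernel_bias:
  fixes K :: "real \<Rightarrow> real" and \<Psi> :: "'h \<Rightarrow> 'h" and Y \<epsilon> :: "'w \<Rightarrow> 'h"
    and \<theta> \<theta>' :: "'h \<Rightarrow> nat \<Rightarrow> real \<Rightarrow> real" and Lx :: "'h \<Rightarrow> nat \<Rightarrow> real"
  assumes e: "orthonormal_basis e" and Yi: "integrable M Y"
    and K1: "\<forall>u>1. K u = 0" and Kb: "\<And>u. 0 \<le> u \<Longrightarrow> \<bar>K u\<bar> \<le> Kb" "0 < Kb"
    and Km: "(\<lambda>u. if 0 \<le> u then K u else 0) \<in> borel_measurable borel"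
    and model: "\<And>\<omega>. \<omega> \<in> space M \<Longrightarrow> Y \<omega> = \<Psi> (X 0 \<omega>) + \<epsilon> \<omega>"
    and noise: "is_cond_exp M (sigma_rv M (X 0)) \<epsilon> (\<lambda>\<omega>. 0)"
    and \<theta>: "\<And>x j. x \<in> S \<Longrightarrow> is_cond_exp_at M
          (\<lambda>\<omega>. \<Psi> (X 0 \<omega>) \<bullet> e j - \<Psi> x \<bullet> e j) (\<lambda>\<omega>. \<rho> (X 0 \<omega>) x) (\<theta> x j)"
    and r: "0 < r" and \<delta>: "0 < \<delta>"
    and A1b: "\<forall>x\<in>S. \<forall>j. \<theta> x j 0 = 0 \<and> 0 < Lx x j \<and>
           (\<forall>u\<in>{0..\<delta>}. (\<theta> x j has_real_derivative \<theta>' x j u) (at u within {0..}) \<and>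
              \<bar>\<theta>' x j u - \<theta>' x j 0\<bar> \<le> Lx x j * u powr r)"
      "(SUP x\<in>S. \<Sum>j. ennreal ((\<theta>' x j 0)\<^sup>2)) < \<infinity>" "(SUP x\<in>S. \<Sum>j. ennreal ((Lx x j)\<^sup>2)) < \<infinity>"
  shows "\<exists>C>0. \<exists>\<delta>'>0. \<forall>x\<in>S. \<forall>h. 0 < h \<and> h \<le> \<delta>' \<longrightarrow>
    norm (expectation (\<lambda>\<omega>. K (\<rho> (X 0 \<omega>) x / h) *\<^sub>R Y \<omega>) - expectation (\<lambda>\<omega>. K (\<rho> (X 0 \<omega>) x / h)) *\<^sub>R \<Psi> x)
      \<le> C * F x h * h"
proof -
  have fin: "\<exists>C\<ge>0. \<forall>x\<in>S. \<forall>J. (\<Sum>j<J. (f x j)\<^sup>2) \<le> C"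
    if sup: "(SUP x\<in>S. \<Sum>j. ennreal ((f x j)\<^sup>2)) < \<infinity>" for f :: "'h \<Rightarrow> nat \<Rightarrow> real"
  proof -
    obtain C where C: "0 \<le> C" "(SUP x\<in>S. \<Sum>j. ennreal ((f x j)\<^sup>2)) = ennreal C"
      using ennreal_finite_eq[OF sup] by (elim exE conjE)
    have "(\<Sum>j<J. (f x j)\<^sup>2) \<le> C" if "x \<in> S" for x J
    proof -
      have "ennreal (\<Sum>j<J. (f x j)\<^sup>2) = (\<Sum>j<J. ennreal ((f x j)\<^sup>2))" by (rule sum_ennreal[symmetric]) simp
      also have "\<dots> \<le> (\<Sum>j. ennreal ((f x j)\<^sup>2))" by (rule sum_le_suminf) auto
      also have "\<dots> \<le> (SUP x\<in>S. \<Sum>j. ennreal ((f x j)\<^sup>2))" by (rule SUP_upper[OF that])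
      finally show ?thesis using C by simp
    qed
    then show ?thesis using C(1) by blast
  qed
  obtain C1 where C1: "0 \<le> C1" "\<And>x J. x \<in> S \<Longrightarrow> (\<Sum>j<J. (\<theta>' x j 0)\<^sup>2) \<le> C1" using fin[OF A1b(2)] by blast
  obtain C2 where C2: "0 \<le> C2" "\<And>x J. x \<in> S \<Longrightarrow> (\<Sum>j<J. (Lx x j)\<^sup>2) \<le> C2" using fin[OF A1b(3)] by blast
  define C where "C = Kb * sqrt (2 * C1 + 2 * C2 + 1)"
  \<comment> \<open>Radii at most 1 make \<open>u powr r\<close> at most 1, so the Hoelder bound on
    the derivative becomes a constant.\<close>
  define \<delta>' where "\<delta>' = min \<delta> 1"
  have \<delta>': "0 < \<delta>'" using \<delta> by (simp add: \<delta>'_def)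
  have C: "0 < C" using Kb C1(1) C2(1) by (simp add: C_def)
  have "norm (expectation (\<lambda>\<omega>. K (\<rho> (X 0 \<omega>) x / h) *\<^sub>R Y \<omega>) - expectation (\<lambda>\<omega>. K (\<rho> (X 0 \<omega>) x / h)) *\<^sub>R \<Psi> x)
      \<le> C * F x h * h" if x: "x \<in> S" and h: "0 < h" "h \<le> \<delta>'" for x h
  proof -
    define V where "V \<omega> = \<rho> (X 0 \<omega>) x" for \<omega>
    have V [measurable]: "V \<in> borel_measurable M" unfolding V_def by (rule \<rho>X_measurable[OF x])
    have V0: "0 \<le> V \<omega>" if "\<omega> \<in> space M" for \<omega> unfolding V_def by (rule \<rho>X_nonneg[OF x that])
    \<comment> \<open>\<open>K\<close> is controlled only at nonnegative arguments, while a factor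
      taken out of a conditional expectation has to be bounded and Borel on the whole line.\<close>
    define \<phi> where "\<phi> v = (if 0 \<le> v / h then K (v / h) else 0)" for v
    have \<phi> [measurable]: "\<phi> \<in> borel_measurable borel"
      unfolding \<phi>_def using measurable_compose[OF _ Km, of "\<lambda>v. v / h" borel] by simp
    have \<phi>b: "\<bar>\<phi> v\<bar> \<le> Kb" for v using Kb by (simp add: \<phi>_def)
    define k where "k \<omega> = \<phi> (V \<omega>)" for \<omega>
    have k [measurable]: "k \<in> borel_measurable M" unfolding k_def by measurable
    have kb: "\<bar>k \<omega>\<bar> \<le> Kb" for \<omega> unfolding k_def by (rule \<phi>b)
    have kK: "k \<omega> = K (\<rho> (X 0 \<omega>) x / h)" if "\<omega> \<in> space M" for \<omega>
      using V0[OF that] h by (simp add: k_def \<phi>_def V_def)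
    have k\<phi>': "k \<omega> = \<phi> (\<rho>_ext x (X 0 \<omega>))" if "\<omega> \<in> space M" for \<omega>
      by (simp add: k_def V_def \<rho>_ext_X[OF x that])
    have ki: "integrable M k" by (rule integrable_bdd[OF k kb])
    have kYi: "integrable M (\<lambda>\<omega>. k \<omega> *\<^sub>R Y \<omega>)" by (rule integrable_mult_bounded[OF Yi k kb])
    define w where "w = expectation (\<lambda>\<omega>. k \<omega> *\<^sub>R Y \<omega>) - expectation k *\<^sub>R \<Psi> x"
    have wj: "\<bar>w \<bullet> e j\<bar> \<le> (\<bar>\<theta>' x j 0\<bar> + Lx x j) * (Kb * h * F x h)" for j
    proof -
      have ce: "is_cond_exp M (sigma_rv M V) (\<lambda>\<omega>. \<Psi> (X 0 \<omega>) \<bullet> e j - \<Psi> x \<bullet> e j) (\<lambda>\<omega>. \<theta> x j (V \<omega>))"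
        using \<theta>[OF x, of j] by (simp add: is_cond_exp_at_def V_def[abs_def])
      have \<Psi>i: "integrable M (\<lambda>\<omega>. \<Psi> (X 0 \<omega>) \<bullet> e j - \<Psi> x \<bullet> e j)" and \<theta>i: "integrable M (\<lambda>\<omega>. \<theta> x j (V \<omega>))"
        using ce by (auto simp: is_cond_exp_def)
      have \<epsilon>i: "integrable M \<epsilon>" using noise by (simp add: is_cond_exp_def)
      \<comment> \<open>Through \<open>\<rho>_ext x\<close> the weight is a Borel function of
        \<open>X 0\<close>, so it can be taken out of the expectation given
        \<open>X 0\<close>.\<close>
      have "expectation (\<lambda>\<omega>. \<phi> (\<rho>_ext x (X 0 \<omega>)) * (\<epsilon> \<omega> \<bullet> e j)) = expectation (\<lambda>\<omega>. \<phi> (\<rho>_ext x (X 0 \<omega>)) * 0)"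
      proof (rule is_cond_exp_mult[OF X, where \<phi> = "\<lambda>y. \<phi> (\<rho>_ext x y)"])
        show "is_cond_exp M (sigma_rv M (X 0)) (\<lambda>\<omega>. \<epsilon> \<omega> \<bullet> e j) (\<lambda>\<omega>. 0)"
          by (rule is_cond_exp_inner[OF noise subalgebra_sigma_rv[OF X]])
        show "(\<lambda>y. \<phi> (\<rho>_ext x y)) \<in> borel_measurable borel"
          by (rule measurable_compose[OF \<rho>_ext_measurable[OF x] \<phi>])
      qed (rule \<phi>b)
      then have E\<epsilon>: "expectation (\<lambda>\<omega>. k \<omega> * (\<epsilon> \<omega> \<bullet> e j)) = 0"
        using k\<phi>' by (simp cong: Bochner_Integration.integral_cong)
      have E\<theta>: "expectation (\<lambda>\<omega>. k \<omega> * (\<Psi> (X 0 \<omega>) \<bullet> e j - \<Psi> x \<bullet> e j)) = expectation (\<lambda>\<omega>. k \<omega> * \<theta> x j (V \<omega>))"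
        unfolding k_def by (rule is_cond_exp_mult[OF V ce \<phi> \<phi>b])
      have i1: "integrable M (\<lambda>\<omega>. k \<omega> * (\<Psi> (X 0 \<omega>) \<bullet> e j - \<Psi> x \<bullet> e j))"
        using integrable_mult_bounded[OF \<Psi>i k kb] by simp
      have i2: "integrable M (\<lambda>\<omega>. k \<omega> * (\<epsilon> \<omega> \<bullet> e j))"
        using integrable_mult_bounded[OF integrable_inner_left[of "e j" M \<epsilon>] k kb] \<epsilon>i by simp
      have "w \<bullet> e j = expectation (\<lambda>\<omega>. (k \<omega> *\<^sub>R Y \<omega>) \<bullet> e j) - expectation k * (\<Psi> x \<bullet> e j)"
        unfolding w_def inner_diff_left inner_scaleR_left using integral_inner_left[OF kYi, of "e j"] by simp
      also have "\<dots> = expectation (\<lambda>\<omega>. (k \<omega> *\<^sub>R Y \<omega>) \<bullet> e j - k \<omega> * (\<Psi> x \<bullet> e j))"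
        using integrable_inner_left[of "e j" M "\<lambda>\<omega>. k \<omega> *\<^sub>R Y \<omega>"] kYi ki
        by (subst Bochner_Integration.integral_diff) auto
      also have "\<dots> = expectation (\<lambda>\<omega>. k \<omega> * (\<Psi> (X 0 \<omega>) \<bullet> e j - \<Psi> x \<bullet> e j) + k \<omega> * (\<epsilon> \<omega> \<bullet> e j))"
        by (rule Bochner_Integration.integral_cong) (auto simp: model inner_add_left algebra_simps)
      also have "\<dots> = expectation (\<lambda>\<omega>. k \<omega> * \<theta> x j (V \<omega>))"
        using i1 i2 E\<epsilon> E\<theta> by simp
      finally have "\<bar>w \<bullet> e j\<bar> \<le> expectation (\<lambda>\<omega>. \<bar>k \<omega> * \<theta> x j (V \<omega>)\<bar>)"
        by (simp only:) (rule integral_abs_bound)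
      also have "\<dots> \<le> expectation (\<lambda>\<omega>. (\<bar>\<theta>' x j 0\<bar> + Lx x j) * (Kb * h) * indicator {\<omega> \<in> space M. V \<omega> \<le> h} \<omega>)"
      proof (rule integral_mono)
        show "integrable M (\<lambda>\<omega>. \<bar>k \<omega> * \<theta> x j (V \<omega>)\<bar>)"
          using integrable_abs[OF integrable_mult_bounded[OF \<theta>i k kb]] by simp
        show "integrable M (\<lambda>\<omega>. (\<bar>\<theta>' x j 0\<bar> + Lx x j) * (Kb * h) * indicator {\<omega> \<in> space M. V \<omega> \<le> h} \<omega>)"
          by (intro integrable_mult_right integrable_real_indicator) (auto simp: less_top[symmetric])
        fix \<omega> assume \<omega>: "\<omega> \<in> space M"
        show "\<bar>k \<omega> * \<theta> x j (V \<omega>)\<bar> \<le> (\<bar>\<theta>' x j 0\<bar> + Lx x j) * (Kb * h) * indicator {\<omega> \<in> space M. V \<omega> \<le> h} \<omega>"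
        proof (cases "V \<omega> \<le> h")
          case True
          have v: "0 \<le> V \<omega>" "V \<omega> \<le> \<delta>" "V \<omega> \<le> 1" using V0[OF \<omega>] True h by (auto simp: \<delta>'_def)
          have Lp: "0 < Lx x j" using A1b(1) x by blast
          have "norm (\<theta> x j (V \<omega>) - \<theta> x j 0) \<le> (\<bar>\<theta>' x j 0\<bar> + Lx x j) * norm (V \<omega> - 0)"
          proof (rule field_differentiable_bound[of "{0..V \<omega>}" "\<theta> x j" "\<theta>' x j"])
            fix u assume u: "u \<in> {0..V \<omega>}"
            then have u': "u \<in> {0..\<delta>}" "0 \<le> u" "u \<le> 1" using v by auto
            have d: "(\<theta> x j has_real_derivative \<theta>' x j u) (at u within {0..})"
              and b: "\<bar>\<theta>' x j u - \<theta>' x j 0\<bar> \<le> Lx x j * u powr r" using A1b(1) x u' by blast+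
            show "(\<theta> x j has_field_derivative \<theta>' x j u) (at u within {0..V \<omega>})"
              by (rule has_field_derivative_subset[OF d]) auto
            have "u powr r \<le> 1" using u' r powr_mono2[of r u 1] by simp
            then have "Lx x j * u powr r \<le> Lx x j" using Lp by (simp add: mult_left_le)
            then show "norm (\<theta>' x j u) \<le> \<bar>\<theta>' x j 0\<bar> + Lx x j" using b unfolding real_norm_def by linarith
          qed (use v in auto)
          then have "\<bar>\<theta> x j (V \<omega>)\<bar> \<le> (\<bar>\<theta>' x j 0\<bar> + Lx x j) * V \<omega>" using A1b(1) x v by simp
          also have "\<dots> \<le> (\<bar>\<theta>' x j 0\<bar> + Lx x j) * h" using True Lp by (intro mult_left_mono) auto
          finally have "\<bar>k \<omega> * \<theta> x j (V \<omega>)\<bar> \<le> Kb * ((\<bar>\<theta>' x j 0\<bar> + Lx x j) * h)"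
            unfolding abs_mult using kb[of \<omega>] Kb(2) by (intro mult_mono) auto
          then show ?thesis using True \<omega> by (simp add: mult_ac)
        next
          case False
          then have "k \<omega> = 0" using kK[OF \<omega>] K1 h by (simp add: V_def)
          then show ?thesis using False by simp
        qed
      qed
      also have "\<dots> = (\<bar>\<theta>' x j 0\<bar> + Lx x j) * (Kb * h * F x h)"
        using sets.Int_space_eq2[OF F_event[OF x, of 0 h]] by (simp add: small_ball_def V_def less_top[symmetric])
      finally show ?thesis .
    qed
    have "(\<Sum>j<J. (w \<bullet> e j)\<^sup>2) \<le> (C * F x h * h)\<^sup>2" for J
    proof -
      have "(\<Sum>j<J. (w \<bullet> e j)\<^sup>2) \<le> (\<Sum>j<J. (2 * (\<theta>' x j 0)\<^sup>2 + 2 * (Lx x j)\<^sup>2) * (Kb * h * F x h)\<^sup>2)"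
      proof (rule sum_mono)
        fix j
        have "(w \<bullet> e j)\<^sup>2 \<le> ((\<bar>\<theta>' x j 0\<bar> + Lx x j) * (Kb * h * F x h))\<^sup>2"
          using power_mono[OF wj abs_ge_zero, of j 2] by simp
        also have "\<dots> = (\<bar>\<theta>' x j 0\<bar> + Lx x j)\<^sup>2 * (Kb * h * F x h)\<^sup>2" by (rule power_mult_distrib)
        also have "\<dots> \<le> (2 * (\<theta>' x j 0)\<^sup>2 + 2 * (Lx x j)\<^sup>2) * (Kb * h * F x h)\<^sup>2"
        proof (rule mult_right_mono)
          show "(\<bar>\<theta>' x j 0\<bar> + Lx x j)\<^sup>2 \<le> 2 * (\<theta>' x j 0)\<^sup>2 + 2 * (Lx x j)\<^sup>2"
            using sum_squares_bound[of "\<bar>\<theta>' x j 0\<bar>" "Lx x j"] by (simp add: power2_sum)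
        qed simp
        finally show "(w \<bullet> e j)\<^sup>2 \<le> (2 * (\<theta>' x j 0)\<^sup>2 + 2 * (Lx x j)\<^sup>2) * (Kb * h * F x h)\<^sup>2" .
      qed
      also have "\<dots> = (2 * (\<Sum>j<J. (\<theta>' x j 0)\<^sup>2) + 2 * (\<Sum>j<J. (Lx x j)\<^sup>2)) * (Kb * h * F x h)\<^sup>2"
        by (simp add: sum_distrib_right[symmetric] sum.distrib sum_distrib_left)
      also have "\<dots> \<le> (2 * C1 + 2 * C2 + 1) * (Kb * h * F x h)\<^sup>2"
        using C1(2)[OF x, of J] C2(2)[OF x, of J] by (intro mult_right_mono) auto
      also have "\<dots> = (C * F x h * h)\<^sup>2"
        using C1(1) C2(1) by (simp add: C_def power_mult_distrib mult_ac)
      finally show ?thesis .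
    qed
    then have "(norm w)\<^sup>2 \<le> (C * F x h * h)\<^sup>2"
      using parseval[OF e, of w] unfolding sums_def by (intro LIMSEQ_le_const2) auto
    then have "norm w \<le> C * F x h * h"
      by (rule power2_le_imp_le) (use C h F_bounds(1)[of x h] in auto)
    moreover have "expectation (\<lambda>\<omega>. K (\<rho> (X 0 \<omega>) x / h) *\<^sub>R Y \<omega>) = expectation (\<lambda>\<omega>. k \<omega> *\<^sub>R Y \<omega>)"
      "expectation (\<lambda>\<omega>. K (\<rho> (X 0 \<omega>) x / h)) = expectation k"
      by (rule Bochner_Integration.integral_cong; simp add: kK)+
    ultimately show ?thesis by (simp add: w_def)
  qed
  then show ?thesis using C \<delta>' by (intro exI[of _ C] conjI exI[of _ \<delta>']) auto
qed

text \<open>The growth condition at distance 0 and the bounded derivative control the conditional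
  mean of the norm on the whole ball. For \<open>B\<close> at least 1 the derivative term is
  absorbed into \<open>B powr r\<close>; the threshold \<open>B0\<close> reflects that the growth
  condition is asymptotic in the radius.\<close>

lemma response_near:
  fixes Y :: "'w \<Rightarrow> 'h" and \<theta>t \<theta>t' :: "'h \<Rightarrow> real \<Rightarrow> real"
  assumes \<theta>t: "\<And>x. x \<in> S \<Longrightarrow> is_cond_exp_at M (\<lambda>\<omega>. norm (Y \<omega>)) (\<lambda>\<omega>. \<rho> (X 0 \<omega>) x) (\<theta>t x)"
    and r: "0 < r" and \<delta>: "0 < \<delta>"
    and A7a: "\<forall>\<^sub>F B in at_top.
        (SUP x\<in>{x \<in> S. ess_norm \<nu> cls x \<le> ereal B}. ereal (\<theta>t x 0)) \<le> ereal (C * B powr r)"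
    and A7b: "\<forall>x\<in>S. \<forall>u\<in>{0..\<delta>}. (\<theta>t x has_real_derivative \<theta>t' x u) (at u within {0..})"
        "(SUP x\<in>S. SUP u\<in>{0..\<delta>}. ennreal \<bar>\<theta>t' x u\<bar>) < \<infinity>"
  shows "\<exists>B0\<ge>1. \<exists>C'>0. \<exists>\<delta>'>0. \<forall>x\<in>S. \<forall>B\<ge>B0. \<forall>h. ess_norm \<nu> cls x \<le> ereal B \<and> 0 < h \<and> h \<le> \<delta>' \<longrightarrow>
    expectation (\<lambda>\<omega>. indicator {0..h} (\<rho> (X 0 \<omega>) x) * norm (Y \<omega>)) \<le> C' * B powr r * F x h"
proof -
  obtain B1 where B1: "\<And>B. B \<ge> B1 \<Longrightarrow> (SUP x\<in>{x \<in> S. ess_norm \<nu> cls x \<le> ereal B}. ereal (\<theta>t x 0)) \<le> ereal (C * B powr r)"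
    using A7a unfolding eventually_at_top_linorder by auto
  define B0 where "B0 = max B1 1"
  obtain D1 where D1: "0 \<le> D1" "(SUP x\<in>S. SUP u\<in>{0..\<delta>}. ennreal \<bar>\<theta>t' x u\<bar>) = ennreal D1"
    using ennreal_finite_eq[OF A7b(2)] by (elim exE conjE)
  have D1': "\<bar>\<theta>t' x u\<bar> \<le> D1" if "x \<in> S" "u \<in> {0..\<delta>}" for x u
  proof -
    have "ennreal \<bar>\<theta>t' x u\<bar> \<le> (SUP x\<in>S. SUP u\<in>{0..\<delta>}. ennreal \<bar>\<theta>t' x u\<bar>)"
      using that by (intro SUP_upper2[of x] SUP_upper) auto
    then show ?thesis using D1 by simp
  qed
  define C' where "C' = \<bar>C\<bar> + D1 + 1"
  define \<delta>' where "\<delta>' = min \<delta> 1"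
  have "expectation (\<lambda>\<omega>. indicator {0..h} (\<rho> (X 0 \<omega>) x) * norm (Y \<omega>)) \<le> C' * B powr r * F x h"
    if x: "x \<in> S" and B: "B0 \<le> B" "ess_norm \<nu> cls x \<le> ereal B" and h: "0 < h" "h \<le> \<delta>'" for x B h
  proof -
    define V where "V \<omega> = \<rho> (X 0 \<omega>) x" for \<omega>
    have V [measurable]: "V \<in> borel_measurable M" unfolding V_def by (rule \<rho>X_measurable[OF x])
    have V0: "0 \<le> V \<omega>" if "\<omega> \<in> space M" for \<omega> unfolding V_def by (rule \<rho>X_nonneg[OF x that])
    have ce: "is_cond_exp M (sigma_rv M V) (\<lambda>\<omega>. norm (Y \<omega>)) (\<lambda>\<omega>. \<theta>t x (V \<omega>))"
      using \<theta>t[OF x] by (simp add: is_cond_exp_at_def V_def[abs_def])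
    have \<theta>i: "integrable M (\<lambda>\<omega>. \<theta>t x (V \<omega>))" using ce by (simp add: is_cond_exp_def)
    have B1': "1 \<le> B powr r" using B(1) r by (intro ge_one_powr_ge_zero) (auto simp: B0_def)
    have "ereal (\<theta>t x 0) \<le> (SUP x\<in>{x \<in> S. ess_norm \<nu> cls x \<le> ereal B}. ereal (\<theta>t x 0))"
      using x B(2) by (intro SUP_upper) auto
    also have "\<dots> \<le> ereal (C * B powr r)" using B1 B(1) by (simp add: B0_def)
    finally have "\<theta>t x 0 \<le> C * B powr r" by simp
    also have "\<dots> \<le> \<bar>C\<bar> * B powr r" by (intro mult_right_mono) auto
    finally have t0: "\<theta>t x 0 \<le> \<bar>C\<bar> * B powr r" .
    have near: "\<theta>t x v \<le> C' * B powr r" if v: "0 \<le> v" "v \<le> h" for v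
    proof -
      have v1: "v \<le> \<delta>" "v \<le> 1" using v h by (auto simp: \<delta>'_def)
      have "norm (\<theta>t x v - \<theta>t x 0) \<le> D1 * norm (v - 0)"
      proof (rule field_differentiable_bound[of "{0..v}" "\<theta>t x" "\<theta>t' x"])
        fix u assume u: "u \<in> {0..v}"
        then have u': "u \<in> {0..\<delta>}" using v1 by auto
        show "(\<theta>t x has_field_derivative \<theta>t' x u) (at u within {0..v})"
          by (rule has_field_derivative_subset[of _ _ _ "{0..}"]) (use A7b(1) x u' in auto)
        show "norm (\<theta>t' x u) \<le> D1" using D1'[OF x u'] by simp
      qed (use v in auto)
      then have "\<theta>t x v \<le> \<theta>t x 0 + D1 * v" using v by (simp add: abs_le_iff)
      also have "D1 * v \<le> D1 * 1" using D1(1) v1 by (intro mult_left_mono) auto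
      also have "D1 * 1 \<le> D1 * B powr r" using D1(1) B1' by (intro mult_left_mono) auto
      also have "\<theta>t x 0 + D1 * B powr r \<le> \<bar>C\<bar> * B powr r + D1 * B powr r" using t0 by simp
      also have "\<dots> \<le> C' * B powr r" using B1' by (simp add: C'_def distrib_right)
      finally show ?thesis by simp
    qed
    have "expectation (\<lambda>\<omega>. indicator {0..h} (V \<omega>) * norm (Y \<omega>)) = expectation (\<lambda>\<omega>. indicator {0..h} (V \<omega>) * \<theta>t x (V \<omega>))"
      by (rule is_cond_exp_mult[OF V ce, where B = 1]) (auto simp: indicator_def)
    also have "\<dots> \<le> expectation (\<lambda>\<omega>. C' * B powr r * indicator {\<omega> \<in> space M. V \<omega> \<le> h} \<omega>)"
    proof (rule integral_mono)
      show "integrable M (\<lambda>\<omega>. indicator {0..h} (V \<omega>) * \<theta>t x (V \<omega>))"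
        using integrable_mult_bounded[OF \<theta>i, of "\<lambda>\<omega>. indicator {0..h} (V \<omega>)" 1] by (simp add: indicator_def)
      show "integrable M (\<lambda>\<omega>. C' * B powr r * indicator {\<omega> \<in> space M. V \<omega> \<le> h} \<omega>)"
        by (intro integrable_mult_right integrable_real_indicator) (auto simp: less_top[symmetric])
      show "indicator {0..h} (V \<omega>) * \<theta>t x (V \<omega>) \<le> C' * B powr r * indicator {\<omega> \<in> space M. V \<omega> \<le> h} \<omega>"
        if "\<omega> \<in> space M" for \<omega>
        using near[of "V \<omega>"] V0[OF that] that by (auto simp: indicator_def)
    qed
    also have "\<dots> = C' * B powr r * F x h"
      using sets.Int_space_eq2[OF F_event[OF x, of 0 h]] by (simp add: small_ball_def V_def less_top[symmetric])
    finally show ?thesis by (simp add: V_def)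
  qed
  moreover have "1 \<le> B0" "0 < C'" "0 < \<delta>'" using D1(1) \<delta> by (auto simp: B0_def C'_def \<delta>'_def)
  ultimately show ?thesis by blast
qed

end

section \<open>Uniform deviations along lattice boxes\<close>

lemma converges_to_infinity_sides:
  assumes "converges_to_infinity n"
  shows "\<forall>\<^sub>F k in sequentially. \<forall>i. 1 \<le> n k $ i"
proof (rule eventually_all_finite)
  fix i
  have "filterlim (\<lambda>k. n k $ i) at_top sequentially" using assms by (simp add: converges_to_infinity_def)
  then show "\<forall>\<^sub>F k in sequentially. 1 \<le> n k $ i" unfolding filterlim_at_top by blast
qed

lemma converges_to_infinity_card:
  fixes n :: "nat \<Rightarrow> nat ^ 'n"
  assumes n: "converges_to_infinity n"
  shows "filterlim (\<lambda>k. card (grid (n k))) at_top sequentially"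
proof -
  have "filterlim (\<lambda>k. n k $ i) at_top sequentially" for i
    using n by (simp add: converges_to_infinity_def)
  then show ?thesis
  proof (rule filterlim_at_top_mono)
    show "\<forall>\<^sub>F k in sequentially. n k $ undefined \<le> card (grid (n k))"
      using converges_to_infinity_sides[OF n]
    proof eventually_elim
      case (elim k)
      then show ?case
        unfolding card_grid by (intro dvd_imp_le dvd_prodI prod_pos) (auto simp: Suc_le_eq)
    qed
  qed
qed

text \<open>A side is at least the smallest one, which is at least \<open>c\<close> times the
  largest, and the largest is at least the N-th root of the volume.\<close>

lemma converges_to_infinity_side_ge:
  fixes n :: "nat \<Rightarrow> nat ^ 'n"
  assumes n: "converges_to_infinity n"
  shows "\<exists>c>0. \<forall>\<^sub>F k in sequentially. c * real (card (grid (n k))) powr (1 / real CARD('n)) \<le> real (n k $ i)"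
proof -
  let ?f = "\<lambda>k. real (Min (range (\<lambda>i. n k $ i))) / real (Max (range (\<lambda>i. n k $ i)))"
  have "0 < liminf (\<lambda>k. ereal (?f k))" using n by (simp add: converges_to_infinity_def)
  then obtain c where c: "0 < ereal c" "ereal c < liminf (\<lambda>k. ereal (?f k))" using ereal_dense2 by blast
  have c0: "0 < c" using c(1) by simp
  have "\<forall>\<^sub>F k in sequentially. ereal c < ereal (?f k)" by (rule less_LiminfD[OF c(2)])
  then have "\<forall>\<^sub>F k in sequentially. c * real (card (grid (n k))) powr (1 / real CARD('n)) \<le> real (n k $ i)"
    using converges_to_infinity_sides[OF n]
  proof eventually_elim
    case (elim k)
    define Mx where "Mx = Max (range (\<lambda>i. n k $ i))"
    define Mn where "Mn = Min (range (\<lambda>i. n k $ i))"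
    have le: "n k $ j \<le> Mx" "Mn \<le> n k $ j" for j by (auto simp: Mx_def Mn_def)
    have Mx: "1 \<le> Mx" using elim(2) le(1)[of i] by (meson order_trans)
    have "card (grid (n k)) \<le> (\<Prod>j\<in>(UNIV :: 'n set). Mx)"
      unfolding card_grid by (intro prod_mono) (auto simp: le)
    then have "real (card (grid (n k))) \<le> real Mx ^ CARD('n)" by (simp flip: of_nat_power)
    then have "real (card (grid (n k))) powr (1 / real CARD('n)) \<le> (real Mx ^ CARD('n)) powr (1 / real CARD('n))"
      by (intro powr_mono2) auto
    also have "\<dots> = real Mx" using Mx by (simp add: powr_realpow[symmetric] powr_powr)
    finally have "c * real (card (grid (n k))) powr (1 / real CARD('n)) \<le> c * real Mx"
      using c0 by (intro mult_left_mono) auto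
    also have "\<dots> \<le> real Mn" using elim(1) Mx by (simp add: Mx_def[symmetric] Mn_def[symmetric] field_simps)
    also have "\<dots> \<le> real (n k $ i)" using le(2) by simp
    finally show ?case .
  qed
  then show ?thesis using c0 by blast
qed

text \<open>The sequence may repeat values or grow slowly, so the union over all boxes of equal size is
  used in place of the index \<open>k\<close>.\<close>

lemma (in prob_space) lattice_borel_cantelli:
  fixes n :: "nat \<Rightarrow> nat ^ 'n" and E :: "nat ^ 'n \<Rightarrow> 'a set"
  assumes n: "converges_to_infinity n" and E: "\<And>m. E m \<in> sets M" and C: "0 \<le> C"
    and bound: "\<forall>\<^sub>F k in sequentially. prob (E (n k)) \<le> C / real (card (grid (n k))) ^ (CARD('n) + 2)"
  shows "AE \<omega> in M. \<forall>\<^sub>F k in sequentially. \<omega> \<notin> E (n k)"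
proof -
  have "\<forall>\<^sub>F k in sequentially. (\<forall>i. 1 \<le> n k $ i) \<and> prob (E (n k)) \<le> C / real (card (grid (n k))) ^ (CARD('n) + 2)"
    using converges_to_infinity_sides[OF n] bound by (rule eventually_conj)
  then obtain k0 where k0: "\<And>k i. k0 \<le> k \<Longrightarrow> 1 \<le> n k $ i"
    "\<And>k. k0 \<le> k \<Longrightarrow> prob (E (n k)) \<le> C / real (card (grid (n k))) ^ (CARD('n) + 2)"
    unfolding eventually_sequentially by blast
  \<comment> \<open>Sides are at least 1, so a box of volume t has all sides at most t, and there
    are at most t^N such boxes. The exponent N + 2 then leaves the summable t^(-2).\<close>
  define B where "B t = {m \<in> n ` {k0..}. card (grid m) = t}" for t
  have B_sub: "B t \<subseteq> {m. \<forall>i. m $ i \<in> {1..t}}" for t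
  proof
    fix m assume "m \<in> B t"
    then obtain k where k: "k0 \<le> k" "m = n k" and t: "(\<Prod>i\<in>UNIV. m $ i) = t" by (auto simp: B_def card_grid)
    have m1: "1 \<le> m $ i" for i using k0(1) k by simp
    have "m $ i \<le> t" for i
      unfolding t[symmetric] using m1 by (intro dvd_imp_le dvd_prodI prod_pos) (auto simp: Suc_le_eq)
    with m1 show "m \<in> {m. \<forall>i. m $ i \<in> {1..t}}" by simp
  qed
  have finB: "finite (B t)" for t by (rule finite_subset[OF B_sub finite_vec_box]) simp
  have cardB: "card (B t) \<le> t ^ CARD('n)" for t
    using card_mono[OF finite_vec_box B_sub, of t] card_vec_box[of "\<lambda>_ :: 'n. {1..t}"] by simp
  define A where "A t = (\<Union>m\<in>B t. E m)" for t
  have A [measurable]: "A t \<in> sets M" for t unfolding A_def using finB E by auto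
  have probA: "prob (A t) \<le> C * inverse (real t ^ 2)" for t
  proof (cases "t = 0")
    case True
    have "B 0 = {}" using B_sub[of 0] by auto
    then show ?thesis using True by (simp add: A_def)
  next
    case False
    have "prob (A t) \<le> (\<Sum>m\<in>B t. prob (E m))"
      unfolding A_def using finB E by (intro finite_measure_subadditive_finite) auto
    also have "\<dots> \<le> (\<Sum>m\<in>B t. C / real t ^ (CARD('n) + 2))"
      using k0(2) by (intro sum_mono) (auto simp: B_def)
    also have "\<dots> = real (card (B t)) * (C / real t ^ (CARD('n) + 2))" by simp
    also have "\<dots> \<le> real (t ^ CARD('n)) * (C / real t ^ (CARD('n) + 2))"
      using cardB[of t] C by (intro mult_right_mono of_nat_mono) auto
    also have "\<dots> = C * inverse (real t ^ 2)" using False by (simp add: power_add power2_eq_square field_simps)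
    finally show ?thesis .
  qed
  have "AE \<omega> in M. \<forall>\<^sub>F t in sequentially. \<omega> \<in> space M - A t"
  proof (rule borel_cantelli_AE1)
    show "summable (\<lambda>t. prob (A t))"
      by (rule summable_comparison_test'[where g = "\<lambda>t. C * inverse (real t ^ 2)" and N = 0])
        (use probA in \<open>auto intro!: summable_mult inverse_power_summable\<close>)
  qed (auto simp: less_top[symmetric])
  then show ?thesis
  proof eventually_elim
    case (elim \<omega>)
    have "\<forall>\<^sub>F k in sequentially. \<omega> \<in> space M - A (card (grid (n k)))"
      using converges_to_infinity_card[OF n] elim by (rule eventually_compose_filterlim[rotated])
    then show ?case
      using eventually_ge_at_top[of k0]
    proof eventually_elim
      case (elim k)
      then have "n k \<in> B (card (grid (n k)))" by (auto simp: B_def)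
      then show ?case using elim by (auto simp: A_def)
    qed
  qed
qed

text \<open>The scale of the net; the same power of the volume stands in both rates.\<close>

definition mesh :: "real \<Rightarrow> nat ^ 'n \<Rightarrow> real" where
  "mesh d m = real (card (grid m)) powr - (1 / real CARD('n) * (2 / (5 * d + 2)))"

text \<open>The numerator of the first rate divided by R^r and by two logarithms, which are held
  back for the size of \<open>\<Psi>\<close>, the truncation height and the number of
  coordinates.\<close>

definition dev_level :: "real \<Rightarrow> real \<Rightarrow> real \<Rightarrow> nat ^ 'n \<Rightarrow> real" where
  "dev_level d r R m = R powr (5 * d / 2 - r) * ln (real (card (grid m))) ^ 5 * mesh d m"

text \<open>With \<open>T = (R / \<delta>)\<^sup>d\<close> the entropy of the net is of order \<open>T L\<close>; the block length
  \<open>q\<close> of order \<open>T L\<^sup>2\<close> makes the mixing error \<open>exp (- c1 q)\<close> beat it, and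
  \<open>p \<eta> \<ge> 16 B T\<^sup>2 L\<^sup>3\<close> does the same for the exponential inequality.\<close>

lemma parameter_bounds:
  fixes I R p c R0 A P r d \<nu> c0 c1 Cd :: real
  defines "L \<equiv> ln I" and "\<delta> \<equiv> I powr - (1 / \<nu> * (2 / (5 * d + 2)))"
  defines "\<eta> \<equiv> R powr (5 * d / 2 - r) * L ^ 5 * \<delta>" and "T \<equiv> (R / \<delta>) powr d"
  defines "q \<equiv> nat \<lceil>L ^ 2 * T\<rceil>"
  assumes d: "1 \<le> d" and \<nu>: "1 \<le> \<nu>" and r: "0 < r" "r \<le> 1" and R0: "0 < R0" "R0 \<le> R" and A: "0 < A" and P: "0 \<le> P"
    and c: "0 < c" "c * I powr (1 / \<nu>) \<le> p" "p \<le> I" and c01: "0 < c0" "0 < c1" "0 < Cd"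
    and I: "6 \<le> I" and L1: "1 \<le> L" and \<delta>R0: "\<delta> \<le> R0" and R\<delta>: "R * \<delta> \<le> 1" and \<eta>2: "\<eta> \<le> 2"
    and H5: "16 * (3 * A powr d + P + 4) \<le> c * L ^ 2 * R0 powr (1 - r)"
    and H6: "3 * A powr d + P + 4 \<le> c1 * L" and H7: "ln (2880 * c0 / Cd) \<le> L"
    and H8: "Cd \<le> L ^ 7 * R0 powr (7 * d / 2 - r)"
  shows "1 \<le> q" "real q \<le> p" "0 < \<eta>" "Cd \<le> q * \<eta>" "\<delta> \<le> R"
    "exp ((A * (R / \<delta>)) powr d * ln (6 * (R / \<delta>))) * I *
      (4 * exp (- (p * \<eta> / (8 * real q))) + 1440 * c0 * p / (q * \<eta>) * exp (- c1 * q)) \<le> exp (- (P * L))"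
proof -
  \<comment> \<open>Multiples of T L that the exponent has to beat: 3 A^d for the entropy, P for the
    target exp(-P L), one for the factor \<open>I\<close> in the number of functions, and three for
    ln 8.\<close>
  define B where "B = 3 * A powr d + P + 4"
  have Ad: "0 < A powr d" using A by simp
  have B: "4 \<le> B" using Ad P by (simp add: B_def)
  have R: "0 < R" using R0 by simp
  have I0: "0 < I" using I by simp
  have \<delta>: "0 < \<delta>" using I0 by (simp add: \<delta>_def)
  have expo: "0 \<le> 1 / \<nu> * (2 / (5 * d + 2))" "1 / \<nu> * (2 / (5 * d + 2)) \<le> 1"
  proof -
    show "0 \<le> 1 / \<nu> * (2 / (5 * d + 2))" using d \<nu> by simp
    have "1 / \<nu> \<le> 1" "2 / (5 * d + 2) \<le> 1" using d \<nu> by auto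
    then show "1 / \<nu> * (2 / (5 * d + 2)) \<le> 1" using d \<nu> by (intro mult_le_one) auto
  qed
  have \<delta>1: "\<delta> \<le> 1"
    unfolding \<delta>_def using powr_mono[of "- (1 / \<nu> * (2 / (5 * d + 2)))" 0 I] I expo by simp
  have inv\<delta>: "1 / \<delta> \<le> I"
  proof -
    have "1 / \<delta> = I powr (1 / \<nu> * (2 / (5 * d + 2)))" by (simp add: \<delta>_def powr_minus_divide)
    also have "\<dots> \<le> I powr 1" using I expo by (intro powr_mono) auto
    finally show ?thesis using I0 by simp
  qed
  show \<delta>R: "\<delta> \<le> R" using \<delta>R0 R0 by simp
  define y where "y = R / \<delta>"
  have y1: "1 \<le> y" using \<delta>R \<delta> by (simp add: y_def)
  have T: "T = y powr d" by (simp add: T_def y_def)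
  have T1: "1 \<le> T" unfolding T using y1 d by (intro ge_one_powr_ge_zero) auto
  \<comment> \<open>Both R and 1/\<open>\<delta>\<close> are at most \<open>I\<close>, so 6y is at
    most \<open>I\<close>^3; its logarithm is the source of the factor 3 in the entropy.\<close>
  have yI: "6 * y \<le> I ^ 3"
  proof -
    have "R \<le> 1 / \<delta>" using R\<delta> \<delta> by (simp add: field_simps)
    then have "R \<le> I" using inv\<delta> by simp
    have "y = R * (1 / \<delta>)" by (simp add: y_def)
    also have "\<dots> \<le> I * I" using \<open>R \<le> I\<close> inv\<delta> R \<delta> by (intro mult_mono) auto
    finally have "6 * y \<le> I * (I * I)" using I I0 by (intro mult_mono) (use y1 in auto)
    then show ?thesis by (simp add: power3_eq_cube mult.assoc)
  qed
  have "ln (6 * y) \<le> ln (I ^ 3)" using yI y1 I0 by (subst ln_le_cancel_iff) auto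
  then have lny: "ln (6 * y) \<le> 3 * L" using I0 by (simp add: L_def ln_realpow)
  have ent: "(A * y) powr d * ln (6 * y) \<le> 3 * A powr d * T * L"
  proof -
    have "(A * y) powr d * ln (6 * y) \<le> (A powr d * T) * (3 * L)"
      unfolding T powr_mult using lny y1 by (intro mult_left_mono) auto
    then show ?thesis by simp
  qed
  have L2T: "1 \<le> L ^ 2 * T" using L1 T1 mult_mono[of 1 "L ^ 2" 1 T] by simp
  have q_ge: "L ^ 2 * T \<le> real q" unfolding q_def by linarith
  have q_le: "real q \<le> 2 * (L ^ 2 * T)"
  proof -
    have "real q = of_int \<lceil>L ^ 2 * T\<rceil>" unfolding q_def using L2T by (simp add: less_le_trans[of "-1" 1])
    also have "\<dots> \<le> L ^ 2 * T + 1" by (rule of_int_ceiling_le_add_one)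
    finally show ?thesis using L2T by simp
  qed
  have q0: "0 < real q" using q_ge L2T by linarith
  then show "1 \<le> q" by simp
  show \<eta>: "0 < \<eta>" unfolding \<eta>_def using R L1 \<delta> by simp
  \<comment> \<open>L^2 T \<open>\<eta>\<close> equals L^7 R^(7d/2 - r) \<open>\<delta>\<close>^(1 -
    d), and the power of \<open>\<delta>\<close> is at least 1 because \<open>\<delta>\<close> \<le>
    1 \<le> d.\<close>
  show Cq: "Cd \<le> q * \<eta>"
  proof -
    have e: "R powr (7 * d / 2 - r) * \<delta> powr (1 - d) = T * (R powr (5 * d / 2 - r) * \<delta>)"
    proof -
      have "T = R powr d * \<delta> powr (- d)"
        unfolding T_def using R \<delta> by (simp add: powr_divide powr_minus_divide)
      then have "T * (R powr (5 * d / 2 - r) * \<delta>) = (R powr d * R powr (5 * d / 2 - r)) * (\<delta> powr (- d) * \<delta> powr 1)"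
        using \<delta> by simp
      also have "\<dots> = R powr (d + (5 * d / 2 - r)) * \<delta> powr (- d + 1)" by (simp only: powr_add)
      also have "d + (5 * d / 2 - r) = 7 * d / 2 - r" by simp
      finally show ?thesis by simp
    qed
    have "R0 powr (7 * d / 2 - r) \<le> R powr (7 * d / 2 - r)" using R0 d r by (intro powr_mono2) auto
    also have "\<dots> \<le> R powr (7 * d / 2 - r) * \<delta> powr (1 - d)"
    proof -
      have "1 \<le> \<delta> powr (1 - d)" using powr_mono'[of "1 - d" 0 \<delta>] \<delta> \<delta>1 d by simp
      then show ?thesis using mult_left_mono[of 1 "\<delta> powr (1 - d)" "R powr (7 * d / 2 - r)"] by simp
    qed
    finally have "L ^ 7 * R0 powr (7 * d / 2 - r) \<le> L ^ 7 * (T * (R powr (5 * d / 2 - r) * \<delta>))"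
      unfolding e using L1 by (intro mult_left_mono) auto
    also have "\<dots> = (L ^ 2 * T) * \<eta>" unfolding \<eta>_def by (simp add: power_numeral_reduce mult_ac)
    also have "\<dots> \<le> q * \<eta>" using q_ge \<eta> by (intro mult_right_mono) auto
    finally show ?thesis using H8 by simp
  qed
  have main: "16 * B * T\<^sup>2 * L ^ 3 \<le> p * \<eta>"
  proof -
    \<comment> \<open>The definition of \<open>\<delta>\<close> inverted, so that the lower bound
      for the side becomes a power of 1/\<open>\<delta>\<close>.\<close>
    have I\<nu>: "I powr (1 / \<nu>) = \<delta> powr (- ((5 * d + 2) / 2))"
    proof -
      have "- (1 / \<nu> * (2 / k)) * - (k / 2) = 1 / \<nu>" if "0 < k" for k using that by simp
      from this[of "5 * d + 2"] have "- (1 / \<nu> * (2 / (5 * d + 2))) * - ((5 * d + 2) / 2) = 1 / \<nu>" using d by simp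
      then show ?thesis unfolding \<delta>_def powr_powr by (simp only:)
    qed
    have T2: "T\<^sup>2 = R powr (2 * d) * \<delta> powr (- (2 * d))"
      unfolding T_def power2_eq_square using R \<delta> by (simp add: powr_divide powr_minus_divide powr_add[symmetric])
    \<comment> \<open>The surplus (R/\<open>\<delta>\<close>)^(d/2) over T^2 outweighs R^(-r): since
      R \<open>\<delta>\<close> \<le> 1, already the square root of R/\<open>\<delta>\<close> is at
      least R.\<close>
    have Rr: "R0 powr (1 - r) \<le> R powr (d / 2 - r) * \<delta> powr (- (d / 2))"
    proof -
      have "R0 powr (1 - r) \<le> R powr (1 - r)" using R0 r by (intro powr_mono2) auto
      also have "\<dots> \<le> R powr (1 - r) * (R * \<delta>) powr (- (1 / 2))"
      proof -
        have "1 \<le> (R * \<delta>) powr (- (1 / 2))" using powr_mono'[of "- (1 / 2)" 0 "R * \<delta>"] R \<delta> R\<delta> by simp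
        then show ?thesis using mult_left_mono[of 1 "(R * \<delta>) powr (- (1 / 2))" "R powr (1 - r)"] by simp
      qed
      also have "\<dots> = R powr (1 - r + - (1 / 2)) * \<delta> powr (- (1 / 2))"
        by (simp only: powr_mult powr_add mult.assoc)
      also have "\<dots> = R powr (- r) * y powr (1 / 2)"
        using R \<delta> unfolding y_def by (simp add: powr_divide powr_minus_divide powr_add[symmetric] powr_diff field_simps)
      also have "\<dots> \<le> R powr (- r) * y powr (d / 2)"
        using y1 d by (intro mult_left_mono powr_mono) auto
      also have "y powr (d / 2) = R powr (d / 2) * \<delta> powr (- (d / 2))"
        using R \<delta> by (simp add: y_def powr_divide powr_minus_divide)
      also have "R powr (- r) * (R powr (d / 2) * \<delta> powr (- (d / 2))) = R powr (- r + d / 2) * \<delta> powr (- (d / 2))"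
        by (simp only: powr_add mult.assoc)
      also have "- r + d / 2 = d / 2 - r" by simp
      finally show ?thesis .
    qed
    have "16 * B * T\<^sup>2 * L ^ 3 \<le> (c * L ^ 2 * R0 powr (1 - r)) * T\<^sup>2 * L ^ 3"
      using H5 L1 unfolding B_def by (intro mult_right_mono) auto
    also have "\<dots> = c * L ^ 5 * T\<^sup>2 * R0 powr (1 - r)" by (simp add: power_numeral_reduce mult_ac)
    also have "\<dots> \<le> c * L ^ 5 * T\<^sup>2 * (R powr (d / 2 - r) * \<delta> powr (- (d / 2)))"
      using c L1 by (intro mult_left_mono[OF Rr]) auto
    also have "\<dots> = c * L ^ 5 * ((R powr (2 * d) * R powr (d / 2 - r)) * (\<delta> powr (- (2 * d)) * \<delta> powr (- (d / 2))))"
      unfolding T2 by (simp add: mult_ac)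
    also have "R powr (2 * d) * R powr (d / 2 - r) = R powr (5 * d / 2 - r)" by (simp add: powr_add[symmetric])
    also have "\<delta> powr (- (2 * d)) * \<delta> powr (- (d / 2)) = \<delta> powr (- ((5 * d + 2) / 2)) * \<delta> powr 1"
      by (simp add: powr_add[symmetric] field_simps del: powr_one powr_one')
    also have "c * L ^ 5 * (R powr (5 * d / 2 - r) * (\<delta> powr (- ((5 * d + 2) / 2)) * \<delta> powr 1)) = (c * I powr (1 / \<nu>)) * \<eta>"
      unfolding I\<nu> \<eta>_def using \<delta> by (simp add: mult_ac)
    also have "\<dots> \<le> p * \<eta>" using c \<eta> by (intro mult_right_mono) auto
    finally show ?thesis .
  qed
  have TL: "1 \<le> T * L" using T1 L1 mult_mono[of 1 T 1 L] by simp
  have "0 < c * I powr (1 / \<nu>)" using c(1) I0 by simp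
  then have p0: "0 < p" using c(2) by linarith
  have main2: "B * T * L \<le> p * \<eta> / (8 * real q)"
  proof -
    have "8 * (B * T * L) * q \<le> 8 * (B * T * L) * (2 * (L ^ 2 * T))"
      by (rule mult_left_mono[OF q_le]) (use B T1 L1 in simp)
    also have "\<dots> = 16 * B * T\<^sup>2 * L ^ 3" by (simp add: power2_eq_square power3_eq_cube mult_ac)
    also note main
    finally show ?thesis using q0 by (simp add: pos_le_divide_eq mult_ac)
  qed
  show "real q \<le> p"
  proof -
    have "1 * real q \<le> (T * L) * real q" by (rule mult_right_mono[OF TL]) simp
    moreover have "4 * ((T * L) * real q) \<le> B * ((T * L) * real q)"
      by (rule mult_right_mono[OF B]) (use T1 L1 in simp)
    moreover have "8 * (B * ((T * L) * real q)) \<le> p * \<eta>"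
      using main2 q0 by (simp add: pos_le_divide_eq mult_ac)
    moreover have "p * \<eta> \<le> p * 2" by (rule mult_left_mono[OF \<eta>2]) (use p0 in simp)
    ultimately show ?thesis using p0 by linarith
  qed
  have eI: "I = exp L" using I0 by (simp add: L_def)
  \<comment> \<open>The two error terms get half of the target each, whence 8 = 2 * 4 here and 2880
    = 2 * 1440 in the next estimate.\<close>
  have b1: "exp ((A * y) powr d * ln (6 * y)) * I * (4 * exp (- (p * \<eta> / (8 * real q)))) \<le> exp (- (P * L)) / 2"
  proof -
    have "ln 8 \<le> (7 :: real)" using ln_le_minus_one[of "8 :: real"] by simp
    have PL: "P * L \<le> P * (T * L)" using P T1 L1 mult_left_mono[of 1 T "P * L"] by (simp add: mult_ac)
    have LTL: "L \<le> T * L" using T1 L1 mult_right_mono[of 1 T L] by simp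
    have ln8: "ln 8 \<le> 3 * (T * L)"
    proof -
      have "(8 :: real) \<le> exp 3"
      proof -
        have "(2 :: real) \<le> exp 1" using exp_ge_add_one_self[of 1] by simp
        then have "(2 :: real) ^ 3 \<le> exp 1 ^ 3" by (intro power_mono) auto
        then show ?thesis by (simp add: exp_of_nat_mult[symmetric])
      qed
      then have "ln 8 \<le> (3 :: real)" using ln_le_cancel_iff[of 8 "exp 3"] by simp
      then show ?thesis using TL by linarith
    qed
    have "(A * y) powr d * ln (6 * y) + L + ln 8 - p * \<eta> / (8 * real q) \<le> - (P * L)"
      using ent main2 PL LTL ln8 unfolding B_def by (simp add: algebra_simps)
    then have "exp ((A * y) powr d * ln (6 * y) + L + ln 8 - p * \<eta> / (8 * real q)) \<le> exp (- (P * L))" by simp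
    moreover have "exp ((A * y) powr d * ln (6 * y) + L + ln 8 - p * \<eta> / (8 * real q))
        = exp ((A * y) powr d * ln (6 * y)) * I * 8 * exp (- (p * \<eta> / (8 * real q)))"
      unfolding eI by (simp add: exp_add exp_diff exp_minus field_simps)
    ultimately have "exp ((A * y) powr d * ln (6 * y)) * I * 8 * exp (- (p * \<eta> / (8 * real q))) \<le> exp (- (P * L))"
      by (simp only:)
    then show ?thesis by simp
  qed
  \<comment> \<open>The mixing error carries one more factor \<open>I\<close>, from p \<le> I and
    the lower bound for q \<open>\<eta>\<close>. The bound \<open>H6\<close> makes c1 q large enough
    to pay for it.\<close>
  have b2: "exp ((A * y) powr d * ln (6 * y)) * I * (1440 * c0 * p / (q * \<eta>) * exp (- c1 * q)) \<le> exp (- (P * L)) / 2"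
  proof -
    have PL: "P * L \<le> P * (T * L)" using P T1 L1 mult_left_mono[of 1 T "P * L"] by (simp add: mult_ac)
    have LTL: "L \<le> T * L" using T1 L1 mult_right_mono[of 1 T L] by simp
    have "(3 * A powr d + P + 4) * (T * L) \<le> (c1 * L) * (T * L)"
      using H6 TL by (intro mult_right_mono) auto
    also have "\<dots> = c1 * (L ^ 2 * T)" by (simp add: power2_eq_square mult_ac)
    also have "\<dots> \<le> c1 * q" using q_ge c01 by (intro mult_left_mono) auto
    finally have cq: "(3 * A powr d + P + 4) * (T * L) \<le> c1 * q" .
    have "p / (q * \<eta>) \<le> I / Cd"
      using Cq c c01 p0 by (intro frac_le) auto
    then have "1440 * c0 * p / (q * \<eta>) \<le> 1440 * c0 * (I / Cd)"
      using c01 mult_left_mono[of "p / (q * \<eta>)" "I / Cd" "1440 * c0"] by simp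
    then have "exp ((A * y) powr d * ln (6 * y)) * I * (1440 * c0 * p / (q * \<eta>) * exp (- c1 * q))
        \<le> exp ((A * y) powr d * ln (6 * y)) * I * (1440 * c0 * (I / Cd) * exp (- c1 * q))"
      using I0 by (intro mult_left_mono mult_right_mono) auto
    also have "\<dots> = exp ((A * y) powr d * ln (6 * y)) * I * I * (2880 * c0 / Cd) * exp (- c1 * q) / 2" by simp
    also have "2880 * c0 / Cd = exp (ln (2880 * c0 / Cd))" using c01 by simp
    also have "exp ((A * y) powr d * ln (6 * y)) * I * I * exp (ln (2880 * c0 / Cd)) * exp (- c1 * q)
      = exp ((A * y) powr d * ln (6 * y) + L + L + ln (2880 * c0 / Cd) + - c1 * q)"
      unfolding eI by (simp only: exp_add)
    finally have "exp ((A * y) powr d * ln (6 * y)) * I * (1440 * c0 * p / (q * \<eta>) * exp (- c1 * q))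
      \<le> exp ((A * y) powr d * ln (6 * y) + L + L + ln (2880 * c0 / Cd) + - c1 * q) / 2" .
    also have "\<dots> \<le> exp (- (P * L)) / 2"
    proof (rule divide_right_mono)
      show "exp ((A * y) powr d * ln (6 * y) + L + L + ln (2880 * c0 / Cd) + - c1 * q) \<le> exp (- (P * L))"
        unfolding exp_le_cancel_iff using ent cq PL LTL H7 TL by (simp add: algebra_simps)
    qed simp
    finally show ?thesis .
  qed
  show "exp ((A * (R / \<delta>)) powr d * ln (6 * (R / \<delta>))) * I *
      (4 * exp (- (p * \<eta> / (8 * real q))) + 1440 * c0 * p / (q * \<eta>) * exp (- c1 * q)) \<le> exp (- (P * L))"
    unfolding y_def[symmetric] distrib_left using b1 b2 by linarith
qed

lemma converges_to_infinity_ln: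
  assumes n: "converges_to_infinity n"
  shows "filterlim (\<lambda>k. ln (real (card (grid (n k))))) at_top sequentially"
  by (intro filterlim_compose[OF ln_at_top] filterlim_compose[OF filterlim_real_sequentially]
      converges_to_infinity_card n)

lemma mesh_tendsto_0:
  fixes n :: "nat \<Rightarrow> nat ^ 'n"
  assumes n: "converges_to_infinity n" and d: "0 < d"
  shows "(\<lambda>k. mesh d (n k)) \<longlonglongrightarrow> 0"
  unfolding mesh_def using d
  by (intro tendsto_neg_powr filterlim_compose[OF filterlim_real_sequentially] converges_to_infinity_card n) auto

lemma mesh_pos: "0 < card (grid m) \<Longrightarrow> 0 < mesh d m"
  by (auto simp: mesh_def card_gt_0_iff)

context mixing_field
begin

lemma uniform_deviation:
  fixes n :: "nat \<Rightarrow> nat ^ 'n" and R :: "nat ^ 'n \<Rightarrow> real" and V :: "nat ^ 'n \<Rightarrow> ('b \<Rightarrow> real) set"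
  assumes n: "converges_to_infinity n" and d: "1 \<le> d" and r: "0 < r" "r \<le> 1" and A: "0 < A"
    and R0: "0 < R0" "\<forall>\<^sub>F k in sequentially. R0 \<le> R (n k)"
    and small: "(\<lambda>k. R (n k) powr (5 * d / 2) * ln (real (card (grid (n k)))) ^ 7 * mesh d (n k)) \<longlonglongrightarrow> 0"
    and V: "\<And>m. finite (V m)" "\<And>m v. v \<in> V m \<Longrightarrow> v \<in> borel_measurable borel" "\<And>m v z. v \<in> V m \<Longrightarrow> \<bar>v z\<bar> \<le> 1"
    and card: "\<forall>\<^sub>F k in sequentially. real (card (V (n k))) \<le>
      exp ((A * (R (n k) / mesh d (n k))) powr d * ln (6 * (R (n k) / mesh d (n k)))) * real (card (grid (n k)))"
  shows "AE \<omega> in M. \<forall>\<^sub>F k in sequentially. \<forall>v\<in>V (n k).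
    \<bar>average (n k) v \<omega> - expectation (\<lambda>\<omega>. v (Z 0 \<omega>))\<bar> < dev_level d r (R (n k)) (n k)"
proof -
  define E where "E m = (\<Union>v\<in>V m. {\<omega> \<in> space M. dev_level d r (R m) m \<le> \<bar>average m v \<omega> - expectation (\<lambda>\<omega>. v (Z 0 \<omega>))\<bar>})" for m
  have ev: "{\<omega> \<in> space M. t \<le> \<bar>average m v \<omega> - expectation (\<lambda>\<omega>. v (Z 0 \<omega>))\<bar>} \<in> sets M" if "v \<in> V m" for v m t
  proof -
    have [measurable]: "average m v \<in> borel_measurable M" by (rule average_measurable[OF V(2)[OF that]])
    show ?thesis by measurable
  qed
  have E: "E m \<in> sets M" for m unfolding E_def using V(1) ev by (intro sets.finite_UN) auto
  let ?N = "real CARD('n)"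
  \<comment> \<open>Any axis serves for the slabs, since all sides are comparable.\<close>
  define i0 :: 'n where "i0 = undefined"
  obtain c where c: "0 < c" "\<forall>\<^sub>F k in sequentially. c * real (card (grid (n k))) powr (1 / ?N) \<le> real (n k $ i0)"
    using converges_to_infinity_side_ge[OF n] by blast
  define Cd where "Cd = 192 * c0 / (1 - exp (- c1))"
  have Cd: "0 < Cd" using c0 c1 by (simp add: Cd_def)
  \<comment> \<open>The power of 1/|I| required by \<open>lattice_borel_cantelli\<close>.\<close>
  define P where "P = ?N + 2"
  define B where "B = 3 * A powr d + P + 4"
  \<comment> \<open>Gathers the lower bounds on log|I| that yield I \<ge> 6 and the conditions
    \<open>H5\<close> to \<open>H8\<close> of \<open>parameter_bounds\<close>.\<close>
  define \<Lambda> where "\<Lambda> = Max {1, ln 6, 16 * B / (c * R0 powr (1 - r)), B / c1, ln (2880 * c0 / Cd), Cd / R0 powr (7 * d / 2 - r)}"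
  have \<Lambda>: "1 \<le> \<Lambda>" "ln 6 \<le> \<Lambda>" "16 * B / (c * R0 powr (1 - r)) \<le> \<Lambda>" "B / c1 \<le> \<Lambda>" "ln (2880 * c0 / Cd) \<le> \<Lambda>"
    "Cd / R0 powr (7 * d / 2 - r) \<le> \<Lambda>"
    unfolding \<Lambda>_def by (rule Max_ge; simp)+
  \<comment> \<open>Thresholds for the numerator of the first rate: \<open>R0 powr r\<close> yields
    \<open>\<eta>\<close> \<le> 2, and \<open>R0 powr (5 * d / 2 - 1)\<close> yields R
    \<open>\<delta>\<close> \<le> 1.\<close>
  define \<epsilon> where "\<epsilon> = min 1 (min (R0 powr r) (R0 powr (5 * d / 2 - 1)))"
  have \<epsilon>: "0 < \<epsilon>" "\<epsilon> \<le> 1" "\<epsilon> \<le> R0 powr r" "\<epsilon> \<le> R0 powr (5 * d / 2 - 1)" using R0(1) by (auto simp: \<epsilon>_def)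
  have "\<forall>\<^sub>F k in sequentially. \<Lambda> \<le> ln (real (card (grid (n k))))"
    using converges_to_infinity_ln[OF n] by (simp add: filterlim_at_top)
  moreover have "\<forall>\<^sub>F k in sequentially. mesh d (n k) < R0"
    using order_tendstoD(2)[OF mesh_tendsto_0[OF n] R0(1)] d by simp
  moreover have "\<forall>\<^sub>F k in sequentially. R (n k) powr (5 * d / 2) * ln (real (card (grid (n k)))) ^ 7 * mesh d (n k) < \<epsilon>"
    by (rule order_tendstoD(2)[OF small \<epsilon>(1)])
  moreover note R0(2) card c(2) converges_to_infinity_sides[OF n]
  ultimately have "\<forall>\<^sub>F k in sequentially. prob (E (n k)) \<le> 1 / real (card (grid (n k))) ^ (CARD('n) + 2)"
  proof eventually_elim
    case (elim k)
    define m where "m = n k"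
    define I where "I = real (card (grid m))"
    define L where "L = ln I"
    define \<delta> where "\<delta> = mesh d m"
    define Rm where "Rm = R m"
    define \<eta> where "\<eta> = Rm powr (5 * d / 2 - r) * L ^ 5 * \<delta>"
    note el = elim[folded m_def, folded I_def \<delta>_def Rm_def, folded L_def]
    have "0 < card (grid m)" unfolding card_grid using el(7) by (intro prod_pos) (auto simp: Suc_le_eq)
    then have I1: "1 \<le> I" unfolding I_def by linarith
    then have I0: "0 < I" by simp
    have L1: "1 \<le> L" using el(1) \<Lambda>(1) by simp
    have \<delta>0: "0 < \<delta>" unfolding \<delta>_def using I0 by (intro mesh_pos) (simp add: I_def)
    have Rm: "R0 \<le> Rm" "0 < Rm" using el(4) R0(1) by auto
    have I6: "6 \<le> I"
    proof -
      have "ln 6 \<le> ln I" using el(1) \<Lambda>(2) by (simp add: L_def)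
      then show ?thesis using I0 by (subst (asm) ln_le_cancel_iff) auto
    qed
    have L57: "L ^ 5 \<le> L ^ 7" "1 \<le> L ^ 7" using L1 by (auto intro: power_increasing one_le_power)
    have pI: "real (m $ i0) \<le> I"
    proof -
      have "m $ i0 dvd (\<Prod>i\<in>UNIV. m $ i)" by (rule dvd_prodI) auto
      then have "m $ i0 \<le> card (grid m)"
        unfolding card_grid using el(7) by (intro dvd_imp_le prod_pos) (auto simp: Suc_le_eq)
      then show ?thesis by (simp add: I_def)
    qed
    have R\<delta>: "Rm * \<delta> \<le> 1"
    proof -
      have "R0 powr (5 * d / 2 - 1) * (Rm * \<delta>) \<le> Rm powr (5 * d / 2 - 1) * (Rm * \<delta>)"
        using R0 Rm d \<delta>0 by (intro mult_right_mono powr_mono2) auto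
      also have "\<dots> = Rm powr (5 * d / 2) * \<delta>" using Rm(2) by (simp add: powr_diff)
      also have "\<dots> \<le> Rm powr (5 * d / 2) * L ^ 7 * \<delta>" using mult_right_mono[OF mult_left_mono[OF L57(2), of "Rm powr (5 * d / 2)"], of \<delta>] \<delta>0 by simp
      also have "\<dots> \<le> R0 powr (5 * d / 2 - 1)" using el(3) \<epsilon>(4) by simp
      finally show ?thesis using R0(1) by simp
    qed
    have \<eta>2: "\<eta> \<le> 2"
    proof -
      have "R0 powr r * \<eta> \<le> Rm powr r * \<eta>"
        using R0 Rm r \<delta>0 L1 by (intro mult_right_mono powr_mono2) (auto simp: \<eta>_def)
      also have "\<dots> = Rm powr (5 * d / 2) * L ^ 5 * \<delta>" using Rm(2) by (simp add: \<eta>_def powr_diff)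
      also have "\<dots> \<le> Rm powr (5 * d / 2) * L ^ 7 * \<delta>" using L57 \<delta>0 by (intro mult_right_mono mult_left_mono) auto
      also have "\<dots> \<le> R0 powr r * 1" using el(3) \<epsilon>(3) by simp
      finally show ?thesis using R0(1) by simp
    qed
    have LL: "L \<le> L ^ 2" "L \<le> L ^ 7" using L1 power_increasing[of 1 2 L] power_increasing[of 1 7 L] by auto
    have H5: "16 * B \<le> c * L ^ 2 * R0 powr (1 - r)"
    proof -
      have "16 * B / (c * R0 powr (1 - r)) \<le> L" using \<Lambda>(3) el(1) by linarith
      then have "16 * B \<le> (c * R0 powr (1 - r)) * L" using c(1) R0(1) by (simp add: pos_divide_le_eq mult.commute)
      also have "\<dots> \<le> (c * R0 powr (1 - r)) * L ^ 2" using c(1) LL by (intro mult_left_mono) auto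
      finally show ?thesis by (simp add: mult_ac)
    qed
    have H6: "B \<le> c1 * L"
    proof -
      have "B / c1 \<le> L" using \<Lambda>(4) el(1) by linarith
      then show ?thesis using c1 by (simp add: pos_divide_le_eq mult.commute)
    qed
    have H8: "Cd \<le> L ^ 7 * R0 powr (7 * d / 2 - r)"
    proof -
      have "Cd / R0 powr (7 * d / 2 - r) \<le> L ^ 7" using \<Lambda>(6) el(1) LL by linarith
      then show ?thesis using R0(1) by (simp add: pos_divide_le_eq)
    qed
    define q where "q = nat \<lceil>L ^ 2 * (Rm / \<delta>) powr d\<rceil>"
    define p where "p = real (m $ i0)"
    have N1: "1 \<le> ?N" by (simp add: Suc_le_eq)
    have P0: "0 \<le> P" by (simp add: P_def)
    have \<delta>eq: "I powr - (1 / ?N * (2 / (5 * d + 2))) = \<delta>" by (simp add: \<delta>_def mesh_def I_def)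
    have cp: "c * I powr (1 / ?N) \<le> p" "p \<le> I" using el(6) pI by (simp_all add: p_def)
    have \<delta>R0: "\<delta> \<le> R0" and H7: "ln (2880 * c0 / Cd) \<le> L" using el(1,2) \<Lambda>(5) by linarith+
    note * = parameter_bounds[OF d N1 r R0(1) Rm(1) A P0 c(1) cp c0 c1 Cd I6, folded L_def, unfolded \<delta>eq,
      folded \<eta>_def q_def B_def, OF L1 \<delta>R0 R\<delta> \<eta>2 H5 H6 H7 H8]
    define X where "X = 4 * exp (- (p * \<eta> / (8 * real q))) + 1440 * c0 * p / (q * \<eta>) * exp (- c1 * q)"
    have X0: "0 \<le> X" using c0 *(3) by (auto simp: X_def p_def)
    have dev: "dev_level d r Rm m = \<eta>" by (simp add: dev_level_def \<eta>_def L_def I_def \<delta>_def)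
    have one: "prob {\<omega> \<in> space M. \<eta> \<le> \<bar>average m v \<omega> - expectation (\<lambda>\<omega>. v (Z 0 \<omega>))\<bar>} \<le> X" if v: "v \<in> V m" for v
      using field_deviation[OF V(2)[OF v] V(3)[OF v], where m = m and q = q and ?i0.0 = i0 and \<eta> = \<eta>]
        el(7) *(1-4) \<eta>2 by (simp add: X_def p_def Cd_def)
    have "prob (E m) \<le> (\<Sum>v\<in>V m. prob {\<omega> \<in> space M. \<eta> \<le> \<bar>average m v \<omega> - expectation (\<lambda>\<omega>. v (Z 0 \<omega>))\<bar>})"
      unfolding E_def Rm_def[symmetric] dev using V(1) ev by (intro finite_measure_subadditive_finite) auto
    also have "\<dots> \<le> (\<Sum>v\<in>V m. X)" by (intro sum_mono one)
    also have "\<dots> = real (card (V m)) * X" by simp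
    also have "\<dots> \<le> (exp ((A * (Rm / \<delta>)) powr d * ln (6 * (Rm / \<delta>))) * I) * X"
      using el(5) X0 by (intro mult_right_mono) auto
    also have "\<dots> \<le> exp (- (P * L))" using *(6) by (simp add: X_def)
    also have "\<dots> = 1 / I ^ (CARD('n) + 2)"
    proof -
      have "exp (P * L) = I powr P" using I0 by (simp add: powr_def L_def)
      also have "\<dots> = I powr real (CARD('n) + 2)" by (simp add: P_def add.commute)
      also have "\<dots> = I ^ (CARD('n) + 2)" using I0 by (rule powr_realpow)
      finally show ?thesis by (simp add: exp_minus divide_inverse)
    qed
    finally show ?case by (simp add: m_def I_def)
  qed
  then have "AE \<omega> in M. \<forall>\<^sub>F k in sequentially. \<omega> \<notin> E (n k)"
    by (intro lattice_borel_cantelli[OF n E, of 1]) auto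
  then show ?thesis
    using AE_space
  proof eventually_elim
    case (elim \<omega>)
    then show ?case
      by (elim eventually_mono) (auto simp: E_def not_le)
  qed
qed

end

section \<open>The kernel estimator\<close>

definition grid_mean :: "nat ^ 'n \<Rightarrow> (int ^ 'n \<Rightarrow> 'b::real_vector) \<Rightarrow> 'b" where
  "grid_mean m f = (\<Sum>s\<in>grid m. f s) /\<^sub>R real (card (grid m))"

lemma grid_mean_diff: "grid_mean m (\<lambda>s. f s - g s) = grid_mean m f - grid_mean m g"
  by (simp add: grid_mean_def sum_subtractf scaleR_diff_right)

lemma grid_mean_add: "grid_mean m (\<lambda>s. f s + g s) = grid_mean m f + grid_mean m g"
  by (simp add: grid_mean_def sum.distrib scaleR_add_right)

lemma grid_mean_mult: "grid_mean m (\<lambda>s. c * f s) = c * grid_mean m f" for f :: "_ \<Rightarrow> real"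
  by (simp add: grid_mean_def sum_distrib_left[symmetric])

lemma grid_mean_scaleR_left: "grid_mean m (\<lambda>s. f s *\<^sub>R c) = grid_mean m f *\<^sub>R c"
  by (simp add: grid_mean_def scaleR_sum_left[symmetric])

lemma grid_mean_mono: "(\<And>s. s \<in> grid m \<Longrightarrow> f s \<le> g s) \<Longrightarrow> grid_mean m f \<le> grid_mean m g"
  for f :: "_ \<Rightarrow> real"
  by (auto simp: grid_mean_def intro!: mult_left_mono sum_mono)

lemma norm_grid_mean_le: "norm (grid_mean m f) \<le> grid_mean m (\<lambda>s. norm (f s))"
  for f :: "_ \<Rightarrow> 'b::real_normed_vector"
  by (auto simp: grid_mean_def divide_inverse_commute intro!: mult_left_mono norm_sum)

lemma grid_mean_const: "0 < card (grid m) \<Longrightarrow> grid_mean m (\<lambda>s. c) = c"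
  by (simp add: grid_mean_def card_gt_0_iff scaleR_conv_of_real sum_constant_scaleR)

lemma grid_mean_linear: "linear f \<Longrightarrow> f (grid_mean m g) = grid_mean m (\<lambda>s. f (g s))"
  by (simp add: grid_mean_def linear_scale linear_sum o_def)

text \<open>The bounds with constants \<open>cK\<close>, \<open>CB\<close>, \<open>C7\<close>, \<open>CF\<close> are what the proof uses of the assumptions
  (2)--(4), (1), (7) and (5).\<close>

locale kernel_regression =
  functional_field D \<nu> cls M S \<rho> X + mixing_field M "\<lambda>s \<omega>. (X s \<omega>, Y s \<omega>)" c0 c1
  for D :: "(real ^ 'd) set" and \<nu> :: "(real ^ 'd) measure"
    and cls :: "(real ^ 'd \<Rightarrow> real) \<Rightarrow> 'h::{real_inner, banach, second_countable_topology}"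
    and M :: "'w measure" and S \<rho> and X Y :: "int ^ 'n \<Rightarrow> 'w \<Rightarrow> 'h" and c0 c1 :: real +
  fixes e :: "nat \<Rightarrow> 'h" and \<Psi> :: "'h \<Rightarrow> 'h" and K :: "real \<Rightarrow> real"
    and r Kb LK CF \<delta>0 cK CB B0 C7 L\<Psi> \<kappa>0 \<kappa>1 d0 d1 :: real
  assumes e: "orthonormal_basis e"
    and Ym: "\<And>s. Y s \<in> borel_measurable M"
    and r: "0 < r" "r \<le> 1"
    and K1: "\<And>u. 1 < u \<Longrightarrow> K u = 0"
    and Kb: "0 < Kb" "\<And>u. 0 \<le> u \<Longrightarrow> \<bar>K u\<bar> \<le> Kb"
    and LK: "0 \<le> LK" "\<And>u v. u \<in> {0..1} \<Longrightarrow> v \<in> {0..1} \<Longrightarrow> \<bar>K u - K v\<bar> \<le> LK * \<bar>u - v\<bar>"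
    and Km: "(\<lambda>u. if 0 \<le> u then K u else 0) \<in> borel_measurable borel"
    and \<delta>0: "0 < \<delta>0"
    and F_pos: "\<And>x h. x \<in> S \<Longrightarrow> 0 < h \<Longrightarrow> 0 < F x h"
    and CF: "0 < CF"
      "\<And>z a b. z \<in> S \<Longrightarrow> 0 \<le> a \<Longrightarrow> a \<le> b \<Longrightarrow> b \<le> \<delta>0 \<Longrightarrow> F z b - F z a \<le> CF * (b - a)"
      "\<And>z z' a. z \<in> S \<Longrightarrow> z' \<in> S \<Longrightarrow> 0 \<le> a \<Longrightarrow> a \<le> \<delta>0 \<Longrightarrow> \<bar>F z a - F z' a\<bar> \<le> CF * \<rho> z z'"
    and cK: "0 < cK" "\<And>x h. x \<in> S \<Longrightarrow> 0 < h \<Longrightarrow> h \<le> \<delta>0 \<Longrightarrow>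
      cK * F x h \<le> expectation (\<lambda>\<omega>. K (\<rho> (X 0 \<omega>) x / h))"
    and CB: "0 < CB" "\<And>x h. x \<in> S \<Longrightarrow> 0 < h \<Longrightarrow> h \<le> \<delta>0 \<Longrightarrow>
      norm (expectation (\<lambda>\<omega>. K (\<rho> (X 0 \<omega>) x / h) *\<^sub>R Y 0 \<omega>) - expectation (\<lambda>\<omega>. K (\<rho> (X 0 \<omega>) x / h)) *\<^sub>R \<Psi> x)
      \<le> CB * F x h * h"
    and C7: "1 \<le> B0" "0 < C7" "\<And>x B h. x \<in> S \<Longrightarrow> B0 \<le> B \<Longrightarrow> ess_norm \<nu> cls x \<le> ereal B \<Longrightarrow> 0 < h \<Longrightarrow> h \<le> \<delta>0 \<Longrightarrow>
      expectation (\<lambda>\<omega>. indicator {0..h} (\<rho> (X 0 \<omega>) x) * norm (Y 0 \<omega>)) \<le> C7 * B powr r * F x h"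
    and \<Psi>: "0 \<le> L\<Psi>" "\<And>x y. x \<in> S \<Longrightarrow> y \<in> S \<Longrightarrow> norm (\<Psi> x - \<Psi> y) \<le> L\<Psi> * norm (x - y) powr r"
    and tail: "0 < \<kappa>0" "0 < \<kappa>1" "\<And>s z. 1 \<le> z \<Longrightarrow> prob {\<omega> \<in> space M. z \<le> norm (Y s \<omega>)} \<le> \<kappa>0 * exp (- \<kappa>1 * z)"
    and coord: "0 < d0" "0 < d1" "\<And>s j. expectation (\<lambda>\<omega>. (Y s \<omega> \<bullet> e j)\<^sup>2) \<le> d0 * exp (- d1 * real j)"
    and Y2: "\<And>s. integrable M (\<lambda>\<omega>. (norm (Y s \<omega>))\<^sup>2)"
begin

lemmas Ym' [measurable] = Ym

lemma Y_int: "integrable M (Y s)"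
proof (rule Bochner_Integration.integrable_bound[of _ "\<lambda>\<omega>. (norm (Y s \<omega>))\<^sup>2 + 1"])
  have "y \<le> y\<^sup>2 + 1" for y :: real
    using sum_squares_bound[of y 1] by (cases "0 \<le> y") (auto intro: order_trans[of _ 0])
  then show "AE \<omega> in M. norm (Y s \<omega>) \<le> norm ((norm (Y s \<omega>))\<^sup>2 + 1)" by (intro AE_I2) simp
qed (use Y2 in auto)

text \<open>Test functions have to be Borel on the whole space, and nothing is known of
  \<open>K\<close> at negative arguments.\<close>

definition K0 :: "real \<Rightarrow> real" where "K0 u = (if 0 \<le> u then K u else 0)"

lemma K0_meas [measurable]: "K0 \<in> borel_measurable borel"
  using Km by (simp add: K0_def[abs_def])

lemma K0_bound: "\<bar>K0 u\<bar> \<le> Kb"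
  using Kb by (simp add: K0_def)

definition k_test :: "'h \<Rightarrow> real \<Rightarrow> 'h \<times> 'h \<Rightarrow> real" where
  "k_test x h z = K0 (\<rho>_ext x (fst z) / h) / Kb"

text \<open>Clipping at height \<open>B\<close> and the divisions by \<open>B\<close> and
  \<open>Kb\<close> bring the product into [-1, 1], the range of the deviation inequality.\<close>

definition k_coord :: "'h \<Rightarrow> real \<Rightarrow> real \<Rightarrow> nat \<Rightarrow> 'h \<times> 'h \<Rightarrow> real" where
  "k_coord x h B j z = K0 (\<rho>_ext x (fst z) / h) / Kb * (max (- B) (min B (snd z \<bullet> e j)) / B)"

definition ind_test :: "'h \<Rightarrow> real \<Rightarrow> real \<Rightarrow> 'h \<times> 'h \<Rightarrow> real" where
  "ind_test x a b z = indicator {a..b} (\<rho>_ext x (fst z))"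

definition ind_norm :: "'h \<Rightarrow> real \<Rightarrow> real \<Rightarrow> real \<Rightarrow> 'h \<times> 'h \<Rightarrow> real" where
  "ind_norm x a b B z = indicator {a..b} (\<rho>_ext x (fst z)) * (min B (norm (snd z)) / B)"

text \<open>Quantities compared with their means at a net point: kernel weights for the denominator,
  kernel times response coordinates for the numerator, and the masses of ball and boundary layer,
  plain and weighted by the truncated norm, which control the passage to nearby centres.\<close>

definition tests :: "'h \<Rightarrow> real \<Rightarrow> real \<Rightarrow> real \<Rightarrow> nat \<Rightarrow> ('h \<times> 'h \<Rightarrow> real) set" where
  "tests x h s B J = {k_test x h, ind_test x 0 h, ind_norm x 0 h B, ind_test x (h - s) (h + s),
     ind_norm x (h - s) (h + s) B} \<union> k_coord x h B ` {..<J}"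

lemma tests_measurable:
  assumes x: "x \<in> S" and v: "v \<in> tests x h s B J"
  shows "v \<in> borel_measurable borel"
proof -
  note [measurable] = \<rho>_ext_measurable[OF x]
  have [measurable]: "(fst :: 'h \<times> 'h \<Rightarrow> 'h) \<in> borel_measurable borel" "(snd :: 'h \<times> 'h \<Rightarrow> 'h) \<in> borel_measurable borel"
    by (intro borel_measurable_continuous_onI continuous_intros)+
  have "k_test x h \<in> borel_measurable borel" unfolding k_test_def[abs_def] by measurable
  moreover have "k_coord x h B j \<in> borel_measurable borel" for j unfolding k_coord_def[abs_def] by measurable
  moreover have "ind_test x a b \<in> borel_measurable borel" for a b unfolding ind_test_def[abs_def] by measurable
  moreover have "ind_norm x a b B \<in> borel_measurable borel" for a b unfolding ind_norm_def[abs_def] by measurable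
  ultimately show ?thesis using v by (auto simp: tests_def)
qed

lemma tests_bounded:
  assumes B: "0 < B" and v: "v \<in> tests x h s B J"
  shows "\<bar>v z\<bar> \<le> 1"
proof -
  have k: "\<bar>K0 u / Kb\<bar> \<le> 1" for u using K0_bound[of u] Kb by (simp add: abs_div)
  have c: "\<bar>max (- B) (min B y) / B\<bar> \<le> 1" for y using B by (simp add: abs_div abs_le_iff)
  have n: "\<bar>min B (norm y) / B\<bar> \<le> 1" for y :: 'h using B by (simp add: abs_div abs_le_iff)
  have "\<bar>k_test x h z\<bar> \<le> 1" unfolding k_test_def by (rule k)
  moreover have "\<bar>k_coord x h B j z\<bar> \<le> 1" for j
    unfolding k_coord_def abs_mult by (intro mult_le_one k c abs_ge_zero)
  moreover have "\<bar>ind_test x a b z\<bar> \<le> 1" for a b by (simp add: ind_test_def indicator_def)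
  moreover have "\<bar>ind_norm x a b B z\<bar> \<le> 1" for a b
    unfolding ind_norm_def abs_mult by (intro mult_le_one n abs_ge_zero) (simp add: indicator_def)
  ultimately show ?thesis using v by (auto simp: tests_def)
qed

lemma tests_finite: "finite (tests x h s B J)"
  by (simp add: tests_def)

lemma tests_card: "card (tests x h s B J) \<le> J + 5"
proof -
  have "card (tests x h s B J) \<le> card {k_test x h, ind_test x 0 h, ind_norm x 0 h B, ind_test x (h - s) (h + s),
     ind_norm x (h - s) (h + s) B} + card (k_coord x h B ` {..<J})"
    unfolding tests_def by (rule card_Un_le)
  also have "\<dots> \<le> 5 + J"
    by (intro add_mono order_trans[OF card_image_le]) (auto intro!: card_insert_le_m1)
  finally show ?thesis by simp
qed

definition tail_proj :: "nat \<Rightarrow> 'h \<Rightarrow> 'h" where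
  "tail_proj J y = y - (\<Sum>j<J. (y \<bullet> e j) *\<^sub>R e j)"

lemma tail_proj_bounded_linear: "bounded_linear (tail_proj J)"
  unfolding tail_proj_def[abs_def]
  by (intro bounded_linear_sub bounded_linear_ident bounded_linear_sum
      bounded_linear_compose[OF bounded_linear_scaleR_left bounded_linear_inner_left])

lemma e_inner: "e i \<bullet> e j = (if i = j then 1 else 0)"
  using e by (simp add: orthonormal_basis_def)

lemma norm_e: "norm (e j) = 1"
  using e_inner[of j j] by (simp add: norm_eq_1)

text \<open>Adding absolute coordinates instead of their squares loses a factor of at most
  \<open>J\<close>, which will be logarithmic.\<close>

lemma norm_le_coords: "norm w \<le> (\<Sum>j<J. \<bar>w \<bullet> e j\<bar>) + norm (tail_proj J w)"
proof -
  have "w = (\<Sum>j<J. (w \<bullet> e j) *\<^sub>R e j) + tail_proj J w" by (simp add: tail_proj_def)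
  then have "norm w \<le> norm (\<Sum>j<J. (w \<bullet> e j) *\<^sub>R e j) + norm (tail_proj J w)" by (metis norm_triangle_ineq)
  also have "norm (\<Sum>j<J. (w \<bullet> e j) *\<^sub>R e j) \<le> (\<Sum>j<J. \<bar>w \<bullet> e j\<bar>)"
    by (rule order_trans[OF norm_sum]) (simp add: norm_e)
  finally show ?thesis by simp
qed

lemma kernel_integral:
  fixes f :: "'w \<Rightarrow> 'b::{banach, second_countable_topology}"
  assumes x: "x \<in> S" and h: "0 < h" and f: "integrable M f"
  shows "integrable M (\<lambda>\<omega>. K (\<rho> (X 0 \<omega>) x / h) *\<^sub>R f \<omega>)"
proof -
  have [measurable]: "(\<lambda>\<omega>. \<rho> (X 0 \<omega>) x) \<in> borel_measurable M" by (rule \<rho>X_measurable[OF x])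
  have "integrable M (\<lambda>\<omega>. K0 (\<rho> (X 0 \<omega>) x / h) *\<^sub>R f \<omega>)"
    by (rule integrable_mult_bounded[OF f _ K0_bound]) measurable
  also have "?this \<longleftrightarrow> ?thesis"
    by (rule Bochner_Integration.integrable_cong[OF refl]) (use h x in \<open>auto simp: K0_def \<rho>X_nonneg\<close>)
  finally show ?thesis .
qed

text \<open>Inside [0, h] the Lipschitz bound applies. A jump of \<open>K\<close> at 1 is seen only
  if \<open>h\<close> separates \<open>a\<close> from \<open>a'\<close>, and then \<open>a'\<close>
  is within \<open>s\<close> of \<open>h\<close>.\<close>

lemma kernel_diff:
  assumes h: "0 < h" and a: "0 \<le> a" "0 \<le> a'" and s: "\<bar>a - a'\<bar> \<le> s" "s \<le> h"
  shows "\<bar>K (a / h) - K (a' / h)\<bar> \<le> LK * (s / h) * indicator {0..h} a' + 2 * Kb * indicator {h - s..h + s} a'"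
proof -
  have s0: "0 \<le> LK * (s / h)" using s(1) h LK(1) by simp
  have b: "\<bar>K (a / h)\<bar> \<le> Kb" "\<bar>K (a' / h)\<bar> \<le> Kb" using Kb(2) a h by auto
  consider "a \<le> h" "a' \<le> h" | "a > h" "a' > h" | "a \<le> h" "h < a'" | "h < a" "a' \<le> h" by linarith
  then show ?thesis
  proof cases
    case 1
    have "\<bar>K (a / h) - K (a' / h)\<bar> \<le> LK * \<bar>a / h - a' / h\<bar>" using 1 a h by (intro LK) auto
    also have "\<dots> \<le> LK * (s / h)"
      using s h LK(1) by (intro mult_left_mono) (auto simp: diff_divide_distrib[symmetric] abs_div divide_right_mono)
    finally show ?thesis using 1 a Kb(1) by (simp add: add_increasing2)
  next
    case 2
    then show ?thesis using K1 h s0 Kb(1) by simp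
  next
    case 3
    then have "a' \<in> {h - s..h + s}" using s by auto
    then show ?thesis using b s0 3 by (simp add: abs_le_iff)
  next
    case 4
    then have "a' \<in> {h - s..h + s}" using s by auto
    then show ?thesis using b s0 a 4 by (simp add: abs_le_iff)
  qed
qed

definition kern :: "real \<Rightarrow> 'w \<Rightarrow> 'h \<Rightarrow> int ^ 'n \<Rightarrow> real" where
  "kern h \<omega> x s = K (\<rho> (X s \<omega>) x / h)"

lemma grid_mean_average: "average m v \<omega> = grid_mean m (\<lambda>s. v (X s \<omega>, Y s \<omega>))"
  by (simp add: average_def grid_mean_def divide_inverse_commute)

text \<open>Every absolute error term is at most \<open>\<epsilon>\<close>, up to constants; the errors relative to \<open>F x h\<close> are
  \<open>T * s / h\<close> from the change of centre and \<open>h powr r\<close> from the bias.\<close>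

lemma pointwise_bound:
  fixes \<epsilon> \<eta> h s B T q R1 cs :: real
  defines "Cp \<equiv> 3 * Kb + CB * (1 + CF) + 2 * LK + 2 * (LK * (CF + 1) + 2 * Kb * (3 * CF + 1))
      + Kb * L\<Psi> * cs * (CF + 2) + cK * CF"
  assumes \<omega>: "\<omega> \<in> space M" and m: "0 < card (grid m)" and x: "x \<in> S" and z: "z \<in> S" and xz: "norm (x - z) \<le> s"
    and h: "0 < h" "h \<le> 1" "2 * s \<le> h" "h + s \<le> \<delta>0" and s: "0 < s" and B: "1 \<le> B" and T: "1 \<le> T"
    and R1: "B0 \<le> R1" "ess_norm \<nu> cls z \<le> ereal R1" "C7 * R1 powr r \<le> T"
    and \<Psi>T: "norm (\<Psi> x) \<le> T" "norm (\<Psi> z) \<le> T"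
    and \<eta>: "0 \<le> \<eta>" and cs: "0 \<le> cs" "s powr r \<le> cs * h powr r"
    and small: "J * B * \<eta> \<le> \<epsilon>" "B * \<eta> \<le> \<epsilon>" "B * s \<le> \<epsilon>" "T * s \<le> \<epsilon>" "T * \<eta> \<le> \<epsilon>" "J * \<beta> + q + q' \<le> \<epsilon>"
    and good: "\<And>v. v \<in> tests z h s B J \<Longrightarrow> \<bar>average m v \<omega> - expectation (\<lambda>\<omega>. v (X 0 \<omega>, Y 0 \<omega>))\<bar> \<le> \<eta>"
    and YB: "\<And>u. u \<in> grid m \<Longrightarrow> norm (Y u \<omega>) \<le> B"
    and YQ: "\<And>u. u \<in> grid m \<Longrightarrow> norm (tail_proj J (Y u \<omega>)) \<le> q"
    and EYB: "expectation (\<lambda>\<omega>. indicator {B..} (norm (Y 0 \<omega>)) * norm (Y 0 \<omega>)) \<le> \<beta>"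
    and EYQ: "expectation (\<lambda>\<omega>. norm (tail_proj J (Y 0 \<omega>))) \<le> q'"
  shows "norm (grid_mean m (\<lambda>u. kern h \<omega> x u *\<^sub>R (Y u \<omega> - \<Psi> x))) \<le>
      Cp * (\<epsilon> + F x h * (T * s / h) + F x h * h powr r)"
    and "cK * F x h - Cp * (\<epsilon> + F x h * (s / h)) \<le> grid_mean m (kern h \<omega> x)"
proof -
  let ?k = "kern h \<omega>"
  define V where "V \<omega>' = \<rho> (X 0 \<omega>') z" for \<omega>'
  have Vm [measurable]: "V \<in> borel_measurable M" unfolding V_def by (rule \<rho>X_measurable[OF z])
  have V0: "0 \<le> V \<omega>'" if "\<omega>' \<in> space M" for \<omega>' unfolding V_def by (rule \<rho>X_nonneg[OF z that])
  have h\<delta>: "h \<le> \<delta>0" using h s by simp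
  have B0': "0 < B" using B by simp
  define inn where "inn u = (indicator {0..h} (\<rho> (X u \<omega>) z) :: real)" for u
  define bd where "bd u = (indicator {h - s..h + s} (\<rho> (X u \<omega>) z) :: real)" for u
  have \<rho>z: "\<rho>_ext z (X u \<omega>) = \<rho> (X u \<omega>) z" for u by (rule \<rho>_ext_X[OF z \<omega>])
  have \<rho>z': "\<rho>_ext z (X 0 \<omega>') = V \<omega>'" if "\<omega>' \<in> space M" for \<omega>' unfolding V_def by (rule \<rho>_ext_X[OF z that])
  have r0: "0 \<le> \<rho> (X u \<omega>) y" if "y \<in> S" for u y by (rule \<rho>X_nonneg[OF that \<omega>])
  have K0k: "K0 (\<rho> (X u \<omega>) z / h) = ?k z u" for u using r0[OF z] h by (simp add: K0_def kern_def)
  have K0V: "K0 (V \<omega>' / h) = K (\<rho> (X 0 \<omega>') z / h)" if "\<omega>' \<in> space M" for \<omega>'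
    using V0[OF that] h by (simp add: K0_def V_def)
  define kz where "kz \<omega>' = K (\<rho> (X 0 \<omega>') z / h)" for \<omega>'
  have kz_b: "\<bar>kz \<omega>'\<bar> \<le> Kb" if "\<omega>' \<in> space M" for \<omega>'
    unfolding kz_def using V0[OF that] h by (intro Kb) (auto simp: V_def)
  have k_b: "\<bar>?k z u\<bar> \<le> Kb * inn u" for u
    using K1 Kb r0[OF z, of u] h by (cases "\<rho> (X u \<omega>) z \<le> h") (auto simp: kern_def inn_def)
  have g1: "\<bar>grid_mean m (?k z) - expectation kz\<bar> \<le> Kb * \<eta>"
  proof -
    have "average m (k_test z h) \<omega> = (1 / Kb) * grid_mean m (?k z)"
      unfolding grid_mean_average by (simp add: k_test_def \<rho>z K0k flip: grid_mean_mult)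
    moreover have "expectation (\<lambda>\<omega>. k_test z h (X 0 \<omega>, Y 0 \<omega>)) = expectation (\<lambda>\<omega>. (1 / Kb) * kz \<omega>)"
      by (rule Bochner_Integration.integral_cong) (auto simp: k_test_def \<rho>z' K0V kz_def)
    ultimately have "\<bar>(1 / Kb) * (grid_mean m (?k z) - expectation kz)\<bar> \<le> \<eta>"
      using good[of "k_test z h"] by (simp add: tests_def diff_divide_distrib)
    then show ?thesis using Kb(1) by (simp add: abs_mult abs_div field_simps)
  qed
  define clip where "clip y = max (- B) (min B y)" for y
  \<comment> \<open>On the grid the responses do not exceed \<open>B\<close>, so clipping leaves the
    empirical mean unchanged. Only the expectation changes, by at most \<open>Kb\<close> times the
    bound \<open>\<beta>\<close> on the truncated tail.\<close>
  have g2: "\<bar>grid_mean m (\<lambda>u. ?k z u * (Y u \<omega> \<bullet> e j)) - expectation (\<lambda>\<omega>. kz \<omega> * (Y 0 \<omega> \<bullet> e j))\<bar> \<le> Kb * B * \<eta> + Kb * \<beta>"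
    if j: "j < J" for j
  proof -
    have Yj: "\<bar>y \<bullet> e j\<bar> \<le> norm y" for y using Cauchy_Schwarz_ineq2[of y "e j"] norm_e by simp
    have clip_id: "clip (y \<bullet> e j) = y \<bullet> e j" if "norm y \<le> B" for y
      using Yj[of y] that by (auto simp: clip_def abs_le_iff)
    have "average m (k_coord z h B j) \<omega> = (1 / (Kb * B)) * grid_mean m (\<lambda>u. ?k z u * (Y u \<omega> \<bullet> e j))"
      unfolding grid_mean_average grid_mean_mult[symmetric]
      unfolding grid_mean_def
      using clip_id[OF YB] by (intro arg_cong2[where f = scaleR] refl sum.cong) (simp add: k_coord_def \<rho>z K0k clip_def)
    moreover have "expectation (\<lambda>\<omega>. k_coord z h B j (X 0 \<omega>, Y 0 \<omega>)) = expectation (\<lambda>\<omega>. (1 / (Kb * B)) * (kz \<omega> * clip (Y 0 \<omega> \<bullet> e j)))"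
      by (rule Bochner_Integration.integral_cong) (auto simp: k_coord_def \<rho>z' K0V kz_def clip_def)
    ultimately have "\<bar>(1 / (Kb * B)) * (grid_mean m (\<lambda>u. ?k z u * (Y u \<omega> \<bullet> e j)) - expectation (\<lambda>\<omega>. kz \<omega> * clip (Y 0 \<omega> \<bullet> e j)))\<bar> \<le> \<eta>"
      using good[of "k_coord z h B j"] j by (simp add: tests_def right_diff_distrib)
    then have 1: "\<bar>grid_mean m (\<lambda>u. ?k z u * (Y u \<omega> \<bullet> e j)) - expectation (\<lambda>\<omega>. kz \<omega> * clip (Y 0 \<omega> \<bullet> e j))\<bar> \<le> Kb * B * \<eta>"
      using Kb(1) B0' unfolding abs_mult by (simp add: field_simps)
    have iY: "integrable M (\<lambda>\<omega>. kz \<omega> * (Y 0 \<omega> \<bullet> e j))"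
      unfolding kz_def using kernel_integral[OF z h(1), of "\<lambda>\<omega>. Y 0 \<omega> \<bullet> e j"] Y_int by simp
    have ic0: "integrable M (\<lambda>\<omega>. clip (Y 0 \<omega> \<bullet> e j))"
      by (rule integrable_bdd[where B = B]) (use B0' in \<open>auto simp: clip_def\<close>)
    have ic: "integrable M (\<lambda>\<omega>. kz \<omega> * clip (Y 0 \<omega> \<bullet> e j))"
      unfolding kz_def using kernel_integral[OF z h(1) ic0] by simp
    have iB: "integrable M (\<lambda>\<omega>. indicator {B..} (norm (Y 0 \<omega>)) * norm (Y 0 \<omega>))"
      using integrable_mult_bounded[OF integrable_norm[OF Y_int[of 0]], of "\<lambda>\<omega>. indicator {B..} (norm (Y 0 \<omega>))" 1]
      by (simp add: indicator_def)
    have "\<bar>expectation (\<lambda>\<omega>. kz \<omega> * clip (Y 0 \<omega> \<bullet> e j)) - expectation (\<lambda>\<omega>. kz \<omega> * (Y 0 \<omega> \<bullet> e j))\<bar>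
        = \<bar>expectation (\<lambda>\<omega>. kz \<omega> * clip (Y 0 \<omega> \<bullet> e j) - kz \<omega> * (Y 0 \<omega> \<bullet> e j))\<bar>"
      using iY ic by simp
    also have "\<dots> \<le> expectation (\<lambda>\<omega>. \<bar>kz \<omega> * clip (Y 0 \<omega> \<bullet> e j) - kz \<omega> * (Y 0 \<omega> \<bullet> e j)\<bar>)"
      by (rule integral_abs_bound)
    also have "\<dots> \<le> expectation (\<lambda>\<omega>. Kb * (indicator {B..} (norm (Y 0 \<omega>)) * norm (Y 0 \<omega>)))"
    proof (rule integral_mono[OF integrable_abs[OF Bochner_Integration.integrable_diff[OF ic iY]] integrable_mult_right[OF iB]])
      fix \<omega>' assume \<omega>': "\<omega>' \<in> space M"
      have c: "\<bar>clip (Y 0 \<omega>' \<bullet> e j) - Y 0 \<omega>' \<bullet> e j\<bar> \<le> indicator {B..} (norm (Y 0 \<omega>')) * norm (Y 0 \<omega>')"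
      proof (cases "norm (Y 0 \<omega>') \<le> B")
        case True
        then show ?thesis using clip_id[OF True] by (simp add: indicator_def)
      next
        case False
        then show ?thesis using Yj[of "Y 0 \<omega>'"] B0' by (auto simp: clip_def max_def min_def abs_le_iff)
      qed
      have "\<bar>kz \<omega>' * clip (Y 0 \<omega>' \<bullet> e j) - kz \<omega>' * (Y 0 \<omega>' \<bullet> e j)\<bar> = \<bar>kz \<omega>'\<bar> * \<bar>clip (Y 0 \<omega>' \<bullet> e j) - Y 0 \<omega>' \<bullet> e j\<bar>"
        by (simp add: abs_mult[symmetric] right_diff_distrib)
      also have "\<dots> \<le> Kb * (indicator {B..} (norm (Y 0 \<omega>')) * norm (Y 0 \<omega>'))"
        using c kz_b[OF \<omega>'] by (intro mult_mono) auto
      finally show "\<bar>kz \<omega>' * clip (Y 0 \<omega>' \<bullet> e j) - kz \<omega>' * (Y 0 \<omega>' \<bullet> e j)\<bar> \<le> Kb * (indicator {B..} (norm (Y 0 \<omega>')) * norm (Y 0 \<omega>'))" .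
    qed
    also have "\<dots> \<le> Kb * \<beta>" using EYB Kb(1) by simp
    finally show ?thesis using 1 by linarith
  qed
  \<comment> \<open>The closed layer is covered by the half-open one from h - 2s to h + s, whose
    mass is a difference of two small ball probabilities; hence the factor 3.\<close>
  have Pbd: "expectation (\<lambda>\<omega>. indicator {h - s..h + s} (V \<omega>)) \<le> 3 * CF * s"
  proof -
    have "expectation (\<lambda>\<omega>. indicator {h - s..h + s} (V \<omega>) :: real)
        \<le> expectation (\<lambda>\<omega>. indicator {\<omega> \<in> space M. V \<omega> \<le> h + s} \<omega> - indicator {\<omega> \<in> space M. V \<omega> \<le> h - 2 * s} \<omega>)"
    proof (rule integral_mono)
      show "integrable M (\<lambda>\<omega>. indicator {h - s..h + s} (V \<omega>) :: real)"
        by (rule integrable_bdd[where B = 1]) (auto simp: indicator_def)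
      show "integrable M (\<lambda>\<omega>. indicator {\<omega> \<in> space M. V \<omega> \<le> h + s} \<omega> - indicator {\<omega> \<in> space M. V \<omega> \<le> h - 2 * s} \<omega> :: real)"
        by (rule integrable_bdd[where B = 1]) (auto simp: indicator_def)
      show "indicator {h - s..h + s} (V \<omega>) \<le> (indicator {\<omega> \<in> space M. V \<omega> \<le> h + s} \<omega> - indicator {\<omega> \<in> space M. V \<omega> \<le> h - 2 * s} \<omega> :: real)"
        if "\<omega> \<in> space M" for \<omega>
        using that s by (auto simp: indicator_def)
    qed
    also have "\<dots> = F z (h + s) - F z (h - 2 * s)"
      using sets.Int_space_eq2[OF F_event[OF z, of 0]] F_event[OF z, of 0]
      by (subst Bochner_Integration.integral_diff)
        (auto simp: small_ball_def V_def less_top[symmetric] intro!: integrable_real_indicator)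
    also have "\<dots> \<le> CF * ((h + s) - (h - 2 * s))" using h s by (intro CF(2) z) auto
    finally show ?thesis by (simp add: algebra_simps)
  qed
  have a_in: "grid_mean m inn \<le> F z h + \<eta>"
  proof -
    have "average m (ind_test z 0 h) \<omega> = grid_mean m inn"
      unfolding grid_mean_average by (simp add: ind_test_def \<rho>z inn_def[abs_def])
    moreover have "expectation (\<lambda>\<omega>. ind_test z 0 h (X 0 \<omega>, Y 0 \<omega>)) = F z h"
    proof -
      have "expectation (\<lambda>\<omega>. ind_test z 0 h (X 0 \<omega>, Y 0 \<omega>)) = expectation (indicator {\<omega> \<in> space M. V \<omega> \<le> h})"
        by (rule Bochner_Integration.integral_cong) (auto simp: ind_test_def \<rho>z' V0 indicator_def)
      then show ?thesis
        using sets.Int_space_eq2[OF F_event[OF z, of 0 h]] by (simp add: small_ball_def V_def)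
    qed
    ultimately show ?thesis using good[of "ind_test z 0 h"] by (simp add: tests_def abs_le_iff)
  qed
  have a_bd: "grid_mean m bd \<le> 3 * CF * s + \<eta>"
  proof -
    have "average m (ind_test z (h - s) (h + s)) \<omega> = grid_mean m bd"
      unfolding grid_mean_average by (simp add: ind_test_def \<rho>z bd_def[abs_def])
    moreover have "expectation (\<lambda>\<omega>. ind_test z (h - s) (h + s) (X 0 \<omega>, Y 0 \<omega>)) = expectation (\<lambda>\<omega>. indicator {h - s..h + s} (V \<omega>))"
      by (rule Bochner_Integration.integral_cong) (auto simp: ind_test_def \<rho>z')
    ultimately show ?thesis using good[of "ind_test z (h - s) (h + s)"] Pbd by (simp add: tests_def abs_le_iff)
  qed
  have norm_test: "grid_mean m (\<lambda>u. indicator {a..b} (\<rho> (X u \<omega>) z) * norm (Y u \<omega>)) \<le>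
      expectation (\<lambda>\<omega>. indicator {a..b} (V \<omega>) * min B (norm (Y 0 \<omega>))) + B * \<eta>"
    if t: "ind_norm z a b B \<in> tests z h s B J" for a b
  proof -
    have "average m (ind_norm z a b B) \<omega> = (1 / B) * grid_mean m (\<lambda>u. indicator {a..b} (\<rho> (X u \<omega>) z) * norm (Y u \<omega>))"
      unfolding grid_mean_average grid_mean_mult[symmetric]
      unfolding grid_mean_def
      by (intro arg_cong2[where f = scaleR] refl sum.cong) (simp add: ind_norm_def \<rho>z min_absorb2[OF YB])
    moreover have "expectation (\<lambda>\<omega>. ind_norm z a b B (X 0 \<omega>, Y 0 \<omega>)) = expectation (\<lambda>\<omega>. (1 / B) * (indicator {a..b} (V \<omega>) * min B (norm (Y 0 \<omega>))))"
      by (rule Bochner_Integration.integral_cong) (auto simp: ind_norm_def \<rho>z')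
    ultimately have "(1 / B) * (grid_mean m (\<lambda>u. indicator {a..b} (\<rho> (X u \<omega>) z) * norm (Y u \<omega>))
        - expectation (\<lambda>\<omega>. indicator {a..b} (V \<omega>) * min B (norm (Y 0 \<omega>)))) \<le> \<eta>"
      using good[OF t] by (simp add: diff_divide_distrib abs_le_iff)
    then show ?thesis using B0' by (simp add: field_simps)
  qed
  have mi: "integrable M (\<lambda>\<omega>. indicator {a..b} (V \<omega>) * min B (norm (Y 0 \<omega>)) :: real)" for a b
    by (rule integrable_bdd[where B = B]) (use B0' in \<open>auto simp: indicator_def\<close>)
  have a_inY: "grid_mean m (\<lambda>u. inn u * norm (Y u \<omega>)) \<le> T * F z h + B * \<eta>"
  proof -
    have "expectation (\<lambda>\<omega>. indicator {0..h} (V \<omega>) * min B (norm (Y 0 \<omega>))) \<le> expectation (\<lambda>\<omega>. indicator {0..h} (V \<omega>) * norm (Y 0 \<omega>))"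
    proof (rule integral_mono[OF mi])
      show "integrable M (\<lambda>\<omega>. indicator {0..h} (V \<omega>) * norm (Y 0 \<omega>))"
        using integrable_mult_bounded[OF integrable_norm[OF Y_int[of 0]], of "\<lambda>\<omega>. indicator {0..h} (V \<omega>)" 1]
        by (simp add: indicator_def)
    qed (auto simp: indicator_def)
    also have "\<dots> \<le> C7 * R1 powr r * F z h" unfolding V_def using R1 h h\<delta> by (intro C7 z) auto
    also have "\<dots> \<le> T * F z h" using R1(3) F_bounds(1) by (rule mult_right_mono)
    finally show ?thesis using norm_test[of 0 h] by (simp add: tests_def inn_def)
  qed
  have a_bdY: "grid_mean m (\<lambda>u. bd u * norm (Y u \<omega>)) \<le> 3 * CF * (B * s) + B * \<eta>"
  proof -
    have "expectation (\<lambda>\<omega>. indicator {h - s..h + s} (V \<omega>) * min B (norm (Y 0 \<omega>))) \<le> expectation (\<lambda>\<omega>. B * indicator {h - s..h + s} (V \<omega>))"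
      by (rule integral_mono[OF mi], rule integrable_bdd[where B = B]) (use B0' in \<open>auto simp: indicator_def\<close>)
    also have "\<dots> \<le> B * (3 * CF * s)" using Pbd B0' by simp
    finally show ?thesis using norm_test[of "h - s" "h + s"] by (simp add: tests_def bd_def mult_ac)
  qed
  \<comment> \<open>Fluctuation of the vector-valued numerator: \<open>g2\<close> handles the first
    \<open>J\<close> coordinates, and the bounds \<open>q\<close> and \<open>q'\<close> the
    remaining ones.\<close>
  define w where "w = grid_mean m (\<lambda>u. ?k z u *\<^sub>R Y u \<omega>) - expectation (\<lambda>\<omega>. kz \<omega> *\<^sub>R Y 0 \<omega>)"
  have kYi: "integrable M (\<lambda>\<omega>. kz \<omega> *\<^sub>R Y 0 \<omega>)" unfolding kz_def by (rule kernel_integral[OF z h(1) Y_int])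
  have kq: "\<bar>?k z u\<bar> \<le> Kb" for u
    using k_b[of u] Kb(1) by (cases "\<rho> (X u \<omega>) z \<in> {0..h}") (auto simp: inn_def)
  have w_le: "norm w \<le> Kb * (J * B * \<eta>) + Kb * (J * \<beta> + q + q')"
  proof -
    have lin: "linear (tail_proj J)" by (rule bounded_linear.linear[OF tail_proj_bounded_linear])
    have wj: "\<bar>w \<bullet> e j\<bar> \<le> Kb * B * \<eta> + Kb * \<beta>" if "j < J" for j
    proof -
      have "linear (\<lambda>y. y \<bullet> e j)" by (rule bounded_linear.linear[OF bounded_linear_inner_left])
      from grid_mean_linear[OF this, of m "\<lambda>u. ?k z u *\<^sub>R Y u \<omega>"]
      have "w \<bullet> e j = grid_mean m (\<lambda>u. ?k z u * (Y u \<omega> \<bullet> e j)) - expectation (\<lambda>\<omega>. kz \<omega> * (Y 0 \<omega> \<bullet> e j))"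
        using integral_inner_left[of "e j" M "\<lambda>\<omega>. kz \<omega> *\<^sub>R Y 0 \<omega>"] kYi by (simp add: w_def inner_diff_left)
      then show ?thesis using g2[OF that] by simp
    qed
    have Q1: "norm (grid_mean m (\<lambda>u. ?k z u *\<^sub>R tail_proj J (Y u \<omega>))) \<le> Kb * q"
    proof -
      have "norm (grid_mean m (\<lambda>u. ?k z u *\<^sub>R tail_proj J (Y u \<omega>))) \<le> grid_mean m (\<lambda>u. Kb * q)"
        using kq YQ Kb(1) by (intro order_trans[OF norm_grid_mean_le grid_mean_mono]) (auto intro!: mult_mono)
      then show ?thesis by (simp add: grid_mean_const[OF m])
    qed
    have Qi: "integrable M (\<lambda>\<omega>. tail_proj J (Y 0 \<omega>))"
      by (rule integrable_bounded_linear[OF tail_proj_bounded_linear Y_int])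
    have Q2: "norm (expectation (\<lambda>\<omega>. kz \<omega> *\<^sub>R tail_proj J (Y 0 \<omega>))) \<le> Kb * q'"
    proof -
      have ki: "integrable M (\<lambda>\<omega>. kz \<omega> *\<^sub>R tail_proj J (Y 0 \<omega>))" unfolding kz_def by (rule kernel_integral[OF z h(1) Qi])
      have "norm (expectation (\<lambda>\<omega>. kz \<omega> *\<^sub>R tail_proj J (Y 0 \<omega>))) \<le> expectation (\<lambda>\<omega>. norm (kz \<omega> *\<^sub>R tail_proj J (Y 0 \<omega>)))"
        by (rule integral_norm_bound)
      also have "\<dots> \<le> expectation (\<lambda>\<omega>. Kb * norm (tail_proj J (Y 0 \<omega>)))"
        by (rule integral_mono[OF integrable_norm[OF ki] integrable_mult_right[OF integrable_norm[OF Qi]]])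
          (use kz_b in \<open>auto intro!: mult_right_mono\<close>)
      also have "\<dots> \<le> Kb * q'" using EYQ Kb(1) by simp
      finally show ?thesis .
    qed
    have "tail_proj J w = grid_mean m (\<lambda>u. ?k z u *\<^sub>R tail_proj J (Y u \<omega>)) - expectation (\<lambda>\<omega>. kz \<omega> *\<^sub>R tail_proj J (Y 0 \<omega>))"
      unfolding w_def linear_diff[OF lin] grid_mean_linear[OF lin] integral_bounded_linear[OF tail_proj_bounded_linear kYi, symmetric]
      by (simp add: linear_scale[OF lin])
    then have "norm (tail_proj J w) \<le> Kb * q + Kb * q'"
      using Q1 Q2 norm_triangle_ineq4[of "grid_mean m (\<lambda>u. ?k z u *\<^sub>R tail_proj J (Y u \<omega>))" "expectation (\<lambda>\<omega>. kz \<omega> *\<^sub>R tail_proj J (Y 0 \<omega>))"] by simp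
    moreover have "(\<Sum>j<J. \<bar>w \<bullet> e j\<bar>) \<le> (\<Sum>j<J. Kb * B * \<eta> + Kb * \<beta>)" by (intro sum_mono wj) simp
    ultimately show ?thesis using norm_le_coords[of w J] by (simp add: algebra_simps)
  qed
  \<comment> \<open>Three contributions at the net point: the fluctuation \<open>w\<close>, the
    fluctuation of the denominator times \<open>\<Psi> z\<close>, and the bias.\<close>
  have Nz: "norm (grid_mean m (\<lambda>u. ?k z u *\<^sub>R (Y u \<omega> - \<Psi> z))) \<le> 3 * Kb * \<epsilon> + CB * F z h * h"
  proof -
    have "grid_mean m (\<lambda>u. ?k z u *\<^sub>R (Y u \<omega> - \<Psi> z)) = grid_mean m (\<lambda>u. ?k z u *\<^sub>R Y u \<omega>) - grid_mean m (?k z) *\<^sub>R \<Psi> z"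
      unfolding scaleR_diff_right grid_mean_diff grid_mean_scaleR_left ..
    also have "\<dots> = w - (grid_mean m (?k z) - expectation kz) *\<^sub>R \<Psi> z + (expectation (\<lambda>\<omega>. kz \<omega> *\<^sub>R Y 0 \<omega>) - expectation kz *\<^sub>R \<Psi> z)"
      by (simp add: w_def scaleR_diff_left)
    also have "norm \<dots> \<le> norm w + \<bar>grid_mean m (?k z) - expectation kz\<bar> * norm (\<Psi> z)
        + norm (expectation (\<lambda>\<omega>. kz \<omega> *\<^sub>R Y 0 \<omega>) - expectation kz *\<^sub>R \<Psi> z)"
    proof -
      have "norm (a - t *\<^sub>R b + c) \<le> norm a + \<bar>t\<bar> * norm b + norm c" for a b c :: 'h and t
        using norm_triangle_ineq[of "a - t *\<^sub>R b" c] norm_triangle_ineq4[of a "t *\<^sub>R b"] by simp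
      then show ?thesis .
    qed
    also have "\<dots> \<le> (Kb * (J * B * \<eta>) + Kb * (J * \<beta> + q + q')) + Kb * (T * \<eta>) + CB * F z h * h"
    proof (intro add_mono w_le)
      have "\<bar>grid_mean m (?k z) - expectation kz\<bar> * norm (\<Psi> z) \<le> (Kb * \<eta>) * T"
        using g1 \<Psi>T by (intro mult_mono) auto
      then show "\<bar>grid_mean m (?k z) - expectation kz\<bar> * norm (\<Psi> z) \<le> Kb * (T * \<eta>)" by (simp add: mult_ac)
      show "norm (expectation (\<lambda>\<omega>. kz \<omega> *\<^sub>R Y 0 \<omega>) - expectation kz *\<^sub>R \<Psi> z) \<le> CB * F z h * h"
        unfolding kz_def by (rule CB(2)[OF z h(1) h\<delta>])
    qed
    also have "\<dots> \<le> (Kb * \<epsilon> + Kb * \<epsilon>) + Kb * \<epsilon> + CB * F z h * h"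
      using mult_left_mono[OF small(1), of Kb] mult_left_mono[OF small(6), of Kb] mult_left_mono[OF small(5), of Kb] Kb(1)
      by linarith
    finally show ?thesis by (simp add: algebra_simps)
  qed
  define \<sigma> where "\<sigma> = s / h"
  have \<sigma>: "0 \<le> \<sigma>" "\<sigma> \<le> 1" using h s by (auto simp: \<sigma>_def)
  have \<epsilon>0: "0 \<le> \<epsilon>" using small(3) B0' s by (meson less_imp_le mult_pos_pos order_trans)
  have s\<epsilon>: "s \<le> \<epsilon>" using small(3) B s mult_right_mono[OF B, of s] by linarith
  have \<eta>\<epsilon>: "\<eta> \<le> \<epsilon>" using small(2) \<eta> mult_right_mono[OF B, of \<eta>] by linarith
  define \<Delta> where "\<Delta> u = \<bar>?k x u - ?k z u\<bar>" for u
  have \<Delta>: "\<Delta> u \<le> LK * \<sigma> * inn u + 2 * Kb * bd u" for u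
  proof -
    have "\<bar>\<rho> (X u \<omega>) x - \<rho> (X u \<omega>) z\<bar> \<le> s" using \<rho>_diff[OF x z XS[OF \<omega>]] xz by (rule order_trans)
    then show ?thesis
      unfolding \<Delta>_def kern_def inn_def bd_def \<sigma>_def using h s r0 x z by (intro kernel_diff) auto
  qed
  define Fx where "Fx = F x h"
  define Fz where "Fz = F z h"
  have Fx0: "0 \<le> Fx" "0 \<le> Fz" by (simp_all add: Fx_def Fz_def F_bounds)
  have "\<bar>Fx - Fz\<bar> \<le> CF * \<rho> x z" unfolding Fx_def Fz_def using h h\<delta> by (intro CF x z) auto
  also have "\<dots> \<le> CF * s" using \<rho>_le[OF x z] xz CF(1) by (intro mult_left_mono) auto
  finally have Fxz: "Fz \<le> Fx + CF * s" "Fx \<le> Fz + CF * s" by (auto simp: abs_le_iff)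
  define C1 where "C1 = LK * (CF + 1) + 2 * Kb * (3 * CF + 1)"
  have C1: "0 \<le> C1" using LK(1) CF(1) Kb(1) by (simp add: C1_def)
  \<comment> \<open>One estimate for the change of centre in three weightings (t, u, v): (1,
    \<open>\<eta>\<close>, s) for plain weights, (T, T \<open>\<eta>\<close>, T s) against
    \<open>\<Psi> x\<close>, and (T, B \<open>\<eta>\<close>, B s) against the responses.\<close>
  have helper: "LK * \<sigma> * (t * Fz + u) + 2 * Kb * (3 * CF * v + u) \<le> LK * \<sigma> * t * Fx + C1 * \<epsilon>"
    if "0 \<le> t" "t * s \<le> \<epsilon>" "u \<le> \<epsilon>" "v \<le> \<epsilon>" for t u v
  proof -
    have "t * Fz + u \<le> t * Fx + (CF + 1) * \<epsilon>"
    proof -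
      have "t * Fz \<le> t * (Fx + CF * s)" using Fxz that(1) by (intro mult_left_mono) auto
      also have "\<dots> = t * Fx + CF * (t * s)" by (simp add: algebra_simps)
      also have "\<dots> \<le> t * Fx + CF * \<epsilon>" using that CF(1) by (intro add_left_mono mult_left_mono) auto
      finally show ?thesis using that by (simp add: algebra_simps)
    qed
    then have "LK * \<sigma> * (t * Fz + u) \<le> LK * \<sigma> * (t * Fx + (CF + 1) * \<epsilon>)"
      using LK(1) \<sigma> by (intro mult_left_mono) auto
    also have "\<dots> = LK * \<sigma> * t * Fx + \<sigma> * (LK * (CF + 1) * \<epsilon>)" by (simp add: algebra_simps)
    also have "\<sigma> * (LK * (CF + 1) * \<epsilon>) \<le> 1 * (LK * (CF + 1) * \<epsilon>)"
      using \<sigma> LK(1) CF(1) \<epsilon>0 by (intro mult_right_mono) auto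
    finally have 1: "LK * \<sigma> * (t * Fz + u) \<le> LK * \<sigma> * t * Fx + LK * (CF + 1) * \<epsilon>" by simp
    have "3 * CF * v + u \<le> 3 * CF * \<epsilon> + \<epsilon>" using that CF(1) by (intro add_mono mult_left_mono) auto
    then have "2 * Kb * (3 * CF * v + u) \<le> 2 * Kb * (3 * CF * \<epsilon> + \<epsilon>)" using Kb(1) by (intro mult_left_mono) auto
    with 1 show ?thesis by (simp add: C1_def algebra_simps)
  qed
  have H: "grid_mean m \<Delta> \<le> LK * \<sigma> * (Fz + \<eta>) + 2 * Kb * (3 * CF * s + \<eta>)"
  proof -
    have "grid_mean m \<Delta> \<le> grid_mean m (\<lambda>u. LK * \<sigma> * inn u + 2 * Kb * bd u)" by (intro grid_mean_mono \<Delta>)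
    also have "\<dots> = LK * \<sigma> * grid_mean m inn + 2 * Kb * grid_mean m bd" by (simp only: grid_mean_add grid_mean_mult)
    also have "\<dots> \<le> LK * \<sigma> * (Fz + \<eta>) + 2 * Kb * (3 * CF * s + \<eta>)"
      using a_in a_bd LK(1) \<sigma> Kb(1) unfolding Fz_def by (intro add_mono mult_left_mono) auto
    finally show ?thesis .
  qed
  have H1: "grid_mean m \<Delta> \<le> LK * \<sigma> * Fx + C1 * \<epsilon>"
    using H helper[of 1 \<eta> s] s\<epsilon> \<eta>\<epsilon> by simp
  have HT: "grid_mean m \<Delta> * T \<le> LK * \<sigma> * T * Fx + C1 * \<epsilon>"
  proof -
    have "grid_mean m \<Delta> * T \<le> (LK * \<sigma> * (Fz + \<eta>) + 2 * Kb * (3 * CF * s + \<eta>)) * T"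
      using H T by (intro mult_right_mono) auto
    also have "\<dots> = LK * \<sigma> * (T * Fz + T * \<eta>) + 2 * Kb * (3 * CF * (T * s) + T * \<eta>)" by (simp add: algebra_simps)
    also have "\<dots> \<le> LK * \<sigma> * T * Fx + C1 * \<epsilon>" using T small by (intro helper) auto
    finally show ?thesis .
  qed
  have HY: "grid_mean m (\<lambda>u. \<Delta> u * norm (Y u \<omega>)) \<le> LK * \<sigma> * T * Fx + C1 * \<epsilon>"
  proof -
    have "grid_mean m (\<lambda>u. \<Delta> u * norm (Y u \<omega>)) \<le> grid_mean m (\<lambda>u. LK * \<sigma> * (inn u * norm (Y u \<omega>)) + 2 * Kb * (bd u * norm (Y u \<omega>)))"
    proof (rule grid_mean_mono)
      fix u
      have "\<Delta> u * norm (Y u \<omega>) \<le> (LK * \<sigma> * inn u + 2 * Kb * bd u) * norm (Y u \<omega>)" by (intro mult_right_mono \<Delta>) auto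
      then show "\<Delta> u * norm (Y u \<omega>) \<le> LK * \<sigma> * (inn u * norm (Y u \<omega>)) + 2 * Kb * (bd u * norm (Y u \<omega>))"
        by (simp add: algebra_simps)
    qed
    also have "\<dots> = LK * \<sigma> * grid_mean m (\<lambda>u. inn u * norm (Y u \<omega>)) + 2 * Kb * grid_mean m (\<lambda>u. bd u * norm (Y u \<omega>))"
      by (simp only: grid_mean_add grid_mean_mult)
    also have "\<dots> \<le> LK * \<sigma> * (T * Fz + B * \<eta>) + 2 * Kb * (3 * CF * (B * s) + B * \<eta>)"
      using a_inY a_bdY LK(1) \<sigma> Kb(1) unfolding Fz_def by (intro add_mono mult_left_mono) auto
    also have "\<dots> \<le> LK * \<sigma> * T * Fx + C1 * \<epsilon>" using T small by (intro helper) auto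
    finally show ?thesis .
  qed
  have Kz: "\<bar>grid_mean m (?k z)\<bar> \<le> Kb * (Fz + \<eta>)"
  proof -
    have "\<bar>grid_mean m (?k z)\<bar> \<le> grid_mean m (\<lambda>u. Kb * inn u)"
      using norm_grid_mean_le[of m "?k z"] grid_mean_mono[of m "\<lambda>u. \<bar>?k z u\<bar>", OF k_b] by simp
    also have "\<dots> \<le> Kb * (Fz + \<eta>)" unfolding grid_mean_mult Fz_def using a_in Kb(1) by (intro mult_left_mono) auto
    finally show ?thesis .
  qed
  \<comment> \<open>The bias is linear in \<open>h\<close>; since h and r are at most 1, it can be
    merged with the Hoelder term of order h^r.\<close>
  have hr: "h \<le> h powr r" "h powr r \<le> 1"
    using h r powr_mono'[of r 1 h] powr_le1[of r h] by auto
  have Cp: "Cp = 3 * Kb + CB * (1 + CF) + 2 * LK + 2 * C1 + Kb * L\<Psi> * cs * (CF + 2) + cK * CF"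
    by (simp add: Cp_def C1_def)
  have nn: "0 \<le> CB * (1 + CF)" "0 \<le> Kb * L\<Psi> * cs * (CF + 2)" "0 \<le> cK * CF" "0 \<le> Kb" "0 \<le> LK"
    using CB(1) CF(1) Kb(1) \<Psi>(1) cs(1) cK(1) LK(1) by auto
  have Fz\<epsilon>: "Fz \<le> Fx + CF * \<epsilon>" using Fxz(1) mult_left_mono[OF s\<epsilon>, of CF] CF(1) by linarith
  have third: "\<bar>grid_mean m (?k z)\<bar> * norm (\<Psi> x - \<Psi> z) \<le> Kb * L\<Psi> * cs * (Fx * h powr r + (CF + 1) * \<epsilon>)"
  proof -
    have "norm (x - z) powr r \<le> s powr r" using xz r by (intro powr_mono2) auto
    then have "norm (x - z) powr r \<le> cs * h powr r" using cs(2) by linarith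
    then have "norm (\<Psi> x - \<Psi> z) \<le> L\<Psi> * (cs * h powr r)"
      using \<Psi>(2)[OF x z] mult_left_mono[OF _ \<Psi>(1)] by (meson order_trans)
    then have "\<bar>grid_mean m (?k z)\<bar> * norm (\<Psi> x - \<Psi> z) \<le> (Kb * (Fz + \<eta>)) * (L\<Psi> * (cs * h powr r))"
      using Kz by (intro mult_mono) auto
    also have "\<dots> = (Kb * L\<Psi> * cs) * ((Fz + \<eta>) * h powr r)" by (simp add: mult_ac)
    also have "\<dots> \<le> (Kb * L\<Psi> * cs) * (Fx * h powr r + (CF + 1) * \<epsilon>)"
    proof (rule mult_left_mono)
      have "(Fz + \<eta>) * h powr r \<le> (Fx + (CF + 1) * \<epsilon>) * h powr r"
        using Fz\<epsilon> \<eta>\<epsilon> by (intro mult_right_mono) (auto simp: algebra_simps)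
      also have "\<dots> = Fx * h powr r + ((CF + 1) * \<epsilon>) * h powr r" by (simp add: algebra_simps)
      also have "((CF + 1) * \<epsilon>) * h powr r \<le> ((CF + 1) * \<epsilon>) * 1"
        using hr CF(1) \<epsilon>0 by (intro mult_left_mono) auto
      finally show "(Fz + \<eta>) * h powr r \<le> Fx * h powr r + (CF + 1) * \<epsilon>" by simp
    qed (use Kb(1) \<Psi>(1) cs(1) in simp)
    finally show ?thesis .
  qed
  have bias: "CB * Fz * h \<le> CB * (Fx * h powr r + CF * \<epsilon>)"
  proof -
    have "Fz * h \<le> (Fx + CF * \<epsilon>) * h" using Fz\<epsilon> h by (intro mult_right_mono) auto
    also have "\<dots> = Fx * h + (CF * \<epsilon>) * h" by (simp add: algebra_simps)
    also have "\<dots> \<le> Fx * h powr r + (CF * \<epsilon>) * 1"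
      using hr h Fx0 CF(1) \<epsilon>0 by (intro add_mono mult_left_mono) auto
    finally show ?thesis using CB(1) mult_left_mono[of "Fz * h" _ CB] by (simp add: mult.assoc)
  qed
  show "norm (grid_mean m (\<lambda>u. ?k x u *\<^sub>R (Y u \<omega> - \<Psi> x))) \<le> Cp * (\<epsilon> + F x h * (T * s / h) + F x h * h powr r)"
  proof -
    let ?a = "grid_mean m (\<lambda>u. ?k z u *\<^sub>R (Y u \<omega> - \<Psi> z))"
    let ?b = "grid_mean m (\<lambda>u. (?k x u - ?k z u) *\<^sub>R Y u \<omega>)"
    let ?t = "grid_mean m (\<lambda>u. ?k x u - ?k z u)"
    let ?u = "grid_mean m (?k z)"
    \<comment> \<open>The centre is changed one factor at a time: the estimate at \<open>z\<close>,
      the change of weights on the responses, the change of weights on \<open>\<Psi> x\<close>, and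
      the old weights on the change of \<open>\<Psi>\<close>.\<close>
    have eq: "grid_mean m (\<lambda>u. ?k x u *\<^sub>R (Y u \<omega> - \<Psi> x)) = ?a + ?b - ?t *\<^sub>R \<Psi> x - ?u *\<^sub>R (\<Psi> x - \<Psi> z)"
      unfolding grid_mean_scaleR_left[symmetric] grid_mean_add[symmetric] grid_mean_diff[symmetric]
      by (simp add: algebra_simps)
    have tri: "norm (a + b - t *\<^sub>R c - u *\<^sub>R d) \<le> norm a + norm b + \<bar>t\<bar> * norm c + \<bar>u\<bar> * norm d" for a b c d :: 'h and t u
      using norm_triangle_ineq[of a b] norm_triangle_ineq4[of "a + b" "t *\<^sub>R c"]
        norm_triangle_ineq4[of "a + b - t *\<^sub>R c" "u *\<^sub>R d"] by simp
    have n1: "norm ?a \<le> 3 * Kb * \<epsilon> + CB * Fz * h" using Nz by (simp add: Fz_def)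
    have n2: "norm ?b \<le> LK * \<sigma> * T * Fx + C1 * \<epsilon>"
      using HY norm_grid_mean_le[of m "\<lambda>u. (?k x u - ?k z u) *\<^sub>R Y u \<omega>"] by (simp add: \<Delta>_def)
    have "\<bar>?t\<bar> \<le> grid_mean m \<Delta>"
      using norm_grid_mean_le[of m "\<lambda>u. ?k x u - ?k z u"] by (simp add: \<Delta>_def[abs_def])
    then have "\<bar>?t\<bar> * norm (\<Psi> x) \<le> grid_mean m \<Delta> * T"
      using \<Psi>T(1) by (intro mult_mono) (auto intro: order_trans[OF abs_ge_zero])
    then have n3: "\<bar>?t\<bar> * norm (\<Psi> x) \<le> LK * \<sigma> * T * Fx + C1 * \<epsilon>" using HT by linarith
    have "norm (grid_mean m (\<lambda>u. ?k x u *\<^sub>R (Y u \<omega> - \<Psi> x))) \<le>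
        (3 * Kb * \<epsilon> + CB * Fz * h) + (LK * \<sigma> * T * Fx + C1 * \<epsilon>) + (LK * \<sigma> * T * Fx + C1 * \<epsilon>)
        + Kb * L\<Psi> * cs * (Fx * h powr r + (CF + 1) * \<epsilon>)"
      unfolding eq by (rule order_trans[OF tri]) (rule add_mono[OF add_mono[OF add_mono[OF n1 n2] n3] third])
    also have "\<dots> \<le> Cp * \<epsilon> + Cp * (Fx * (T * \<sigma>)) + Cp * (Fx * h powr r)"
    proof -
      have A1: "(3 * Kb + CB * CF + 2 * C1 + Kb * L\<Psi> * cs * (CF + 1)) * \<epsilon> \<le> Cp * \<epsilon>"
        using \<epsilon>0 nn CB(1) Kb(1) \<Psi>(1) cs(1) unfolding Cp by (intro mult_right_mono) (auto simp: algebra_simps)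
      have A2: "(2 * LK) * (Fx * (T * \<sigma>)) \<le> Cp * (Fx * (T * \<sigma>))"
        using Fx0 T \<sigma> nn C1 unfolding Cp by (intro mult_right_mono) auto
      have A3: "(CB + Kb * L\<Psi> * cs) * (Fx * h powr r) \<le> Cp * (Fx * h powr r)"
      proof (rule mult_right_mono)
        have "CB * 1 \<le> CB * (1 + CF)" "(Kb * L\<Psi> * cs) * 1 \<le> (Kb * L\<Psi> * cs) * (CF + 2)"
          using CB(1) CF(1) Kb(1) \<Psi>(1) cs(1) by (intro mult_left_mono; simp)+
        then show "CB + Kb * L\<Psi> * cs \<le> Cp" unfolding Cp using nn C1 by linarith
      qed (use Fx0 in simp)
      show ?thesis using A1 A2 A3 bias by (simp add: algebra_simps)
    qed
    finally show ?thesis by (simp add: Fx_def \<sigma>_def distrib_left)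
  qed
  show "cK * F x h - Cp * (\<epsilon> + F x h * (s / h)) \<le> grid_mean m (?k x)"
  proof -
    have "\<bar>grid_mean m (?k x) - grid_mean m (?k z)\<bar> \<le> grid_mean m \<Delta>"
      using norm_grid_mean_le[of m "\<lambda>u. ?k x u - ?k z u"] by (simp add: \<Delta>_def[abs_def] grid_mean_diff)
    moreover have "cK * Fz \<le> expectation kz" unfolding Fz_def kz_def by (rule cK(2)[OF z h(1) h\<delta>])
    moreover have "cK * Fx \<le> cK * Fz + cK * CF * \<epsilon>"
    proof -
      have "Fx \<le> Fz + CF * \<epsilon>" using Fxz(2) mult_left_mono[OF s\<epsilon>, of CF] CF(1) by linarith
      then have "cK * Fx \<le> cK * (Fz + CF * \<epsilon>)" using cK(1) by (intro mult_left_mono) auto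
      then show ?thesis by (simp add: algebra_simps)
    qed
    moreover have "Kb * \<eta> \<le> Kb * \<epsilon>" using \<eta>\<epsilon> Kb(1) by (intro mult_left_mono) auto
    ultimately have *: "cK * Fx - (cK * CF + Kb + C1) * \<epsilon> - LK * (Fx * \<sigma>) \<le> grid_mean m (?k x)"
      using g1 H1 by (simp add: algebra_simps abs_le_iff)
    have "(cK * CF + Kb + C1) * \<epsilon> \<le> Cp * \<epsilon>" "LK * (Fx * \<sigma>) \<le> Cp * (Fx * \<sigma>)"
      using \<epsilon>0 Fx0 \<sigma> nn C1 unfolding Cp by (intro mult_right_mono; simp)+
    with * show ?thesis by (simp add: Fx_def \<sigma>_def distrib_left)
  qed
qed

section \<open>Tails of the response: high coordinates and large norms\<close>

lemma tail_proj_coord: "tail_proj J y \<bullet> e j = (if j < J then 0 else y \<bullet> e j)"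
  by (simp add: tail_proj_def inner_diff_left inner_sum_left e_inner if_distrib cong: if_cong)

lemma tail_proj_norm: "norm (tail_proj J y) \<le> norm y"
proof (rule power2_le_imp_le)
  show "(norm (tail_proj J y))\<^sup>2 \<le> (norm y)\<^sup>2"
    using parseval[OF e, of "tail_proj J y"] parseval[OF e, of y]
    by (rule sums_le[rotated]) (simp add: tail_proj_coord)
qed simp

lemma tail_proj_measurable [measurable]: "(\<lambda>\<omega>. tail_proj J (Y s \<omega>)) \<in> borel_measurable M"
  using integrable_bounded_linear[OF tail_proj_bounded_linear Y_int, of J s] by simp

text \<open>The geometric sum of the bounds d0 exp(-d1 j) on the second moments of the coordinates;
  a start at \<open>J\<close> contributes the separate factor exp(-d1 J).\<close>

definition Cq :: real where "Cq = d0 / (1 - exp (- d1))"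

lemma Cq_pos: "0 < Cq"
  using coord(1,2) by (simp add: Cq_def)

lemma tail_proj_sq_integrable: "integrable M (\<lambda>\<omega>. (norm (tail_proj J (Y s \<omega>)))\<^sup>2)"
  by (rule Bochner_Integration.integrable_bound[OF Y2[of s]])
    (auto intro!: AE_I2 power_mono tail_proj_norm)

text \<open>Parseval and dominated convergence exchange expectation and coordinate sum; coordinates
  below \<open>J\<close> vanish and the others are dominated by a geometric series.\<close>

lemma tail_proj_second_moment:
  "expectation (\<lambda>\<omega>. (norm (tail_proj J (Y s \<omega>)))\<^sup>2) \<le> Cq * exp (- d1 * J)"
proof -
  let ?f = "\<lambda>K \<omega>. \<Sum>j<K. (tail_proj J (Y s \<omega>) \<bullet> e j)\<^sup>2"
  have le: "?f K \<omega> \<le> (norm (tail_proj J (Y s \<omega>)))\<^sup>2" for K \<omega>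
    using sum_le_suminf[OF sums_summable[OF parseval[OF e]], of "{..<K}" "tail_proj J (Y s \<omega>)"]
      sums_unique[OF parseval[OF e, of "tail_proj J (Y s \<omega>)"]] by simp
  have lim: "(\<lambda>K. expectation (?f K)) \<longlonglongrightarrow> expectation (\<lambda>\<omega>. (norm (tail_proj J (Y s \<omega>)))\<^sup>2)"
  proof (rule integral_dominated_convergence[OF _ _ tail_proj_sq_integrable])
    show "AE \<omega> in M. (\<lambda>K. ?f K \<omega>) \<longlonglongrightarrow> (norm (tail_proj J (Y s \<omega>)))\<^sup>2"
      using parseval[OF e] by (intro AE_I2) (simp add: sums_def)
    show "AE \<omega> in M. norm (?f K \<omega>) \<le> (norm (tail_proj J (Y s \<omega>)))\<^sup>2" for K
      using le by (intro AE_I2) (simp add: sum_nonneg)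
  qed measurable
  have r: "0 < exp (- d1)" "exp (- d1) < 1" using coord(2) by auto
  have bound: "expectation (?f K) \<le> Cq * exp (- d1 * J)" for K
  proof -
    have ci: "integrable M (\<lambda>\<omega>. (tail_proj J (Y s \<omega>) \<bullet> e j)\<^sup>2)" for j
      by (rule Bochner_Integration.integrable_bound[OF tail_proj_sq_integrable[of J s]])
        (use Cauchy_Schwarz_ineq[of _ "e j"] in \<open>auto intro!: AE_I2 simp: power2_norm_eq_inner e_inner\<close>)
    have "expectation (?f K) = (\<Sum>j<K. expectation (\<lambda>\<omega>. (tail_proj J (Y s \<omega>) \<bullet> e j)\<^sup>2))"
      using ci by (rule Bochner_Integration.integral_sum)
    also have "\<dots> \<le> (\<Sum>j<K. if j < J then 0 else d0 * exp (- d1) ^ j)"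
    proof (rule sum_mono)
      fix j
      have "exp (- d1 * real j) = exp (- d1) ^ j" by (simp add: exp_of_nat_mult[symmetric] mult.commute)
      then show "expectation (\<lambda>\<omega>. (tail_proj J (Y s \<omega>) \<bullet> e j)\<^sup>2) \<le> (if j < J then 0 else d0 * exp (- d1) ^ j)"
        using coord(3)[of s j] by (simp add: tail_proj_coord)
    qed
    \<comment> \<open>Summing up to J + K makes the index shift by \<open>J\<close> exact whether or
      not \<open>K\<close> exceeds \<open>J\<close>.\<close>
    also have "\<dots> \<le> (\<Sum>j<J + K. if j < J then 0 else d0 * exp (- d1) ^ j)"
      using coord(1) by (intro sum_mono2) auto
    also have "\<dots> = (\<Sum>j<K. d0 * exp (- d1) ^ (J + j))"
    proof -
      have "(\<Sum>j<J + K. if j < J then 0 else d0 * exp (- d1) ^ j) = (\<Sum>j\<in>{J..<J + K}. d0 * exp (- d1) ^ j)"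
        by (rule sum.mono_neutral_cong_right) auto
      also have "\<dots> = (\<Sum>j<K. d0 * exp (- d1) ^ (J + j))"
        using sum.shift_bounds_nat_ivl[of "\<lambda>j. d0 * exp (- d1) ^ j" 0 J K] by (simp add: add.commute lessThan_atLeast0)
      finally show ?thesis .
    qed
    also have "\<dots> = d0 * exp (- d1) ^ J * (\<Sum>j<K. exp (- d1) ^ j)"
      by (simp add: power_add sum_distrib_left mult_ac)
    also have "\<dots> \<le> d0 * exp (- d1) ^ J * (1 / (1 - exp (- d1)))"
    proof (rule mult_left_mono)
      show "(\<Sum>j<K. exp (- d1) ^ j) \<le> 1 / (1 - exp (- d1))"
        using sum_le_suminf[OF summable_geometric[of "exp (- d1)"], of "{..<K}"] r by (simp add: suminf_geometric)
    qed (use coord(1) in simp)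
    also have "\<dots> = Cq * exp (- d1) ^ J" by (simp add: Cq_def)
    also have "exp (- d1) ^ J = exp (- d1 * J)" by (simp add: exp_of_nat_mult[symmetric] mult.commute)
    finally show ?thesis .
  qed
  show ?thesis by (rule LIMSEQ_le_const2[OF lim]) (use bound in auto)
qed

text \<open>Chebyshev's inequality at the level 1/I, whence the factor I^2.\<close>

lemma tail_proj_prob:
  assumes I: "0 < I"
  shows "prob {\<omega> \<in> space M. 1 / I \<le> norm (tail_proj J (Y s \<omega>))} \<le> I\<^sup>2 * (Cq * exp (- d1 * J))"
proof -
  let ?A = "{\<omega> \<in> space M. 1 / I \<le> norm (tail_proj J (Y s \<omega>))}"
  have "prob ?A = expectation (indicator ?A)" by (simp add: Int_def conj_commute cong: conj_cong)
  also have "\<dots> \<le> expectation (\<lambda>\<omega>. I\<^sup>2 * (norm (tail_proj J (Y s \<omega>)))\<^sup>2)"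
  proof (rule integral_mono[OF _ integrable_mult_right[OF tail_proj_sq_integrable]])
    show "integrable M (indicator ?A :: 'w \<Rightarrow> real)" by (intro integrable_real_indicator) (auto simp: less_top[symmetric])
    fix \<omega>
    show "indicator ?A \<omega> \<le> I\<^sup>2 * (norm (tail_proj J (Y s \<omega>)))\<^sup>2"
    proof (cases "\<omega> \<in> ?A")
      case True
      then have "1 \<le> I * norm (tail_proj J (Y s \<omega>))" using I by (simp add: field_simps)
      then have "1 \<le> (I * norm (tail_proj J (Y s \<omega>)))\<^sup>2" by (rule one_le_power)
      then show ?thesis using True by (simp add: power_mult_distrib)
    qed simp
  qed
  also have "\<dots> \<le> I\<^sup>2 * (Cq * exp (- d1 * J))" using tail_proj_second_moment[of J s] by (simp add: mult_left_mono)
  finally show ?thesis .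
qed

text \<open>A weighted form of the arithmetic-geometric mean inequality. It trades first moments for
  second moments without square roots.\<close>

lemma le_sq_scaled: "y \<le> a * y\<^sup>2 + 1 / a" if "0 < a" for y a :: real
proof -
  have "0 \<le> (a * y - 1)\<^sup>2 + (a * y)\<^sup>2 + 1" by simp
  then have "2 * (a * y) \<le> 2 * (a * y)\<^sup>2 + 2" by (simp add: power2_diff)
  then have "a * y \<le> a * (a * y\<^sup>2 + 1 / a)" using that by (simp add: power2_eq_square algebra_simps)
  then show ?thesis using that by simp
qed

lemma tail_proj_mean:
  assumes I: "0 < I"
  shows "expectation (\<lambda>\<omega>. norm (tail_proj J (Y s \<omega>))) \<le> I * (Cq * exp (- d1 * J)) + 1 / I"
proof -
  have "expectation (\<lambda>\<omega>. norm (tail_proj J (Y s \<omega>))) \<le> expectation (\<lambda>\<omega>. I * (norm (tail_proj J (Y s \<omega>)))\<^sup>2 + 1 / I)"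
    by (intro integral_mono integrable_norm integrable_bounded_linear[OF tail_proj_bounded_linear Y_int]
        Bochner_Integration.integrable_add integrable_mult_right tail_proj_sq_integrable le_sq_scaled I) simp
  also have "\<dots> = I * expectation (\<lambda>\<omega>. (norm (tail_proj J (Y s \<omega>)))\<^sup>2) + 1 / I"
    using tail_proj_sq_integrable[of J s] by (simp add: prob_space)
  also have "\<dots> \<le> I * (Cq * exp (- d1 * J)) + 1 / I" using tail_proj_second_moment[of J s] I by simp
  finally show ?thesis .
qed

text \<open>On the tail event the norm is at most its square over I plus I, by
  \<open>le_sq_scaled\<close> with a = 1/I. Off the event the integrand vanishes, so I is multiplied
  by the exponentially small tail probability.\<close>

lemma truncation_mean:
  assumes I: "0 < I" and B: "1 \<le> B"
  shows "expectation (\<lambda>\<omega>. indicator {B..} (norm (Y s \<omega>)) * norm (Y s \<omega>)) \<le>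
    expectation (\<lambda>\<omega>. (norm (Y s \<omega>))\<^sup>2) / I + I * (\<kappa>0 * exp (- \<kappa>1 * B))"
proof -
  let ?A = "{\<omega> \<in> space M. B \<le> norm (Y s \<omega>)}"
  have Ai: "integrable M (indicator ?A :: 'w \<Rightarrow> real)" by (intro integrable_real_indicator) (auto simp: less_top[symmetric])
  have "expectation (\<lambda>\<omega>. indicator {B..} (norm (Y s \<omega>)) * norm (Y s \<omega>)) \<le>
      expectation (\<lambda>\<omega>. (1 / I) * (norm (Y s \<omega>))\<^sup>2 + I * indicator ?A \<omega>)"
  proof (rule integral_mono)
    show "integrable M (\<lambda>\<omega>. indicator {B..} (norm (Y s \<omega>)) * norm (Y s \<omega>))"
      using integrable_mult_bounded[OF integrable_norm[OF Y_int[of s]], of "\<lambda>\<omega>. indicator {B..} (norm (Y s \<omega>))" 1]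
      by (simp add: indicator_def)
    show "integrable M (\<lambda>\<omega>. (1 / I) * (norm (Y s \<omega>))\<^sup>2 + I * indicator ?A \<omega>)"
      by (intro Bochner_Integration.integrable_add integrable_mult_right Y2 Ai)
    show "indicator {B..} (norm (Y s \<omega>)) * norm (Y s \<omega>) \<le> (1 / I) * (norm (Y s \<omega>))\<^sup>2 + I * indicator ?A \<omega>"
      if "\<omega> \<in> space M" for \<omega>
      using le_sq_scaled[of "1 / I" "norm (Y s \<omega>)"] I that by (auto simp: indicator_def)
  qed
  also have "\<dots> = (1 / I) * expectation (\<lambda>\<omega>. (norm (Y s \<omega>))\<^sup>2) + I * prob ?A"
    using Ai Y2[of s] by (simp add: Int_def conj_commute cong: conj_cong)
  also have "\<dots> \<le> (1 / I) * expectation (\<lambda>\<omega>. (norm (Y s \<omega>))\<^sup>2) + I * (\<kappa>0 * exp (- \<kappa>1 * B))"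
    using tail(3)[OF B, of s] I by (intro add_left_mono mult_left_mono) auto
  finally show ?thesis by simp
qed

section \<open>Lipschitz balls, the estimator as a quotient, and the rates\<close>

lemma Lip_ball_nonempty: "0 \<le> R \<Longrightarrow> origin \<in> Lip_ball D cls R"
  by (auto simp: Lip_ball_def origin_def C0_def norm1_C0_def bot_ennreal[symmetric] intro!: image_eqI[of _ _ "\<lambda>_. 0"] SUP_least)

lemma Lip_ball_norm:
  assumes "x \<in> Lip_ball D cls R" "0 \<le> R"
  shows "norm (x - origin) \<le> sqrt (measure \<nu> D) * R" "ess_norm \<nu> cls x \<le> ereal R"
proof -
  obtain f where f: "f \<in> C0 D" "norm1_C0 D f \<le> ennreal R" "x = cls f" using assms(1) by (auto simp: Lip_ball_def)
  have b: "\<bar>f u\<bar> \<le> R" if "u \<in> D" for u by (rule norm1_C0_bound[OF f(2) assms(2) that])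
  show "norm (x - origin) \<le> sqrt (measure \<nu> D) * R"
    unfolding f(3) origin_def using b assms(2) f(1) by (intro norm_cls_diff) (auto simp: C0_def)
  show "ess_norm \<nu> cls x \<le> ereal R" unfolding f(3) by (rule ess_norm_le[OF f(1) b])
qed

text \<open>Division by zero yields 0, so \<open>rate1\<close> is informative only when this infimum
  is positive. The upper bound 1 makes the undivided numerator no larger than
  \<open>rate1\<close>.\<close>

lemma INF_small_ball:
  assumes R: "0 < R" and h: "0 < h" "h \<le> \<delta>0"
  shows "0 < (INF x\<in>Lip_ball D cls R. F x h)" "(INF x\<in>Lip_ball D cls R. F x h) \<le> 1"
    "\<And>x. x \<in> Lip_ball D cls R \<Longrightarrow> (INF x\<in>Lip_ball D cls R. F x h) \<le> F x h"
proof -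
  have bdd: "bdd_below ((\<lambda>x. F x h) ` Lip_ball D cls R)" by (rule bdd_belowI[of _ 0]) (auto simp: F_bounds)
  show low: "(INF x\<in>Lip_ball D cls R. F x h) \<le> F x h" if "x \<in> Lip_ball D cls R" for x by (rule cINF_lower[OF bdd that])
  have o: "origin \<in> Lip_ball D cls R" using R by (intro Lip_ball_nonempty) simp
  show "(INF x\<in>Lip_ball D cls R. F x h) \<le> 1" using low[OF o] F_bounds(2)[of origin h] by linarith
  show "0 < (INF x\<in>Lip_ball D cls R. F x h)"
  proof (rule Lip_ball_Inf_pos[OF R, where L = CF])
    show "Lip_ball D cls R \<noteq> {}" using o by blast
    show "0 < F x h" if "x \<in> cls ` C0 D" for x using that S h by (intro F_pos) auto
    show "\<bar>F x h - F y h\<bar> \<le> CF * norm (x - y)" if "x \<in> cls ` C0 D" "y \<in> cls ` C0 D" for x y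
    proof -
      have xy: "x \<in> S" "y \<in> S" using that S by auto
      have "\<bar>F x h - F y h\<bar> \<le> CF * \<rho> x y" using h xy by (intro CF) auto
      also have "\<dots> \<le> CF * norm (x - y)" using \<rho>_le[OF xy] CF(1) by (intro mult_left_mono) auto
      finally show ?thesis .
    qed
  qed
qed

text \<open>The normalization by |I| and \<open>F x h\<close> cancels in the quotient, and
  \<open>\<Psi> x\<close> moves inside the weighted mean; a positive denominator excludes the
  default value of the quotient.\<close>

lemma Psi_hat_diff:
  assumes m: "0 < card (grid m)" and F: "0 < F x h" and den: "0 < grid_mean m (\<lambda>s. K (\<rho> (X s \<omega>) x / h))"
  shows "Psi_hat M \<rho> K X Y m h x \<omega> - \<Psi> x =
    grid_mean m (\<lambda>s. K (\<rho> (X s \<omega>) x / h) *\<^sub>R (Y s \<omega> - \<Psi> x)) /\<^sub>R grid_mean m (\<lambda>s. K (\<rho> (X s \<omega>) x / h))"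
proof -
  let ?k = "\<lambda>s. K (\<rho> (X s \<omega>) x / h)"
  have f: "f_hat M \<rho> K X m h x \<omega> = grid_mean m ?k / F x h"
    by (simp add: f_hat_def grid_mean_def divide_inverse_commute mult_ac)
  have g: "g_hat M \<rho> K X Y m h x \<omega> = grid_mean m (\<lambda>s. ?k s *\<^sub>R Y s \<omega>) /\<^sub>R F x h"
    by (simp add: g_hat_def grid_mean_def divide_inverse_commute mult_ac)
  have 1: "Psi_hat M \<rho> K X Y m h x \<omega> = grid_mean m (\<lambda>s. ?k s *\<^sub>R Y s \<omega>) /\<^sub>R grid_mean m ?k"
    unfolding Psi_hat_def f g using F by (simp add: inverse_eq_divide)
  have 2: "\<Psi> x = (grid_mean m ?k *\<^sub>R \<Psi> x) /\<^sub>R grid_mean m ?k" using den by simp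
  have "Psi_hat M \<rho> K X Y m h x \<omega> - \<Psi> x =
      (grid_mean m (\<lambda>s. ?k s *\<^sub>R Y s \<omega>) - grid_mean m ?k *\<^sub>R \<Psi> x) /\<^sub>R grid_mean m ?k"
    unfolding 1 scaleR_diff_right using 2 by simp
  then show ?thesis unfolding scaleR_diff_right grid_mean_diff grid_mean_scaleR_left by (simp add: scaleR_diff_right)
qed

text \<open>The numerator of \<open>rate1\<close>, with the power of |I| moved up; absolute errors
  are measured in it.\<close>

definition main_rate :: "(nat ^ 'n \<Rightarrow> real) \<Rightarrow> nat ^ 'n \<Rightarrow> real" where
  "main_rate R m = R m powr (5 * real CARD('d) / 2) * ln (real (card (grid m))) ^ 7 * mesh (real CARD('d)) m"

lemma rate1_eq: "rate1 M \<rho> X D cls R h m = main_rate R m / (INF x\<in>Lip_ball D cls (R m). F x (h m))"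
  unfolding rate1_def main_rate_def mesh_def powr_minus_divide
  by (simp only: times_divide_eq_right mult_1_right divide_divide_eq_left)

lemma rate2_eq: "rate2 TYPE('d) r R h m = R m powr r * (mesh (real CARD('d)) m / h m)"
  unfolding rate2_def mesh_def powr_minus_divide
  by (simp only: times_divide_eq_right mult_1_right divide_divide_eq_left)

text \<open>The mesh is a power of 1/|I| with exponent at most 1. This absorbs truncation errors of
  order 1/|I|.\<close>

lemma mesh_ge_inverse:
  assumes "0 < card (grid m)" shows "1 / real (card (grid m)) \<le> mesh (real CARD('d)) (m :: nat ^ 'n)"
proof -
  have I: "1 \<le> real (card (grid m))" using assms by linarith
  have N: "1 \<le> real CARD('n)" by (simp add: Suc_le_eq)
  have "1 / real CARD('n) \<le> 1" "2 / (5 * real CARD('d) + 2) \<le> 1" using N by auto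
  then have "1 / real CARD('n) * (2 / (5 * real CARD('d) + 2)) \<le> 1" by (intro mult_le_one) auto
  then have "real (card (grid m)) powr - 1 \<le> mesh (real CARD('d)) m"
    unfolding mesh_def using I by (intro powr_mono) auto
  then show ?thesis using I by (simp add: powr_minus_divide)
qed

text \<open>Count of powers of |I|: N + 2 for the Borel-Cantelli argument and one for the union over
  the sites. The coordinate tail needs two more, since Chebyshev's inequality at level 1/|I| costs
  |I|^2.\<close>

lemma truncation_event:
  fixes n :: "nat \<Rightarrow> nat ^ 'n" and B :: "nat ^ 'n \<Rightarrow> real" and J :: "nat ^ 'n \<Rightarrow> nat"
  assumes n: "converges_to_infinity n" and B: "\<And>m. 1 \<le> B m"
    and eB: "\<And>m. 0 < card (grid m) \<Longrightarrow> exp (- \<kappa>1 * B m) \<le> 1 / real (card (grid m)) ^ (CARD('n) + 3)"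
    and eJ: "\<And>m. 0 < card (grid m) \<Longrightarrow> exp (- d1 * J m) \<le> 1 / real (card (grid m)) ^ (CARD('n) + 5)"
  shows "AE \<omega> in M. \<forall>\<^sub>F k in sequentially. \<forall>u\<in>grid (n k).
    norm (Y u \<omega>) \<le> B (n k) \<and> norm (tail_proj (J (n k)) (Y u \<omega>)) \<le> 1 / real (card (grid (n k)))"
proof -
  define I where "I m = real (card (grid m))" for m :: "nat ^ 'n"
  define A where "A m u = {\<omega> \<in> space M. B m \<le> norm (Y u \<omega>)} \<union> {\<omega> \<in> space M. 1 / I m \<le> norm (tail_proj (J m) (Y u \<omega>))}" for m u
  define E where "E m = (\<Union>u\<in>grid m. A m u)" for m
  have Am [measurable]: "A m u \<in> sets M" for m u unfolding A_def by measurable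
  have Em: "E m \<in> sets M" for m unfolding E_def by (intro sets.finite_UN) auto
  have "AE \<omega> in M. \<forall>\<^sub>F k in sequentially. \<omega> \<notin> E (n k)"
  proof (rule lattice_borel_cantelli[OF n Em, of "\<kappa>0 + Cq"])
    show "0 \<le> \<kappa>0 + Cq" using tail(1) Cq_pos by simp
    have "\<forall>\<^sub>F k in sequentially. 1 \<le> card (grid (n k))"
      using converges_to_infinity_card[OF n] unfolding filterlim_at_top by blast
    then show "\<forall>\<^sub>F k in sequentially. prob (E (n k)) \<le> (\<kappa>0 + Cq) / real (card (grid (n k))) ^ (CARD('n) + 2)"
    proof eventually_elim
      case (elim k)
      define m where "m = n k"
      have m: "0 < card (grid m)" using elim by (simp add: m_def)
      then have I0: "0 < I m" unfolding I_def by linarith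
      have "prob (A m u) \<le> (\<kappa>0 + Cq) / I m ^ (CARD('n) + 3)" for u
      proof -
        have "prob (A m u) \<le> prob {\<omega> \<in> space M. B m \<le> norm (Y u \<omega>)} + prob {\<omega> \<in> space M. 1 / I m \<le> norm (tail_proj (J m) (Y u \<omega>))}"
          unfolding A_def by (rule measure_Un_le) auto
        also have "\<dots> \<le> \<kappa>0 * exp (- \<kappa>1 * B m) + (I m)\<^sup>2 * (Cq * exp (- d1 * J m))"
          by (intro add_mono tail(3) B tail_proj_prob I0)
        also have "\<dots> \<le> \<kappa>0 * (1 / I m ^ (CARD('n) + 3)) + (I m)\<^sup>2 * (Cq * (1 / I m ^ (CARD('n) + 5)))"
          using eB[OF m] eJ[OF m] tail(1) Cq_pos unfolding I_def by (intro add_mono mult_left_mono) auto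
        also have "(I m)\<^sup>2 * (Cq * (1 / I m ^ (CARD('n) + 5))) = Cq * (1 / I m ^ (CARD('n) + 3))"
          using I0 by (simp add: power_add power_numeral_reduce field_simps)
        finally show ?thesis by (simp add: add_divide_distrib)
      qed
      note one = this
      have "prob (E m) \<le> (\<Sum>u\<in>grid m. prob (A m u))"
        unfolding E_def by (intro finite_measure_subadditive_finite) auto
      also have "\<dots> \<le> (\<Sum>u\<in>grid m. (\<kappa>0 + Cq) / I m ^ (CARD('n) + 3))" by (intro sum_mono one)
      also have "\<dots> = I m * ((\<kappa>0 + Cq) / I m ^ (CARD('n) + 3))" by (simp add: I_def)
      also have "\<dots> = (\<kappa>0 + Cq) / I m ^ (CARD('n) + 2)" using I0 by (simp add: power_add power_numeral_reduce field_simps)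
      finally show ?case by (simp add: m_def I_def)
    qed
  qed
  then show ?thesis
    using AE_space
  proof eventually_elim
    case (elim \<omega>)
    from elim(1) show ?case
      by (rule eventually_mono) (use elim(2) in \<open>auto simp: E_def A_def I_def not_le intro: less_imp_le\<close>)
  qed
qed

lemma rates_eventually:
  fixes n :: "nat \<Rightarrow> nat ^ 'n" and R h :: "nat ^ 'n \<Rightarrow> real"
  assumes R0: "0 < R0" "\<forall>\<^sub>F k in sequentially. R0 \<le> R (n k)"
    and h: "\<And>k. 0 < h (n k)" "(\<lambda>k. h (n k)) \<longlonglongrightarrow> 0"
  shows "\<forall>\<^sub>F k in sequentially. Lip_ball D cls (R (n k)) \<noteq> {} \<and>
      0 \<le> main_rate R (n k) \<and> main_rate R (n k) \<le> rate1 M \<rho> X D cls R h (n k) \<and> 0 \<le> rate2 TYPE('d) r R h (n k)"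
proof -
  have "\<forall>\<^sub>F k in sequentially. h (n k) < \<delta>0" using order_tendstoD(2)[OF h(2) \<delta>0] .
  with R0(2) show ?thesis
  proof eventually_elim
    case (elim k)
    have R: "0 < R (n k)" using R0(1) elim(1) by linarith
    note G = INF_small_ball[OF R h(1) less_imp_le[OF elim(2)]]
    have "0 \<le> ln (real c)" for c :: nat by (cases c) (simp_all add: ln_ge_zero)
    then have mr: "0 \<le> main_rate R (n k)" unfolding main_rate_def mesh_def by (intro mult_nonneg_nonneg zero_le_power) simp_all
    have "main_rate R (n k) * 1 \<le> main_rate R (n k) * (1 / (INF x\<in>Lip_ball D cls (R (n k)). F x (h (n k))))"
      using G(1,2) mr by (intro mult_left_mono) auto
    then have "main_rate R (n k) \<le> rate1 M \<rho> X D cls R h (n k)" by (simp add: rate1_eq)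
    moreover have "0 \<le> rate2 TYPE('d) r R h (n k)" unfolding rate2_eq mesh_def using h(1)[of k] by simp
    moreover have "origin \<in> Lip_ball D cls (R (n k))" using R by (intro Lip_ball_nonempty) simp
    ultimately show ?case using mr by blast
  qed
qed

text \<open>\<open>pointwise_bound\<close> is applied on the almost sure event where deviations at
  the net are small and the responses bounded; the constant is fixed before the sample point. The
  smallness of both rates keeps the denominator above half of \<open>cK * F x h\<close>.\<close>

lemma uniform_rate:
  fixes n :: "nat \<Rightarrow> nat ^ 'n" and R h :: "nat ^ 'n \<Rightarrow> real"
  assumes n: "converges_to_infinity n"
    and R0: "0 < R0" "\<forall>\<^sub>F k in sequentially. R0 \<le> R (n k)"
    and h: "\<And>k. 0 < h (n k)" "(\<lambda>k. h (n k)) \<longlonglongrightarrow> 0"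
    and r1: "(\<lambda>k. rate1 M \<rho> X D cls R h (n k)) \<longlonglongrightarrow> 0"
    and r2: "(\<lambda>k. rate2 TYPE('d) r R h (n k)) \<longlonglongrightarrow> 0"
  shows "\<exists>C. AE \<omega> in M. \<forall>\<^sub>F k in sequentially. \<forall>x\<in>Lip_ball D cls (R (n k)).
    norm (Psi_hat M \<rho> K X Y (n k) (h (n k)) x \<omega> - \<Psi> x) \<le>
      C * (rate1 M \<rho> X D cls R h (n k) + rate2 TYPE('d) r R h (n k) + h (n k) powr r)"
proof -
  let ?d = "real CARD('d)" and ?N = "real CARD('n)"
  define I where "I m = real (card (grid m))" for m :: "nat ^ 'n"
  define L where "L m = ln (I m)" for m
  define \<delta> where "\<delta> m = mesh ?d m" for m :: "nat ^ 'n"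
  define \<eta> where "\<eta> m = dev_level ?d r (R m) m" for m :: "nat ^ 'n"
  have d1': "1 \<le> ?d" by (simp add: Suc_le_eq)
  obtain A where A: "0 < A" and net: "\<And>R \<delta>. 0 < \<delta> \<Longrightarrow> \<delta> \<le> R \<Longrightarrow>
    \<exists>T\<subseteq>Lip_ball D cls R. finite T \<and> real (card T) \<le> exp ((A * (R / \<delta>)) ^ CARD('d) * ln (6 * (R / \<delta>))) \<and>
      (\<forall>x\<in>Lip_ball D cls R. \<exists>y\<in>T. norm (x - y) \<le> A * \<delta>)"
    using Lip_ball_net by blast
  \<comment> \<open>The cardinality and covering clauses are conditional, so that a suitable set
    exists for every box and can be chosen as a function of the box. The condition holds
    eventually.\<close>
  define is_net where "is_net m T \<longleftrightarrow> T \<subseteq> Lip_ball D cls (R m) \<and> finite T \<and> (0 < \<delta> m \<and> \<delta> m \<le> R m \<longrightarrow>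
      real (card T) \<le> exp ((A * (R m / \<delta> m)) ^ CARD('d) * ln (6 * (R m / \<delta> m))) \<and>
      (\<forall>x\<in>Lip_ball D cls (R m). \<exists>y\<in>T. norm (x - y) \<le> A * \<delta> m))" for m T
  have "\<exists>T. is_net m T" for m
  proof (cases "0 < \<delta> m \<and> \<delta> m \<le> R m")
    case True
    then show ?thesis unfolding is_net_def using net[of "\<delta> m" "R m"] by blast
  next
    case False
    then show ?thesis unfolding is_net_def by (intro exI[of _ "{}"]) auto
  qed
  then obtain Tn where Tn: "\<And>m. is_net m (Tn m)" by metis
  have Tn_sub: "Tn m \<subseteq> Lip_ball D cls (R m)" and Tn_fin: "finite (Tn m)" for m
    using Tn[of m] by (auto simp: is_net_def)
  \<comment> \<open>Truncation at \<open>\<beta>\<close> log|I| and (N + 5)/d1 log|I| coordinates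
    give the powers N + 3 and N + 5 that \<open>truncation_event\<close> asks for. The summand 1
    makes \<open>\<beta>\<close> at least 1, and in \<open>cJ\<close> it absorbs the rounding up of
    \<open>J\<close>.\<close>
  define \<beta> where "\<beta> = (?N + 3) / \<kappa>1 + 1"
  define cJ where "cJ = (?N + 5) / d1 + 1"
  have \<beta>: "1 \<le> \<beta>" and cJ: "1 \<le> cJ" using tail(2) coord(2) by (auto simp: \<beta>_def cJ_def)
  define B where "B m = max 1 (\<beta> * L m)" for m
  define J where "J m = nat \<lceil>(?N + 5) / d1 * L m\<rceil>" for m
  define V where "V m = (\<Union>z\<in>Tn m. tests z (h m) (A * \<delta> m) (B m) (J m))" for m
  have B1: "1 \<le> B m" for m by (simp add: B_def)
  have V: "finite (V m)" "\<And>v. v \<in> V m \<Longrightarrow> v \<in> borel_measurable borel" "\<And>v z. v \<in> V m \<Longrightarrow> \<bar>v z\<bar> \<le> 1" for m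
  proof -
    show "finite (V m)" unfolding V_def using Tn_fin tests_finite by blast
    show "v \<in> borel_measurable borel" if "v \<in> V m" for v
      using that Tn_sub[of m] tests_measurable[OF Lip_ball_S] unfolding V_def by blast
    show "\<bar>v z\<bar> \<le> 1" if "v \<in> V m" for v z
      using that tests_bounded[OF less_le_trans[OF zero_less_one B1]] unfolding V_def by blast
  qed
  have I_exp: "1 / I m ^ j = exp (- (real j * L m))" if "0 < card (grid m)" for m j
  proof -
    have "I m = exp (L m)" using that by (simp add: L_def I_def card_gt_0_iff)
    then show ?thesis by (simp add: exp_of_nat_mult exp_minus divide_inverse)
  qed
  have eB: "exp (- \<kappa>1 * B m) \<le> 1 / I m ^ (CARD('n) + 3)" if "0 < card (grid m)" for m
  proof -
    have L0: "0 \<le> L m" using that by (simp add: L_def I_def card_gt_0_iff Suc_le_eq)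
    have "(?N + 3) * L m = \<kappa>1 * (((?N + 3) / \<kappa>1) * L m)" using tail(2) by simp
    also have "\<dots> \<le> \<kappa>1 * B m"
    proof (rule mult_left_mono)
      have "((?N + 3) / \<kappa>1) * L m \<le> \<beta> * L m" using L0 by (intro mult_right_mono) (auto simp: \<beta>_def)
      then show "((?N + 3) / \<kappa>1) * L m \<le> B m" by (simp add: B_def)
    qed (use tail(2) in simp)
    finally show ?thesis unfolding I_exp[OF that] by simp
  qed
  have eJ: "exp (- d1 * J m) \<le> 1 / I m ^ (CARD('n) + 5)" if "0 < card (grid m)" for m
  proof -
    have "(?N + 5) * L m = d1 * ((?N + 5) / d1 * L m)" using coord(2) by simp
    also have "\<dots> \<le> d1 * J m" unfolding J_def using coord(2) by (intro mult_left_mono real_nat_ceiling_ge) auto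
    finally show ?thesis unfolding I_exp[OF that] by simp
  qed
  \<comment> \<open>The infimum in \<open>rate1\<close> is at most 1, so the numerator tends to 0
    along with the quotient.\<close>
  have small: "(\<lambda>k. R (n k) powr (5 * ?d / 2) * ln (real (card (grid (n k)))) ^ 7 * mesh ?d (n k)) \<longlonglongrightarrow> 0"
    unfolding main_rate_def[symmetric]
    by (rule Lim_null_comparison[OF _ r1], rule eventually_mono[OF rates_eventually[of R0 R n h, OF R0 h]]) auto
  have ev_L: "\<forall>\<^sub>F k in sequentially. 1 \<le> L (n k)"
    using converges_to_infinity_ln[OF n] unfolding filterlim_at_top L_def I_def by blast
  have ev_\<delta>: "\<forall>\<^sub>F k in sequentially. \<delta> (n k) < R0"
    unfolding \<delta>_def using mesh_tendsto_0[OF n, of ?d] d1' R0(1) by (intro order_tendstoD(2)) auto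
  have ev_card: "\<forall>\<^sub>F k in sequentially. 1 \<le> card (grid (n k))"
    using converges_to_infinity_card[OF n] unfolding filterlim_at_top by blast
  \<comment> \<open>The at most J + 5 tests per net point fit into the factor |I| that
    \<open>uniform_deviation\<close> allows.\<close>
  have ev_J: "\<forall>\<^sub>F k in sequentially. real (J (n k) + 5) \<le> I (n k)"
  proof -
    have If: "filterlim (\<lambda>k. I (n k)) at_top sequentially"
      unfolding I_def by (intro filterlim_compose[OF filterlim_real_sequentially] converges_to_infinity_card n)
    have "(\<lambda>k. ln (I (n k)) / I (n k)) \<longlonglongrightarrow> 0"
      by (rule filterlim_compose[OF ln_x_over_x_tendsto_0 If])
    then have "\<forall>\<^sub>F k in sequentially. ln (I (n k)) / I (n k) < 1 / (6 * cJ)"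
      by (rule order_tendstoD(2)) (use cJ in simp)
    moreover have "\<forall>\<^sub>F k in sequentially. 10 \<le> I (n k)" using If unfolding filterlim_at_top by blast
    moreover note ev_L
    ultimately show ?thesis
    proof eventually_elim
      case (elim k)
      have y: "0 \<le> (?N + 5) / d1 * L (n k)" using elim(3) coord(2) by simp
      have "real (J (n k)) \<le> (?N + 5) / d1 * L (n k) + 1"
        unfolding J_def using y of_int_ceiling_le_add_one[of "(?N + 5) / d1 * L (n k)"] by (simp add: ceiling_less_iff)
      also have "\<dots> \<le> cJ * L (n k)" using elim(3) by (simp add: cJ_def distrib_right)
      also have "cJ * L (n k) \<le> I (n k) / 6"
      proof -
        have "L (n k) < 1 / (6 * cJ) * I (n k)" using elim(1,2) by (simp add: L_def pos_divide_less_eq)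
        then have "cJ * L (n k) \<le> cJ * (1 / (6 * cJ) * I (n k))" using cJ by (intro mult_left_mono) auto
        then show ?thesis using cJ by simp
      qed
      finally show ?case using elim(2) by simp
    qed
  qed
  have dev: "AE \<omega> in M. \<forall>\<^sub>F k in sequentially. \<forall>v\<in>V (n k).
      \<bar>average (n k) v \<omega> - expectation (\<lambda>\<omega>. v (X 0 \<omega>, Y 0 \<omega>))\<bar> < dev_level ?d r (R (n k)) (n k)"
  proof (rule uniform_deviation[where V = V and R = R and n = n and d = "?d" and r = r and A = A, OF n d1' r A R0 small])
    show "finite (V m)" for m by (rule V)
    show "v \<in> borel_measurable borel" if "v \<in> V m" for v m by (rule V(2)[OF that])
    show "\<bar>v z\<bar> \<le> 1" if "v \<in> V m" for v m z by (rule V(3)[OF that])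
    show "\<forall>\<^sub>F k in sequentially. real (card (V (n k))) \<le>
      exp ((A * (R (n k) / mesh ?d (n k))) powr ?d * ln (6 * (R (n k) / mesh ?d (n k)))) * real (card (grid (n k)))"
      using ev_J ev_\<delta> R0(2) ev_card
    proof eventually_elim
      case (elim k)
      define m where "m = n k"
      have \<delta>0': "0 < \<delta> m" unfolding \<delta>_def m_def using elim(4) by (intro mesh_pos) simp
      have \<delta>R: "\<delta> m \<le> R m" using elim by (simp add: m_def)
      have cT: "real (card (Tn m)) \<le> exp ((A * (R m / \<delta> m)) ^ CARD('d) * ln (6 * (R m / \<delta> m)))"
        using Tn[of m] \<delta>0' \<delta>R by (simp add: is_net_def)
      have "card (V m) \<le> (\<Sum>z\<in>Tn m. card (tests z (h m) (A * \<delta> m) (B m) (J m)))"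
        unfolding V_def by (rule card_UN_le[OF Tn_fin])
      also have "\<dots> \<le> (\<Sum>z\<in>Tn m. J m + 5)" by (intro sum_mono tests_card)
      finally have "card (V m) \<le> card (Tn m) * (J m + 5)" by simp
      then have "real (card (V m)) \<le> real (card (Tn m) * (J m + 5))" by (simp only: of_nat_le_iff)
      also have "\<dots> = real (card (Tn m)) * real (J m + 5)" by (rule of_nat_mult)
      also have "\<dots> \<le> exp ((A * (R m / \<delta> m)) ^ CARD('d) * ln (6 * (R m / \<delta> m))) * I m"
        using cT elim(1) by (intro mult_mono) (auto simp: m_def)
      also have "(A * (R m / \<delta> m)) ^ CARD('d) = (A * (R m / \<delta> m)) powr ?d"
        using A \<delta>0' \<delta>R by (subst powr_realpow) auto
      finally show ?case by (simp add: m_def \<delta>_def I_def)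
    qed
  qed
  have trunc: "AE \<omega> in M. \<forall>\<^sub>F k in sequentially. \<forall>u\<in>grid (n k).
    norm (Y u \<omega>) \<le> B (n k) \<and> norm (tail_proj (J (n k)) (Y u \<omega>)) \<le> 1 / real (card (grid (n k)))"
    by (rule truncation_event[OF n B1 eB[unfolded I_def] eJ[unfolded I_def]])
  define Y2m where "Y2m = expectation (\<lambda>\<omega>. (norm (Y 0 \<omega>))\<^sup>2)"
  have Y2m: "0 \<le> Y2m" by (simp add: Y2m_def)
  define s\<nu> where "s\<nu> = sqrt (measure \<nu> D)"
  define u where "u = R0 powr r"
  define v where "v = R0 powr (5 * ?d / 2)"
  define w where "w = R0 powr (5 * ?d / 2 - r)"
  have uvw: "0 < u" "0 < v" "0 < w" using R0(1) by (auto simp: u_def v_def w_def)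
  \<comment> \<open>CT R^r has to dominate 1, the bound of \<open>response_near\<close>, and the
    norm of \<open>\<Psi>\<close> on the ball, that is its value at \<open>origin\<close> plus
    Hoelder growth. The lower bound R0 for R turns constants into multiples of R^r.\<close>
  define CT where "CT = 1 / u + C7 * (1 + B0 / R0) powr r + norm (\<Psi> origin) / u + L\<Psi> * s\<nu> powr r"
  have CT: "0 < CT" using uvw C7 \<Psi>(1) by (auto simp: CT_def intro!: add_pos_nonneg)
  define c5 where "c5 = cJ * (Y2m + \<kappa>0) + Cq + 2"
  have c5: "0 < c5" using cJ Y2m tail(1) Cq_pos by (auto simp: c5_def intro!: add_nonneg_pos)
  \<comment> \<open>The six summands are the constants of \<open>e1\<close> to \<open>e6\<close>
    below, in this order.\<close>
  define Ce where "Ce = cJ * \<beta> / u + \<beta> / u + \<beta> * A / v + CT * A / w + CT + c5 / v"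
  have Ce_parts: "0 \<le> cJ * \<beta> / u" "0 \<le> \<beta> / u" "0 \<le> \<beta> * A / v" "0 \<le> CT * A / w" "0 < CT" "0 \<le> c5 / v"
    using cJ \<beta> A CT uvw c5 by auto
  have Ce: "0 < Ce" using Ce_parts by (simp add: Ce_def)
  define Cp where "Cp = 3 * Kb + CB * (1 + CF) + 2 * LK + 2 * (LK * (CF + 1) + 2 * Kb * (3 * CF + 1))
      + Kb * L\<Psi> * A powr r * (CF + 2) + cK * CF"
  have Cp: "0 < Cp" unfolding Cp_def using Kb(1) CB(1) CF(1) LK(1) \<Psi>(1) cK(1)
    by (intro add_pos_nonneg mult_nonneg_nonneg add_nonneg_nonneg) auto
  define C where "C = 2 * Cp / cK * (Ce + CT * A + 1)"
  \<comment> \<open>Below this threshold the second rate gives \<open>\<delta>\<close> \<le> h for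
    the Hoelder term, 2s \<le> h for the boundary layer, and a loss of at most a quarter of
    \<open>cK\<close> in the denominator.\<close>
  define cr where "cr = u * min 1 (min (1 / (2 * A)) (cK / (4 * Cp * A)))"
  have cr: "0 < cr" using uvw A cK(1) Cp by (simp add: cr_def)
  have ev_h: "\<forall>\<^sub>F k in sequentially. h (n k) < min 1 (\<delta>0 / 2)"
    using \<delta>0 by (intro order_tendstoD(2)[OF h(2)]) simp
  \<comment> \<open>Allots another quarter of \<open>cK\<close> to the absolute error, so half of
    the lower bound for the denominator survives.\<close>
  have ev_r1: "\<forall>\<^sub>F k in sequentially. rate1 M \<rho> X D cls R h (n k) < cK / (4 * Cp * Ce)"
    using cK(1) Cp Ce by (intro order_tendstoD(2)[OF r1]) simp
  have ev_r2: "\<forall>\<^sub>F k in sequentially. rate2 TYPE('d) r R h (n k) < cr"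
    by (rule order_tendstoD(2)[OF r2 cr])
  have "AE \<omega> in M. \<forall>\<^sub>F k in sequentially. \<forall>x\<in>Lip_ball D cls (R (n k)).
    norm (Psi_hat M \<rho> K X Y (n k) (h (n k)) x \<omega> - \<Psi> x) \<le>
      C * (rate1 M \<rho> X D cls R h (n k) + rate2 TYPE('d) r R h (n k) + h (n k) powr r)"
    using dev trunc AE_space
  proof eventually_elim
    case (elim \<omega>)
    note \<omega> = elim(3)
    from elim(1,2) ev_L ev_\<delta> ev_card ev_h ev_r1 ev_r2 R0(2)
    show ?case
    proof eventually_elim
      case (elim k)
      define m where "m = n k"
      note el = elim[folded m_def]
      define Rm where "Rm = R m"
      define hm where "hm = h m"
      define \<epsilon>0 where "\<epsilon>0 = main_rate R m"
      define G where "G = (INF x\<in>Lip_ball D cls Rm. F x hm)"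
      have m0: "0 < card (grid m)" using el(5) by simp
      then have I1: "1 \<le> I m" unfolding I_def by linarith
      have L1: "1 \<le> L m" using el(3) .
      have Rm: "R0 \<le> Rm" "0 < Rm" using el(9) R0(1) by (auto simp: Rm_def)
      have hm: "0 < hm" "hm < 1" "hm < \<delta>0 / 2" using h(1)[of k] el(6) by (auto simp: hm_def m_def)
      have \<delta>m: "0 < \<delta> m" unfolding \<delta>_def by (rule mesh_pos[OF m0])
      have \<delta>R: "\<delta> m \<le> Rm" using el(4) Rm by simp
      have rd: "r \<le> 5 * ?d / 2" using r d1' by linarith
      have powrs: "u \<le> Rm powr r" "v \<le> Rm powr (5 * ?d / 2)" "w \<le> Rm powr (5 * ?d / 2 - r)"
        unfolding u_def v_def w_def using R0(1) Rm r rd by (auto intro!: powr_mono2)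
      have split: "Rm powr (5 * ?d / 2) = Rm powr r * Rm powr (5 * ?d / 2 - r)"
        by (simp add: powr_add[symmetric])
      have \<epsilon>0: "\<epsilon>0 = Rm powr (5 * ?d / 2) * L m ^ 7 * \<delta> m"
        by (simp add: \<epsilon>0_def main_rate_def Rm_def L_def I_def \<delta>_def)
      have \<eta>m: "\<eta> m = Rm powr (5 * ?d / 2 - r) * L m ^ 5 * \<delta> m"
        by (simp add: \<eta>_def dev_level_def Rm_def L_def I_def \<delta>_def)
      have \<epsilon>00: "0 \<le> \<epsilon>0" using L1 \<delta>m by (simp add: \<epsilon>0)
      have \<eta>0: "0 \<le> \<eta> m" using L1 \<delta>m by (simp add: \<eta>m)
      have Lp: "L m \<le> (L m)\<^sup>2" "L m \<le> L m ^ 7" "1 \<le> L m ^ 7" "L m ^ 5 \<le> L m ^ 7"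
        using L1 power_increasing[of 1 2 "L m"] power_increasing[of 1 7 "L m"] power_increasing[of 5 7 "L m"]
        by (auto intro: one_le_power)
      \<comment> \<open>The reserved logarithms are spent here: the numerator of the first rate is
        R^r L^2 \<open>\<eta>\<close>, and truncation height times number of coordinates is of order
        L^2.\<close>
      have s1: "(L m)\<^sup>2 * \<eta> m \<le> \<epsilon>0 / u"
      proof -
        have "u * ((L m)\<^sup>2 * \<eta> m) \<le> Rm powr r * ((L m)\<^sup>2 * \<eta> m)"
          using powrs \<eta>0 by (intro mult_right_mono) auto
        also have "\<dots> = \<epsilon>0" unfolding \<eta>m \<epsilon>0 split by (simp add: power_numeral_reduce mult_ac)
        finally show ?thesis using uvw by (simp add: pos_le_divide_eq mult.commute)
      qed
      have s2: "L m * \<delta> m \<le> \<epsilon>0 / v"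
      proof -
        have "v * (L m * \<delta> m) \<le> Rm powr (5 * ?d / 2) * (L m ^ 7 * \<delta> m)"
          using powrs uvw Lp L1 \<delta>m by (intro mult_mono mult_right_mono) auto
        then show ?thesis using uvw by (simp add: pos_le_divide_eq \<epsilon>0 mult_ac)
      qed
      have s3: "Rm powr r * \<delta> m \<le> \<epsilon>0 / w"
      proof -
        have "w * (Rm powr r * \<delta> m) \<le> Rm powr (5 * ?d / 2 - r) * (Rm powr r * \<delta> m)"
          using powrs \<delta>m by (intro mult_right_mono) auto
        also have "\<dots> = Rm powr (5 * ?d / 2) * 1 * \<delta> m" unfolding split by simp
        also have "\<dots> \<le> \<epsilon>0" unfolding \<epsilon>0 using Lp \<delta>m by (intro mult_right_mono mult_left_mono) auto
        finally show ?thesis using uvw by (simp add: pos_le_divide_eq mult.commute)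
      qed
      have s4: "Rm powr r * \<eta> m \<le> \<epsilon>0"
      proof -
        have "Rm powr r * \<eta> m = Rm powr (5 * ?d / 2) * L m ^ 5 * \<delta> m" unfolding \<eta>m split by simp
        also have "\<dots> \<le> \<epsilon>0" unfolding \<epsilon>0 using Lp \<delta>m by (intro mult_right_mono mult_left_mono) auto
        finally show ?thesis .
      qed
      have Bm: "B m \<le> \<beta> * L m" using \<beta> L1 mult_mono[of 1 \<beta> 1 "L m"] by (simp add: B_def)
      have Jm: "real (J m) \<le> cJ * L m"
      proof -
        have "0 \<le> (?N + 5) / d1 * L m" using L1 coord(2) by simp
        then have "real (J m) \<le> (?N + 5) / d1 * L m + 1"
          unfolding J_def using of_int_ceiling_le_add_one[of "(?N + 5) / d1 * L m"] by (simp add: ceiling_less_iff)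
        also have "\<dots> \<le> cJ * L m" using L1 by (simp add: cJ_def distrib_right)
        finally show ?thesis .
      qed
      define \<epsilon> where "\<epsilon> = Ce * \<epsilon>0"
      have part: "c * \<epsilon>0 \<le> \<epsilon>" if "c \<le> Ce" for c
        unfolding \<epsilon>_def using that \<epsilon>00 by (rule mult_right_mono)
      define s where "s = A * \<delta> m"
      define T where "T = CT * Rm powr r"
      have s0: "0 < s" using A \<delta>m by (simp add: s_def)
      have e1: "real (J m) * B m * \<eta> m \<le> \<epsilon>"
      proof -
        have "real (J m) * B m * \<eta> m \<le> (cJ * L m) * (\<beta> * L m) * \<eta> m"
          using Jm Bm B1[of m] cJ L1 \<eta>0 by (intro mult_right_mono mult_mono) auto
        also have "\<dots> = cJ * \<beta> * ((L m)\<^sup>2 * \<eta> m)" by (simp add: power2_eq_square mult_ac)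
        also have "\<dots> \<le> cJ * \<beta> * (\<epsilon>0 / u)" using s1 cJ \<beta> by (intro mult_left_mono) auto
        also have "\<dots> = cJ * \<beta> / u * \<epsilon>0" by simp
        also have "\<dots> \<le> \<epsilon>" by (rule part) (use Ce_parts in \<open>simp add: Ce_def\<close>)
        finally show ?thesis .
      qed
      have e2: "B m * \<eta> m \<le> \<epsilon>"
      proof -
        have "B m * \<eta> m \<le> (\<beta> * (L m)\<^sup>2) * \<eta> m"
          by (rule mult_right_mono[OF order_trans[OF Bm mult_left_mono[OF Lp(1)]] \<eta>0]) (use \<beta> in simp)
        also have "\<dots> = \<beta> * ((L m)\<^sup>2 * \<eta> m)" by simp
        also have "\<dots> \<le> \<beta> * (\<epsilon>0 / u)" using s1 \<beta> by (intro mult_left_mono) auto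
        also have "\<dots> = \<beta> / u * \<epsilon>0" by simp
        also have "\<dots> \<le> \<epsilon>" by (rule part) (use Ce_parts in \<open>simp add: Ce_def\<close>)
        finally show ?thesis .
      qed
      have e3: "B m * s \<le> \<epsilon>"
      proof -
        have "B m * s \<le> (\<beta> * L m) * s" using Bm s0 by (intro mult_right_mono) auto
        also have "\<dots> = \<beta> * A * (L m * \<delta> m)" by (simp add: s_def)
        also have "\<dots> \<le> \<beta> * A * (\<epsilon>0 / v)" using s2 \<beta> A by (intro mult_left_mono) auto
        also have "\<dots> = \<beta> * A / v * \<epsilon>0" by simp
        also have "\<dots> \<le> \<epsilon>" by (rule part) (use Ce_parts in \<open>simp add: Ce_def\<close>)
        finally show ?thesis .
      qed
      have e4: "T * s \<le> \<epsilon>"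
      proof -
        have "T * s = CT * A * (Rm powr r * \<delta> m)" by (simp add: T_def s_def)
        also have "\<dots> \<le> CT * A * (\<epsilon>0 / w)" using s3 CT A by (intro mult_left_mono) auto
        also have "\<dots> = CT * A / w * \<epsilon>0" by simp
        also have "\<dots> \<le> \<epsilon>" by (rule part) (use Ce_parts in \<open>simp add: Ce_def\<close>)
        finally show ?thesis .
      qed
      have e5: "T * \<eta> m \<le> \<epsilon>"
      proof -
        have "T * \<eta> m = CT * (Rm powr r * \<eta> m)" by (simp add: T_def)
        also have "\<dots> \<le> CT * \<epsilon>0" using s4 CT by (intro mult_left_mono) auto
        also have "\<dots> \<le> \<epsilon>" by (rule part) (use Ce_parts in \<open>simp add: Ce_def\<close>)
        finally show ?thesis .
      qed
      have e6: "real (J m) * ((Y2m + \<kappa>0) / I m) + 1 / I m + (Cq + 1) / I m \<le> \<epsilon>"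
      proof -
        have "real (J m) * (Y2m + \<kappa>0) \<le> cJ * L m * (Y2m + \<kappa>0)"
          using Jm Y2m tail(1) by (intro mult_right_mono) auto
        moreover have "(Cq + 2) * 1 \<le> (Cq + 2) * L m" using L1 Cq_pos by (intro mult_left_mono) auto
        ultimately have "real (J m) * (Y2m + \<kappa>0) + (Cq + 2) \<le> c5 * L m" by (simp add: c5_def algebra_simps)
        then have "(real (J m) * (Y2m + \<kappa>0) + (Cq + 2)) * (1 / I m) \<le> (c5 * L m) * \<delta> m"
          using mesh_ge_inverse[OF m0] I1 c5 L1 unfolding \<delta>_def I_def by (intro mult_mono) auto
        also have "\<dots> = c5 * (L m * \<delta> m)" by simp
        also have "\<dots> \<le> c5 * (\<epsilon>0 / v)" using s2 c5 by (intro mult_left_mono) auto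
        also have "\<dots> = c5 / v * \<epsilon>0" by simp
        also have "\<dots> \<le> \<epsilon>" by (rule part) (use Ce_parts in \<open>simp add: Ce_def\<close>)
        finally have *: "(real (J m) * (Y2m + \<kappa>0) + (Cq + 2)) * (1 / I m) \<le> \<epsilon>" .
        have "a * (b / i) + 1 / i + (c + 1) / i = (a * b + (c + 2)) * (1 / i)" for a b c i :: real
          by (simp add: add_divide_distrib)
        then show ?thesis using * by (simp only:)
      qed
      have \<delta>h: "u * (\<delta> m / hm) \<le> rate2 TYPE('d) r R h m"
        unfolding rate2_eq \<delta>_def[symmetric] hm_def[symmetric] Rm_def[symmetric]
        using powrs \<delta>m hm by (intro mult_right_mono) auto
      then have "u * (\<delta> m / hm) \<le> u * min 1 (min (1 / (2 * A)) (cK / (4 * Cp * A)))"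
        using el(8) by (simp add: cr_def)
      then have "\<delta> m / hm \<le> min 1 (min (1 / (2 * A)) (cK / (4 * Cp * A)))"
        by (simp only: mult_le_cancel_left_pos[OF uvw(1)])
      then have \<delta>h1: "\<delta> m / hm \<le> 1" "\<delta> m / hm \<le> 1 / (2 * A)" "\<delta> m / hm \<le> cK / (4 * Cp * A)" by auto
      have \<delta>hm: "\<delta> m \<le> hm" using \<delta>h1(1) hm by simp
      have s2h: "2 * s \<le> hm" using \<delta>h1(2) A hm by (simp add: s_def field_simps)
      have sh: "Cp * (s / hm) \<le> cK / 4"
      proof -
        have "Cp * A * (\<delta> m / hm) \<le> Cp * A * (cK / (4 * Cp * A))" using \<delta>h1(3) Cp A by (intro mult_left_mono) auto
        then show ?thesis using Cp A by (simp add: s_def)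
      qed
      note G = INF_small_ball[OF Rm(2) hm(1), folded G_def]
      have hm\<delta>: "hm \<le> \<delta>0" using hm(3) \<delta>0 by simp
      have rate1G: "rate1 M \<rho> X D cls R h m = \<epsilon>0 / G" by (simp add: rate1_eq \<epsilon>0_def G_def Rm_def hm_def)
      \<comment> \<open>R may stay below \<open>B0\<close>, where the growth condition says nothing;
        the maximum with \<open>B0\<close> is still of order R because R \<ge> R0 > 0.\<close>
      have R1: "B0 \<le> max Rm B0" "C7 * max Rm B0 powr r \<le> T"
      proof -
        have B0': "0 \<le> B0" using C7 by simp
        have "max Rm B0 \<le> (1 + B0 / R0) * Rm"
        proof -
          have "B0 \<le> B0 / R0 * Rm" using R0(1) Rm(1) B0' mult_left_mono[of 1 "Rm / R0" B0] by simp
          moreover have "0 \<le> B0 / R0 * Rm" using B0' R0(1) Rm(2) by simp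
          ultimately show ?thesis using Rm(2) by (simp add: distrib_right)
        qed
        then have "max Rm B0 powr r \<le> ((1 + B0 / R0) * Rm) powr r"
          using r Rm(2) by (intro powr_mono2) auto
        also have "\<dots> = (1 + B0 / R0) powr r * Rm powr r" by (rule powr_mult)
        finally have "C7 * max Rm B0 powr r \<le> C7 * ((1 + B0 / R0) powr r * Rm powr r)"
          using C7(2) by (intro mult_left_mono) auto
        also have "\<dots> = (C7 * (1 + B0 / R0) powr r) * Rm powr r" by simp
        also have "\<dots> \<le> T" unfolding T_def CT_def using uvw \<Psi>(1) by (intro mult_right_mono) auto
        finally show "C7 * max Rm B0 powr r \<le> T" .
      qed simp
      have T1: "1 \<le> T"
      proof -
        have "1 = (1 / u) * u" using uvw by simp
        also have "\<dots> \<le> CT * Rm powr r"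
          using powrs uvw C7 \<Psi>(1) CT by (intro mult_mono) (auto simp: CT_def)
        finally show ?thesis by (simp add: T_def)
      qed
      have \<Psi>T: "norm (\<Psi> y) \<le> T" if y: "y \<in> Lip_ball D cls Rm" for y
      proof -
        have yS: "y \<in> S" by (rule Lip_ball_S[OF y])
        have "norm (y - origin) powr r \<le> (s\<nu> * Rm) powr r"
          using Lip_ball_norm(1)[OF y] Rm(2) r by (intro powr_mono2) (auto simp: s\<nu>_def)
        also have "\<dots> = s\<nu> powr r * Rm powr r" by (rule powr_mult)
        finally have "norm (\<Psi> y - \<Psi> origin) \<le> L\<Psi> * (s\<nu> powr r * Rm powr r)"
          using \<Psi>(2)[OF yS origin] mult_left_mono[OF _ \<Psi>(1)] order_trans by blast
        moreover have "norm (\<Psi> origin) \<le> norm (\<Psi> origin) / u * Rm powr r"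
          using powrs(1) uvw mult_left_mono[of 1 "Rm powr r / u" "norm (\<Psi> origin)"] by simp
        moreover have "norm (\<Psi> y) \<le> norm (\<Psi> y - \<Psi> origin) + norm (\<Psi> origin)"
          using norm_triangle_ineq[of "\<Psi> y - \<Psi> origin" "\<Psi> origin"] by simp
        ultimately have "norm (\<Psi> y) \<le> (norm (\<Psi> origin) / u + L\<Psi> * s\<nu> powr r) * Rm powr r"
          by (simp add: distrib_right mult.assoc)
        also have "\<dots> \<le> T" unfolding T_def CT_def using uvw C7(2) by (intro mult_right_mono) auto
        finally show ?thesis .
      qed
      have cs: "s powr r \<le> A powr r * hm powr r"
        unfolding s_def powr_mult using \<delta>hm \<delta>m r by (intro mult_left_mono powr_mono2) auto
      have EYB: "expectation (\<lambda>\<omega>. indicator {B m..} (norm (Y 0 \<omega>)) * norm (Y 0 \<omega>)) \<le> (Y2m + \<kappa>0) / I m"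
      proof -
        have I0: "0 < I m" using I1 by simp
        have "1 / I m ^ (CARD('n) + 3) \<le> 1 / I m ^ 2"
          using I1 by (intro divide_left_mono power_increasing) auto
        then have "exp (- \<kappa>1 * B m) \<le> 1 / (I m)\<^sup>2" using eB[OF m0] by linarith
        then have "I m * (\<kappa>0 * exp (- \<kappa>1 * B m)) \<le> I m * (\<kappa>0 * (1 / (I m)\<^sup>2))"
          using I0 tail(1) by (intro mult_left_mono) auto
        also have "\<dots> = \<kappa>0 / I m" using I0 by (simp add: power2_eq_square)
        finally show ?thesis using truncation_mean[OF I0 B1[of m], of 0] by (simp add: Y2m_def add_divide_distrib)
      qed
      have EYQ: "expectation (\<lambda>\<omega>. norm (tail_proj (J m) (Y 0 \<omega>))) \<le> (Cq + 1) / I m"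
      proof -
        have I0: "0 < I m" using I1 by simp
        have "1 / I m ^ (CARD('n) + 5) \<le> 1 / I m ^ 2"
          using I1 by (intro divide_left_mono power_increasing) auto
        then have "exp (- d1 * J m) \<le> 1 / (I m)\<^sup>2" using eJ[OF m0] by linarith
        then have "I m * (Cq * exp (- d1 * J m)) \<le> I m * (Cq * (1 / (I m)\<^sup>2))"
          using I0 Cq_pos by (intro mult_left_mono) auto
        also have "\<dots> = Cq / I m" using I0 by (simp add: power2_eq_square)
        finally show ?thesis using tail_proj_mean[OF I0, of "J m" 0] by (simp add: add_divide_distrib)
      qed
      show ?case
        unfolding m_def[symmetric] hm_def[symmetric]
      proof
        fix x assume x: "x \<in> Lip_ball D cls (R m)"
        then have x': "x \<in> Lip_ball D cls Rm" by (simp add: Rm_def)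
        obtain z where z: "z \<in> Tn m" "norm (x - z) \<le> s"
          using Tn[of m] x \<delta>m \<delta>R unfolding is_net_def Rm_def s_def by blast
        have z': "z \<in> Lip_ball D cls Rm" using z(1) Tn_sub[of m] by (auto simp: Rm_def)
        have xS: "x \<in> S" and zS: "z \<in> S" using x' z' Lip_ball_S by auto
        have ez: "ess_norm \<nu> cls z \<le> ereal (max Rm B0)"
          using Lip_ball_norm(2)[OF z'] Rm(2) by (auto intro: order_trans)
        have good: "\<bar>average m v \<omega> - expectation (\<lambda>\<omega>. v (X 0 \<omega>, Y 0 \<omega>))\<bar> \<le> \<eta> m" if "v \<in> tests z hm s (B m) (J m)" for v
          using el(1) that z(1) unfolding V_def hm_def s_def \<eta>_def by (blast intro: less_imp_le)
        have hs: "hm + s \<le> \<delta>0" using hm s2h by simp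
        have Ar: "0 \<le> A powr r" by simp
        note pb = pointwise_bound[where \<beta> = "(Y2m + \<kappa>0) / I m" and q = "1 / I m" and q' = "(Cq + 1) / I m" and \<epsilon> = \<epsilon> and T = T,
          OF \<omega> m0 xS zS z(2) hm(1) less_imp_le[OF hm(2)] s2h hs s0 B1 T1 R1(1) ez R1(2) \<Psi>T[OF x'] \<Psi>T[OF z']
            \<eta>0 Ar cs e1 e2 e3 e4 e5 e6, folded Cp_def]
        define N where "N = grid_mean m (\<lambda>u. K (\<rho> (X u \<omega>) x / hm) *\<^sub>R (Y u \<omega> - \<Psi> x))"
        define den where "den = grid_mean m (\<lambda>u. K (\<rho> (X u \<omega>) x / hm))"
        have YY: "norm (Y a \<omega>) \<le> B m" "norm (tail_proj (J m) (Y a \<omega>)) \<le> 1 / I m" if "a \<in> grid m" for a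
          using el(2) that by (auto simp: I_def)
        have N: "norm N \<le> Cp * (\<epsilon> + F x hm * (T * s / hm) + F x hm * hm powr r)"
          unfolding N_def kern_def[symmetric] by (rule pb(1)[OF _ _ _ EYB EYQ]) (fact good YY)+
        have den: "cK * F x hm - Cp * (\<epsilon> + F x hm * (s / hm)) \<le> den"
          unfolding den_def kern_def[symmetric] by (rule pb(2)[OF _ _ _ EYB EYQ]) (fact good YY)+
        have Fx: "0 < F x hm" "G \<le> F x hm" using F_pos[OF xS hm(1)] G(3)[OF hm\<delta> x'] by auto
        have Gp: "0 < G" using G(1)[OF hm\<delta>] .
        \<comment> \<open>The absolute error becomes relative here: the infimum bounds
          \<open>F x hm\<close> from below at every \<open>x\<close> of the ball.\<close>
        have \<epsilon>G: "\<epsilon> / F x hm \<le> Ce * rate1 M \<rho> X D cls R h m"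
          unfolding rate1G \<epsilon>_def using Fx Gp Ce \<epsilon>00
          by (simp add: frac_le mult_left_mono times_divide_eq_right[symmetric] del: times_divide_eq_right)
        have "Cp * (\<epsilon> / F x hm) \<le> Cp * (Ce * rate1 M \<rho> X D cls R h m)" using \<epsilon>G Cp by (intro mult_left_mono) auto
        also have "\<dots> \<le> Cp * (Ce * (cK / (4 * Cp * Ce)))" using el(7) Cp Ce by (intro mult_left_mono) auto
        also have "\<dots> = cK / 4" using Cp Ce by simp
        finally have "Cp * \<epsilon> \<le> cK / 4 * F x hm" using Fx(1) by (simp add: pos_divide_le_eq)
        moreover have "Cp * (F x hm * (s / hm)) \<le> cK / 4 * F x hm"
          using mult_right_mono[OF sh, of "F x hm"] Fx(1) by (simp add: mult_ac)
        ultimately have den': "cK / 2 * F x hm \<le> den" using den by (simp add: distrib_left)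
        then have den0: "0 < den" using cK(1) Fx(1) by (meson half_gt_zero less_le_trans mult_pos_pos)
        have "norm (Psi_hat M \<rho> K X Y m hm x \<omega> - \<Psi> x) = norm N / den"
          unfolding Psi_hat_diff[OF m0 Fx(1) den0[unfolded den_def]] using den0
          by (simp add: N_def den_def divide_inverse_commute)
        also have "\<dots> \<le> (Cp * (\<epsilon> + F x hm * (T * s / hm) + F x hm * hm powr r)) / (cK / 2 * F x hm)"
          using N den' cK(1) Fx(1) by (intro frac_le) (auto intro: order_trans[OF norm_ge_zero])
        also have "\<dots> = 2 * Cp / cK * (\<epsilon> / F x hm + T * s / hm + hm powr r)"
          using Fx(1) cK(1) by (simp add: field_simps)
        also have "\<dots> \<le> 2 * Cp / cK * ((Ce + CT * A + 1) * (rate1 M \<rho> X D cls R h m + rate2 TYPE('d) r R h m + hm powr r))"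
        proof (rule mult_left_mono)
          have ts: "T * s / hm = CT * A * rate2 TYPE('d) r R h m"
            by (simp add: T_def s_def rate2_eq \<delta>_def Rm_def hm_def mult_ac)
          have nn: "0 \<le> rate1 M \<rho> X D cls R h m" "0 \<le> rate2 TYPE('d) r R h m" "0 \<le> hm powr r" "0 \<le> CT * A"
            using \<epsilon>00 Gp CT A \<delta>m hm by (auto simp: rate1G rate2_eq \<delta>_def[symmetric] hm_def[symmetric])
          have "Ce * rate1 M \<rho> X D cls R h m \<le> (Ce + CT * A + 1) * rate1 M \<rho> X D cls R h m"
            "CT * A * rate2 TYPE('d) r R h m \<le> (Ce + CT * A + 1) * rate2 TYPE('d) r R h m"
            "1 * hm powr r \<le> (Ce + CT * A + 1) * hm powr r"
            using nn Ce by (intro mult_right_mono; simp)+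
          then show "\<epsilon> / F x hm + T * s / hm + hm powr r \<le> (Ce + CT * A + 1) * (rate1 M \<rho> X D cls R h m + rate2 TYPE('d) r R h m + hm powr r)"
            using \<epsilon>G unfolding ts by (simp add: distrib_left)
        qed (use Cp cK(1) in simp)
        finally show "norm (Psi_hat M \<rho> K X Y m hm x \<omega> - \<Psi> x) \<le> C * (rate1 M \<rho> X D cls R h m + rate2 TYPE('d) r R h m + hm powr r)"
          by (simp add: C_def mult.assoc)
      qed
    qed
  qed
  then show ?thesis by blast
qed

end

text \<open>The supremum is split in proportion to the three rates, so each share is at most
  \<open>C\<close> times its own rate. Positivity of \<open>r3\<close> makes the total nonzero;
  nonemptiness and the two-sided bound make the extended supremum a real number.\<close>

lemma sup_decomposition:
  fixes f :: "nat \<Rightarrow> 'a \<Rightarrow> real" and r1 r2 r3 :: "nat \<Rightarrow> real"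
  assumes "\<forall>\<^sub>F k in sequentially. 0 \<le> r1 k \<and> 0 \<le> r2 k \<and> 0 < r3 k \<and> A k \<noteq> {} \<and>
    (\<forall>x\<in>A k. 0 \<le> f k x \<and> f k x \<le> C * (r1 k + r2 k + r3 k))"
  shows "\<exists>a b c. a \<in> O(r1) \<and> b \<in> O(r2) \<and> c \<in> O(r3) \<and>
    (\<forall>\<^sub>F k in sequentially. (SUP x\<in>A k. ereal (f k x)) = ereal (a k + b k + c k))"
proof -
  define s where "s k = real_of_ereal (SUP x\<in>A k. ereal (f k x))" for k
  define t where "t k = r1 k + r2 k + r3 k" for k
  have s: "\<forall>\<^sub>F k in sequentially. (SUP x\<in>A k. ereal (f k x)) = ereal (s k) \<and> 0 \<le> s k \<and> s k \<le> C * t k \<and>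
      0 < t k \<and> 0 \<le> r1 k \<and> 0 \<le> r2 k \<and> 0 \<le> r3 k"
    using assms
  proof eventually_elim
    case (elim k)
    then obtain x where x: "x \<in> A k" by blast
    have up: "(SUP x\<in>A k. ereal (f k x)) \<le> ereal (C * t k)"
      by (rule SUP_least) (use elim in \<open>simp add: t_def\<close>)
    have "ereal 0 \<le> ereal (f k x)" using elim x by simp
    also have "\<dots> \<le> (SUP x\<in>A k. ereal (f k x))" by (rule SUP_upper[OF x])
    finally have low: "ereal 0 \<le> (SUP x\<in>A k. ereal (f k x))" .
    have eq: "(SUP x\<in>A k. ereal (f k x)) = ereal (s k)"
      unfolding s_def using low up by (cases "SUP x\<in>A k. ereal (f k x)") auto
    have "0 \<le> s k" "s k \<le> C * t k" using low up unfolding eq by simp_all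
    moreover have "0 < t k" unfolding t_def using elim by linarith
    ultimately show ?case using eq elim by simp
  qed
  have O: "(\<lambda>k. s k * (r k / t k)) \<in> O(r)" if r: "r = r1 \<or> r = r2 \<or> r = r3" for r
  proof (rule bigoI[of _ C])
    show "\<forall>\<^sub>F k in sequentially. norm (s k * (r k / t k)) \<le> C * norm (r k)"
      using s
    proof eventually_elim
      case (elim k)
      have r0: "0 \<le> r k" using r elim by auto
      have "s k * (r k / t k) \<le> (C * t k) * (r k / t k)" using elim r0 by (intro mult_right_mono) auto
      also have "\<dots> = C * r k" using elim by simp
      finally show ?case using elim r0 by (simp add: abs_mult)
    qed
  qed
  have sum: "\<forall>\<^sub>F k in sequentially. (SUP x\<in>A k. ereal (f k x)) =
      ereal (s k * (r1 k / t k) + s k * (r2 k / t k) + s k * (r3 k / t k))"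
    using s
  proof eventually_elim
    case (elim k)
    have "s k * (r1 k / t k) + s k * (r2 k / t k) + s k * (r3 k / t k) = s k * (t k / t k)"
      by (simp only: t_def distrib_left[symmetric] add_divide_distrib[symmetric])
    then show ?case using elim by simp
  qed
  show ?thesis
  proof (intro exI conjI)
    show "(\<lambda>k. s k * (r1 k / t k)) \<in> O(r1)" "(\<lambda>k. s k * (r2 k / t k)) \<in> O(r2)" "(\<lambda>k. s k * (r3 k / t k)) \<in> O(r3)"
      using O[of r1] O[of r2] O[of r3] by simp_all
  qed (rule sum)
qed

theorem theorem4p3:
  fixes D :: "(real ^ 'd) set"
    and \<nu> :: "(real ^ 'd) measure"
    and cls :: "(real ^ 'd \<Rightarrow> real) \<Rightarrow> 'h::{real_inner, banach, second_countable_topology}"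
    and e :: "nat \<Rightarrow> 'h"
    and S :: "'h set"
    and \<rho> :: "'h \<Rightarrow> 'h \<Rightarrow> real"
    and M :: "'w measure"
    and X Y \<epsilon> :: "int ^ 'n \<Rightarrow> 'w \<Rightarrow> 'h"
    and \<Psi> :: "'h \<Rightarrow> 'h"
    and \<theta> \<theta>' :: "'h \<Rightarrow> nat \<Rightarrow> real \<Rightarrow> real"
    and \<theta>t \<theta>t' :: "'h \<Rightarrow> real \<Rightarrow> real"
    and K K' :: "real \<Rightarrow> real"
    and \<tau> :: "'h \<Rightarrow> real \<Rightarrow> real"
    and r :: real
    and n :: "nat \<Rightarrow> nat ^ 'n"
    and R h :: "nat ^ 'n \<Rightarrow> real"
  assumes D: "convex D" "compact D"
    and \<nu>: "sets \<nu> = sets (restrict_space borel D)" "finite_measure \<nu>"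
    and H: "L2_space \<nu> cls" "orthonormal_basis e"
    and S: "cls ` C0 D \<subseteq> S"
    and \<rho>: "pseudometric_on S \<rho>" "\<forall>x\<in>S. \<forall>y\<in>S. \<rho> x y \<le> norm (x - y)"
    and M: "prob_space M"
    and X: "\<forall>s. X s \<in> borel_measurable M" "\<forall>s. \<forall>\<omega>\<in>space M. X s \<omega> \<in> S"
    and Y: "\<forall>s. Y s \<in> borel_measurable M"
    and stationary: "strictly_stationary M (\<lambda>s \<omega>. (X s \<omega>, Y s \<omega>))"
    and model: "\<forall>s. \<forall>\<omega>\<in>space M. Y s \<omega> = \<Psi> (X s \<omega>) + \<epsilon> s \<omega>"
    and noise: "\<forall>s. is_cond_exp M (sigma_rv M (X s)) (\<epsilon> s) (\<lambda>\<omega>. 0)"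
    and \<theta>: "\<forall>s j. \<forall>x\<in>S. is_cond_exp_at M
          (\<lambda>\<omega>. \<Psi> (X s \<omega>) \<bullet> e j - \<Psi> x \<bullet> e j) (\<lambda>\<omega>. \<rho> (X s \<omega>) x) (\<theta> x j)"
    and \<theta>t: "\<forall>s. \<forall>x\<in>S. is_cond_exp_at M
          (\<lambda>\<omega>. norm (Y s \<omega>)) (\<lambda>\<omega>. \<rho> (X s \<omega>) x) (\<theta>t x)"
    and r: "0 < r" "r \<le> 1"
    and A1a: "\<exists>L. \<forall>x\<in>S. \<forall>y\<in>S. norm (\<Psi> x - \<Psi> y) \<le> L * norm (x - y) powr r"
    and A1b: "\<exists>\<delta>>0. \<exists>L.
        (\<forall>x\<in>S. \<forall>j. \<theta> x j 0 = 0 \<and> 0 < L x j \<and>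
           (\<forall>u\<in>{0..\<delta>}. (\<theta> x j has_real_derivative \<theta>' x j u) (at u within {0..}) \<and>
              \<bar>\<theta>' x j u - \<theta>' x j 0\<bar> \<le> L x j * u powr r)) \<and>
        (SUP x\<in>S. \<Sum>j. ennreal ((\<theta>' x j 0)\<^sup>2)) < \<infinity> \<and>
        (SUP x\<in>S. \<Sum>j. ennreal ((L x j)\<^sup>2)) < \<infinity>"
    and A2a: "\<forall>u>1. K u = 0"
    and A2b: "\<forall>u\<in>{0..1}. (K has_real_derivative K' u) (at u within {0..1}) \<and> K' u \<le> 0"
      "continuous_on {0..1} K'"
    and A2c: "\<exists>L. \<forall>u\<in>{0..1}. \<forall>v\<in>{0..1}. \<bar>K u - K v\<bar> \<le> L * \<bar>u - v\<bar>"
    and A3a: "\<forall>x\<in>S. \<forall>\<eta>>0. 0 < small_ball M \<rho> X x \<eta>"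
    and A3b: "\<forall>x\<in>S. \<forall>u\<in>{0..1}.
        ((\<lambda>\<eta>. small_ball M \<rho> X x (\<eta> * u) / small_ball M \<rho> X x \<eta>) \<longlongrightarrow> \<tau> x u) (at_right 0)"
    and A3c: "((\<lambda>\<eta>. SUP x\<in>S. SUP u\<in>{0..1}.
          ennreal \<bar>small_ball M \<rho> X x (\<eta> * u) / small_ball M \<rho> X x \<eta> - \<tau> x u\<bar>) \<longlongrightarrow> 0)
        (at_right 0)"
    and A4: "\<forall>x\<in>S. 0 < K 1 - integral {0..1} (\<lambda>u. K' u * \<tau> x u)"
      "0 < (INF x\<in>S. K 1 - integral {0..1} (\<lambda>u. K' u * \<tau> x u))"
    and A5: "\<exists>\<delta>>0. \<exists>L. \<forall>x\<in>S. \<forall>\<eta>. 0 < \<eta> \<and> \<eta> \<le> \<delta> \<longrightarrow>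
        (\<forall>z\<in>S. \<forall>z'\<in>S. \<forall>u\<in>{0..1}. \<forall>u'\<in>{0..1}.
           \<bar>small_ball M \<rho> X z (\<eta> * u) / small_ball M \<rho> X x \<eta>
             - small_ball M \<rho> X z' (\<eta> * u') / small_ball M \<rho> X x \<eta>\<bar>
           \<le> L x * (\<rho> z z' + \<bar>u - u'\<bar>))"
    and A6a: "\<exists>\<gamma>\<ge>1. \<exists>\<kappa>0>0. \<exists>\<kappa>1>0. \<forall>s. \<forall>z\<ge>0.
        measure M {\<omega> \<in> space M. z \<le> norm (Y s \<omega>)} \<le> \<kappa>0 * exp (- \<kappa>1 * z powr \<gamma>)"
    and A6b: "\<exists>d0>0. \<exists>d1>0. \<forall>s j.
        (\<integral>\<omega>. (Y s \<omega> \<bullet> e j)\<^sup>2 \<partial>M) \<le> d0 * exp (- d1 * real j)"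
    and A7a: "\<exists>C. \<forall>\<^sub>F B in at_top.
        (SUP x\<in>{x \<in> S. ess_norm \<nu> cls x \<le> ereal B}. ereal (\<theta>t x 0)) \<le> ereal (C * B powr r)"
    and A7b: "\<exists>\<delta>>0.
        (\<forall>x\<in>S. \<forall>u\<in>{0..\<delta>}. (\<theta>t x has_real_derivative \<theta>t' x u) (at u within {0..})) \<and>
        (SUP x\<in>S. SUP u\<in>{0..\<delta>}. ennreal \<bar>\<theta>t' x u\<bar>) < \<infinity>"
    and A8: "\<exists>c0>0. \<exists>c1>0. \<forall>k.
        mixing_coeff M (\<lambda>s \<omega>. (X s \<omega>, Y s \<omega>)) k \<le> c0 * exp (- c1 * real k)"
    and n: "converges_to_infinity n"
    and R: "\<exists>l>0. (\<lambda>k. ereal (R (n k))) \<longlonglongrightarrow> l"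
    and h: "\<forall>k. 0 < h (n k)" "(\<lambda>k. h (n k)) \<longlonglongrightarrow> 0"
    and rate1: "(\<lambda>k. rate1 M \<rho> X D cls R h (n k)) \<longlonglongrightarrow> 0"
    and rate2: "(\<lambda>k. rate2 TYPE('d) r R h (n k)) \<longlonglongrightarrow> 0"
  shows "AE \<omega> in M. \<exists>a b c.
      a \<in> O(\<lambda>k. rate1 M \<rho> X D cls R h (n k)) \<and> b \<in> O(\<lambda>k. rate2 TYPE('d) r R h (n k)) \<and> c \<in> O(\<lambda>k. h (n k) powr r) \<and>
      (\<forall>\<^sub>F k in sequentially.
         (SUP x\<in>Lip_ball D cls (R (n k)).
            ereal (norm (Psi_hat M \<rho> K X Y (n k) (h (n k)) x \<omega> - \<Psi> x))) =
         ereal (a k + b k + c k))"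
proof -
  interpret prob_space M by (rule M)
  have \<rho>_le: "\<rho> x y \<le> norm (x - y)" if "x \<in> S" "y \<in> S" for x y using \<rho>(2) that by blast
  have Xm: "X s \<in> borel_measurable M" for s using X(1) by blast
  have XS: "X s \<omega> \<in> S" if "\<omega> \<in> space M" for s \<omega> using X(2) that by blast
  interpret FF: functional_field D \<nu> cls M S \<rho> X
    by (intro functional_field.intro L2_compact.intro functional_field_axioms.intro)
      (fact D(2) \<nu> H(1) prob_space_axioms S \<rho>(1) \<rho>_le Xm XS)+
  obtain \<delta>5 L5 where \<delta>5: "0 < \<delta>5" and A5': "\<forall>x\<in>S. \<forall>\<eta>. 0 < \<eta> \<and> \<eta> \<le> \<delta>5 \<longrightarrow>
        (\<forall>z\<in>S. \<forall>z'\<in>S. \<forall>u\<in>{0..1}. \<forall>u'\<in>{0..1}.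
           \<bar>small_ball M \<rho> X z (\<eta> * u) / small_ball M \<rho> X x \<eta>
             - small_ball M \<rho> X z' (\<eta> * u') / small_ball M \<rho> X x \<eta>\<bar>
           \<le> L5 x * (\<rho> z z' + \<bar>u - u'\<bar>))"
    using A5 by (elim exE conjE)
  obtain CF where CF: "0 < CF"
    "\<And>z a b. z \<in> S \<Longrightarrow> 0 \<le> a \<Longrightarrow> a \<le> b \<Longrightarrow> b \<le> \<delta>5 \<Longrightarrow> small_ball M \<rho> X z b - small_ball M \<rho> X z a \<le> CF * (b - a)"
    "\<And>z z' a. z \<in> S \<Longrightarrow> z' \<in> S \<Longrightarrow> 0 \<le> a \<Longrightarrow> a \<le> \<delta>5 \<Longrightarrow> \<bar>small_ball M \<rho> X z a - small_ball M \<rho> X z' a\<bar> \<le> CF * \<rho> z z'"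
    by (rule FF.small_ball_regular[OF A3a \<delta>5 A5']) blast
  obtain cK \<delta>K where cK: "0 < cK" "0 < \<delta>K" "\<And>x h. x \<in> S \<Longrightarrow> 0 < h \<Longrightarrow> h \<le> \<delta>K \<Longrightarrow>
      cK * small_ball M \<rho> X x h \<le> expectation (\<lambda>\<omega>. K (\<rho> (X 0 \<omega>) x / h))"
    using FF.kernel_mean_lower[OF A2a A2b A3a A3b A3c A4 \<delta>5 A5'] by blast
  obtain \<gamma> \<kappa>0 \<kappa>1 where \<gamma>: "1 \<le> \<gamma>" and \<kappa>: "0 < \<kappa>0" "0 < \<kappa>1"
    and tail0: "\<forall>s. \<forall>z\<ge>0. measure M {\<omega> \<in> space M. z \<le> norm (Y s \<omega>)} \<le> \<kappa>0 * exp (- \<kappa>1 * z powr \<gamma>)"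
    using A6a by (elim exE conjE)
  have tail: "prob {\<omega> \<in> space M. z \<le> norm (Y s \<omega>)} \<le> \<kappa>0 * exp (- \<kappa>1 * z)" if z: "1 \<le> z" for s z
  proof -
    \<comment> \<open>For z \<ge> 1 an exponent \<open>\<gamma>\<close> \<ge> 1 only improves the
      tail, so a plain exponential tail is kept.\<close>
    have "z powr 1 \<le> z powr \<gamma>" using z \<gamma> by (intro powr_mono) auto
    then have "\<kappa>0 * exp (- \<kappa>1 * z powr \<gamma>) \<le> \<kappa>0 * exp (- \<kappa>1 * z)" using \<kappa> z by simp
    moreover have "prob {\<omega> \<in> space M. z \<le> norm (Y s \<omega>)} \<le> \<kappa>0 * exp (- \<kappa>1 * z powr \<gamma>)" using tail0 z by simp
    ultimately show ?thesis by linarith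
  qed
  have Ym: "Y s \<in> borel_measurable M" for s using Y by simp
  have Y2: "integrable M (\<lambda>\<omega>. (norm (Y s \<omega>))\<^sup>2)" for s
  proof (rule exp_tail_square_integrable[where c = "\<kappa>0 + 1" and b = \<kappa>1])
    show "(\<lambda>\<omega>. norm (Y s \<omega>)) \<in> borel_measurable M" using Ym by measurable
    \<comment> \<open>The exponential tail was derived from 1 on; raising \<open>\<kappa>0\<close>
      by 1 makes the bound trivial at k = 0.\<close>
    show "prob {\<omega> \<in> space M. real k \<le> norm (Y s \<omega>)} \<le> (\<kappa>0 + 1) * exp (- \<kappa>1 * real k)" for k
    proof (cases "k = 0")
      case True
      then show ?thesis using prob_le_1 \<kappa> by (auto intro: order_trans)
    next
      case False
      then have "prob {\<omega> \<in> space M. real k \<le> norm (Y s \<omega>)} \<le> \<kappa>0 * exp (- \<kappa>1 * real k)" by (intro tail) simp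
      also have "\<dots> \<le> (\<kappa>0 + 1) * exp (- \<kappa>1 * real k)" by (intro mult_right_mono) auto
      finally show ?thesis .
    qed
  qed (use \<kappa> in auto)
  have Yi: "integrable M (Y 0)"
  proof (rule Bochner_Integration.integrable_bound[of _ "\<lambda>\<omega>. (norm (Y 0 \<omega>))\<^sup>2 + 1"])
    have "y \<le> y\<^sup>2 + 1" if "0 \<le> y" for y :: real using sum_squares_bound[of y 1] that by simp
    then show "AE \<omega> in M. norm (Y 0 \<omega>) \<le> norm ((norm (Y 0 \<omega>))\<^sup>2 + 1)" by (intro AE_I2) simp
  qed (use Y2 Ym in auto)
  have Kcont: "continuous_on {0..1} K"
    unfolding continuous_on_eq_continuous_within using A2b(1) DERIV_continuous by blast
  have "bounded (K ` {0..1})" by (rule compact_imp_bounded[OF compact_continuous_image[OF Kcont]]) simp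
  then obtain Kb where Kb: "0 < Kb" "\<forall>y\<in>K ` {0..1}. norm y \<le> Kb" unfolding bounded_pos by (elim exE conjE)
  have K1: "K u = 0" if "1 < u" for u using A2a that by blast
  have Kbd: "\<bar>K u\<bar> \<le> Kb" if "0 \<le> u" for u
  proof (cases "u \<le> 1")
    case True
    then have "K u \<in> K ` {0..1}" using that by auto
    then show ?thesis using Kb(2) by fastforce
  qed (use K1 Kb(1) in auto)
  have Km: "(\<lambda>u. if 0 \<le> u then K u else 0) \<in> borel_measurable borel"
  proof -
    have "(\<lambda>u. indicator {0..1} u *\<^sub>R K u) \<in> borel_measurable borel"
      by (rule borel_measurable_continuous_on_indicator[OF _ Kcont]) simp
    moreover have "(\<lambda>u. indicator {0..1} u *\<^sub>R K u) = (\<lambda>u. if 0 \<le> u then K u else 0)"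
      by (rule ext) (auto simp: indicator_def K1)
    ultimately show ?thesis by simp
  qed
  obtain LK0 where LK0: "\<forall>u\<in>{0..1}. \<forall>v\<in>{0..1}. \<bar>K u - K v\<bar> \<le> LK0 * \<bar>u - v\<bar>" using A2c by blast
  have LK: "\<bar>K u - K v\<bar> \<le> \<bar>LK0\<bar> * \<bar>u - v\<bar>" if "u \<in> {0..1}" "v \<in> {0..1}" for u v
    using LK0[rule_format, OF that] mult_right_mono[OF abs_ge_self[of LK0] abs_ge_zero[of "u - v"]] by linarith
  obtain L\<Psi>0 where L\<Psi>0: "\<forall>x\<in>S. \<forall>y\<in>S. norm (\<Psi> x - \<Psi> y) \<le> L\<Psi>0 * norm (x - y) powr r" using A1a by blast
  have L\<Psi>: "norm (\<Psi> x - \<Psi> y) \<le> \<bar>L\<Psi>0\<bar> * norm (x - y) powr r" if "x \<in> S" "y \<in> S" for x y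
    using L\<Psi>0[rule_format, OF that] mult_right_mono[OF abs_ge_self[of L\<Psi>0] powr_ge_zero[of "norm (x - y)" r]] by linarith
  obtain \<delta>1 Lx where \<delta>1: "0 < \<delta>1" and A1b':
    "\<forall>x\<in>S. \<forall>j. \<theta> x j 0 = 0 \<and> 0 < Lx x j \<and>
           (\<forall>u\<in>{0..\<delta>1}. (\<theta> x j has_real_derivative \<theta>' x j u) (at u within {0..}) \<and>
              \<bar>\<theta>' x j u - \<theta>' x j 0\<bar> \<le> Lx x j * u powr r)"
    "(SUP x\<in>S. \<Sum>j. ennreal ((\<theta>' x j 0)\<^sup>2)) < \<infinity>" "(SUP x\<in>S. \<Sum>j. ennreal ((Lx x j)\<^sup>2)) < \<infinity>"
    using A1b by (elim exE conjE)
  have model0: "Y 0 \<omega> = \<Psi> (X 0 \<omega>) + \<epsilon> 0 \<omega>" if "\<omega> \<in> space M" for \<omega> using model that by blast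
  have noise0: "is_cond_exp M (sigma_rv M (X 0)) (\<epsilon> 0) (\<lambda>\<omega>. 0)" using noise by blast
  have \<theta>0: "is_cond_exp_at M (\<lambda>\<omega>. \<Psi> (X 0 \<omega>) \<bullet> e j - \<Psi> x \<bullet> e j) (\<lambda>\<omega>. \<rho> (X 0 \<omega>) x) (\<theta> x j)" if "x \<in> S" for x j
    using \<theta> that by blast
  have \<theta>t0: "is_cond_exp_at M (\<lambda>\<omega>. norm (Y 0 \<omega>)) (\<lambda>\<omega>. \<rho> (X 0 \<omega>) x) (\<theta>t x)" if "x \<in> S" for x
    using \<theta>t that by blast
  have "\<exists>C>0. \<exists>\<delta>'>0. \<forall>x\<in>S. \<forall>h. 0 < h \<and> h \<le> \<delta>' \<longrightarrow>
    norm (expectation (\<lambda>\<omega>. K (\<rho> (X 0 \<omega>) x / h) *\<^sub>R Y 0 \<omega>) - expectation (\<lambda>\<omega>. K (\<rho> (X 0 \<omega>) x / h)) *\<^sub>R \<Psi> x)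
      \<le> C * small_ball M \<rho> X x h * h"
    by (rule FF.kernel_bias[where \<Psi> = \<Psi> and \<epsilon> = "\<epsilon> 0" and Kb = Kb and \<theta> = \<theta> and \<theta>' = \<theta>' and e = e and Lx = Lx and r = r and \<delta> = \<delta>1])
      (fact H(2) Yi A2a Kbd Kb(1) Km model0 noise0 \<theta>0 r(1) \<delta>1 A1b')+
  then obtain CB \<delta>B where CB: "0 < CB" "0 < \<delta>B" "\<And>x h. x \<in> S \<Longrightarrow> 0 < h \<Longrightarrow> h \<le> \<delta>B \<Longrightarrow>
    norm (expectation (\<lambda>\<omega>. K (\<rho> (X 0 \<omega>) x / h) *\<^sub>R Y 0 \<omega>) - expectation (\<lambda>\<omega>. K (\<rho> (X 0 \<omega>) x / h)) *\<^sub>R \<Psi> x)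
      \<le> CB * small_ball M \<rho> X x h * h" by blast
  obtain C7a where A7a': "\<forall>\<^sub>F B in at_top.
        (SUP x\<in>{x \<in> S. ess_norm \<nu> cls x \<le> ereal B}. ereal (\<theta>t x 0)) \<le> ereal (C7a * B powr r)" using A7a by blast
  obtain \<delta>7 where \<delta>7: "0 < \<delta>7" and A7b': "\<forall>x\<in>S. \<forall>u\<in>{0..\<delta>7}. (\<theta>t x has_real_derivative \<theta>t' x u) (at u within {0..})"
        "(SUP x\<in>S. SUP u\<in>{0..\<delta>7}. ennreal \<bar>\<theta>t' x u\<bar>) < \<infinity>" using A7b by (elim exE conjE)
  have "\<exists>B0\<ge>1. \<exists>C'>0. \<exists>\<delta>'>0. \<forall>x\<in>S. \<forall>B\<ge>B0. \<forall>h. ess_norm \<nu> cls x \<le> ereal B \<and> 0 < h \<and> h \<le> \<delta>' \<longrightarrow>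
    expectation (\<lambda>\<omega>. indicator {0..h} (\<rho> (X 0 \<omega>) x) * norm (Y 0 \<omega>)) \<le> C' * B powr r * small_ball M \<rho> X x h"
    by (rule FF.response_near[where \<theta>t = \<theta>t and \<theta>t' = \<theta>t' and \<delta> = \<delta>7 and C = C7a])
      (fact \<theta>t0 r(1) \<delta>7 A7a' A7b')+
  then obtain B0 C7 \<delta>R where C7: "1 \<le> B0" "0 < C7" "0 < \<delta>R"
    "\<And>x B h. x \<in> S \<Longrightarrow> B0 \<le> B \<Longrightarrow> ess_norm \<nu> cls x \<le> ereal B \<Longrightarrow> 0 < h \<Longrightarrow> h \<le> \<delta>R \<Longrightarrow>
      expectation (\<lambda>\<omega>. indicator {0..h} (\<rho> (X 0 \<omega>) x) * norm (Y 0 \<omega>)) \<le> C7 * B powr r * small_ball M \<rho> X x h" by blast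
  obtain d0 d1 where coord: "0 < d0" "0 < d1"
    and coord': "\<forall>s j. (\<integral>\<omega>. (Y s \<omega> \<bullet> e j)\<^sup>2 \<partial>M) \<le> d0 * exp (- d1 * real j)" using A6b by (elim exE conjE)
  obtain c0 c1 where c01: "0 < c0" "0 < c1"
    and mix: "\<forall>k. mixing_coeff M (\<lambda>s \<omega>. (X s \<omega>, Y s \<omega>)) k \<le> c0 * exp (- c1 * real k)" using A8 by (elim exE conjE)
  \<comment> \<open>A single bandwidth threshold below those of the individual estimates.\<close>
  define \<delta>0 where "\<delta>0 = min (min \<delta>5 \<delta>K) (min \<delta>B \<delta>R)"
  have \<delta>0: "0 < \<delta>0" "\<delta>0 \<le> \<delta>5" "\<delta>0 \<le> \<delta>K" "\<delta>0 \<le> \<delta>B" "\<delta>0 \<le> \<delta>R"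
    using \<delta>5 cK(2) CB(2) C7(3) by (auto simp: \<delta>0_def)
  interpret MF: mixing_field M "\<lambda>s \<omega>. (X s \<omega>, Y s \<omega>)" c0 c1
  proof
    show "(\<lambda>\<omega>. (X s \<omega>, Y s \<omega>)) \<in> borel_measurable M" for s by (rule borel_measurable_Pair[OF Xm Ym])
    show "mixing_coeff M (\<lambda>s \<omega>. (X s \<omega>, Y s \<omega>)) k \<le> c0 * exp (- c1 * real k)" for k using mix by blast
  qed (fact stationary c01)+
  interpret KR: kernel_regression D \<nu> cls M S \<rho> X Y c0 c1 e \<Psi> K r Kb "\<bar>LK0\<bar>" CF \<delta>0 cK CB B0 C7 "\<bar>L\<Psi>0\<bar>" \<kappa>0 \<kappa>1 d0 d1
  proof
    show "0 < small_ball M \<rho> X x h" if "x \<in> S" "0 < h" for x h using A3a that by blast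
    show "small_ball M \<rho> X z b - small_ball M \<rho> X z a \<le> CF * (b - a)"
      if "z \<in> S" "0 \<le> a" "a \<le> b" "b \<le> \<delta>0" for z a b using that \<delta>0 by (intro CF(2)) auto
    show "\<bar>small_ball M \<rho> X z a - small_ball M \<rho> X z' a\<bar> \<le> CF * \<rho> z z'"
      if "z \<in> S" "z' \<in> S" "0 \<le> a" "a \<le> \<delta>0" for z z' a using that \<delta>0 by (intro CF(3)) auto
    show "cK * small_ball M \<rho> X x h \<le> expectation (\<lambda>\<omega>. K (\<rho> (X 0 \<omega>) x / h))"
      if "x \<in> S" "0 < h" "h \<le> \<delta>0" for x h using that \<delta>0 by (intro cK(3)) auto
    show "norm (expectation (\<lambda>\<omega>. K (\<rho> (X 0 \<omega>) x / h) *\<^sub>R Y 0 \<omega>) - expectation (\<lambda>\<omega>. K (\<rho> (X 0 \<omega>) x / h)) *\<^sub>R \<Psi> x)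
      \<le> CB * small_ball M \<rho> X x h * h" if "x \<in> S" "0 < h" "h \<le> \<delta>0" for x h using that \<delta>0 by (intro CB(3)) auto
    show "expectation (\<lambda>\<omega>. indicator {0..h} (\<rho> (X 0 \<omega>) x) * norm (Y 0 \<omega>)) \<le> C7 * B powr r * small_ball M \<rho> X x h"
      if "x \<in> S" "B0 \<le> B" "ess_norm \<nu> cls x \<le> ereal B" "0 < h" "h \<le> \<delta>0" for x B h using that \<delta>0 by (intro C7(4)) auto
    show "expectation (\<lambda>\<omega>. (Y s \<omega> \<bullet> e j)\<^sup>2) \<le> d0 * exp (- d1 * real j)" for s j using coord' by blast
  qed (fact H(2) Ym r K1 Kb(1) Kbd Km \<delta>0(1) CF(1) cK(1) CB(1) C7(1,2) LK L\<Psi> \<kappa> tail coord Y2 abs_ge_zero)+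
  obtain l where l: "0 < l" "(\<lambda>k. ereal (R (n k))) \<longlonglongrightarrow> l" using R by blast
  \<comment> \<open>Finite or infinite, the limit exceeds some positive real, and hence so does R
    eventually.\<close>
  obtain R0 where R0: "0 < ereal R0" "ereal R0 < l" using ereal_dense2[OF l(1)] by blast
  have R0': "0 < R0" "\<forall>\<^sub>F k in sequentially. R0 \<le> R (n k)"
    using R0(1) order_tendstoD(1)[OF l(2) R0(2)] by (auto elim: eventually_mono)
  have hp: "0 < h (n k)" for k using h(1) by blast
  obtain C where C: "AE \<omega> in M. \<forall>\<^sub>F k in sequentially. \<forall>x\<in>Lip_ball D cls (R (n k)).
    norm (Psi_hat M \<rho> K X Y (n k) (h (n k)) x \<omega> - \<Psi> x) \<le>
      C * (rate1 M \<rho> X D cls R h (n k) + rate2 TYPE('d) r R h (n k) + h (n k) powr r)"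
    using KR.uniform_rate[OF n R0' hp h(2) rate1 rate2] by blast
  note rates = KR.rates_eventually[OF R0' hp h(2)]
  from C show ?thesis
  proof eventually_elim
    case (elim \<omega>)
    show ?case
    proof (rule sup_decomposition)
      show "\<forall>\<^sub>F k in sequentially. 0 \<le> rate1 M \<rho> X D cls R h (n k) \<and> 0 \<le> rate2 TYPE('d) r R h (n k) \<and> 0 < h (n k) powr r \<and>
        Lip_ball D cls (R (n k)) \<noteq> {} \<and> (\<forall>x\<in>Lip_ball D cls (R (n k)).
          0 \<le> norm (Psi_hat M \<rho> K X Y (n k) (h (n k)) x \<omega> - \<Psi> x) \<and>
          norm (Psi_hat M \<rho> K X Y (n k) (h (n k)) x \<omega> - \<Psi> x) \<le>
            C * (rate1 M \<rho> X D cls R h (n k) + rate2 TYPE('d) r R h (n k) + h (n k) powr r))"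
        using rates elim
      proof eventually_elim
        case (elim k)
        then show ?case using hp[of k] by auto
      qed
    qed
  qed
qed

end
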